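(* Let $D:\mathbb V\to\mathbb V$ and $s:\mathbb V$. Let $C$ be a class of sets (a predicate $\mathbb V\to\mathsf{Prop}$) and let $T_\eta$ be a target assignment for each set $\eta$, such that $T_\eta$ only depends on $\eta$ up to $\approx$ (if $\eta\approx\eta'$ then $T_\eta\,p\,t\iff T_{\eta'}\,p\,t$ for all $p,t$) and, for every $\eta$ in $C$, $T_\eta$ is coherent with respect to $D$ and the parameter $U=s$ and gives the root path $[\,]$ the target $\eta$. Let $\varphi:\mathbb V\to\mathbb V\to\mathsf{Prop}$ be a relation that respects $\approx$ and is functional on $s$, with all values in $C$ (if $x\in s$ and $\varphi(x,y)$ then $y$ is in $C$). Then there is a set whose elements are exactly the $y$ with $\varphi(x,y)$ for some $x\in s$.
   Context: The setting is the type theory of Lean 4 with no axioms (no excluded middle, no choice, no propositional extensionality, no quotients). $\mathbb V:\mathsf{Type}_1$ is the inductive type with one constructor $\mathsf{sup}:\Pi A{:}\mathsf{Type}_0.\ (A\to\mathbb V)\to\mathbb V$. For $x=\mathsf{sup}\,A\,f$ write $\bar x:=A$ and $x_i:=f\,i$. Bisimulation, by recursion: $x\approx y$ iff $\forall i\,\exists j.\ x_i\approx y_j$ and $\forall j\,\exists i.\ x_i\approx y_j$. Membership: $x\in y:=\exists j.\ x\approx y_j$. A set is an element of $\mathbb V$. A relation $\varphi$ is functional on $s$ if for $x\in s$, $\varphi(x,y)$ and $\varphi(x,y')$ imply $y\approx y'$. A label is $\mathsf a$, or $\mathsf b\,w$, or $\mathsf c\,x$, for sets $w,x$; two labels are equivalent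 if they have the same constructor and bisimilar arguments. A path is a list of labels, deepest first; $[\,]$ is the root and $l::p$ the child of $p$ with label $l$. A target assignment is a relation $\tau$ between paths and sets; $p$ has the target $t$ if $\tau\,p\,t$. $G$ is the first value at $p$ if the elements of $G$ are exactly the elements of the targets of $\mathsf a::p$. A label $l$ is available for $G$ (with respect to $D:\mathbb V\to\mathbb V$ and $U:\mathbb V$) if $l=\mathsf a$, or $l$ is equivalent to $\mathsf b\,w$ with $w\in D(G)$, or to $\mathsf c\,x$ with $x\in U$. The assignment is coherent (with respect to $D,U$) if: (1) the targets of a path are closed under $\approx$, and any two targets of a path are bisimilar; (2) equivalent labels give children (of the same path) with the same targets; (3) if $l::p$ has the target $t$ and $p$ has the target $t'$ then $t\in t'$; (4) if $p$ has the target $t$ and $G$ is the first value at $p$, then for all $x$: $x\in t$ iff $x\in t'\cup\{t'\}$ for some target $t'$ of a child $l::p$ with $l$ available for $G$. *)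

theory Defs
  imports Main
begin

text \<open>
  HOL itself has excluded middle and choice, and with them the replacement statement is immediate
  whatever the coherence hypotheses say. Its content is that it has a proof in Lean's type theory
  without axioms. So that type theory is formalized first: dependent products, the universes,
  an impredicative and proof irrelevant \<open>Prop\<close>, and inductive families. The statement
  is then that a certain closed type is inhabited by a closed term.

  Universe levels are numerals: \<open>Sort 0\<close> is \<open>Prop\<close> and \<open>Sort (i + 1)\<close>
  is \<open>Type\<^sub>i\<close>. There are no constants without computation rules, hence no axioms;
  quotients are absent. Universe polymorphism is the ability to choose the numerals, and mutual
  and nested inductive types and definitional eta for structures are left out; what is derivable
  here is derivable in Lean. Variables are de Bruijn indices.
\<close>

section \<open>Terms\<close>

text \<open>
  An inductive declaration is a part of the terms that refer to it, so no global environment is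
  needed. All telescopes are listed outermost binder first. Scopes: \<open>indices\<close> and
  \<open>args\<close> live under the parameters; \<open>recs\<close> and \<open>res\<close> live under the
  parameters and \<open>args\<close>. A constructor takes the parameters, the non-recursive arguments
  \<open>args\<close>, and for each \<open>(\<Xi>, is)\<close> in \<open>recs\<close> a recursive argument
  of type \<open>\<Pi>\<Xi>. I params is\<close>; its result has the indices \<open>res\<close>.
  Nothing can depend on a recursive argument, so listing these last loses no generality, and
  occurrences of the declared family are strictly positive by construction.
\<close>

datatype 'a ctor = Ctor (args: "'a list") (recs: "('a list \<times> 'a list) list") (res: "'a list")

datatype 'a decl =
  Decl (params: "'a list") (indices: "'a list") (level: nat) (ctors: "'a ctor list")

datatype tm =
    Var nat
  | Sort nat
  | App tm tm
  | Lam tm tm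
  | Pi tm tm
  | Ind "tm decl"
  | Con "tm decl" nat
  | Rec "tm decl" nat  \<comment> \<open>the recursor with motive in \<open>Sort\<close> of the given level\<close>

abbreviation Apps :: "tm \<Rightarrow> tm list \<Rightarrow> tm" where "Apps \<equiv> foldl App"
abbreviation Pis :: "tm list \<Rightarrow> tm \<Rightarrow> tm" where "Pis \<equiv> foldr Pi"
abbreviation Lams :: "tm list \<Rightarrow> tm \<Rightarrow> tm" where "Lams \<equiv> foldr Lam"

text \<open>\<open>lift n k t\<close> makes room for \<open>n\<close> binders outside the innermost \<open>k\<close>.
  Declarations are closed, so neither \<open>lift\<close> nor \<open>subst\<close> enters them.\<close>

primrec lift :: "nat \<Rightarrow> nat \<Rightarrow> tm \<Rightarrow> tm" where
  "lift n k (Var i) = Var (if i < k then i else i + n)"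
| "lift n k (Sort u) = Sort u"
| "lift n k (App f a) = App (lift n k f) (lift n k a)"
| "lift n k (Lam A b) = Lam (lift n k A) (lift n (Suc k) b)"
| "lift n k (Pi A B) = Pi (lift n k A) (lift n (Suc k) B)"
| "lift n k (Ind d) = Ind d"
| "lift n k (Con d c) = Con d c"
| "lift n k (Rec d u) = Rec d u"

text \<open>\<open>subst ts k t\<close> replaces the \<open>length ts\<close> variables bound just outside the
  innermost \<open>k\<close> binders; the last entry of \<open>ts\<close> is for the innermost of them.\<close>

primrec subst :: "tm list \<Rightarrow> nat \<Rightarrow> tm \<Rightarrow> tm" where
  "subst ts k (Var i) =
     (if i < k then Var i
      else if i < k + length ts then lift k 0 (rev ts ! (i - k))
      else Var (i - length ts))"
| "subst ts k (Sort u) = Sort u"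
| "subst ts k (App f a) = App (subst ts k f) (subst ts k a)"
| "subst ts k (Lam A b) = Lam (subst ts k A) (subst ts (Suc k) b)"
| "subst ts k (Pi A B) = Pi (subst ts k A) (subst ts (Suc k) B)"
| "subst ts k (Ind d) = Ind d"
| "subst ts k (Con d c) = Con d c"
| "subst ts k (Rec d u) = Rec d u"

primrec lift_tele :: "nat \<Rightarrow> nat \<Rightarrow> tm list \<Rightarrow> tm list" where
  "lift_tele n k [] = []"
| "lift_tele n k (A # \<Delta>) = lift n k A # lift_tele n (Suc k) \<Delta>"

primrec subst_tele :: "tm list \<Rightarrow> nat \<Rightarrow> tm list \<Rightarrow> tm list" where
  "subst_tele ts k [] = []"
| "subst_tele ts k (A # \<Delta>) = subst ts k A # subst_tele ts (Suc k) \<Delta>"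

text \<open>\<open>vars k n\<close>: the variables of a telescope of length \<open>n\<close>, seen from under
  \<open>k\<close> further binders. \<open>nondep As\<close>: types over one context as a telescope.\<close>

definition vars :: "nat \<Rightarrow> nat \<Rightarrow> tm list" where
  "vars k n = map Var (rev [k..<k + n])"

definition nondep :: "tm list \<Rightarrow> tm list" where
  "nondep As = map (\<lambda>j. lift j 0 (As ! j)) [0..<length As]"

section \<open>Types of formers, constructors and recursors\<close>

definition ind_type :: "tm decl \<Rightarrow> tm" where
  "ind_type d = Pis (params d) (Pis (indices d) (Sort (level d)))"

definition rec_arg_type :: "tm decl \<Rightarrow> nat \<Rightarrow> tm list \<times> tm list \<Rightarrow> tm" where
  "rec_arg_type d b = (\<lambda>(\<Xi>, is).
     Pis \<Xi> (Apps (Ind d) (vars (length \<Xi> + b) (length (params d)) @ is)))"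

definition con_type :: "tm decl \<Rightarrow> tm ctor \<Rightarrow> tm" where
  "con_type d c =
    (let b = length (args c); m = length (recs c) in
     Pis (params d) (Pis (args c) (Pis (nondep (map (rec_arg_type d b) (recs c)))
       (Apps (Ind d) (vars (m + b) (length (params d)) @ map (lift m 0) (res c))))))"

text \<open>The induction hypothesis for the \<open>j\<close>-th of \<open>m\<close> recursive arguments, in the
  context parameters, motive, \<open>b\<close> non-recursive arguments, \<open>m\<close> recursive arguments.\<close>

definition ih_type :: "nat \<Rightarrow> nat \<Rightarrow> nat \<Rightarrow> tm list \<times> tm list \<Rightarrow> tm" where
  "ih_type b m j = (\<lambda>(\<Xi>, is).
    (let x = length \<Xi> in
     Pis (lift_tele m 0 (lift_tele 1 b \<Xi>))
       (App (Apps (Var (x + m + b)) (map (\<lambda>t. lift m x (lift 1 (b + x) t)) is))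
            (Apps (Var (x + (m - 1 - j))) (vars 0 x)))))"

text \<open>The minor premise for the \<open>k\<close>-th constructor, in the context parameters, motive.\<close>

definition minor_type :: "tm decl \<Rightarrow> nat \<Rightarrow> tm" where
  "minor_type d k =
    (let c = ctors d ! k; p = length (params d); b = length (args c); m = length (recs c) in
     Pis (lift_tele 1 0 (args c))
      (Pis (nondep (map (\<lambda>r. lift 1 b (rec_arg_type d b r)) (recs c)))
       (Pis (nondep (map (\<lambda>j. ih_type b m j (recs c ! j)) [0..<m]))
         (App (Apps (Var (2 * m + b)) (map (\<lambda>t. lift (2 * m) 0 (lift 1 b t)) (res c)))
              (Apps (Con d k) (vars (2 * m + b + 1) p @ vars (2 * m) b @ vars m m))))))"

definition rec_type :: "tm decl \<Rightarrow> nat \<Rightarrow> tm" where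
  "rec_type d u =
    (let p = length (params d); x = length (indices d); n = length (ctors d) in
     Pis (params d)
      (Pi (Pis (indices d) (Pi (Apps (Ind d) (vars x p @ vars 0 x)) (Sort u)))
       (Pis (nondep (map (minor_type d) [0..<n]))
        (Pis (lift_tele (n + 1) 0 (indices d))
         (Pi (Apps (Ind d) (vars (x + n + 1) p @ vars 0 x))
           (App (Apps (Var (1 + x + n)) (vars 1 x)) (Var 0)))))))"

text \<open>The contractum of \<open>Rec d u ps C ms is (Con d k ps' bs rs)\<close>.\<close>

definition iota :: "tm decl \<Rightarrow> nat \<Rightarrow> tm list \<Rightarrow> tm \<Rightarrow> tm list \<Rightarrow> nat \<Rightarrow> tm list \<Rightarrow> tm list \<Rightarrow> tm" where
  "iota d u ps C ms k bs rs =
    Apps (ms ! k) (bs @ rs @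
      map (\<lambda>(r, \<Xi>, is).
            (let x = length \<Xi> in
             Lams (subst_tele (ps @ bs) 0 \<Xi>)
               (Apps (Rec d u)
                 (map (lift x 0) (ps @ [C] @ ms) @ map (subst (ps @ bs) x) is
                  @ [Apps (lift x 0 r) (vars 0 x)]))))
          (zip rs (recs (ctors d ! k))))"

section \<open>Judgements\<close>

definition imax :: "nat \<Rightarrow> nat \<Rightarrow> nat" where
  "imax u v = (if v = 0 then 0 else max u v)"

text \<open>
  The basic judgement \<open>\<Gamma> \<turnstile> a \<equiv> b : A\<close> is typed definitional equality, and
  \<open>\<Gamma> \<turnstile> a : A\<close> is its reflexive case. Contexts list the innermost variable first.
  Context formation is not a premise: a context that arises in a derivation from \<open>[]\<close>
  is well formed because each rule that extends the context checks the new type.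

  \<^item> \<open>tele S \<Gamma> \<Delta>\<close>: \<open>\<Delta>\<close> is a telescope over \<open>\<Gamma>\<close> of types
    in sorts of levels satisfying \<open>S\<close>.
  \<^item> \<open>spine \<Gamma> T ts T'\<close>: a function of type \<open>T\<close> applied to
    \<open>ts\<close> has type \<open>T'\<close>.

  The side condition of \<open>ind_rec\<close> is Lean's restriction on large elimination for families
  in \<open>Prop\<close>.
\<close>

inductive
  eqj :: "tm list \<Rightarrow> tm \<Rightarrow> tm \<Rightarrow> tm \<Rightarrow> bool"
    ("(_ \<turnstile>/ _ \<equiv>/ _ :/ _)" [51, 51, 51, 51] 50) and
  has_type :: "tm list \<Rightarrow> tm \<Rightarrow> tm \<Rightarrow> bool" ("(_ \<turnstile>/ _ :/ _)" [51, 51, 51] 50) and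
  tele :: "(nat \<Rightarrow> bool) \<Rightarrow> tm list \<Rightarrow> tm list \<Rightarrow> bool" and
  spine :: "tm list \<Rightarrow> tm \<Rightarrow> tm list \<Rightarrow> tm \<Rightarrow> bool" and
  wf_ctor :: "tm decl \<Rightarrow> tm ctor \<Rightarrow> bool" and
  wf_decl :: "tm decl \<Rightarrow> bool"
where
  "\<Gamma> \<turnstile> a : A \<equiv> \<Gamma> \<turnstile> a \<equiv> a : A"
| eq_sym: "\<Gamma> \<turnstile> a \<equiv> b : A \<Longrightarrow> \<Gamma> \<turnstile> b \<equiv> a : A"
| eq_trans: "\<Gamma> \<turnstile> a \<equiv> b : A \<Longrightarrow> \<Gamma> \<turnstile> b \<equiv> c : A \<Longrightarrow> \<Gamma> \<turnstile> a \<equiv> c : A"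
| eq_conv: "\<Gamma> \<turnstile> a \<equiv> b : A \<Longrightarrow> \<Gamma> \<turnstile> A \<equiv> B : Sort u \<Longrightarrow> \<Gamma> \<turnstile> a \<equiv> b : B"
| var: "i < length \<Gamma> \<Longrightarrow> \<Gamma> \<turnstile> Var i : lift (Suc i) 0 (\<Gamma> ! i)"
| sort: "\<Gamma> \<turnstile> Sort u : Sort (Suc u)"
| pi: "\<Gamma> \<turnstile> A \<equiv> A' : Sort u \<Longrightarrow> A # \<Gamma> \<turnstile> B \<equiv> B' : Sort v
    \<Longrightarrow> \<Gamma> \<turnstile> Pi A B \<equiv> Pi A' B' : Sort (imax u v)"
| lam: "\<Gamma> \<turnstile> A \<equiv> A' : Sort u \<Longrightarrow> A # \<Gamma> \<turnstile> b \<equiv> b' : B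
    \<Longrightarrow> \<Gamma> \<turnstile> Lam A b \<equiv> Lam A' b' : Pi A B"
| app: "\<Gamma> \<turnstile> f \<equiv> f' : Pi A B \<Longrightarrow> \<Gamma> \<turnstile> a \<equiv> a' : A
    \<Longrightarrow> \<Gamma> \<turnstile> App f a \<equiv> App f' a' : subst [a] 0 B"
| beta: "\<Gamma> \<turnstile> App (Lam A b) a : T \<Longrightarrow> \<Gamma> \<turnstile> App (Lam A b) a \<equiv> subst [a] 0 b : T"
| eta: "\<Gamma> \<turnstile> f : Pi A B \<Longrightarrow> \<Gamma> \<turnstile> Lam A (App (lift 1 0 f) (Var 0)) \<equiv> f : Pi A B"
| proof_irrel: "\<Gamma> \<turnstile> P : Sort 0 \<Longrightarrow> \<Gamma> \<turnstile> h : P \<Longrightarrow> \<Gamma> \<turnstile> h' : P \<Longrightarrow> \<Gamma> \<turnstile> h \<equiv> h' : P"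
| ind: "wf_decl d \<Longrightarrow> \<Gamma> \<turnstile> Ind d : ind_type d"
| con: "wf_decl d \<Longrightarrow> k < length (ctors d) \<Longrightarrow> \<Gamma> \<turnstile> Con d k : con_type d (ctors d ! k)"
| ind_rec: "wf_decl d \<Longrightarrow>
      u = 0 \<or> level d \<noteq> 0 \<or> ctors d = [] \<or>
      (\<exists>c. ctors d = [c] \<and>
        (\<forall>i < length (args c).
          (rev (take i (args c)) @ rev (params d) \<turnstile> args c ! i : Sort 0) \<or>
          Var (length (args c) - 1 - i) \<in> set (res c)))
    \<Longrightarrow> \<Gamma> \<turnstile> Rec d u : rec_type d u"
| iota: "k < length (ctors d) \<Longrightarrow>
      length ps = length (params d) \<Longrightarrow> length ps' = length (params d) \<Longrightarrow>
      length ms = length (ctors d) \<Longrightarrow> length is = length (indices d) \<Longrightarrow>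
      length bs = length (args (ctors d ! k)) \<Longrightarrow> length rs = length (recs (ctors d ! k)) \<Longrightarrow>
      \<Gamma> \<turnstile> Apps (Rec d u) (ps @ [C] @ ms @ is @ [Apps (Con d k) (ps' @ bs @ rs)]) : T
    \<Longrightarrow> \<Gamma> \<turnstile> Apps (Rec d u) (ps @ [C] @ ms @ is @ [Apps (Con d k) (ps' @ bs @ rs)])
        \<equiv> iota d u ps C ms k bs rs : T"
| tele_nil: "tele S \<Gamma> []"
| tele_cons: "\<Gamma> \<turnstile> A : Sort u \<Longrightarrow> S u \<Longrightarrow> tele S (A # \<Gamma>) \<Delta> \<Longrightarrow> tele S \<Gamma> (A # \<Delta>)"
| spine_nil: "spine \<Gamma> T [] T"
| spine_cons: "\<Gamma> \<turnstile> t : A \<Longrightarrow> spine \<Gamma> (subst [t] 0 B) ts T \<Longrightarrow> spine \<Gamma> (Pi A B) (t # ts) T"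
| wf_ctor: "\<Gamma> = rev (args c) @ rev (params d) \<Longrightarrow> b = length (args c) \<Longrightarrow>
      X = Pis (indices d) (Sort (level d)) \<Longrightarrow>
      tele (\<lambda>u. level d = 0 \<or> u \<le> level d) (rev (params d)) (args c) \<Longrightarrow>
      \<forall>(\<Xi>, is) \<in> set (recs c).
        tele (\<lambda>u. level d = 0 \<or> u \<le> level d) \<Gamma> \<Xi> \<and>
        spine (rev \<Xi> @ \<Gamma>) (lift (length \<Xi> + b) 0 X) is (Sort (level d)) \<Longrightarrow>
      spine \<Gamma> (lift b 0 X) (res c) (Sort (level d))
    \<Longrightarrow> wf_ctor d c"
| wf_decl: "tele (\<lambda>_. True) [] (params d) \<Longrightarrow>
      tele (\<lambda>_. True) (rev (params d)) (indices d) \<Longrightarrow>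
      \<forall>c \<in> set (ctors d). wf_ctor d c
    \<Longrightarrow> wf_decl d"

section \<open>Terms with named variables\<close>

text \<open>
  To write terms readably, a term in an unspecified context is represented by the function that
  maps the number of enclosing binders to the de Bruijn term. A variable bound by the
  \<open>(n + 1)\<close>-st binder has the index \<open>m - (n + 1)\<close> under \<open>m\<close> binders.
\<close>

type_synonym tmd = "nat \<Rightarrow> tm"

definition closed :: "tm \<Rightarrow> tmd" where "closed t = (\<lambda>_. t)"

definition close :: "tmd \<Rightarrow> tm" where "close t = t 0"

definition appd :: "tmd \<Rightarrow> tmd \<Rightarrow> tmd" (infixl "\<cdot>" 100) where
  "f \<cdot> a = (\<lambda>n. App (f n) (a n))"

definition lamd :: "tmd \<Rightarrow> (tmd \<Rightarrow> tmd) \<Rightarrow> tmd" where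
  "lamd A b = (\<lambda>n. Lam (A n) (b (\<lambda>m. Var (m - Suc n)) (Suc n)))"

definition pid :: "tmd \<Rightarrow> (tmd \<Rightarrow> tmd) \<Rightarrow> tmd" where
  "pid A B = (\<lambda>n. Pi (A n) (B (\<lambda>m. Var (m - Suc n)) (Suc n)))"

definition arr :: "tmd \<Rightarrow> tmd \<Rightarrow> tmd" (infixr "\<^bold>\<rightarrow>" 25) where
  "(A \<^bold>\<rightarrow> B) = pid A (\<lambda>_. B)"

syntax
  "_lamd" :: "[idt, tmd, tmd] \<Rightarrow> tmd" ("(3\<^bold>\<lambda>_ : _./ _)" [0, 51, 10] 10)
  "_pid" :: "[idt, tmd, tmd] \<Rightarrow> tmd" ("(3\<^bold>\<forall>_ : _./ _)" [0, 51, 10] 10)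
translations
  "\<^bold>\<lambda>x : A. b" \<rightleftharpoons> "CONST lamd A (\<lambda>x. b)"
  "\<^bold>\<forall>x : A. B" \<rightleftharpoons> "CONST pid A (\<lambda>x. B)"

abbreviation Propd :: tmd where "Propd \<equiv> closed (Sort 0)"
abbreviation Type0 :: tmd where "Type0 \<equiv> closed (Sort 1)"

section \<open>Standard inductive types\<close>

definition True_decl :: "tm decl" where
  "True_decl = Decl [] [] 0 [Ctor [] [] []]"

definition False_decl :: "tm decl" where
  "False_decl = Decl [] [] 0 []"

definition And_decl :: "tm decl" where
  "And_decl = Decl [Sort 0, Sort 0] [] 0 [Ctor [Var 1, Var 1] [] []]"

definition Or_decl :: "tm decl" where
  "Or_decl = Decl [Sort 0, Sort 0] [] 0 [Ctor [Var 1] [] [], Ctor [Var 0] [] []]"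

definition Iff_decl :: "tm decl" where
  "Iff_decl = Decl [Sort 0, Sort 0] [] 0 [Ctor [Pi (Var 1) (Var 1), Pi (Var 1) (Var 3)] [] []]"

text \<open>\<open>Exists_decl u\<close> and \<open>Eq_decl u\<close> are for a carrier in \<open>Sort u\<close>.\<close>

definition Exists_decl :: "nat \<Rightarrow> tm decl" where
  "Exists_decl u =
     Decl [Sort u, Pi (Var 0) (Sort 0)] [] 0 [Ctor [Var 1, App (Var 1) (Var 0)] [] []]"

definition Eq_decl :: "nat \<Rightarrow> tm decl" where
  "Eq_decl u = Decl [Sort u, Var 0] [Var 1] 0 [Ctor [] [] [Var 0]]"

definition Unit_decl :: "tm decl" where
  "Unit_decl = Decl [] [] 1 [Ctor [] [] []]"

definition Sum_decl :: "tm decl" where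
  "Sum_decl = Decl [Sort 1, Sort 1] [] 1 [Ctor [Var 1] [] [], Ctor [Var 0] [] []]"

definition List_decl :: "nat \<Rightarrow> tm decl" where
  "List_decl u = Decl [Sort u] [] u [Ctor [] [] [], Ctor [Var 0] [([], [])] []]"

definition conjd :: "tmd \<Rightarrow> tmd \<Rightarrow> tmd" (infixr "\<^bold>\<and>" 35) where
  "(P \<^bold>\<and> Q) = closed (Ind And_decl) \<cdot> P \<cdot> Q"

definition disjd :: "tmd \<Rightarrow> tmd \<Rightarrow> tmd" (infixr "\<^bold>\<or>" 30) where
  "(P \<^bold>\<or> Q) = closed (Ind Or_decl) \<cdot> P \<cdot> Q"

definition iffd :: "tmd \<Rightarrow> tmd \<Rightarrow> tmd" (infix "\<^bold>\<leftrightarrow>" 26) where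
  "(P \<^bold>\<leftrightarrow> Q) = closed (Ind Iff_decl) \<cdot> P \<cdot> Q"

definition exd :: "nat \<Rightarrow> tmd \<Rightarrow> (tmd \<Rightarrow> tmd) \<Rightarrow> tmd" where
  "exd u A P = closed (Ind (Exists_decl u)) \<cdot> A \<cdot> lamd A P"

text \<open>\<open>\<^bold>\<exists>\<^sub>0\<close> and \<open>\<^bold>\<exists>\<^sub>1\<close>: existential quantifiers
  over types in \<open>Type\<^sub>0\<close> and in \<open>Type\<^sub>1\<close>.\<close>

syntax
  "_exd0" :: "[idt, tmd, tmd] \<Rightarrow> tmd" ("(3\<^bold>\<exists>\<^sub>0_ : _./ _)" [0, 51, 10] 10)
  "_exd1" :: "[idt, tmd, tmd] \<Rightarrow> tmd" ("(3\<^bold>\<exists>\<^sub>1_ : _./ _)" [0, 51, 10] 10)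
translations
  "\<^bold>\<exists>\<^sub>0x : A. P" \<rightleftharpoons> "CONST exd (CONST Suc 0) A (\<lambda>x. P)"
  "\<^bold>\<exists>\<^sub>1x : A. P" \<rightleftharpoons> "CONST exd (CONST Suc (CONST Suc 0)) A (\<lambda>x. P)"

section \<open>Sets\<close>

definition V_decl :: "tm decl" where
  "V_decl = Decl [] [] 2 [Ctor [Sort 1] [([Var 0], [])] []]"

definition V :: tmd where "V = closed (Ind V_decl)"

definition supd :: "tmd \<Rightarrow> tmd \<Rightarrow> tmd" where
  "supd A f = closed (Con V_decl 0) \<cdot> A \<cdot> f"

text \<open>\<open>bar x\<close> and \<open>child x i\<close> are the paper's $\bar x$ and $x_i$.\<close>

definition bar :: "tmd \<Rightarrow> tmd" where
  "bar x = closed (Rec V_decl 2) \<cdot> (\<^bold>\<lambda>_ : V. Type0)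
     \<cdot> (\<^bold>\<lambda>A : Type0. \<^bold>\<lambda>f : (A \<^bold>\<rightarrow> V). \<^bold>\<lambda>ih : (A \<^bold>\<rightarrow> Type0). A) \<cdot> x"

definition child :: "tmd \<Rightarrow> tmd \<Rightarrow> tmd" where
  "child x i = closed (Rec V_decl 2) \<cdot> (\<^bold>\<lambda>x : V. (bar x \<^bold>\<rightarrow> V))
     \<cdot> (\<^bold>\<lambda>A : Type0. \<^bold>\<lambda>f : (A \<^bold>\<rightarrow> V). \<^bold>\<lambda>ih : (\<^bold>\<forall>i : A. (bar (f \<cdot> i) \<^bold>\<rightarrow> V)). f)
     \<cdot> x \<cdot> i"

definition bisim :: "tmd \<Rightarrow> tmd \<Rightarrow> tmd" (infix "\<^bold>\<approx>" 50) where
  "(x \<^bold>\<approx> y) = closed (Rec V_decl 2) \<cdot> (\<^bold>\<lambda>_ : V. (V \<^bold>\<rightarrow> Propd))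
     \<cdot> (\<^bold>\<lambda>A : Type0. \<^bold>\<lambda>f : (A \<^bold>\<rightarrow> V). \<^bold>\<lambda>ih : (A \<^bold>\<rightarrow> V \<^bold>\<rightarrow> Propd). \<^bold>\<lambda>y : V.
          (\<^bold>\<forall>i : A. \<^bold>\<exists>\<^sub>0j : bar y. ih \<cdot> i \<cdot> child y j) \<^bold>\<and>
          (\<^bold>\<forall>j : bar y. \<^bold>\<exists>\<^sub>0i : A. ih \<cdot> i \<cdot> child y j))
     \<cdot> x \<cdot> y"

definition mem :: "tmd \<Rightarrow> tmd \<Rightarrow> tmd" (infix "\<^bold>\<in>" 50) where
  "(x \<^bold>\<in> y) = (\<^bold>\<exists>\<^sub>0j : bar y. x \<^bold>\<approx> child y j)"

definition singleton :: "tmd \<Rightarrow> tmd" where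
  "singleton x = supd (closed (Ind Unit_decl)) (\<^bold>\<lambda>_ : closed (Ind Unit_decl). x)"

definition union :: "tmd \<Rightarrow> tmd \<Rightarrow> tmd" (infixl "\<^bold>\<union>" 65) where
  "x \<^bold>\<union> y =
    (let S = closed (Ind Sum_decl) \<cdot> bar x \<cdot> bar y in
     supd S (closed (Rec Sum_decl 2) \<cdot> bar x \<cdot> bar y \<cdot> (\<^bold>\<lambda>_ : S. V)
       \<cdot> (\<^bold>\<lambda>i : bar x. child x i) \<cdot> (\<^bold>\<lambda>j : bar y. child y j)))"

section \<open>Labels, paths, target assignments\<close>

definition Label_decl :: "tm decl" where
  "Label_decl = Decl [] [] 2 [Ctor [] [] [], Ctor [Ind V_decl] [] [], Ctor [Ind V_decl] [] []]"

definition Label :: tmd where "Label = closed (Ind Label_decl)"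

definition lab_a :: tmd where "lab_a = closed (Con Label_decl 0)"
definition lab_b :: "tmd \<Rightarrow> tmd" where "lab_b w = closed (Con Label_decl 1) \<cdot> w"
definition lab_c :: "tmd \<Rightarrow> tmd" where "lab_c x = closed (Con Label_decl 2) \<cdot> x"

text \<open>Case distinction with values in \<open>Sort u\<close>, of a type that does not depend on the label.\<close>

definition lab_case :: "nat \<Rightarrow> tmd \<Rightarrow> tmd \<Rightarrow> (tmd \<Rightarrow> tmd) \<Rightarrow> (tmd \<Rightarrow> tmd) \<Rightarrow> tmd \<Rightarrow> tmd" where
  "lab_case u R ra rb rc l =
     closed (Rec Label_decl u) \<cdot> (\<^bold>\<lambda>_ : Label. R) \<cdot> ra \<cdot> lamd V rb \<cdot> lamd V rc \<cdot> l"

definition lab_eqv :: "tmd \<Rightarrow> tmd \<Rightarrow> tmd" (infix "\<^bold>\<sim>" 50) where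
  "(l \<^bold>\<sim> l') =
    (let T = closed (Ind True_decl); F = closed (Ind False_decl) in
     lab_case 2 (Label \<^bold>\<rightarrow> Propd)
       (\<^bold>\<lambda>l' : Label. lab_case 1 Propd T (\<lambda>_. F) (\<lambda>_. F) l')
       (\<lambda>w. \<^bold>\<lambda>l' : Label. lab_case 1 Propd F (\<lambda>w'. w \<^bold>\<approx> w') (\<lambda>_. F) l')
       (\<lambda>x. \<^bold>\<lambda>l' : Label. lab_case 1 Propd F (\<lambda>_. F) (\<lambda>x'. x \<^bold>\<approx> x') l')
       l \<cdot> l')"

definition Path :: tmd where "Path = closed (Ind (List_decl 2)) \<cdot> Label"

definition root :: tmd where "root = closed (Con (List_decl 2) 0) \<cdot> Label"

definition cons :: "tmd \<Rightarrow> tmd \<Rightarrow> tmd" (infixr "\<^bold>#" 65) where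
  "l \<^bold># p = closed (Con (List_decl 2) 1) \<cdot> Label \<cdot> l \<cdot> p"

definition first_value :: "tmd \<Rightarrow> tmd \<Rightarrow> tmd \<Rightarrow> tmd" where
  "first_value \<tau> p G =
     (\<^bold>\<forall>x : V. (x \<^bold>\<in> G \<^bold>\<leftrightarrow> (\<^bold>\<exists>\<^sub>1t : V. \<tau> \<cdot> (lab_a \<^bold># p) \<cdot> t \<^bold>\<and> x \<^bold>\<in> t)))"

definition available :: "tmd \<Rightarrow> tmd \<Rightarrow> tmd \<Rightarrow> tmd \<Rightarrow> tmd" where
  "available D U G l =
     (closed (Ind (Eq_decl 2)) \<cdot> Label \<cdot> l \<cdot> lab_a \<^bold>\<or>
      (\<^bold>\<exists>\<^sub>1w : V. l \<^bold>\<sim> lab_b w \<^bold>\<and> w \<^bold>\<in> D \<cdot> G) \<^bold>\<or>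
      (\<^bold>\<exists>\<^sub>1x : V. l \<^bold>\<sim> lab_c x \<^bold>\<and> x \<^bold>\<in> U))"

definition coherent :: "tmd \<Rightarrow> tmd \<Rightarrow> tmd \<Rightarrow> tmd" where
  "coherent D U \<tau> =
     ((\<^bold>\<forall>p : Path.
         (\<^bold>\<forall>t : V. \<^bold>\<forall>t' : V. (\<tau> \<cdot> p \<cdot> t \<^bold>\<rightarrow> t \<^bold>\<approx> t' \<^bold>\<rightarrow> \<tau> \<cdot> p \<cdot> t')) \<^bold>\<and>
         (\<^bold>\<forall>t : V. \<^bold>\<forall>t' : V. (\<tau> \<cdot> p \<cdot> t \<^bold>\<rightarrow> \<tau> \<cdot> p \<cdot> t' \<^bold>\<rightarrow> t \<^bold>\<approx> t'))) \<^bold>\<and>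
      (\<^bold>\<forall>p : Path. \<^bold>\<forall>l : Label. \<^bold>\<forall>l' : Label.
         (l \<^bold>\<sim> l' \<^bold>\<rightarrow> (\<^bold>\<forall>t : V. (\<tau> \<cdot> (l \<^bold># p) \<cdot> t \<^bold>\<leftrightarrow> \<tau> \<cdot> (l' \<^bold># p) \<cdot> t)))) \<^bold>\<and>
      (\<^bold>\<forall>p : Path. \<^bold>\<forall>l : Label. \<^bold>\<forall>t : V. \<^bold>\<forall>t' : V.
         (\<tau> \<cdot> (l \<^bold># p) \<cdot> t \<^bold>\<rightarrow> \<tau> \<cdot> p \<cdot> t' \<^bold>\<rightarrow> t \<^bold>\<in> t')) \<^bold>\<and>
      (\<^bold>\<forall>p : Path. \<^bold>\<forall>t : V. \<^bold>\<forall>G : V.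
         (\<tau> \<cdot> p \<cdot> t \<^bold>\<rightarrow> first_value \<tau> p G \<^bold>\<rightarrow>
          (\<^bold>\<forall>x : V. (x \<^bold>\<in> t \<^bold>\<leftrightarrow>
            (\<^bold>\<exists>\<^sub>1l : Label. \<^bold>\<exists>\<^sub>1t' : V.
               available D U G l \<^bold>\<and> \<tau> \<cdot> (l \<^bold># p) \<cdot> t' \<^bold>\<and>
               x \<^bold>\<in> t' \<^bold>\<union> singleton t'))))))"

end

theory Submission
  imports Defs
begin

text \<open>
  Let \<open>E p\<close> say that the path \<open>p\<close> has a target. Targets of children are elements of targets, so by
  induction on sets a path with a target is accessible for the relation \<open>child in E\<close>. Accessibility is a
  proposition with one constructor, all of whose data are determined by the path, and so it eliminates into
  \<open>V\<close>. By this recursion an accessible path \<open>p\<close> gets a value, which is bisimilar to its target: the value of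
  \<open>a :: p\<close> is a first value \<open>G\<close> at \<open>p\<close>, so that the available labels are indexed by the small type
  \<open>1 + D G + s\<close>, and the value of \<open>p\<close> is the union of the successors of the values of these children. Whether
  a child has a target cannot be decided; instead the union ranges also over the proofs of it.

  For replacement, take for \<open>E\<close> at \<open>x \<in> s\<close> the paths that have a target for some \<open>\<eta>\<close> with \<open>\<phi> x \<eta>\<close>. The
  wanted set is the union, over \<open>x\<close> in \<open>s\<close> and proofs \<open>h\<close> that the root is accessible, of the singletons of
  the values of the root. So no choice of \<open>\<eta>\<close> is made, and \<open>h\<close> ranges over a proposition, hence a small type.
\<close>

section \<open>Substitution and weakening\<close>

text \<open>The obstacle is that a value \<eta>, like the target of a path, is given only by an
  existential proposition, which cannot be eliminated into \<open>V\<close>. What can be recursed on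
  is the domain of paths alone: it is a predicate on paths, and accessibility in it, unlike the
  existence of a target, has a constructor that determines its data. The constructor also carries
  the proof that the path itself lies in the domain. Otherwise, for an element of s without a value
  under \<phi>, the domain would be empty, the root would be accessible for lack of children, and a
  set without justification would enter the union.

  All of this has to be a derivation in the object theory. Terms are written with metalevel
  functions as binders, whereas the rules speak of de Bruijn substitution, and a metalevel function
  may inspect its argument. The relational condition \<open>uni\<close> excludes such functions; for
  the remaining ones, metalevel application agrees with substitution.\<close>

primrec sc :: "nat \<Rightarrow> tm \<Rightarrow> bool" where
  "sc n (Var i) = (i < n)"
| "sc n (Sort u) = True"
| "sc n (App f a) = (sc n f \<and> sc n a)"
| "sc n (Lam A b) = (sc n A \<and> sc (Suc n) b)"
| "sc n (Pi A B) = (sc n A \<and> sc (Suc n) B)"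
| "sc n (Ind d) = True"
| "sc n (Con d c) = True"
| "sc n (Rec d u) = True"

lemma lift_0 [simp]: "lift 0 k t = t"
  by (induction t arbitrary: k) auto

lemma subst_Nil [simp]: "subst [] k t = t"
  by (induction t arbitrary: k) auto

lemma lift_lift: "k \<le> l \<Longrightarrow> l \<le> k + n \<Longrightarrow> lift m l (lift n k t) = lift (m + n) k t"
  by (induction t arbitrary: k l) auto

lemma lift_lift_swap: "k \<le> l \<Longrightarrow> lift m (l + n) (lift n k t) = lift n k (lift m l t)"
proof (induction t arbitrary: k l)
  case (Lam A b)
  then show ?case using Lam(2)[of "Suc k" "Suc l"] by simp
next
  case (Pi A b)
  then show ?case using Pi(2)[of "Suc k" "Suc l"] by simp
qed auto

lemma lift_sc: "sc n t \<Longrightarrow> n \<le> k \<Longrightarrow> lift m k t = t"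
proof (induction t arbitrary: n k)
  case (Lam A b)
  then show ?case using Lam(2)[of "Suc n" "Suc k"] by auto
next
  case (Pi A b)
  then show ?case using Pi(2)[of "Suc n" "Suc k"] by auto
qed auto

lemma sc_mono: "sc n t \<Longrightarrow> n \<le> m \<Longrightarrow> sc m t"
proof (induction t arbitrary: n m)
  case (Lam A b)
  then show ?case using Lam(2)[of "Suc n" "Suc m"] by auto
next
  case (Pi A b)
  then show ?case using Pi(2)[of "Suc n" "Suc m"] by auto
qed auto

lemma sc_lift: "sc n t \<Longrightarrow> sc (m + n) (lift m k t)"
proof (induction t arbitrary: n k)
  case (Lam A b)
  then show ?case using Lam(2)[of "Suc n" "Suc k"] by simp
next
  case (Pi A b)
  then show ?case using Pi(2)[of "Suc n" "Suc k"] by simp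
qed auto

text \<open>Of the \<open>Suc d\<close> positions opened at \<open>k\<close>, the one numbered
  \<open>j\<close> is filled by \<open>s\<close>. None of them occurs in the lifted term, so
  \<open>s\<close> vanishes and \<open>d\<close> positions remain.\<close>

lemma subst_lift: "k \<le> j \<Longrightarrow> j \<le> k + d \<Longrightarrow> subst [s] j (lift (Suc d) k t) = lift d k t"
  by (induction t arbitrary: k j) (auto simp: not_less)

text \<open>The variable at \<open>k\<close> is renamed to the adjacent opened position, which uses
  up one of the \<open>Suc d\<close>. In \<open>uni_lift\<close> this moves the body of a binder
  into a larger context.\<close>

lemma subst_Var0: "subst [Var 0] k (lift (Suc d) (Suc k) t) = lift d (Suc k) t"
  by (induction t arbitrary: k) (auto simp: less_Suc_eq)

lemma lift_subst:
  "lift d (l + k) (subst [s] k t) = subst [lift d l s] k (lift d (Suc (l + k)) t)"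
proof (induction t arbitrary: k)
  case (Var i)
  then show ?case using lift_lift_swap[of 0 l d k s] by auto
next
  case (Lam A b)
  then show ?case using Lam(2)[of "Suc k"] by simp
next
  case (Pi A b)
  then show ?case using Pi(2)[of "Suc k"] by simp
qed auto

lemma sc_subst: "sc (Suc (n + k)) t \<Longrightarrow> sc n s \<Longrightarrow> sc (n + k) (subst [s] k t)"
proof (induction t arbitrary: k)
  case (Var i)
  then show ?case using sc_lift[of n s k 0] by (auto simp: add.commute)
next
  case (Lam A b)
  then show ?case using Lam(2)[of "Suc k"] by simp
next
  case (Pi A b)
  then show ?case using Pi(2)[of "Suc k"] by simp
qed auto

text \<open>The last entry of a list belongs to the innermost variable, hence
  \<open>ts @ [s]\<close>. The identity matches a \<beta>-step that supplies \<open>s\<close> after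
  \<open>ts\<close> has already passed under the binder.\<close>

lemma subst_subst: "subst [s] k (subst ts (Suc k) t) = subst (ts @ [s]) k t"
proof (induction t arbitrary: k)
  case (Var i)
  consider "i < k" | "i = k" | "k < i" "i \<le> k + length ts" | "k + length ts < i" by linarith
  then show ?case
  proof cases
    case 3
    then have "rev (ts @ [s]) ! (i - k) = rev ts ! (i - Suc k)"
      by (simp add: nth_Cons' )
    then show ?thesis using 3 subst_lift[of 0 k k s] by simp
  qed auto
qed auto

text \<open>Through this identity weakening becomes an instance of substitution. Scoping matters: an
  index beyond the \<open>m\<close> replaced variables would be lowered by \<open>m\<close> instead
  of raised by \<open>n\<close>.\<close>

lemma subst_vars: "sc (m + k) t \<Longrightarrow> subst (vars n m) k t = lift n k t"
proof (induction t arbitrary: k)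
  case (Var i)
  then show ?case by (auto simp: vars_def rev_map)
next
  case (Lam A b)
  then show ?case using Lam(2)[of "Suc k"] by simp
next
  case (Pi A b)
  then show ?case using Pi(2)[of "Suc k"] by simp
qed auto

lemma vars_Suc: "vars k (Suc n) = vars (Suc k) n @ [Var k]"
  by (simp add: vars_def upt_conv_Cons del: upt_Suc)

text \<open>Contexts list the innermost variable first, so variables appended at the outer end
  change no index and no term has to be lifted. This is the only induction over derivations;
  weakening at the inner end is later derived from substitution. Well-formedness of declarations is
  judged over contexts of its own, hence the conclusion \<open>True\<close> there.\<close>

lemma outer_weakening:
  "\<Gamma> \<turnstile> a \<equiv> b : A \<Longrightarrow> \<Gamma> @ \<Delta> \<turnstile> a \<equiv> b : A"
  and "tele S \<Gamma> \<Theta> \<Longrightarrow> tele S (\<Gamma> @ \<Delta>) \<Theta>"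
  and "spine \<Gamma> T ts T' \<Longrightarrow> spine (\<Gamma> @ \<Delta>) T ts T'"
  and "wf_ctor d c \<Longrightarrow> True"
  and "wf_decl d \<Longrightarrow> True"
proof (induction rule: eqj_tele_spine_wf_ctor_wf_decl.inducts)
  case (var i \<Gamma>)
  then show ?case using eqj_tele_spine_wf_ctor_wf_decl.var[of i "\<Gamma> @ \<Delta>"] by (simp add: nth_append)
next
  case (ind_rec d u \<Gamma>)
  \<comment> \<open>The side condition on large elimination is judged over the context of the
    declaration itself and carries over unchanged.\<close>
  from ind_rec(1) show ?case
    by (rule eqj_tele_spine_wf_ctor_wf_decl.ind_rec) (use ind_rec(3) in blast)
next
  case (lam \<Gamma> A A' u b b' B)
  from eqj_tele_spine_wf_ctor_wf_decl.lam[OF lam(3)] lam(4) show ?case by simp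
next
  case (pi \<Gamma> A A' u B B' v)
  from eqj_tele_spine_wf_ctor_wf_decl.pi[OF pi(3)] pi(4) show ?case by simp
next
  case (tele_cons \<Gamma> A u S \<Delta>')
  from tele_cons(2,4,5) show ?case by (auto intro: eqj_tele_spine_wf_ctor_wf_decl.tele_cons)
next
  case (eq_conv \<Gamma> a b A B u)
  show ?case by (rule eqj_tele_spine_wf_ctor_wf_decl.eq_conv[OF eq_conv(3,4)])
next
  case (eq_trans \<Gamma> a b A c)
  show ?case by (rule eqj_tele_spine_wf_ctor_wf_decl.eq_trans[OF eq_trans(3,4)])
next
  case (app \<Gamma> f f' A B a a')
  show ?case by (rule eqj_tele_spine_wf_ctor_wf_decl.app[OF app(3,4)])
next
  case (iota k d ps ps' ms ixs bs rs \<Gamma> u C T)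
  show ?case by (rule eqj_tele_spine_wf_ctor_wf_decl.iota[OF iota(1-7,9)])
next
  case (spine_cons \<Gamma> t A B ts T)
  show ?case by (rule eqj_tele_spine_wf_ctor_wf_decl.spine_cons[OF spine_cons(3,4)])
next
  case (proof_irrel \<Gamma> P h h')
  show ?case by (rule eqj_tele_spine_wf_ctor_wf_decl.proof_irrel[OF proof_irrel(4-6)])
next
  case (eta \<Gamma> f A B)
  show ?case by (rule eqj_tele_spine_wf_ctor_wf_decl.eta[OF eta(2)])
qed (simp_all add: eq_sym sort beta ind con tele_nil spine_nil)

lemma refl_left: "\<Gamma> \<turnstile> a \<equiv> b : A \<Longrightarrow> \<Gamma> \<turnstile> a : A"
  by (rule eq_trans[OF _ eq_sym])

lemma refl_right: "\<Gamma> \<turnstile> a \<equiv> b : A \<Longrightarrow> \<Gamma> \<turnstile> b : A"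
  by (rule eq_trans[OF eq_sym])

lemma eq_beta:
  assumes "\<Gamma> \<turnstile> App (Lam A b) a \<equiv> App (Lam A' b') a' : T"
  shows "\<Gamma> \<turnstile> subst [a] 0 b \<equiv> subst [a'] 0 b' : T"
  by (rule eq_trans[OF eq_sym[OF beta[OF refl_left[OF assms]]]
        eq_trans[OF assms beta[OF refl_right[OF assms]]]])

text \<open>Scoping is recorded beside typing because \<open>subst_vars\<close>, which is applied to
  the types of a context, works on raw terms.\<close>

inductive wf_cx :: "tm list \<Rightarrow> bool" where
  "wf_cx []"
| "wf_cx \<Gamma> \<Longrightarrow> \<Gamma> \<turnstile> A : Sort u \<Longrightarrow> sc (length \<Gamma>) A \<Longrightarrow> wf_cx (A # \<Gamma>)"

inductive wf_subst :: "tm list \<Rightarrow> tm list \<Rightarrow> tm list \<Rightarrow> bool" for \<Theta> where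
  "wf_subst \<Theta> [] []"
| "wf_subst \<Theta> ts \<Gamma> \<Longrightarrow> \<Theta> \<turnstile> s : subst ts 0 A \<Longrightarrow> wf_subst \<Theta> (ts @ [s]) (A # \<Gamma>)"

text \<open>Abstracting the substituted variable and applying the result gives \<open>\<beta>\<close>-redexes,
  whose contraction is the substitution; so no induction on derivations is needed.\<close>

lemma substitution:
  "wf_subst \<Theta> ts \<Gamma> \<Longrightarrow> wf_cx \<Gamma> \<Longrightarrow> \<Gamma> \<turnstile> a \<equiv> b : T
    \<Longrightarrow> \<Theta> \<turnstile> subst ts 0 a \<equiv> subst ts 0 b : subst ts 0 T"
proof (induction arbitrary: a b T rule: wf_subst.induct)
  case 1
  \<comment> \<open>A judgement over the empty context holds over \<Theta> as it stands.\<close>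
  then show ?case using outer_weakening(1)[of "[]" a b T \<Theta>] by simp
next
  case (2 ts \<Gamma> s A)
  from 2(4) obtain u where A: "\<Gamma> \<turnstile> A : Sort u" and w: "wf_cx \<Gamma>" by (auto elim: wf_cx.cases)
  from lam[OF A 2(5)] have "\<Theta> \<turnstile> subst ts 0 (Lam A a) \<equiv> subst ts 0 (Lam A b) : subst ts 0 (Pi A T)"
    by (rule 2(3)[OF w])
  then have "\<Theta> \<turnstile> Lam (subst ts 0 A) (subst ts 1 a) \<equiv> Lam (subst ts 0 A) (subst ts 1 b)
      : Pi (subst ts 0 A) (subst ts 1 T)"
    by simp
  from eq_beta[OF app[OF this 2(2)]] show ?case by (simp add: subst_subst)
qed

text \<open>This is the substitution of every variable for itself, renumbered past
  \<open>\<Delta>\<close>. The induction moves the head of the context into \<open>\<Delta>\<close>,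
  which is why \<open>\<Delta>\<close> is arbitrary.\<close>

lemma wf_subst_vars: "wf_cx \<Gamma> \<Longrightarrow> wf_subst (\<Delta> @ \<Gamma>) (vars (length \<Delta>) (length \<Gamma>)) \<Gamma>"
proof (induction arbitrary: \<Delta> rule: wf_cx.induct)
  case 1
  then show ?case by (simp add: vars_def wf_subst.intros)
next
  case (2 \<Gamma> A u)
  have "wf_subst ((\<Delta> @ [A]) @ \<Gamma>) (vars (length (\<Delta> @ [A])) (length \<Gamma>)) \<Gamma>" by (rule 2)
  moreover have "\<Delta> @ A # \<Gamma> \<turnstile> Var (length \<Delta>) : lift (Suc (length \<Delta>)) 0 A"
    using var[of "length \<Delta>" "\<Delta> @ A # \<Gamma>"] by simp
  ultimately show ?case
    using 2(3) by (simp add: vars_Suc wf_subst.intros subst_vars)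
qed

lemma weakening:
  assumes "wf_cx \<Gamma>" "\<Gamma> \<turnstile> a \<equiv> b : T" "sc (length \<Gamma>) a" "sc (length \<Gamma>) b" "sc (length \<Gamma>) T"
  shows "\<Delta> @ \<Gamma> \<turnstile> lift (length \<Delta>) 0 a \<equiv> lift (length \<Delta>) 0 b : lift (length \<Delta>) 0 T"
  using substitution[OF wf_subst_vars[OF assms(1), of \<Delta>] assms(1,2)] assms(3-) by (simp add: subst_vars)

section \<open>Judgements on terms with named variables\<close>

definition lvl :: "nat \<Rightarrow> tmd" where "lvl n = (\<lambda>m. Var (m - Suc n))"

text \<open>A function from numbers of binders to terms need not represent a term at all. It does
  so, from \<open>n\<close> binders on, if further binders only lift the de Bruijn term that it has
  at \<open>n\<close>.\<close>

definition st :: "nat \<Rightarrow> tmd \<Rightarrow> bool" where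
  "st n t \<longleftrightarrow> sc n (t n) \<and> (\<forall>d. t (d + n) = lift d 0 (t n))"

lemma st_mono: "st n t \<Longrightarrow> n \<le> m \<Longrightarrow> st m t"
proof -
  assume t: "st n t" and "n \<le> m"
  then obtain d where m: "m = d + n" by (metis add.commute le_Suc_ex)
  have "t (e + m) = lift e 0 (t m)" for e
    using t unfolding st_def m by (metis add.assoc lift_lift le0 add_0)
  moreover have "sc m (t m)" using t sc_lift unfolding m st_def by simp
  ultimately show ?thesis unfolding st_def by blast
qed

lemma st_Suc: "st n t \<Longrightarrow> st (Suc n) t"
  by (rule st_mono) auto

lemma st_lvl [simp]: "st (Suc n) (lvl n)"
  by (auto simp: st_def lvl_def)

lemma lvl_Suc [simp]: "lvl n (Suc n) = Var 0"
  by (simp add: lvl_def)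

lemma st_at_Suc: "st n t \<Longrightarrow> t (Suc n) = lift 1 0 (t n)"
  unfolding st_def by (metis plus_1_eq_Suc)

lemma st_closed [simp]: "sc 0 t \<Longrightarrow> st n (closed t)"
  using sc_mono[of 0 t n] lift_sc[of n t] by (auto simp: st_def closed_def lift_sc)

lemma st_app [simp]: "st n f \<Longrightarrow> st n a \<Longrightarrow> st n (f \<cdot> a)"
  by (auto simp: st_def appd_def)

text \<open>\<open>rel (n, d, a) k t t'\<close>: substituting \<open>a\<close>, a term over \<open>d + n\<close> variables,
  for the variable number \<open>n\<close> of \<open>t\<close> gives \<open>t'\<close>, where both sides may have \<open>k\<close> or more
  further binders. A function on terms that preserves these relations commutes with substitution.\<close>

definition rel :: "nat \<times> nat \<times> tmd \<Rightarrow> nat \<Rightarrow> tmd \<Rightarrow> tmd \<Rightarrow> bool" where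
  "rel = (\<lambda>(n, d, a) k t t'. \<forall>j\<ge>k. sc (Suc n + j) (t (Suc n + j)) \<and>
     subst [a (d + n)] j (lift d (Suc j) (t (Suc n + j))) = t' (d + n + j))"

lemma relD:
  assumes "rel (n, d, a) k t t'" "k \<le> j"
  shows "sc (Suc n + j) (t (Suc n + j))"
    "subst [a (d + n)] j (lift d (Suc j) (t (Suc n + j))) = t' (d + n + j)"
  using assms by (auto simp: rel_def)

text \<open>The inequality makes the first \<open>n\<close> variables parameters that the
  substitution does not touch.\<close>

definition good :: "nat \<Rightarrow> nat \<times> nat \<times> tmd \<Rightarrow> bool" where
  "good n = (\<lambda>(n', d, a). n \<le> n' \<and> st (d + n') a)"

text \<open>A parametricity condition. A metalevel function could inspect its argument or the number
  of binders, and then applying it would not be a substitution. Preservation of every relation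
  \<open>rel\<close> rules this out, and since the term formers preserve these relations too, the
  condition is verified by decomposing the body.\<close>

definition uni :: "nat \<Rightarrow> (tmd \<Rightarrow> tmd) \<Rightarrow> bool" where
  "uni n b \<longleftrightarrow> (\<forall>\<theta>. good n \<theta> \<longrightarrow> (\<forall>k x x'. rel \<theta> k x x' \<longrightarrow> rel \<theta> k (b x) (b x')))"

lemma uniI: "(\<And>\<theta> k x x'. good n \<theta> \<Longrightarrow> rel \<theta> k x x' \<Longrightarrow> rel \<theta> k (b x) (b x')) \<Longrightarrow> uni n b"
  unfolding uni_def by blast

lemma rel_uni: "uni n b \<Longrightarrow> good n \<theta> \<Longrightarrow> rel \<theta> k x x' \<Longrightarrow> rel \<theta> k (b x) (b x')"
  unfolding uni_def by blast

lemma good_Suc: "good (Suc n) \<theta> \<Longrightarrow> good n \<theta>"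
  by (auto simp: good_def)

lemma uni_Suc: "uni n b \<Longrightarrow> uni (Suc n) b"
  by (auto simp: uni_def good_Suc)

lemma rel_mono: "rel \<theta> k x x' \<Longrightarrow> k \<le> l \<Longrightarrow> rel \<theta> l x x'"
  by (auto simp: rel_def split: prod.splits)

text \<open>A term that is stable at \<open>n\<close> cannot mention the substituted variable, whose
  number is at least \<open>n\<close>.\<close>

lemma rel_const: "st n c \<Longrightarrow> good n \<theta> \<Longrightarrow> rel \<theta> k c c"
proof -
  assume c: "st n c" and g: "good n \<theta>"
  obtain n' d a where \<theta>: "\<theta> = (n', d, a)" by (cases \<theta>)
  have c: "st n' c" using st_mono[OF c] g \<theta> by (auto simp: good_def)
  have eq: "c (e + n') = lift e 0 (c n')" for e using c by (auto simp: st_def)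
  have "sc (Suc n' + j) (c (Suc n' + j))" for j
    using st_mono[OF c, of "Suc n' + j"] by (auto simp: st_def)
  moreover have "subst [a (d + n')] j (lift d (Suc j) (c (Suc n' + j))) = c (d + n' + j)" for j
    using eq[of "Suc j"] eq[of "d + j"] lift_lift[of 0 "Suc j" "Suc j" d "c n'"]
      subst_lift[of 0 j "d + j" "a (d + n')" "c n'"] by (simp add: ac_simps)
  ultimately show ?thesis by (auto simp: rel_def \<theta>)
qed

lemma rel_var0: "good n (n, d, a) \<Longrightarrow> rel (n, d, a) 0 (lvl n) a"
  by (auto simp: rel_def good_def lvl_def st_def) (metis add.commute)

lemma rel_app: "rel \<theta> k f f' \<Longrightarrow> rel \<theta> k a a' \<Longrightarrow> rel \<theta> k (f \<cdot> a) (f' \<cdot> a')"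
  by (auto simp: rel_def appd_def split: prod.splits)

text \<open>The same inner binder has the number \<open>Suc n + l\<close> before the substitution
  and \<open>d + n + l\<close> after it, since the substituted variable disappears and
  \<open>d\<close> others are inserted.\<close>

lemma rel_bound: "k \<le> l \<Longrightarrow> rel (n, d, a) (Suc l) (lvl (Suc n + l)) (lvl (d + n + l))"
  by (auto simp: rel_def lvl_def)

lemma rel_binder:
  assumes "rel \<theta> k A A'" "\<And>d x x'. rel \<theta> (Suc (k + d)) x x' \<Longrightarrow> rel \<theta> (Suc (k + d)) (b x) (b' x')"
  shows rel_lam: "rel \<theta> k (lamd A b) (lamd A' b')" and rel_pi: "rel \<theta> k (pid A b) (pid A' b')"
proof -
  obtain n d a where \<theta>: "\<theta> = (n, d, a)" by (cases \<theta>)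
  have "rel \<theta> (Suc l) (b (lvl (Suc n + l))) (b' (lvl (d + n + l)))" if "k \<le> l" for l
    using assms(2)[of "l - k"] rel_bound[OF that, of n d a] that \<theta> by simp
  then have "sc (Suc (Suc n + l)) (b (lvl (Suc n + l)) (Suc (Suc n + l)))"
     "subst [a (d + n)] (Suc l) (lift d (Suc (Suc l)) (b (lvl (Suc n + l)) (Suc (Suc n + l))))
       = b' (lvl (d + n + l)) (Suc (d + n + l))" if "k \<le> l" for l
    using that relD[of n d a "Suc l" _ _ "Suc l"] by (auto simp: \<theta>)
  then show "rel \<theta> k (lamd A b) (lamd A' b')" "rel \<theta> k (pid A b) (pid A' b')"
    using assms(1) by (auto simp: rel_def \<theta> lamd_def pid_def lvl_def)
qed

lemma rel_arr: "rel \<theta> k A A' \<Longrightarrow> rel \<theta> k B B' \<Longrightarrow> rel \<theta> k (A \<^bold>\<rightarrow> B) (A' \<^bold>\<rightarrow> B')"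
  unfolding arr_def by (rule rel_pi) (auto elim: rel_mono)

text \<open>The variable \<open>lvl n\<close> is related to \<open>a\<close>, and \<open>b\<close>
  preserves the relation; read at depth 0, this identifies the metalevel application
  \<open>b a\<close> with a de Bruijn substitution.\<close>

lemma uni_eq:
  assumes "uni n b" "st (d + n) a"
  shows "b a (d + n) = subst [a (d + n)] 0 (lift d 1 (b (lvl n) (Suc n)))"
proof -
  have g: "good n (n, d, a)" using assms by (auto simp: good_def)
  from rel_uni[OF assms(1) g rel_var0[OF g]] show ?thesis by (auto dest!: relD[of _ _ _ _ _ _ 0])
qed

lemma uni_subst: "uni n b \<Longrightarrow> st n a \<Longrightarrow> subst [a n] 0 (b (lvl n) (Suc n)) = b a n"
  using uni_eq[of n b 0 a] by simp

lemma uni_sc: "uni n b \<Longrightarrow> sc (Suc n) (b (lvl n) (Suc n))"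
proof -
  assume b: "uni n b"
  \<comment> \<open>Only the scoping half of \<open>rel\<close> is wanted, so any admissible
    substitute serves; with one inserted variable, \<open>lvl n\<close> itself is
    admissible.\<close>
  have g: "good n (n, 1, lvl n)" by (auto simp: good_def)
  from rel_uni[OF b g rel_var0[OF g]] show ?thesis using relD(1)[of n 1 _ 0 _ _ 0] by auto
qed

lemma uni_st: "uni n b \<Longrightarrow> st n a \<Longrightarrow> st n (b a)"
proof -
  assume b: "uni n b" and a: "st n a"
  have "sc n (b a n)"
    using uni_subst[OF b a, symmetric] uni_sc[OF b] sc_subst[of n 0] a by (simp add: st_def)
  moreover have "b a (d + n) = lift d 0 (b a n)" for d
    using uni_eq[OF b st_mono[OF a], of d] uni_subst[OF b a, symmetric] a
      lift_subst[of d 0 0 "a n" "b (lvl n) (Suc n)"]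
    by (simp add: st_def)
  ultimately show ?thesis by (auto simp: st_def)
qed

text \<open>Renaming the bound variable is the case of \<open>uni_eq\<close> in which the substitute
  is itself a variable.\<close>

lemma uni_lift: "uni n b \<Longrightarrow> b (lvl (d + n)) (Suc (d + n)) = lift d 1 (b (lvl n) (Suc n))"
  using uni_eq[of n b "Suc d" "lvl (d + n)"] subst_Var0[of 0 d] by simp

lemma st_lam: "st n A \<Longrightarrow> uni n b \<Longrightarrow> st n (lamd A b)"
  using uni_sc uni_lift by (auto simp: st_def lamd_def lvl_def)

lemma st_pi: "st n A \<Longrightarrow> uni n b \<Longrightarrow> st n (pid A b)"
  using uni_sc uni_lift by (auto simp: st_def pid_def lvl_def)

lemma uni_const: "st n c \<Longrightarrow> uni n (\<lambda>_. c)"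
  by (auto intro: uniI rel_const)

section \<open>Contexts, typed equality and provability with named variables\<close>

primrec cx :: "tmd list \<Rightarrow> tm list" where
  "cx [] = []"
| "cx (A # G) = A (length G) # cx G"

primrec ok :: "tmd list \<Rightarrow> bool" where
  "ok [] = True"
| "ok (A # G) = (ok G \<and> st (length G) A \<and> (\<exists>u. cx G \<turnstile> A (length G) : Sort u))"

text \<open>Well-formedness of the context is a premise of the equation only; the scoping conditions hold without it.\<close>

definition deq :: "tmd list \<Rightarrow> tmd \<Rightarrow> tmd \<Rightarrow> tmd \<Rightarrow> bool"
    ("(_ \<tturnstile>/ _ \<equiv>/ _ :/ _)" [51, 51, 51, 51] 50) where
  "(G \<tturnstile> a \<equiv> b : A) \<longleftrightarrow> st (length G) a \<and> st (length G) b \<and> st (length G) A \<and>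
     (ok G \<longrightarrow> cx G \<turnstile> a (length G) \<equiv> b (length G) : A (length G))"

abbreviation typed :: "tmd list \<Rightarrow> tmd \<Rightarrow> tmd \<Rightarrow> bool" ("(_ \<tturnstile>/ _ :/ _)" [51, 51, 51] 50) where
  "G \<tturnstile> a : A \<equiv> G \<tturnstile> a \<equiv> a : A"

text \<open>Provability hides the proof term in a metalevel existential, so that propositional
  arguments carry no terms. The term is obtained again where a proof occurs inside another term, as
  with proofs of accessibility.\<close>

definition holds :: "tmd list \<Rightarrow> tmd \<Rightarrow> bool" ("(_ \<TTurnstile>/ _)" [51, 25] 25) where
  "(G \<TTurnstile> P) \<longleftrightarrow> (\<exists>h. G \<tturnstile> h : P)"

abbreviation Srt :: "nat \<Rightarrow> tmd" where "Srt u \<equiv> closed (Sort u)"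

lemma length_cx [simp]: "length (cx G) = length G"
  by (induction G) auto

lemma wf_cx: "ok G \<Longrightarrow> wf_cx (cx G)"
  by (induction G) (auto intro: wf_cx.intros simp: st_def)

lemma deq_st:
  assumes "G \<tturnstile> a \<equiv> b : A"
  shows "st (length G) a" "st (length G) b" "st (length G) A"
  using assms by (auto simp: deq_def)

lemma deq_sym: "G \<tturnstile> a \<equiv> b : A \<Longrightarrow> G \<tturnstile> b \<equiv> a : A"
  unfolding deq_def by (blast dest: eq_sym)

lemma deq_trans: "G \<tturnstile> a \<equiv> b : A \<Longrightarrow> G \<tturnstile> b \<equiv> c : A \<Longrightarrow> G \<tturnstile> a \<equiv> c : A"
  unfolding deq_def by (blast dest: eq_trans)

lemma deq_left: "G \<tturnstile> a \<equiv> b : A \<Longrightarrow> G \<tturnstile> a : A"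
  by (rule deq_trans[OF _ deq_sym])

lemma deq_right: "G \<tturnstile> a \<equiv> b : A \<Longrightarrow> G \<tturnstile> b : A"
  by (rule deq_trans[OF deq_sym])

lemma deq_conv: "G \<tturnstile> a \<equiv> b : A \<Longrightarrow> G \<tturnstile> A \<equiv> B : Srt u \<Longrightarrow> G \<tturnstile> a \<equiv> b : B"
  unfolding deq_def closed_def by (blast dest: eq_conv)

lemma weak: "G \<tturnstile> a \<equiv> b : T \<Longrightarrow> A # G \<tturnstile> a \<equiv> b : T"
proof -
  assume h: "G \<tturnstile> a \<equiv> b : T"
  have "cx (A # G) \<turnstile> a (length (A # G)) \<equiv> b (length (A # G)) : T (length (A # G))" if "ok (A # G)"
    using weakening[OF wf_cx, of G "a (length G)" "b (length G)" "T (length G)" "[A (length G)]"]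
      h that deq_st[OF h] by (auto simp: st_at_Suc) (auto simp: deq_def st_def)
  then show ?thesis using deq_st[OF h] by (auto simp: deq_def st_Suc)
qed

definition ext :: "tmd list \<Rightarrow> tmd list \<Rightarrow> bool" (infix "\<preceq>" 50) where
  "G \<preceq> H \<longleftrightarrow> (\<exists>\<Delta>. H = \<Delta> @ G)"

text \<open>Stable named terms represent themselves in every larger context, so weakening changes
  the context and nothing else.\<close>

lemma lift_deq: "G \<preceq> H \<Longrightarrow> G \<tturnstile> a \<equiv> b : T \<Longrightarrow> H \<tturnstile> a \<equiv> b : T"
proof -
  have "G \<tturnstile> a \<equiv> b : T \<Longrightarrow> \<Delta> @ G \<tturnstile> a \<equiv> b : T" for \<Delta>
    by (induction \<Delta>) (auto intro: weak)
  then show "G \<preceq> H \<Longrightarrow> G \<tturnstile> a \<equiv> b : T \<Longrightarrow> H \<tturnstile> a \<equiv> b : T"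
    by (auto simp: ext_def)
qed

lemma lift_holds: "G \<preceq> H \<Longrightarrow> G \<TTurnstile> P \<Longrightarrow> H \<TTurnstile> P"
  unfolding holds_def by (blast intro: lift_deq)

lemma ext_Cons: "G \<preceq> A # G" "G \<preceq> B # A # G" "G \<preceq> C # B # A # G"
    "G \<preceq> A4 # C # B # A # G" "G \<preceq> A5 # A4 # C # B # A # G"
  unfolding ext_def by force+

lemma good_ext: "G \<preceq> H \<Longrightarrow> good (length H) \<theta> \<Longrightarrow> good (length G) \<theta>"
  by (cases \<theta>) (auto simp: ext_def good_def)

lemma ext_refl: "G \<preceq> G"
  unfolding ext_def by force

lemma ext_trans: "G \<preceq> H \<Longrightarrow> H \<preceq> K \<Longrightarrow> G \<preceq> K"
  unfolding ext_def by force

lemma typ_lvl: "st (length G) A \<Longrightarrow> A # G \<tturnstile> lvl (length G) : A"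
  using var[of 0 "cx (A # G)"] by (auto simp: deq_def st_Suc st_at_Suc)

lemma typ_sort: "G \<tturnstile> Srt u : Srt (Suc u)"
  by (auto simp: deq_def closed_def[abs_def] sort st_def)

lemma ok_Cons: "ok G \<Longrightarrow> G \<tturnstile> A : Srt u \<Longrightarrow> ok (A # G)"
  by (auto simp: deq_def closed_def)

text \<open>The second premise is used only at the new variable \<open>lvl (length G)\<close>. Its
  quantification over all \<open>x\<close> keeps that variable opaque while rules are applied to the
  body.\<close>

lemma deq_pi:
  assumes "G \<tturnstile> A \<equiv> A' : Srt u" "\<And>x. A # G \<tturnstile> x : A \<Longrightarrow> A # G \<tturnstile> B x \<equiv> B' x : Srt v"
    "uni (length G) B" "uni (length G) B'"
  shows "G \<tturnstile> pid A B \<equiv> pid A' B' : Srt (imax u v)"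
proof -
  let ?x = "lvl (length G)"
  have "cx G \<turnstile> pid A B (length G) \<equiv> pid A' B' (length G) : Sort (imax u v)" if "ok G"
    using pi[of "cx G" "A (length G)" "A' (length G)" u] assms(1) that
      assms(2)[OF typ_lvl[OF deq_st(1)[OF assms(1)]]] ok_Cons[OF that deq_left[OF assms(1)]]
    by (simp add: deq_def pid_def closed_def flip: lvl_def)
  then show ?thesis
    using deq_st[OF assms(1)] assms(3,4) by (auto simp: deq_def st_pi) (simp add: closed_def)
qed

lemma deq_lam:
  assumes "G \<tturnstile> A \<equiv> A' : Srt u" "\<And>x. A # G \<tturnstile> x : A \<Longrightarrow> A # G \<tturnstile> b x \<equiv> b' x : B x"
    "uni (length G) b" "uni (length G) b'" "uni (length G) B"
  shows "G \<tturnstile> lamd A b \<equiv> lamd A' b' : pid A B"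
proof -
  have "cx G \<turnstile> lamd A b (length G) \<equiv> lamd A' b' (length G) : pid A B (length G)" if "ok G"
    using lam[of "cx G" "A (length G)" "A' (length G)" u] assms(1) that
      assms(2)[OF typ_lvl[OF deq_st(1)[OF assms(1)]]] ok_Cons[OF that deq_left[OF assms(1)]]
    by (simp add: deq_def lamd_def pid_def closed_def flip: lvl_def)
  then show ?thesis
    using deq_st[OF assms(1)] assms(3-) by (auto simp: deq_def st_pi st_lam)
qed

lemma deq_app:
  assumes "G \<tturnstile> f \<equiv> f' : pid A B" "G \<tturnstile> a \<equiv> a' : A" "uni (length G) B"
  shows "G \<tturnstile> f \<cdot> a \<equiv> f' \<cdot> a' : B a"
proof -
  have "cx G \<turnstile> (f \<cdot> a) (length G) \<equiv> (f' \<cdot> a') (length G) : B a (length G)" if "ok G"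
    using app[of "cx G" "f (length G)" "f' (length G)" "A (length G)" "B (lvl (length G)) (Suc (length G))"
        "a (length G)" "a' (length G)"]
      assms that uni_subst[OF assms(3) deq_st(1)[OF assms(2)]]
    by (auto simp: deq_def pid_def appd_def simp flip: lvl_def)
  then show ?thesis
    using deq_st[OF assms(1)] deq_st[OF assms(2)] assms(3) by (auto simp: deq_def uni_st)
qed

lemma deq_beta:
  assumes "G \<tturnstile> lamd A b : pid A B" "uni (length G) b" "uni (length G) B" "G \<tturnstile> a : A"
  shows "G \<tturnstile> lamd A b \<cdot> a \<equiv> b a : B a"
proof -
  have "G \<tturnstile> lamd A b \<cdot> a : B a"
    by (rule deq_app) (use assms in auto)
  then show ?thesis
    using beta[of "cx G" "A (length G)" "b (lvl (length G)) (Suc (length G))" "a (length G)" "B a (length G)"]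
      uni_subst[OF assms(2) deq_st(1)[OF assms(4)]] uni_st[OF assms(2) deq_st(1)[OF assms(4)]]
    by (auto simp: deq_def lamd_def appd_def simp flip: lvl_def)
qed

named_theorems rels
named_theorems typing

lemma rel_amb: "good (length G) \<theta> \<Longrightarrow> G \<tturnstile> c : T \<Longrightarrow> rel \<theta> k c c"
  by (rule rel_const[OF deq_st(1)])

lemma rel_shift: "rel \<theta> k x x' \<Longrightarrow> rel \<theta> (Suc (k + d)) x x'"
  by (erule rel_mono) simp

text \<open>Typing is stated of the abstraction, since the judgement \<open>A # G \<tturnstile> P x : Srt v\<close> for all
  \<open>x\<close> of type \<open>A\<close> would not be stable under weakening.\<close>

definition fam :: "tmd list \<Rightarrow> tmd \<Rightarrow> (tmd \<Rightarrow> tmd) \<Rightarrow> nat \<Rightarrow> bool" where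
  "fam G A P v \<longleftrightarrow> uni (length G) P \<and> G \<tturnstile> lamd A P : pid A (\<lambda>_. Srt v)"

lemma fam_weak: "fam G A P v \<Longrightarrow> fam (B # G) A P v"
  by (auto simp: fam_def uni_Suc intro: weak)

text \<open>Rules to be tried last: \<open>rel_amb\<close> treats a term as a constant for later substitutions.\<close>

lemmas ambient = uniI rel_shift rel_amb weak fam_weak

lemma subst_sc: "sc n t \<Longrightarrow> n \<le> k \<Longrightarrow> subst ts k t = t"
proof (induction t arbitrary: n k)
  case (Lam A b)
  then show ?case using Lam(2)[of "Suc n" "Suc k"] by auto
next
  case (Pi A b)
  then show ?case using Pi(2)[of "Suc n" "Suc k"] by auto
qed auto

lemma rel_closed: "sc 0 t \<Longrightarrow> rel \<theta> k (closed t) (closed t)"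
  by (cases \<theta>) (auto simp: rel_def closed_def lift_sc subst_sc elim: sc_mono)

lemmas [rels] = rel_app rel_lam rel_pi rel_arr rel_closed[of "Sort u" for u, simplified] rel_closed[of "Ind d"
  for d, simplified]
  rel_closed[of "Con d k" for d k, simplified] rel_closed[of "Rec d u" for d u, simplified]

text \<open>Applied first, \<open>typed_eqI\<close> makes the rules synthesize the type, which is compared with the given one at
  the end.\<close>

lemma typed_eqI: "G \<tturnstile> t : T' \<Longrightarrow> T' = T \<Longrightarrow> G \<tturnstile> t : T"
  by simp

lemmas typed_pi = deq_pi[where B = B and B' = B and A = A and A' = A for A B]
lemmas typed_lam = deq_lam[where B = B and b = b and b' = b and A = A and A' = A for A B b]
lemmas typed_app = deq_app[where f = f and f' = f and a = a and a' = a for f a]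

text \<open>Impredicativity: \<open>imax u 0 = 0\<close> whatever the sort of the domain.\<close>

lemma typed_all:
  "G \<tturnstile> A : Srt u \<Longrightarrow> (\<And>x. A # G \<tturnstile> x : A \<Longrightarrow> A # G \<tturnstile> B x : Propd) \<Longrightarrow> uni (length G) B
   \<Longrightarrow> G \<tturnstile> pid A B : Propd"
  using deq_pi[of G A A u B B 0] by (simp add: imax_def)

lemma typed_const:
  assumes "\<And>\<Gamma>. \<Gamma> \<turnstile> t : close T" "sc 0 t" "sc 0 (close T)" "\<And>n. T n = close T"
  shows "G \<tturnstile> closed t : T"
proof -
  have T: "T = closed (close T)" using assms(4) by (auto simp: closed_def)
  show ?thesis using assms(1-3) by (subst T) (auto simp: deq_def closed_def st_def lift_sc elim: sc_mono)
qed

lemmas raw = close_def closed_def appd_def lamd_def pid_def arr_def lvl_def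
lemmas types = rec_type_def con_type_def ind_type_def minor_type_def rec_arg_type_def ih_type_def
  Let_def nondep_def vars_def

lemma var': "i < length \<Gamma> \<Longrightarrow> lift (Suc i) 0 (\<Gamma> ! i) = T \<Longrightarrow> \<Gamma> \<turnstile> Var i : T"
  using var by blast

lemma app': "\<Gamma> \<turnstile> f : Pi A B \<Longrightarrow> \<Gamma> \<turnstile> a : A \<Longrightarrow> subst [a] 0 B = T \<Longrightarrow> \<Gamma> \<turnstile> App f a : T"
  using app by blast

lemma spine_nil': "T = T' \<Longrightarrow> spine \<Gamma> T [] T'"
  by (simp add: spine_nil)

lemma wf_declI:
  "tele (\<lambda>_. True) [] ps \<Longrightarrow> tele (\<lambda>_. True) (rev ps) ixs \<Longrightarrow> list_all (wf_ctor (Decl ps ixs l cs)) cs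
   \<Longrightarrow> wf_decl (Decl ps ixs l cs)"
  by (rule wf_decl) (auto simp: list_all_iff)

lemma wf_ctorI:
  "tele (\<lambda>u. l = 0 \<or> u \<le> l) (rev ps) as \<Longrightarrow>
   list_all (\<lambda>(\<Xi>, js). tele (\<lambda>u. l = 0 \<or> u \<le> l) (rev as @ rev ps) \<Xi> \<and>
     spine (rev \<Xi> @ rev as @ rev ps) (lift (length \<Xi> + length as) 0 (Pis ixs (Sort l))) js (Sort l)) rs \<Longrightarrow>
   spine (rev as @ rev ps) (lift (length as) 0 (Pis ixs (Sort l))) res' (Sort l)
   \<Longrightarrow> wf_ctor (Decl ps ixs l cs) (Ctor as rs res')"
  by (rule wf_ctor) (auto simp: list_all_iff)

lemma list_all_NilI: "list_all P []" by simp
lemma list_all_ConsI: "P x \<Longrightarrow> list_all P xs \<Longrightarrow> list_all P (x # xs)" by simp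

lemmas wf_intros = wf_declI wf_ctorI tele_cons tele_nil spine_cons spine_nil' sort pi app' var' list_all_NilI
  list_all_ConsI

section \<open>Introduction and elimination rules for quantifiers\<close>

lemma wf_Exists: "wf_decl (Exists_decl u)"
  unfolding Exists_decl_def
  by ((rule wf_intros)+ | simp | (simp, rule wf_intros))+

lemma typed_Ind:
  assumes "wf_decl d" "\<And>n. T n = ind_type d" "sc 0 (ind_type d)"
  shows "G \<tturnstile> closed (Ind d) : T"
  by (rule typed_const) (use assms ind in \<open>auto simp: close_def\<close>)

lemma typed_Con:
  assumes "wf_decl d" "k < length (ctors d)" "\<And>n. T n = con_type d (ctors d ! k)"
    "sc 0 (con_type d (ctors d ! k))"
  shows "G \<tturnstile> closed (Con d k) : T"
  by (rule typed_const) (use assms con in \<open>auto simp: close_def\<close>)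

lemma typed_Rec:
  assumes "wf_decl d" "u = 0 \<or> level d \<noteq> 0 \<or> ctors d = [] \<or>
      (\<exists>c. ctors d = [c] \<and>
        (\<forall>i < length (args c).
          (rev (take i (args c)) @ rev (params d) \<turnstile> args c ! i : Sort 0) \<or>
          Var (length (args c) - 1 - i) \<in> set (res c)))"
    "\<And>n. T n = rec_type d u" "sc 0 (rec_type d u)"
  shows "G \<tturnstile> closed (Rec d u) : T"
  by (rule typed_const) (use assms(1,3,4) ind_rec[OF assms(1,2)] in \<open>auto simp: close_def\<close>)

lemma good_tls:
  "good (length (A # G)) \<theta> \<Longrightarrow> good (length G) \<theta>"
  "good (length (B # A # G)) \<theta> \<Longrightarrow> good (length G) \<theta>"
  "good (length (C # B # A # G)) \<theta> \<Longrightarrow> good (length G) \<theta>"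
  "good (length (D # C # B # A # G)) \<theta> \<Longrightarrow> good (length G) \<theta>"
  "good (length (E # D # C # B # A # G)) \<theta> \<Longrightarrow> good (length G) \<theta>"
  by (simp_all add: good_Suc)

lemmas [typing] = typ_sort typed_pi typed_all typed_app typed_lam

lemma allI0:
  assumes "G \<tturnstile> A : Srt u" "uni (length G) B" "\<And>x. A # G \<tturnstile> x : A \<Longrightarrow> A # G \<TTurnstile> B x"
  shows "G \<TTurnstile> pid A B"
proof -
  let ?n = "length G"
  obtain r where r: "A # G \<tturnstile> r : B (lvl ?n)"
    using assms(3)[OF typ_lvl[OF deq_st(1)[OF assms(1)]]] by (auto simp: holds_def)
  \<comment> \<open>The proof \<open>r\<close> is a single term over the extended context and not a
    function of the bound variable. So the abstraction is formed on the de Bruijn level and then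
    turned into a stable named term by lifting.\<close>
  define t where "t = Lam (A ?n) (r (Suc ?n))"
  have "sc ?n t" using deq_st(1)[OF assms(1)] deq_st(1)[OF r] by (simp add: st_def t_def)
  then have "st ?n (\<lambda>m. lift (m - ?n) 0 t)"
    by (auto simp: st_def)
  moreover have "cx G \<turnstile> t : pid A B ?n" if "ok G"
    using lam[of "cx G" "A ?n" "A ?n" u "r (Suc ?n)"] assms(1) that r ok_Cons[OF that assms(1)]
    by (simp add: t_def pid_def deq_def closed_def flip: lvl_def)
  ultimately have "G \<tturnstile> (\<lambda>m. lift (m - ?n) 0 t) : pid A B"
    using st_pi[OF deq_st(1)[OF assms(1)] assms(2)] by (auto simp: deq_def)
  then show ?thesis by (auto simp: holds_def)
qed

lemma holdsI: "G \<tturnstile> h : P \<Longrightarrow> G \<TTurnstile> P"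
  by (auto simp: holds_def)

lemma holds_conv: "G \<TTurnstile> P \<Longrightarrow> G \<tturnstile> P \<equiv> Q : Srt u \<Longrightarrow> G \<TTurnstile> Q"
  unfolding holds_def by (blast dest: deq_conv)

text \<open>The types computed by \<open>ind_type\<close>, \<open>con_type\<close> and
  \<open>rec_type\<close> are raw de Bruijn terms. Evaluation identifies them with these named
  forms, to which the rules for named terms apply; later declarations are treated in the same
  way.\<close>

lemma typed_Exists:
  "\<And>G. G \<tturnstile> closed (Ind (Exists_decl u)) : (\<^bold>\<forall>A : Srt u. \<^bold>\<forall>p : (A \<^bold>\<rightarrow> Propd). Propd)"
  "G \<tturnstile> closed (Con (Exists_decl u) 0) : (\<^bold>\<forall>A : Srt u. \<^bold>\<forall>p : (A \<^bold>\<rightarrow> Propd). \<^bold>\<forall>a : A. \<^bold>\<forall>h : p \<cdot> a.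
      closed (Ind (Exists_decl u)) \<cdot> A \<cdot> p)"
  "G \<tturnstile> closed (Rec (Exists_decl u) 0) :
    (\<^bold>\<forall>A : Srt u. \<^bold>\<forall>p : (A \<^bold>\<rightarrow> Propd). \<^bold>\<forall>C : (closed (Ind (Exists_decl u)) \<cdot> A \<cdot> p \<^bold>\<rightarrow> Propd).
       \<^bold>\<forall>m : (\<^bold>\<forall>a : A. \<^bold>\<forall>h : p \<cdot> a. C \<cdot> (closed (Con (Exists_decl u) 0) \<cdot> A \<cdot> p \<cdot> a \<cdot> h)).
       \<^bold>\<forall>x : closed (Ind (Exists_decl u)) \<cdot> A \<cdot> p. C \<cdot> x)"
  by ((rule typed_Ind[OF wf_Exists] typed_Con[OF wf_Exists] typed_Rec[OF wf_Exists]);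
      simp add: raw types Exists_decl_def)+

lemmas [typing] = typed_Exists[unfolded arr_def]

lemma rel_ex [rels]:
  "rel \<theta> k A A' \<Longrightarrow> (\<And>d x x'. rel \<theta> (Suc (k + d)) x x' \<Longrightarrow> rel \<theta> (Suc (k + d)) (P x) (P' x'))
   \<Longrightarrow> rel \<theta> k (exd u A P) (exd u A' P')"
  unfolding exd_def by (rule rels | assumption)+

lemma lift_fam: "G \<preceq> H \<Longrightarrow> fam G A P v \<Longrightarrow> fam H A P v"
  unfolding fam_def uni_def by (blast intro: lift_deq good_ext)

lemma famI:
  assumes "G \<tturnstile> A : Srt u" "uni (length G) P" "\<And>x. A # G \<tturnstile> x : A \<Longrightarrow> A # G \<tturnstile> P x : Srt v"
  shows "fam G A P v"
  unfolding fam_def by ((assumption | rule assms typing rels rel_uni[OF assms(2)] ambient)+ | rule conjI)+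

lemma fam_uni: "fam G A P v \<Longrightarrow> uni (length G) P"
  by (simp add: fam_def)

lemma fam_lam: "fam G A P v \<Longrightarrow> G \<tturnstile> lamd A P : pid A (\<lambda>_. Srt v)"
  by (simp add: fam_def)

lemma deq_fam: "fam G A P v \<Longrightarrow> G \<tturnstile> a : A \<Longrightarrow> G \<tturnstile> lamd A P \<cdot> a \<equiv> P a : Srt v"
  unfolding fam_def by (rule deq_beta[where B = "\<lambda>_. Srt v"]) (simp_all add: uni_const)

lemma typed_fam: "fam G A P v \<Longrightarrow> G \<tturnstile> a : A \<Longrightarrow> G \<tturnstile> P a : Srt v"
  by (rule deq_right[OF deq_fam])

lemma typed_ex:
  assumes "G \<tturnstile> A : Srt u" "fam G A P 0"
  shows "G \<tturnstile> exd u A P : Propd"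
  unfolding exd_def by (rule typed_eqI, (assumption | rule assms fam_lam[OF assms(2)] typing rels rel_uni[OF
    fam_uni[OF assms(2)]] ambient)+, rule refl)

lemma exI0:
  assumes "G \<tturnstile> A : Srt u" "fam G A P 0" "G \<tturnstile> a : A" "G \<TTurnstile> P a"
  shows "G \<TTurnstile> exd u A P"
proof -
  from holds_conv[OF assms(4) deq_sym[OF deq_fam[OF assms(2,3)]]]
  obtain h where h: "G \<tturnstile> h : lamd A P \<cdot> a" by (auto simp: holds_def)
  have "G \<tturnstile> closed (Con (Exists_decl u) 0) \<cdot> A \<cdot> lamd A P \<cdot> a \<cdot> h : exd u A P"
    unfolding exd_def
    by (rule typed_eqI, (assumption | rule assms h fam_lam[OF assms(2)] typing rels rel_uni[OF fam_uni[OF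
      assms(2)]] ambient)+, rule refl)
  then show ?thesis by (auto simp: holds_def)
qed

text \<open>The recursor eliminates into a motive over proofs of the existential. A motive that is
  constantly \<open>R\<close> gives the ordinary elimination rule, at the price of conversions
  between \<open>?C \<cdot> e\<close> and \<open>R\<close>; the other connectives follow this
  scheme.\<close>

lemma exE0:
  assumes "G \<TTurnstile> exd u A P" "G \<tturnstile> A : Srt u" "fam G A P 0" "G \<tturnstile> R : Propd"
    "\<And>x. A # G \<tturnstile> x : A \<Longrightarrow> P x # A # G \<TTurnstile> P x \<Longrightarrow> P x # A # G \<TTurnstile> R"
  shows "G \<TTurnstile> R"
proof -
  let ?E = "closed (Ind (Exists_decl u)) \<cdot> A \<cdot> lamd A P" and ?c = "closed (Con (Exists_decl u) 0) \<cdot> A \<cdot> lamd A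
    P"
  let ?C = "lamd ?E (\<lambda>_. R)"
  note U = rel_uni[OF fam_uni[OF assms(3)]]
  obtain e where e: "G \<tturnstile> e : ?E" using assms(1) by (auto simp: holds_def exd_def)
  have Ex: "G \<tturnstile> ?E : Propd" using typed_ex[OF assms(2,3)] by (simp add: exd_def)
  have C: "fam G ?E (\<lambda>_. R) 0"
    by (rule famI) ((assumption | rule assms Ex typing rels ambient)+)
  have c: "P x # A # G \<tturnstile> ?c \<cdot> x \<cdot> h : ?E" if "A # G \<tturnstile> x : A" "P x # A # G \<tturnstile> h : P x" for x h
  proof -
    note h = deq_conv[OF that(2) deq_sym[OF deq_fam[OF fam_weak[OF fam_weak[OF assms(3)]] weak[OF that(1)]]]]
    show ?thesis by (rule typed_eqI, (assumption | rule that(1) h assms typed_fam[where P = P] typing uniI rels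
      | (erule rel_mono, simp; fail) | rule U rel_amb | (rule lift_deq lift_fam good_ext, (assumption
      | rule that(1) h assms typed_fam[where P = P])) | erule good_tls | rule weak fam_weak)+, rule refl)
  qed
  have "G \<TTurnstile> (\<^bold>\<forall>a : A. \<^bold>\<forall>h : P a. R)"
    apply (rule allI0)
      apply (rule assms)
    subgoal by ((assumption | rule assms typing rels U ambient)+)
    apply (rule allI0)
    apply (erule typed_fam[OF fam_weak[OF assms(3)]])
     apply ((assumption | rule typing rels assms(4) ambient)+)[]
    apply (rule assms(5))
    apply assumption
    apply (erule holdsI)
   done
  \<comment> \<open>The recursor wants the minor premise for the applied motive, so \<open>R\<close>
    is \<beta>-expanded below both binders.\<close>
  then have "G \<TTurnstile> (\<^bold>\<forall>a : A. \<^bold>\<forall>h : lamd A P \<cdot> a. ?C \<cdot> (?c \<cdot> a \<cdot> h))"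
    apply (rule holds_conv)
    apply (rule deq_pi)
       apply (rule assms)
      apply (rule deq_pi)
         apply (rule deq_sym)
         apply (erule deq_fam[OF fam_weak[OF assms(3)]])
        apply (rule deq_sym)
    apply (rule deq_fam[OF fam_weak[OF fam_weak[OF C]]])
    apply (erule (1) c)
    apply ((assumption | rule assms typing rels U fam_lam[OF assms(3)] ambient | erule good_tls)+)
    done
  then obtain m where "G \<tturnstile> m : (\<^bold>\<forall>a : A. \<^bold>\<forall>h : lamd A P \<cdot> a. ?C \<cdot> (?c \<cdot> a \<cdot> h))" by (auto simp: holds_def)
  then have "G \<tturnstile> closed (Rec (Exists_decl u) 0) \<cdot> A \<cdot> lamd A P \<cdot> ?C \<cdot> m \<cdot> e : ?C \<cdot> e"
    by - (rule typed_eqI, (assumption | rule assms e fam_lam[OF assms(3)] fam_lam[OF C] typing rels U ambient)+,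
      rule refl)
  from deq_conv[OF this deq_fam[OF C e]] show ?thesis by (auto simp: holds_def)
qed

section \<open>Connectives\<close>

lemma fam_const: "G \<tturnstile> X : Srt u \<Longrightarrow> G \<tturnstile> R : Srt v \<Longrightarrow> fam G X (\<lambda>_. R) v"
  by (rule famI) ((assumption | rule typing rels ambient)+)

lemma impI0: "G \<tturnstile> P : Srt u \<Longrightarrow> G \<tturnstile> Q : Srt v \<Longrightarrow> (\<And>h. P # G \<tturnstile> h : P \<Longrightarrow> P # G \<TTurnstile> Q) \<Longrightarrow> G \<TTurnstile> P \<^bold>\<rightarrow> Q"
  unfolding arr_def by (rule allI0) (assumption | rule uni_const | erule deq_st)+

lemma allE0: "G \<TTurnstile> pid A B \<Longrightarrow> G \<tturnstile> a : A \<Longrightarrow> uni (length G) B \<Longrightarrow> G \<TTurnstile> B a"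
  unfolding holds_def by (blast intro: typed_app)

lemma mp0: "G \<TTurnstile> P \<^bold>\<rightarrow> Q \<Longrightarrow> G \<TTurnstile> P \<Longrightarrow> G \<tturnstile> Q : Srt v \<Longrightarrow> G \<TTurnstile> Q"
  unfolding holds_def arr_def using typed_app[of G _ P "\<lambda>_. Q"] uni_const[OF deq_st(1)] by blast

lemma typed_imp [typing]: "G \<tturnstile> P : Srt u \<Longrightarrow> G \<tturnstile> Q : Propd \<Longrightarrow> G \<tturnstile> (P \<^bold>\<rightarrow> Q) : Propd"
  unfolding arr_def by (rule typed_all) ((assumption | rule typing rels ambient)+)

lemma wf_True: "wf_decl True_decl"
  and wf_False: "wf_decl False_decl"
  and wf_And: "wf_decl And_decl"
  and wf_Or: "wf_decl Or_decl"
  and wf_Iff: "wf_decl Iff_decl"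
  and wf_Eq: "wf_decl (Eq_decl u)"
  unfolding True_decl_def False_decl_def And_decl_def Or_decl_def Iff_decl_def Eq_decl_def
  by ((rule wf_intros)+ | simp | (simp, rule wf_intros))+

lemma typed_True [typing]: "G \<tturnstile> closed (Ind True_decl) : Propd"
  by (rule typed_Ind[OF wf_True]) (simp_all add: raw types True_decl_def)

lemma typed_False [typing]: "G \<tturnstile> closed (Ind False_decl) : Propd"
  by (rule typed_Ind[OF wf_False]) (simp_all add: raw types False_decl_def)

lemma typed_False_rec: "G \<tturnstile> closed (Rec False_decl 0) :
    (\<^bold>\<forall>C : (closed (Ind False_decl) \<^bold>\<rightarrow> Propd). \<^bold>\<forall>x : closed (Ind False_decl). C \<cdot> x)"
  by (rule typed_Rec[OF wf_False]) (simp_all add: raw types False_decl_def)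

lemma typed_And:
  "G \<tturnstile> closed (Ind And_decl) : (\<^bold>\<forall>P : Propd. \<^bold>\<forall>Q : Propd. Propd)"
  "G \<tturnstile> closed (Con And_decl 0) : (\<^bold>\<forall>P : Propd. \<^bold>\<forall>Q : Propd. \<^bold>\<forall>p : P. \<^bold>\<forall>q : Q. (P \<^bold>\<and> Q))"
  "G \<tturnstile> closed (Rec And_decl 0) : (\<^bold>\<forall>P : Propd. \<^bold>\<forall>Q : Propd. \<^bold>\<forall>C : ((P \<^bold>\<and> Q) \<^bold>\<rightarrow> Propd).
      \<^bold>\<forall>m : (\<^bold>\<forall>p : P. \<^bold>\<forall>q : Q. C \<cdot> (closed (Con And_decl 0) \<cdot> P \<cdot> Q \<cdot> p \<cdot> q)). \<^bold>\<forall>x : (P \<^bold>\<and> Q). C \<cdot> x)"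
  by ((rule typed_Ind[OF wf_And] typed_Con[OF wf_And] typed_Rec[OF wf_And]);
      simp add: raw types conjd_def And_decl_def)+

lemma typed_Or:
  "G \<tturnstile> closed (Ind Or_decl) : (\<^bold>\<forall>P : Propd. \<^bold>\<forall>Q : Propd. Propd)"
  "G \<tturnstile> closed (Con Or_decl 0) : (\<^bold>\<forall>P : Propd. \<^bold>\<forall>Q : Propd. \<^bold>\<forall>p : P. (P \<^bold>\<or> Q))"
  "G \<tturnstile> closed (Con Or_decl 1) : (\<^bold>\<forall>P : Propd. \<^bold>\<forall>Q : Propd. \<^bold>\<forall>q : Q. (P \<^bold>\<or> Q))"
  "G \<tturnstile> closed (Rec Or_decl 0) : (\<^bold>\<forall>P : Propd. \<^bold>\<forall>Q : Propd. \<^bold>\<forall>C : ((P \<^bold>\<or> Q) \<^bold>\<rightarrow> Propd).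
      \<^bold>\<forall>m : (\<^bold>\<forall>p : P. C \<cdot> (closed (Con Or_decl 0) \<cdot> P \<cdot> Q \<cdot> p)).
      \<^bold>\<forall>m' : (\<^bold>\<forall>q : Q. C \<cdot> (closed (Con Or_decl 1) \<cdot> P \<cdot> Q \<cdot> q)). \<^bold>\<forall>x : (P \<^bold>\<or> Q). C \<cdot> x)"
  by ((rule typed_Ind[OF wf_Or] typed_Con[OF wf_Or] typed_Rec[OF wf_Or]);
      simp add: raw types disjd_def Or_decl_def)+

lemma typed_Iff:
  "G \<tturnstile> closed (Ind Iff_decl) : (\<^bold>\<forall>P : Propd. \<^bold>\<forall>Q : Propd. Propd)"
  "G \<tturnstile> closed (Con Iff_decl 0) : (\<^bold>\<forall>P : Propd. \<^bold>\<forall>Q : Propd. \<^bold>\<forall>p : (P \<^bold>\<rightarrow> Q). \<^bold>\<forall>q : (Q \<^bold>\<rightarrow> P). (P \<^bold>\<leftrightarrow> Q))"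
  "G \<tturnstile> closed (Rec Iff_decl 0) : (\<^bold>\<forall>P : Propd. \<^bold>\<forall>Q : Propd. \<^bold>\<forall>C : ((P \<^bold>\<leftrightarrow> Q) \<^bold>\<rightarrow> Propd).
      \<^bold>\<forall>m : (\<^bold>\<forall>p : (P \<^bold>\<rightarrow> Q). \<^bold>\<forall>q : (Q \<^bold>\<rightarrow> P). C \<cdot> (closed (Con Iff_decl 0) \<cdot> P \<cdot> Q \<cdot> p \<cdot> q)). \<^bold>\<forall>x : (P \<^bold>\<leftrightarrow> Q). C \<cdot> x)"
  by ((rule typed_Ind[OF wf_Iff] typed_Con[OF wf_Iff] typed_Rec[OF wf_Iff]);
      simp add: raw types iffd_def Iff_decl_def)+

definition eqd :: "nat \<Rightarrow> tmd \<Rightarrow> tmd \<Rightarrow> tmd \<Rightarrow> tmd" where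
  "eqd u A a b = closed (Ind (Eq_decl u)) \<cdot> A \<cdot> a \<cdot> b"

lemma typed_Eq:
  "G \<tturnstile> closed (Ind (Eq_decl u)) : (\<^bold>\<forall>A : Srt u. \<^bold>\<forall>a : A. \<^bold>\<forall>b : A. Propd)"
  "G \<tturnstile> closed (Con (Eq_decl u) 0) : (\<^bold>\<forall>A : Srt u. \<^bold>\<forall>a : A. eqd u A a a)"
  "G \<tturnstile> closed (Rec (Eq_decl u) 0) : (\<^bold>\<forall>A : Srt u. \<^bold>\<forall>a : A. \<^bold>\<forall>C : (\<^bold>\<forall>b : A. (eqd u A a b \<^bold>\<rightarrow> Propd)).
     \<^bold>\<forall>m : C \<cdot> a \<cdot> (closed (Con (Eq_decl u) 0) \<cdot> A \<cdot> a). \<^bold>\<forall>b : A. \<^bold>\<forall>x : eqd u A a b. C \<cdot> b \<cdot> x)"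
  by ((rule typed_Ind[OF wf_Eq] typed_Con[OF wf_Eq] typed_Rec[OF wf_Eq]);
      simp add: raw types eqd_def Eq_decl_def)+

lemmas [typing] = typed_False_rec[unfolded arr_def] typed_And[unfolded arr_def] typed_Or[unfolded arr_def]
  typed_Iff[unfolded arr_def[of _ Propd]] typed_Eq[unfolded arr_def]

lemma rel_conj [rels]: "rel \<theta> k P P' \<Longrightarrow> rel \<theta> k Q Q' \<Longrightarrow> rel \<theta> k (P \<^bold>\<and> Q) (P' \<^bold>\<and> Q')"
  and rel_disj [rels]: "rel \<theta> k P P' \<Longrightarrow> rel \<theta> k Q Q' \<Longrightarrow> rel \<theta> k (P \<^bold>\<or> Q) (P' \<^bold>\<or> Q')"
  and rel_iff [rels]: "rel \<theta> k P P' \<Longrightarrow> rel \<theta> k Q Q' \<Longrightarrow> rel \<theta> k (P \<^bold>\<leftrightarrow> Q) (P' \<^bold>\<leftrightarrow> Q')"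
  and rel_eq [rels]: "rel \<theta> k A A' \<Longrightarrow> rel \<theta> k P P' \<Longrightarrow> rel \<theta> k Q Q' \<Longrightarrow> rel \<theta> k (eqd u A P Q) (eqd u A' P' Q')"
  unfolding conjd_def disjd_def iffd_def eqd_def by (rule rels | assumption)+

lemma typed_conj [typing]: "G \<tturnstile> P : Propd \<Longrightarrow> G \<tturnstile> Q : Propd \<Longrightarrow> G \<tturnstile> (P \<^bold>\<and> Q) : Propd"
  unfolding conjd_def by (rule typed_eqI, (assumption | rule typing rels ambient)+, rule refl)
lemma typed_disj [typing]: "G \<tturnstile> P : Propd \<Longrightarrow> G \<tturnstile> Q : Propd \<Longrightarrow> G \<tturnstile> (P \<^bold>\<or> Q) : Propd"
  unfolding disjd_def by (rule typed_eqI, (assumption | rule typing rels ambient)+, rule refl)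
lemma typed_iff [typing]: "G \<tturnstile> P : Propd \<Longrightarrow> G \<tturnstile> Q : Propd \<Longrightarrow> G \<tturnstile> (P \<^bold>\<leftrightarrow> Q) : Propd"
  unfolding iffd_def by (rule typed_eqI, (assumption | rule typing rels ambient)+, rule refl)
lemma typed_eqd [typing]: "G \<tturnstile> A : Srt u \<Longrightarrow> G \<tturnstile> a : A \<Longrightarrow> G \<tturnstile> b : A \<Longrightarrow> G \<tturnstile> eqd u A a b : Propd"
  unfolding eqd_def by (rule typed_eqI, (assumption | rule typing rels ambient)+, rule refl)

lemma conjI0:
  "G \<tturnstile> P : Propd \<Longrightarrow> G \<tturnstile> Q : Propd \<Longrightarrow> G \<TTurnstile> P \<Longrightarrow> G \<TTurnstile> Q \<Longrightarrow> G \<TTurnstile> P \<^bold>\<and> Q"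
proof (unfold holds_def, elim exE, rule exI)
  fix p q assume "G \<tturnstile> P : Propd" "G \<tturnstile> Q : Propd" "G \<tturnstile> p : P" "G \<tturnstile> q : Q"
  then show "G \<tturnstile> closed (Con And_decl 0) \<cdot> P \<cdot> Q \<cdot> p \<cdot> q : (P \<^bold>\<and> Q)"
    by - (rule typed_eqI, (assumption | rule typing rels ambient)+, rule refl)
qed

lemma disjI10:
  "G \<tturnstile> P : Propd \<Longrightarrow> G \<tturnstile> Q : Propd \<Longrightarrow> G \<TTurnstile> P \<Longrightarrow> G \<TTurnstile> P \<^bold>\<or> Q"
proof (unfold holds_def, elim exE, rule exI)
  fix p assume "G \<tturnstile> P : Propd" "G \<tturnstile> Q : Propd" "G \<tturnstile> p : P"
  then show "G \<tturnstile> closed (Con Or_decl 0) \<cdot> P \<cdot> Q \<cdot> p : (P \<^bold>\<or> Q)"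
    by - (rule typed_eqI, (assumption | rule typing rels ambient)+, rule refl)
qed

lemma disjI20:
  "G \<tturnstile> P : Propd \<Longrightarrow> G \<tturnstile> Q : Propd \<Longrightarrow> G \<TTurnstile> Q \<Longrightarrow> G \<TTurnstile> P \<^bold>\<or> Q"
proof (unfold holds_def, elim exE, rule exI)
  fix p assume "G \<tturnstile> P : Propd" "G \<tturnstile> Q : Propd" "G \<tturnstile> p : Q"
  then show "G \<tturnstile> closed (Con Or_decl 1) \<cdot> P \<cdot> Q \<cdot> p : (P \<^bold>\<or> Q)"
    by - (rule typed_eqI, (assumption | rule typing rels ambient)+, rule refl)
qed

lemma iffI0:
  "G \<tturnstile> P : Propd \<Longrightarrow> G \<tturnstile> Q : Propd \<Longrightarrow> (P # G \<TTurnstile> P \<Longrightarrow> P # G \<TTurnstile> Q) \<Longrightarrow> (Q # G \<TTurnstile> Q \<Longrightarrow> Q # G \<TTurnstile> P)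
   \<Longrightarrow> G \<TTurnstile> P \<^bold>\<leftrightarrow> Q"
proof -
  assume a: "G \<tturnstile> P : Propd" "G \<tturnstile> Q : Propd"
    "(P # G \<TTurnstile> P \<Longrightarrow> P # G \<TTurnstile> Q)" "(Q # G \<TTurnstile> Q \<Longrightarrow> Q # G \<TTurnstile> P)"
  have "G \<TTurnstile> P \<^bold>\<rightarrow> Q" "G \<TTurnstile> Q \<^bold>\<rightarrow> P" by (rule impI0, (rule a)+, erule holdsI)+
  then obtain p q where "G \<tturnstile> p : (P \<^bold>\<rightarrow> Q)" "G \<tturnstile> q : (Q \<^bold>\<rightarrow> P)" by (auto simp: holds_def)
  then have "G \<tturnstile> closed (Con Iff_decl 0) \<cdot> P \<cdot> Q \<cdot> p \<cdot> q : (P \<^bold>\<leftrightarrow> Q)"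
    by - (rule typed_eqI, (assumption | rule a typing rels ambient)+, rule refl)
  then show ?thesis by (rule holdsI)
qed

lemma eqI0: "G \<tturnstile> A : Srt u \<Longrightarrow> G \<tturnstile> a : A \<Longrightarrow> G \<TTurnstile> eqd u A a a"
  by (rule holdsI, rule typed_eqI[where t = "closed (Con (Eq_decl u) 0) \<cdot> A \<cdot> a"], (assumption
    | rule typing rels ambient)+, rule refl)

lemma FalseE0:
  assumes "G \<TTurnstile> closed (Ind False_decl)" "G \<tturnstile> R : Propd"
  shows "G \<TTurnstile> R"
proof -
  obtain e where e: "G \<tturnstile> e : closed (Ind False_decl)" using assms by (auto simp: holds_def)
  have C: "fam G (closed (Ind False_decl)) (\<lambda>_. R) 0" by (rule fam_const) ((assumption
    | rule assms typing rels ambient)+)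
  have "G \<tturnstile> closed (Rec False_decl 0) \<cdot> lamd (closed (Ind False_decl)) (\<lambda>_. R) \<cdot> e : lamd (closed
    (Ind False_decl)) (\<lambda>_. R) \<cdot> e"
    by (rule typed_eqI, (assumption | rule e assms(2) fam_lam[OF C] typing rels ambient)+, rule refl)
  from deq_conv[OF this deq_fam[OF C e]] show ?thesis by (rule holdsI)
qed

text \<open>The case to be proved is a curried implication, so that both projections follow from
  \<open>impI0\<close> alone. The motive is again constant.\<close>

lemma conjE0:
  assumes "G \<TTurnstile> P \<^bold>\<and> Q" "G \<tturnstile> P : Propd" "G \<tturnstile> Q : Propd" "G \<tturnstile> R : Propd" "G \<TTurnstile> P \<^bold>\<rightarrow> Q \<^bold>\<rightarrow> R"
  shows "G \<TTurnstile> R"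
proof -
  obtain e where e: "G \<tturnstile> e : (P \<^bold>\<and> Q)" using assms by (auto simp: holds_def)
  have C: "fam G (P \<^bold>\<and> Q) (\<lambda>_. R) 0" by (rule fam_const) ((assumption | rule assms typing rels ambient)+)
  let ?C = "lamd (P \<^bold>\<and> Q) (\<lambda>_. R)"
  from assms(5)[unfolded arr_def]
  have "G \<TTurnstile> (\<^bold>\<forall>p : P. \<^bold>\<forall>q : Q. ?C \<cdot> (closed (Con And_decl 0) \<cdot> P \<cdot> Q \<cdot> p \<cdot> q))"
    apply (rule holds_conv)
    apply (rule deq_pi)
       apply (rule assms)
      apply (rule deq_pi)
         apply (rule weak, rule assms)
        apply (rule deq_sym)
        apply (rule deq_fam)
         apply (rule fam_weak C)+
        apply (rule typed_eqI, (assumption | rule assms typing rels ambient)+, rule refl)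
       apply ((assumption | rule assms fam_lam[OF C] typing rels ambient)+)+
    done
  then obtain m where m: "G \<tturnstile> m : (\<^bold>\<forall>p : P. \<^bold>\<forall>q : Q. ?C \<cdot> (closed (Con And_decl 0) \<cdot> P \<cdot> Q \<cdot> p \<cdot> q))"
    by (auto simp: holds_def)
  have "G \<tturnstile> closed (Rec And_decl 0) \<cdot> P \<cdot> Q \<cdot> ?C \<cdot> m \<cdot> e : ?C \<cdot> e"
    by (rule typed_eqI, (assumption | rule e m assms(2-4) fam_lam[OF C] typing rels ambient)+, rule refl)
  from deq_conv[OF this deq_fam[OF C e]] show ?thesis by (rule holdsI)
qed

lemma conjunct1_0: "G \<TTurnstile> P \<^bold>\<and> Q \<Longrightarrow> G \<tturnstile> P : Propd \<Longrightarrow> G \<tturnstile> Q : Propd \<Longrightarrow> G \<TTurnstile> P"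
  by (rule conjE0, assumption+, rule impI0, ((assumption | rule typing rels ambient)+), rule impI0, ((assumption
    | rule typing rels ambient)+), erule holdsI[OF weak])

lemma conjunct2_0: "G \<TTurnstile> P \<^bold>\<and> Q \<Longrightarrow> G \<tturnstile> P : Propd \<Longrightarrow> G \<tturnstile> Q : Propd \<Longrightarrow> G \<TTurnstile> Q"
  by (rule conjE0, assumption+, rule impI0, ((assumption | rule typing rels ambient)+), rule impI0, ((assumption
    | rule typing rels ambient)+), erule holdsI)

lemma iffE0:
  assumes "G \<TTurnstile> P \<^bold>\<leftrightarrow> Q" "G \<tturnstile> P : Propd" "G \<tturnstile> Q : Propd" "G \<tturnstile> R : Propd"
    "G \<TTurnstile> (P \<^bold>\<rightarrow> Q) \<^bold>\<rightarrow> (Q \<^bold>\<rightarrow> P) \<^bold>\<rightarrow> R"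
  shows "G \<TTurnstile> R"
proof -
  let ?P = "P \<^bold>\<rightarrow> Q" and ?Q = "Q \<^bold>\<rightarrow> P"
  obtain e where e: "G \<tturnstile> e : (P \<^bold>\<leftrightarrow> Q)" using assms by (auto simp: holds_def)
  have C: "fam G (P \<^bold>\<leftrightarrow> Q) (\<lambda>_. R) 0" by (rule fam_const) ((assumption | rule assms typing rels ambient)+)
  let ?C = "lamd (P \<^bold>\<leftrightarrow> Q) (\<lambda>_. R)"
  have "G \<TTurnstile> (\<^bold>\<forall>p : ?P. \<^bold>\<forall>q : ?Q. R)" using assms(5) unfolding arr_def .
  then have "G \<TTurnstile> (\<^bold>\<forall>p : ?P. \<^bold>\<forall>q : ?Q. ?C \<cdot> (closed (Con Iff_decl 0) \<cdot> P \<cdot> Q \<cdot> p \<cdot> q))"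
    apply (rule holds_conv)
    apply (rule deq_pi)
       apply (rule typed_imp assms)+
      apply (rule deq_pi)
         apply (rule weak, rule typed_imp, (rule assms)+)
        apply (rule deq_sym)
        apply (rule deq_fam)
         apply (rule fam_weak C)+
        apply (rule typed_eqI, (assumption | rule assms typing rels ambient)+, rule refl)
       apply ((assumption | rule assms fam_lam[OF C] typing rels ambient)+)+
    done
  then obtain m where m: "G \<tturnstile> m : (\<^bold>\<forall>p : ?P. \<^bold>\<forall>q : ?Q. ?C \<cdot> (closed (Con Iff_decl 0) \<cdot> P \<cdot> Q \<cdot> p \<cdot> q))"
    by (auto simp: holds_def)
  have "G \<tturnstile> closed (Rec Iff_decl 0) \<cdot> P \<cdot> Q \<cdot> ?C \<cdot> m \<cdot> e : ?C \<cdot> e"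
    by (rule typed_eqI, (assumption | rule e m assms(2-4) fam_lam[OF C] typing rels ambient)+, rule refl)
  from deq_conv[OF this deq_fam[OF C e]] show ?thesis by (rule holdsI)
qed

lemma iffD1_0: "G \<TTurnstile> P \<^bold>\<leftrightarrow> Q \<Longrightarrow> G \<tturnstile> P : Propd \<Longrightarrow> G \<tturnstile> Q : Propd \<Longrightarrow> G \<TTurnstile> P \<Longrightarrow> G \<TTurnstile> Q"
  by (rule mp0[of _ P], rule iffE0, assumption+, ((assumption | rule typing rels ambient)+), rule impI0,
    ((assumption | rule typing rels ambient)+), rule impI0, ((assumption | rule typing rels ambient)+),
    erule holdsI[OF weak])

lemma iffD2_0: "G \<TTurnstile> P \<^bold>\<leftrightarrow> Q \<Longrightarrow> G \<tturnstile> P : Propd \<Longrightarrow> G \<tturnstile> Q : Propd \<Longrightarrow> G \<TTurnstile> Q \<Longrightarrow> G \<TTurnstile> P"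
  by (rule mp0[of _ Q], rule iffE0, assumption+, ((assumption | rule typing rels ambient)+), rule impI0,
    ((assumption | rule typing rels ambient)+), rule impI0, ((assumption | rule typing rels ambient)+),
    erule holdsI)

lemma disjE_0:
  assumes "G \<TTurnstile> P \<^bold>\<or> Q" "G \<tturnstile> P : Propd" "G \<tturnstile> Q : Propd" "G \<tturnstile> R : Propd"
    "\<And>h. P # G \<TTurnstile> P \<Longrightarrow> P # G \<TTurnstile> R" "\<And>h. Q # G \<TTurnstile> Q \<Longrightarrow> Q # G \<TTurnstile> R"
  shows "G \<TTurnstile> R"
proof -
  obtain e where e: "G \<tturnstile> e : (P \<^bold>\<or> Q)" using assms by (auto simp: holds_def)
  have C: "fam G (P \<^bold>\<or> Q) (\<lambda>_. R) 0" by (rule fam_const) ((assumption | rule assms typing rels ambient)+)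
  let ?C = "lamd (P \<^bold>\<or> Q) (\<lambda>_. R)"
  have "G \<TTurnstile> (\<^bold>\<forall>p : P. R)"
    by (rule allI0, rule assms, ((assumption | rule assms(2-4) typing rels ambient)+), erule assms(5,6)[OF
      holdsI])
  then have m0: "G \<TTurnstile> (\<^bold>\<forall>p : P. ?C \<cdot> (closed (Con Or_decl 0) \<cdot> P \<cdot> Q \<cdot> p))"
    apply (rule holds_conv)
    apply (rule deq_pi)
       apply (rule assms)
      apply (rule deq_sym)
      apply (rule deq_fam)
       apply (rule fam_weak C)+
      apply (rule typed_eqI, (assumption | rule assms typing rels ambient)+, rule refl)
     apply ((assumption | rule assms fam_lam[OF C] typing rels ambient)+)+
    done
  have "G \<TTurnstile> (\<^bold>\<forall>q : Q. R)"
    by (rule allI0, rule assms, ((assumption | rule assms(2-4) typing rels ambient)+), erule assms(5,6)[OF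
      holdsI])
  then have m1: "G \<TTurnstile> (\<^bold>\<forall>q : Q. ?C \<cdot> (closed (Con Or_decl 1) \<cdot> P \<cdot> Q \<cdot> q))"
    apply (rule holds_conv)
    apply (rule deq_pi)
       apply (rule assms)
      apply (rule deq_sym)
      apply (rule deq_fam)
       apply (rule fam_weak C)+
      apply (rule typed_eqI, (assumption | rule assms typing rels ambient)+, rule refl)
     apply ((assumption | rule assms fam_lam[OF C] typing rels ambient)+)+
    done
  from m0 m1 obtain m m' where m: "G \<tturnstile> m : (\<^bold>\<forall>p : P. ?C \<cdot> (closed (Con Or_decl 0) \<cdot> P \<cdot> Q \<cdot> p))"
    "G \<tturnstile> m' : (\<^bold>\<forall>q : Q. ?C \<cdot> (closed (Con Or_decl 1) \<cdot> P \<cdot> Q \<cdot> q))"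
    by (auto simp: holds_def)
  have "G \<tturnstile> closed (Rec Or_decl 0) \<cdot> P \<cdot> Q \<cdot> ?C \<cdot> m \<cdot> m' \<cdot> e : ?C \<cdot> e"
    by (rule typed_eqI, (assumption | rule e m assms(2-4) fam_lam[OF C] typing rels ambient)+, rule refl)
  from deq_conv[OF this deq_fam[OF C e]] show ?thesis by (rule holdsI)
qed

text \<open>The recursor of equality allows a motive that depends on the equality proof. Here the
  motive ignores that proof, which leaves Leibniz substitution; two \<beta>-steps relate it to
  \<open>P\<close>.\<close>

lemma eq_elim0:
  assumes "G \<TTurnstile> eqd u A a b" "G \<tturnstile> A : Srt u" "G \<tturnstile> a : A" "G \<tturnstile> b : A" "fam G A P 0" "G \<TTurnstile> P a"
  shows "G \<TTurnstile> P b"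
proof -
  let ?C = "lamd A (\<lambda>x. lamd (eqd u A a x) (\<lambda>_. P x))" and ?r = "closed (Con (Eq_decl u) 0) \<cdot> A \<cdot> a"
  note U = rel_uni[OF fam_uni[OF assms(5)]] and F = typed_fam[where P = P] assms(5)
  have r: "G \<tturnstile> ?r : eqd u A a a"
    by (rule typed_eqI, (assumption | rule assms typing rels ambient)+, rule refl)
  obtain e where e: "G \<tturnstile> e : eqd u A a b" using assms by (auto simp: holds_def)
  have C: "G \<tturnstile> ?C : (\<^bold>\<forall>x : A. \<^bold>\<forall>e : eqd u A a x. Propd)"
    by ((assumption | rule assms(2-4) F typing rels U ambient)+)
  have *: "G \<tturnstile> ?C \<cdot> x \<cdot> h \<equiv> P x : Propd" if "G \<tturnstile> x : A" "G \<tturnstile> h : eqd u A a x" for x h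
  proof -
    have "G \<tturnstile> ?C \<cdot> x \<equiv> lamd (eqd u A a x) (\<lambda>_. P x) : (\<^bold>\<forall>e : eqd u A a x. Propd)"
      by (rule deq_beta[OF C _ _ that(1)]) ((assumption | rule assms(2-4) F typing rels U ambient)+)
    from deq_app[OF this that(2)]
    have "G \<tturnstile> ?C \<cdot> x \<cdot> h \<equiv> lamd (eqd u A a x) (\<lambda>_. P x) \<cdot> h : Propd"
      by (rule meta_mp) ((assumption | rule assms(2-4) F typing rels U ambient)+)
    moreover have "G \<tturnstile> lamd (eqd u A a x) (\<lambda>_. P x) \<cdot> h \<equiv> P x : Propd"
      by (rule deq_fam[OF fam_const that(2)]) ((assumption | rule that assms(2-4) F typing rels U ambient)+)
    ultimately show ?thesis by (rule deq_trans)
  qed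
  obtain m where m: "G \<tturnstile> m : ?C \<cdot> a \<cdot> ?r"
    using holds_conv[OF assms(6) deq_sym[OF *[OF assms(3) r]]] by (auto simp: holds_def)
  have "G \<tturnstile> closed (Rec (Eq_decl u) 0) \<cdot> A \<cdot> a \<cdot> ?C \<cdot> m \<cdot> b \<cdot> e : ?C \<cdot> b \<cdot> e"
    by (rule typed_eqI, (assumption | rule e m C assms(2-4) F typing rels U ambient)+, rule refl)
  from deq_conv[OF this *[OF assms(4) e]] show ?thesis by (rule holdsI)
qed

section \<open>Sets\<close>

text \<open>The function is given only up to conversion, so the rule can be iterated and reduces a
  curried application from the left.\<close>

lemma beta_step:
  "G \<tturnstile> f \<equiv> lamd A b : pid A B \<Longrightarrow> uni (length G) b \<Longrightarrow> uni (length G) B \<Longrightarrow> G \<tturnstile> a : A \<Longrightarrow> G \<tturnstile> f \<cdot> a \<equiv> b a : B a"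
  by (rule deq_trans[OF deq_app deq_beta[OF deq_right]])

lemma deq_app_arr: "G \<tturnstile> f \<equiv> f' : (\<^bold>\<forall>_ : A. B) \<Longrightarrow> G \<tturnstile> B : Srt u \<Longrightarrow> G \<tturnstile> a \<equiv> a' : A \<Longrightarrow> G \<tturnstile> f \<cdot> a \<equiv> f' \<cdot> a' : B"
  using deq_app[of G f f' A "\<lambda>_. B"] by (simp add: uni_const deq_st)

text \<open>Typed equality comes with congruence rules for the basic term formers only. Those for
  connectives are derived, in order to convert inside the unfolded bisimilarity.\<close>

lemma deq_conj: "G \<tturnstile> P \<equiv> P' : Propd \<Longrightarrow> G \<tturnstile> Q \<equiv> Q' : Propd \<Longrightarrow> G \<tturnstile> (P \<^bold>\<and> Q) \<equiv> (P' \<^bold>\<and> Q') : Propd"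
  unfolding conjd_def using deq_app[OF deq_app[OF typed_And(1)], of G P P' Q Q'] uni_const[OF st_closed, of
    "Sort 0"] st_pi[of "length G" Propd "\<lambda>_. Propd"]
  by (simp add: uni_const)

lemma deq_ex:
  assumes "G \<tturnstile> A \<equiv> A' : Srt u" "\<And>x. A # G \<tturnstile> x : A \<Longrightarrow> A # G \<tturnstile> P x \<equiv> P' x : Propd" "uni (length G) P"
    "uni (length G) P'"
  shows "G \<tturnstile> exd u A P \<equiv> exd u A' P' : Propd"
proof -
  have "G \<tturnstile> lamd A P \<equiv> lamd A' P' : (\<^bold>\<forall>_ : A. Propd)" by (rule deq_lam[OF assms(1)]) (assumption
    | rule assms uni_const st_closed | simp)+
  from deq_app[OF deq_app[OF typed_Exists(1)[unfolded arr_def] assms(1)] this] show ?thesis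
    unfolding exd_def by (rule meta_mp) ((assumption | rule typing rels ambient)+)
qed

section \<open>The type of sets and its recursor\<close>

lemma wf_V: "wf_decl V_decl"
  unfolding V_decl_def
  by ((rule wf_intros conjI)+ | simp | (simp, rule wf_intros conjI))+

lemma typ_Type0 [typing]: "G \<tturnstile> Type0 : Srt 2"
  using typ_sort[of G 1] by (simp add: numeral_2_eq_2)

lemma typed_V [typing]: "G \<tturnstile> V : Srt 2"
  unfolding V_def by (rule typed_Ind[OF wf_V]) (simp_all add: raw types V_decl_def)

lemma typed_Con_V [typing]: "G \<tturnstile> closed (Con V_decl 0) : (\<^bold>\<forall>A : Type0. \<^bold>\<forall>f : (\<^bold>\<forall>_ : A. V). V)"
  by (rule typed_Con[OF wf_V]) (simp_all add: raw types V_def V_decl_def)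

lemma typed_Rec_V [typing]: "G \<tturnstile> closed (Rec V_decl u) : (\<^bold>\<forall>C : (\<^bold>\<forall>_ : V. Srt u).
   \<^bold>\<forall>m : (\<^bold>\<forall>A : Type0. \<^bold>\<forall>f : (\<^bold>\<forall>_ : A. V). \<^bold>\<forall>ih : (\<^bold>\<forall>i : A. C \<cdot> (f \<cdot> i)). C \<cdot> supd A f). \<^bold>\<forall>x : V. C \<cdot> x)"
  by (rule typed_Rec[OF wf_V]) (simp_all add: raw types V_def V_decl_def supd_def)

lemma rel_V [rels]: "rel \<theta> k V V" unfolding V_def by (rule rels)
lemma rel_sup [rels]: "rel \<theta> k A A' \<Longrightarrow> rel \<theta> k f f' \<Longrightarrow> rel \<theta> k (supd A f) (supd A' f')"
  unfolding supd_def by (rule rels | assumption)+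
lemma typed_sup [typing]: "G \<tturnstile> A : Type0 \<Longrightarrow> G \<tturnstile> f : (\<^bold>\<forall>_ : A. V) \<Longrightarrow> G \<tturnstile> supd A f : V"
  unfolding supd_def by (rule typed_eqI, (assumption | rule typing rels ambient)+, rule refl)

text \<open>Motives are metalevel functions \<open>P\<close>, while the recursor expects an
  abstraction. The conversion between \<open>lamd V P \<cdot> x\<close> and \<open>P x\<close> is
  carried out here once for all recursions on sets.\<close>

lemma
  assumes "fam G V P u" "G \<tturnstile> m : (\<^bold>\<forall>A : Type0. \<^bold>\<forall>f : (\<^bold>\<forall>_ : A. V). \<^bold>\<forall>ih : (\<^bold>\<forall>i : A. P (f \<cdot> i)). P (supd A f))"
  shows typed_rec_V_fun: "G \<tturnstile> closed (Rec V_decl u) \<cdot> lamd V P \<cdot> m : pid V P"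
    and typed_rec_V: "G \<tturnstile> x : V \<Longrightarrow> G \<tturnstile> closed (Rec V_decl u) \<cdot> lamd V P \<cdot> m \<cdot> x : P x"
    and deq_rec_V: "G \<tturnstile> A : Type0 \<Longrightarrow> G \<tturnstile> f : (\<^bold>\<forall>_ : A. V) \<Longrightarrow>
      G \<tturnstile> closed (Rec V_decl u) \<cdot> lamd V P \<cdot> m \<cdot> supd A f \<equiv>
        m \<cdot> A \<cdot> f \<cdot> (\<^bold>\<lambda>i : A. closed (Rec V_decl u) \<cdot> lamd V P \<cdot> m \<cdot> (f \<cdot> i)) : P (supd A f)"
proof -
  note F = typed_fam[where P = P] assms(1) and U = rel_uni[OF fam_uni[OF assms(1)]]
  let ?C = "lamd V P"
  have "G \<tturnstile> (\<^bold>\<forall>A : Type0. \<^bold>\<forall>f : (\<^bold>\<forall>_ : A. V). \<^bold>\<forall>ih : (\<^bold>\<forall>i : A. P (f \<cdot> i)). P (supd A f))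
     \<equiv> (\<^bold>\<forall>A : Type0. \<^bold>\<forall>f : (\<^bold>\<forall>_ : A. V). \<^bold>\<forall>ih : (\<^bold>\<forall>i : A. ?C \<cdot> (f \<cdot> i)). ?C \<cdot> supd A f) : Srt (imax 2 (imax
       (imax 1 2) (imax (imax 1 u) u)))"
    apply (rule deq_pi, ((assumption | rule typing rels ambient | erule good_tls
      | rule lift_deq lift_fam good_ext, (assumption))+)[])
    apply (rule deq_pi, ((assumption | rule typing rels ambient | erule good_tls
      | rule lift_deq lift_fam good_ext, (assumption))+)[])
    apply (rule deq_pi)
    apply (rule deq_pi, ((assumption | rule typing rels ambient | erule good_tls
      | rule lift_deq lift_fam good_ext, (assumption))+)[])
    apply (rule deq_sym, rule deq_fam, (rule assms fam_weak)+, ((assumption | rule typing rels ambient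
      | erule good_tls | rule lift_deq lift_fam good_ext, (assumption))+)[])
    apply (((assumption | rule typing rels U ambient | erule good_tls | rule lift_deq lift_fam good_ext,
      (assumption))+))[2]
    apply (rule deq_sym, rule deq_fam, (rule assms fam_weak)+, ((assumption | rule typing uniI rels
      | (erule rel_mono, simp; fail) | rule rel_amb | (rule lift_deq lift_fam good_ext, assumption)
      | erule good_tls | rule weak fam_weak)+)[])
    apply (((assumption | rule typing rels U ambient | erule good_tls | rule lift_deq lift_fam good_ext,
      (assumption))+))
    done
  from deq_conv[OF assms(2) this] have m: "G \<tturnstile> m : (\<^bold>\<forall>A : Type0. \<^bold>\<forall>f : (\<^bold>\<forall>_ : A. V). \<^bold>\<forall>ih : (\<^bold>\<forall>i : A. ?C \<cdot>
    (f \<cdot> i)). ?C \<cdot> supd A f)" .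
  have 1: "G \<tturnstile> closed (Rec V_decl u) \<cdot> ?C \<cdot> m : (\<^bold>\<forall>x : V. ?C \<cdot> x)"
    by (rule typed_eqI, (assumption | rule m fam_lam[OF assms(1)] typing rels U ambient | erule good_tls
      | rule lift_deq lift_fam good_ext, (assumption | rule m fam_lam[OF assms(1)]))+, rule refl)
  show 2: "G \<tturnstile> closed (Rec V_decl u) \<cdot> ?C \<cdot> m : pid V P"
    by (rule deq_conv[OF 1], rule deq_pi, ((assumption | rule typing rels ambient | erule good_tls
      | rule lift_deq lift_fam good_ext, (assumption))+)[], rule deq_fam[OF fam_weak[OF assms(1)]]) ((assumption
      | rule fam_lam[OF assms(1)] typing rels U ambient | erule good_tls | rule lift_deq lift_fam good_ext,
      (assumption | rule fam_lam[OF assms(1)]))+)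
  have *: "G \<tturnstile> closed (Rec V_decl u) \<cdot> ?C \<cdot> m \<cdot> x : P x" if "G \<tturnstile> x : V" for x
    by (rule typed_app[OF 2 that fam_uni[OF assms(1)]])
  then show "G \<tturnstile> x : V \<Longrightarrow> G \<tturnstile> closed (Rec V_decl u) \<cdot> ?C \<cdot> m \<cdot> x : P x" .
  assume A: "G \<tturnstile> A : Type0" "G \<tturnstile> f : (\<^bold>\<forall>_ : A. V)"
  let ?n = "length G"
  have l: "G \<tturnstile> closed (Rec V_decl u) \<cdot> ?C \<cdot> m \<cdot> supd A f : P (supd A f)"
    by (rule *) ((assumption | rule A typing rels ambient)+)
  have C: "st ?n ?C" "st ?n m" "st ?n f" "st ?n A"
    using fam_lam[OF assms(1)] m A by (auto dest: deq_st)
  have u: "uni ?n (\<lambda>i. closed (Rec V_decl u) \<cdot> ?C \<cdot> m \<cdot> (f \<cdot> i))"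
    by ((assumption | rule typing rels A m U ambient)+)
  have "cx G \<turnstile> (closed (Rec V_decl u) \<cdot> ?C \<cdot> m \<cdot> supd A f) ?n \<equiv>
    (m \<cdot> A \<cdot> f \<cdot> (\<^bold>\<lambda>i : A. closed (Rec V_decl u) \<cdot> ?C \<cdot> m \<cdot> (f \<cdot> i))) ?n : P (supd A f) ?n" if "ok G"
    \<comment> \<open>There are no parameters and no indices; \<open>A\<close> is the only plain
      argument and \<open>f\<close> the only recursive one. The telescope of \<open>f\<close> has
      length one, hence the abstraction over \<open>i\<close> in the contractum.\<close>
    using iota[of 0 V_decl "[]" "[]" "[m ?n]" "[]" "[A ?n]" "[f ?n]" "cx G" u "?C ?n" "P (supd A f) ?n"] l that
      C[THEN st_at_Suc]
    by (simp add: V_decl_def iota_def deq_def appd_def closed_def supd_def vars_def lamd_def[of A])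
  then show "G \<tturnstile> closed (Rec V_decl u) \<cdot> ?C \<cdot> m \<cdot> supd A f \<equiv>
    m \<cdot> A \<cdot> f \<cdot> (\<^bold>\<lambda>i : A. closed (Rec V_decl u) \<cdot> ?C \<cdot> m \<cdot> (f \<cdot> i)) : P (supd A f)"
    using deq_st[OF l] C u by (simp add: deq_def st_lam)
qed

lemma typed_ex0 [typing]:
  "G \<tturnstile> A : Type0 \<Longrightarrow> (\<And>x. A # G \<tturnstile> x : A \<Longrightarrow> A # G \<tturnstile> P x : Propd) \<Longrightarrow> uni (length G) P \<Longrightarrow> G \<tturnstile> exd (Suc 0) A P : Propd"
  using typed_ex[of G A 1 P] famI[of G A 1 P 0] by simp

lemma typed_ex1 [typing]:
  "G \<tturnstile> A : Srt 2 \<Longrightarrow> (\<And>x. A # G \<tturnstile> x : A \<Longrightarrow> A # G \<tturnstile> P x : Propd) \<Longrightarrow> uni (length G) P \<Longrightarrow> G \<tturnstile> exd (Suc (Suc 0)) A P :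
    Propd"
  using typed_ex[of G A 2 P] famI[of G A 2 P 0] by (simp add: numeral_2_eq_2)

lemma deq_ex0:
  "G \<tturnstile> A \<equiv> A' : Type0 \<Longrightarrow> (\<And>x. A # G \<tturnstile> x : A \<Longrightarrow> A # G \<tturnstile> P x \<equiv> P' x : Propd) \<Longrightarrow> uni (length G) P \<Longrightarrow> uni (length G) P'
   \<Longrightarrow> G \<tturnstile> exd (Suc 0) A P \<equiv> exd (Suc 0) A' P' : Propd"
  using deq_ex[of G A A' 1] by simp

lemma deq_all:
  "G \<tturnstile> A \<equiv> A' : Srt u \<Longrightarrow> (\<And>x. A # G \<tturnstile> x : A \<Longrightarrow> A # G \<tturnstile> B x \<equiv> B' x : Propd) \<Longrightarrow> uni (length G) B \<Longrightarrow> uni (length G) B'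
   \<Longrightarrow> G \<tturnstile> pid A B \<equiv> pid A' B' : Propd"
  using deq_pi[of G A A' u B B' 0] by (simp add: imax_def)

lemma V_induct:
  assumes "fam G V P 0" "G \<tturnstile> x : V"
    "\<And>A f. (\<^bold>\<forall>_ : A. V) # Type0 # G \<tturnstile> A : Type0 \<Longrightarrow> (\<^bold>\<forall>_ : A. V) # Type0 # G \<tturnstile> f : (\<^bold>\<forall>_ : A. V) \<Longrightarrow>
       (\<^bold>\<forall>i : A. P (f \<cdot> i)) # (\<^bold>\<forall>_ : A. V) # Type0 # G \<TTurnstile> (\<^bold>\<forall>i : A. P (f \<cdot> i)) \<Longrightarrow>
       (\<^bold>\<forall>i : A. P (f \<cdot> i)) # (\<^bold>\<forall>_ : A. V) # Type0 # G \<TTurnstile> P (supd A f)"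
  shows "G \<TTurnstile> P x"
proof -
  note F = typed_fam[where P = P] assms(1) and U = rel_uni[OF fam_uni[OF assms(1)]]
  have "G \<TTurnstile> (\<^bold>\<forall>A : Type0. \<^bold>\<forall>f : (\<^bold>\<forall>_ : A. V). \<^bold>\<forall>ih : (\<^bold>\<forall>i : A. P (f \<cdot> i)). P (supd A f))"
    apply (rule allI0, ((assumption | rule typing rels ambient | erule good_tls
      | rule lift_deq lift_fam good_ext, (assumption))+)[], ((assumption | rule F typing rels U ambient
      | erule good_tls | rule lift_deq lift_fam good_ext, (assumption | rule F))+)[])
    apply (rule allI0, ((assumption | rule typing rels ambient | erule good_tls
      | rule lift_deq lift_fam good_ext, (assumption))+)[], ((assumption | rule F typing rels U ambient
      | erule good_tls | rule lift_deq lift_fam good_ext, (assumption | rule F))+)[])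
    apply (rule allI0, ((assumption | rule F typing uniI rels | (erule rel_mono, simp; fail) | rule U rel_amb
      | (rule lift_deq lift_fam good_ext, (assumption | rule F)) | erule good_tls | rule weak fam_weak)+)[],
      ((assumption | rule F typing uniI rels | (erule rel_mono, simp; fail) | rule U rel_amb
      | (rule lift_deq lift_fam good_ext, (assumption | rule F)) | erule good_tls | rule weak fam_weak)+)[])
    apply (rule assms(3), rule weak, assumption, assumption, erule holdsI)
    done
  then show ?thesis using typed_rec_V[OF assms(1) _ assms(2)] by (auto simp: holds_def)
qed

section \<open>Index types, children and bisimilarity\<close>

lemma rel_bar [rels]: "rel \<theta> k x x' \<Longrightarrow> rel \<theta> k (bar x) (bar x')"
  and rel_child [rels]: "rel \<theta> k x x' \<Longrightarrow> rel \<theta> k i i' \<Longrightarrow> rel \<theta> k (child x i) (child x' i')"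
  and rel_bisim [rels]: "rel \<theta> k x x' \<Longrightarrow> rel \<theta> k i i' \<Longrightarrow> rel \<theta> k (x \<^bold>\<approx> i) (x' \<^bold>\<approx> i')"
  and rel_mem [rels]: "rel \<theta> k x x' \<Longrightarrow> rel \<theta> k i i' \<Longrightarrow> rel \<theta> k (x \<^bold>\<in> i) (x' \<^bold>\<in> i')"
  unfolding mem_def bisim_def child_def bar_def
  by (assumption | rule rels rel_shift)+

lemma typed_bar [typing]: "G \<tturnstile> x : V \<Longrightarrow> G \<tturnstile> bar x : Type0"
  and deq_bar: "G \<tturnstile> A : Type0 \<Longrightarrow> G \<tturnstile> f : (\<^bold>\<forall>_ : A. V) \<Longrightarrow> G \<tturnstile> bar (supd A f) \<equiv> A : Type0"
proof -
  have F: "fam G V (\<lambda>_. Type0) 2" by (rule fam_const) ((assumption | rule typing rels ambient)+)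
  have L: "G \<tturnstile> (\<^bold>\<lambda>A : Type0. \<^bold>\<lambda>f : (\<^bold>\<forall>_ : A. V). \<^bold>\<lambda>ih : (\<^bold>\<forall>_ : A. Type0). A)
      : (\<^bold>\<forall>A : Type0. \<^bold>\<forall>f : (\<^bold>\<forall>_ : A. V). \<^bold>\<forall>ih : (\<^bold>\<forall>i : A. Type0). Type0)"
    by ((assumption | rule typing rels ambient)+)
  show "G \<tturnstile> x : V \<Longrightarrow> G \<tturnstile> bar x : Type0"
    unfolding bar_def arr_def by (rule typed_rec_V[OF F L])
  assume A: "G \<tturnstile> A : Type0" "G \<tturnstile> f : (\<^bold>\<forall>_ : A. V)"
  show "G \<tturnstile> bar (supd A f) \<equiv> A : Type0"
    unfolding bar_def arr_def
    apply (rule deq_trans[OF deq_rec_V[OF F L A]])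
    apply (rule beta_step[OF beta_step[OF deq_beta[OF L]]])
    apply ((assumption | rule L A typed_rec_V[where P = "\<lambda>_. Type0" and u = 2] typing rels fam_const ambient)+)
    done
qed

lemma typed_child [typing]: "G \<tturnstile> x : V \<Longrightarrow> G \<tturnstile> i : bar x \<Longrightarrow> G \<tturnstile> child x i : V"
  and deq_child: "G \<tturnstile> A : Type0 \<Longrightarrow> G \<tturnstile> f : (\<^bold>\<forall>_ : A. V) \<Longrightarrow> G \<tturnstile> i : A \<Longrightarrow> G \<tturnstile> child (supd A f) i \<equiv> f \<cdot> i : V"
proof -
  have bV: "H \<tturnstile> (\<^bold>\<forall>_ : bar x. V) : Srt 2" if "H \<tturnstile> x : V" for H x
    using typed_pi[of H "bar x" 1 "\<lambda>_. V" 2] typed_bar[OF that] typed_V uni_const[OF deq_st(1)[OF typed_V]]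
    by (simp add: imax_def numeral_2_eq_2)
  have F: "fam H V (\<lambda>x. \<^bold>\<forall>_ : bar x. V) 2" for H by (rule famI) ((assumption | rule bV typing rels ambient)+)
  \<comment> \<open>The minor premise returns \<open>f\<close>, whose domain is \<open>A\<close>,
    where a function on \<open>bar (supd A f)\<close> is expected; the two domains are
    convertible.\<close>
  have f: "H \<tturnstile> f : (\<^bold>\<forall>_ : bar (supd A f). V)" if "H \<tturnstile> A : Type0" "H \<tturnstile> f : (\<^bold>\<forall>_ : A. V)" for H A f
    by (rule deq_conv[OF that(2)], rule deq_pi, rule deq_sym, rule deq_bar, ((assumption
      | rule that typing rels ambient)+))
  let ?L = "\<^bold>\<lambda>A : Type0. \<^bold>\<lambda>f : (\<^bold>\<forall>_ : A. V). \<^bold>\<lambda>ih : (\<^bold>\<forall>i : A. \<^bold>\<forall>_ : bar (f \<cdot> i). V). f"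
  have L: "H \<tturnstile> ?L : (\<^bold>\<forall>A : Type0. \<^bold>\<forall>f : (\<^bold>\<forall>_ : A. V). \<^bold>\<forall>ih : (\<^bold>\<forall>i : A. \<^bold>\<forall>_ : bar (f \<cdot> i). V). \<^bold>\<forall>_ : bar (supd A f). V)"
    for H
    by (rule typed_lam, ((assumption | rule typing rels ambient)+)[], rule typed_lam, ((assumption
      | rule typing rels ambient)+)[], rule typed_lam, ((assumption | rule typing rels ambient)+)[], rule f,
      ((assumption | rule typing rels ambient)+))
  show "G \<tturnstile> x : V \<Longrightarrow> G \<tturnstile> i : bar x \<Longrightarrow> G \<tturnstile> child x i : V"
    unfolding child_def arr_def by (rule typed_eqI, rule typed_app[OF typed_rec_V[OF F L]]) ((assumption
      | rule typing rels ambient)+ | rule refl)+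
  assume A: "G \<tturnstile> A : Type0" "G \<tturnstile> f : (\<^bold>\<forall>_ : A. V)" "G \<tturnstile> i : A"
  have i: "G \<tturnstile> i : bar (supd A f)"
    by (rule deq_conv[OF A(3) deq_sym[OF deq_bar[OF A(1,2)]]])
  have "G \<tturnstile> closed (Rec V_decl 2) \<cdot> lamd V (\<lambda>x. \<^bold>\<forall>_ : bar x. V) \<cdot> ?L \<cdot> supd A f \<equiv> f : (\<^bold>\<forall>_ : bar (supd A f). V)"
    apply (rule deq_trans[OF deq_rec_V[OF F L A(1,2)]])
    apply (rule beta_step[OF beta_step[OF deq_beta[OF L]]])
    apply ((assumption | rule L A typed_rec_V[where P = "\<lambda>x. \<^bold>\<forall>_ : bar x. V" and u = 2] typing rels F ambient)+)
    done
  from deq_app[OF this i] show "G \<tturnstile> child (supd A f) i \<equiv> f \<cdot> i : V"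
    unfolding child_def arr_def by (rule meta_mp) ((assumption | rule typing rels ambient)+)
qed

lemma typed_bisim [typing]: "G \<tturnstile> x : V \<Longrightarrow> G \<tturnstile> y : V \<Longrightarrow> G \<tturnstile> (x \<^bold>\<approx> y) : Propd"
  and deq_bisim_sup: "G \<tturnstile> A : Type0 \<Longrightarrow> G \<tturnstile> f : (\<^bold>\<forall>_ : A. V) \<Longrightarrow> G \<tturnstile> y : V \<Longrightarrow>
    G \<tturnstile> (supd A f \<^bold>\<approx> y) \<equiv> ((\<^bold>\<forall>i : A. \<^bold>\<exists>\<^sub>0j : bar y. f \<cdot> i \<^bold>\<approx> child y j) \<^bold>\<and> (\<^bold>\<forall>j : bar y. \<^bold>\<exists>\<^sub>0i : A. f \<cdot> i \<^bold>\<approx> child y j)) :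
      Propd"
  and deq_bisim: "G \<tturnstile> x \<equiv> x' : V \<Longrightarrow> G \<tturnstile> y \<equiv> y' : V \<Longrightarrow> G \<tturnstile> (x \<^bold>\<approx> y) \<equiv> (x' \<^bold>\<approx> y') : Propd"
proof -
  have VP: "H \<tturnstile> (\<^bold>\<forall>_ : V. Propd) : Srt 2" for H
    using typed_pi[of H V 2 "\<lambda>_. Propd" 1] typed_V typ_sort[of "V # H" 0] uni_const[OF st_closed, of "Sort 0"]
    by (simp add: imax_def numeral_2_eq_2)
  have F: "fam H V (\<lambda>x. \<^bold>\<forall>_ : V. Propd) 2" for H by (rule famI) ((assumption | rule VP typing rels ambient)+)
  let ?B = "\<lambda>A f ih y. (\<^bold>\<forall>i : A. \<^bold>\<exists>\<^sub>0j : bar y. ih \<cdot> i \<cdot> child y j) \<^bold>\<and> (\<^bold>\<forall>j : bar y. \<^bold>\<exists>\<^sub>0i : A. ih \<cdot> i \<cdot> child y j)"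
  let ?L = "\<^bold>\<lambda>A : Type0. \<^bold>\<lambda>f : (\<^bold>\<forall>_ : A. V). \<^bold>\<lambda>ih : (\<^bold>\<forall>i : A. \<^bold>\<forall>_ : V. Propd). \<^bold>\<lambda>y : V. ?B A f ih y"
  let ?R = "closed (Rec V_decl 2) \<cdot> lamd V (\<lambda>x. \<^bold>\<forall>_ : V. Propd) \<cdot> ?L"
  have R: "(x \<^bold>\<approx> y) = ?R \<cdot> x \<cdot> y" for x y unfolding bisim_def arr_def ..
  have L: "H \<tturnstile> ?L : (\<^bold>\<forall>A : Type0. \<^bold>\<forall>f : (\<^bold>\<forall>_ : A. V). \<^bold>\<forall>ih : (\<^bold>\<forall>i : A. \<^bold>\<forall>_ : V. Propd). \<^bold>\<forall>_ : V. Propd)" for H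
    by ((assumption | rule typing rels ambient)+)
  note r = typed_rec_V[OF F L]
  have Rt: "H \<tturnstile> ?R : (\<^bold>\<forall>_ : V. \<^bold>\<forall>_ : V. Propd)" for H by (rule typed_rec_V_fun[OF F L])
  show "G \<tturnstile> x : V \<Longrightarrow> G \<tturnstile> y : V \<Longrightarrow> G \<tturnstile> (x \<^bold>\<approx> y) : Propd"
    unfolding R by (rule typed_eqI, rule typed_app[OF r]) ((assumption | rule typing rels ambient)+
      | rule refl)+
  show "G \<tturnstile> x \<equiv> x' : V \<Longrightarrow> G \<tturnstile> y \<equiv> y' : V \<Longrightarrow> G \<tturnstile> (x \<^bold>\<approx> y) \<equiv> (x' \<^bold>\<approx> y') : Propd"
    unfolding R
    by (rule deq_app_arr[OF deq_app_arr[OF Rt]]) ((assumption | rule typing rels ambient)+)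
  assume A: "G \<tturnstile> A : Type0" "G \<tturnstile> f : (\<^bold>\<forall>_ : A. V)" "G \<tturnstile> y : V"
  \<comment> \<open>This is what the computation rule passes for \<open>ih\<close>. After the outer
    reductions it still has to be \<beta>-reduced below the quantifiers.\<close>
  let ?h = "\<^bold>\<lambda>i : A. ?R \<cdot> (f \<cdot> i)"
  have h: "G \<tturnstile> ?h : (\<^bold>\<forall>i : A. \<^bold>\<forall>_ : V. Propd)"
    by ((assumption | rule A Rt typing rels ambient)+)
  have "G \<tturnstile> ?R \<cdot> supd A f \<equiv> lamd V (?B A f ?h) : (\<^bold>\<forall>_ : V. Propd)"
    apply (rule deq_trans[OF deq_rec_V[OF F L A(1,2)]])
    apply (rule beta_step[OF beta_step[OF deq_beta[OF L]]])
    apply ((assumption | rule L A h Rt typing rels F ambient)+)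
    done
  from beta_step[OF this _ _ A(3)]
  have "G \<tturnstile> (supd A f \<^bold>\<approx> y) \<equiv> ?B A f ?h y : Propd"
    unfolding R by (rule meta_mp[OF meta_mp]) ((assumption | rule typing rels A h ambient)+)
  moreover have "G \<tturnstile> ?B A f ?h y \<equiv> ((\<^bold>\<forall>i : A. \<^bold>\<exists>\<^sub>0j : bar y. f \<cdot> i \<^bold>\<approx> child y j) \<^bold>\<and> (\<^bold>\<forall>j : bar y. \<^bold>\<exists>\<^sub>0i : A. f \<cdot> i \<^bold>\<approx>
    child y j)) : Propd"
    apply (rule deq_conj)
     apply (rule deq_all, ((assumption | rule A typing rels ambient)+)[])
     apply (rule deq_ex0, ((assumption | rule A typing rels ambient)+)[])
     apply (unfold R)
     apply (rule deq_app_arr[OF beta_step[where b = "\<lambda>i. ?R \<cdot> (f \<cdot> i)" and B = "\<lambda>_. \<^bold>\<forall>_ : V. Propd" and A = A]])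
     apply (rule weak, rule weak, rule h)
     apply ((assumption | rule A Rt h typing rels ambient)+)
     apply (rule deq_all, ((assumption | rule A typing rels ambient)+)[])
     apply (rule deq_ex0, ((assumption | rule A typing rels ambient)+)[])
     apply (rule deq_app_arr[OF beta_step[where b = "\<lambda>i. ?R \<cdot> (f \<cdot> i)" and B = "\<lambda>_. \<^bold>\<forall>_ : V. Propd" and A = A]])
     apply (rule weak, rule weak, rule h)
     apply ((assumption | rule A Rt h typing rels ambient)+)
    done
  ultimately show "G \<tturnstile> (supd A f \<^bold>\<approx> y) \<equiv> ((\<^bold>\<forall>i : A. \<^bold>\<exists>\<^sub>0j : bar y. f \<cdot> i \<^bold>\<approx> child y j) \<^bold>\<and> (\<^bold>\<forall>j : bar y. \<^bold>\<exists>\<^sub>0i : A. f \<cdot> i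
    \<^bold>\<approx> child y j)) : Propd"
    by (rule deq_trans)
qed

section \<open>Rules in Kripke style, over arbitrary extensions of a context\<close>

lemma allI1:
  "G \<tturnstile> A : Srt u \<Longrightarrow> uni (length G) B \<Longrightarrow> (\<And>H x. G \<preceq> H \<Longrightarrow> H \<tturnstile> x : A \<Longrightarrow> H \<TTurnstile> B x) \<Longrightarrow> G \<TTurnstile> pid A B"
  by (rule allI0) (auto intro: ext_Cons)

lemma impI1:
  "G \<tturnstile> P : Propd \<Longrightarrow> G \<tturnstile> Q : Propd \<Longrightarrow> (\<And>H. G \<preceq> H \<Longrightarrow> H \<TTurnstile> P \<Longrightarrow> H \<TTurnstile> Q) \<Longrightarrow> G \<TTurnstile> P \<^bold>\<rightarrow> Q"
  by (rule impI0) (auto intro: ext_Cons holdsI)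

lemma iffI1:
  "G \<tturnstile> P : Propd \<Longrightarrow> G \<tturnstile> Q : Propd \<Longrightarrow> (\<And>H. G \<preceq> H \<Longrightarrow> H \<TTurnstile> P \<Longrightarrow> H \<TTurnstile> Q) \<Longrightarrow>
   (\<And>H. G \<preceq> H \<Longrightarrow> H \<TTurnstile> Q \<Longrightarrow> H \<TTurnstile> P) \<Longrightarrow> G \<TTurnstile> P \<^bold>\<leftrightarrow> Q"
  by (rule iffI0) (auto intro: ext_Cons)

lemma disjE1:
  "G \<TTurnstile> P \<^bold>\<or> Q \<Longrightarrow> G \<tturnstile> P : Propd \<Longrightarrow> G \<tturnstile> Q : Propd \<Longrightarrow> G \<tturnstile> R : Propd \<Longrightarrow> (\<And>H. G \<preceq> H \<Longrightarrow> H \<TTurnstile> P \<Longrightarrow> H \<TTurnstile> R) \<Longrightarrow>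
   (\<And>H. G \<preceq> H \<Longrightarrow> H \<TTurnstile> Q \<Longrightarrow> H \<TTurnstile> R) \<Longrightarrow> G \<TTurnstile> R"
  by (rule disjE_0[of G P Q]) (auto intro: ext_Cons)

lemma ex0I:
  "G \<tturnstile> A : Type0 \<Longrightarrow> (\<And>x. A # G \<tturnstile> x : A \<Longrightarrow> A # G \<tturnstile> P x : Propd) \<Longrightarrow> uni (length G) P \<Longrightarrow> G \<tturnstile> a : A \<Longrightarrow> G \<TTurnstile> P a
   \<Longrightarrow> G \<TTurnstile> exd (Suc 0) A P"
  using exI0[of G A 1 P a] famI[of G A 1 P 0] by simp

lemma ex1I:
  "G \<tturnstile> A : Srt 2 \<Longrightarrow> (\<And>x. A # G \<tturnstile> x : A \<Longrightarrow> A # G \<tturnstile> P x : Propd) \<Longrightarrow> uni (length G) P \<Longrightarrow> G \<tturnstile> a : A \<Longrightarrow> G \<TTurnstile> P a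
   \<Longrightarrow> G \<TTurnstile> exd (Suc (Suc 0)) A P"
  using exI0[of G A 2 P a] famI[of G A 2 P 0] by (simp add: numeral_2_eq_2)

lemma ex0E:
  assumes "G \<TTurnstile> exd (Suc 0) A P" "G \<tturnstile> A : Type0" "\<And>x. A # G \<tturnstile> x : A \<Longrightarrow> A # G \<tturnstile> P x : Propd" "uni (length G) P"
    "G \<tturnstile> R : Propd" "\<And>H x. G \<preceq> H \<Longrightarrow> H \<tturnstile> x : A \<Longrightarrow> H \<TTurnstile> P x \<Longrightarrow> H \<TTurnstile> R"
  shows "G \<TTurnstile> R"
  by (rule exE0[of G 1 A P]) (use assms famI[of G A 1 P 0] in \<open>auto intro: ext_Cons weak\<close>)

lemma ex1E:
  assumes "G \<TTurnstile> exd (Suc (Suc 0)) A P" "G \<tturnstile> A : Srt 2" "\<And>x. A # G \<tturnstile> x : A \<Longrightarrow> A # G \<tturnstile> P x : Propd"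
    "uni (length G) P"
    "G \<tturnstile> R : Propd" "\<And>H x. G \<preceq> H \<Longrightarrow> H \<tturnstile> x : A \<Longrightarrow> H \<TTurnstile> P x \<Longrightarrow> H \<TTurnstile> R"
  shows "G \<TTurnstile> R"
  by (rule exE0[of G 2 A P]) (use assms famI[of G A 2 P 0] in \<open>auto intro: ext_Cons weak simp: numeral_2_eq_2\<close>)

text \<open>Induction hypotheses are used in contexts larger than the one that introduced them.
  Stating them for every extension \<open>H'\<close> hides the context entries for \<open>A\<close>,
  for \<open>f\<close> and for the hypothesis itself.\<close>

lemma V_induct1:
  assumes "fam G V P 0" "G \<tturnstile> x : V"
    "\<And>H A f. G \<preceq> H \<Longrightarrow> H \<tturnstile> A : Type0 \<Longrightarrow> H \<tturnstile> f : (\<^bold>\<forall>_ : A. V) \<Longrightarrow>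
      (\<And>H' i. H \<preceq> H' \<Longrightarrow> H' \<tturnstile> i : A \<Longrightarrow> H' \<TTurnstile> P (f \<cdot> i)) \<Longrightarrow> H \<TTurnstile> P (supd A f)"
  shows "G \<TTurnstile> P x"
proof (rule V_induct[OF assms(1,2)])
  fix A f
  let ?H = "(\<^bold>\<forall>i : A. P (f \<cdot> i)) # (\<^bold>\<forall>_ : A. V) # Type0 # G"
  assume A: "(\<^bold>\<forall>_ : A. V) # Type0 # G \<tturnstile> A : Type0" "(\<^bold>\<forall>_ : A. V) # Type0 # G \<tturnstile> f : (\<^bold>\<forall>_ : A. V)"
    and h: "?H \<TTurnstile> (\<^bold>\<forall>i : A. P (f \<cdot> i))"
  show "?H \<TTurnstile> P (supd A f)"
  proof (rule assms(3))
    fix H' i assume "?H \<preceq> H'" "H' \<tturnstile> i : A"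
    show "H' \<TTurnstile> P (f \<cdot> i)"
      apply (rule allE0[OF lift_holds[OF \<open>?H \<preceq> H'\<close> h] \<open>H' \<tturnstile> i : A\<close>])
      apply ((assumption | rule \<open>?H \<preceq> H'\<close> A typing rels rel_uni[OF fam_uni[OF assms(1)]] good_ext[OF _
        good_ext[OF \<open>?H \<preceq> H'\<close>]] ext_Cons ambient | erule good_tls | rule lift_deq lift_fam good_ext, (assumption
        | rule \<open>?H \<preceq> H'\<close> A))+)
      done
  qed (use A in \<open>auto intro: ext_Cons weak\<close>)
qed

text \<open>For \<open>supd A f\<close> both sides are convertible. For an arbitrary
  \<open>x\<close> the recursors are stuck, so the unfolding is only a provable equivalence,
  obtained by induction on \<open>x\<close> used as a case distinction.\<close>

lemma bisim_unfold:
  assumes "G \<tturnstile> x : V" "G \<tturnstile> y : V"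
  shows "G \<TTurnstile> (x \<^bold>\<approx> y) \<^bold>\<leftrightarrow> (\<^bold>\<forall>i : bar x. \<^bold>\<exists>\<^sub>0j : bar y. child x i \<^bold>\<approx> child y j) \<^bold>\<and> (\<^bold>\<forall>j : bar y. \<^bold>\<exists>\<^sub>0i : bar x. child x i \<^bold>\<approx>
    child y j)"
    (is "G \<TTurnstile> ?P x")
proof (rule V_induct1[of G ?P])
  show "fam G V ?P 0" by (rule famI) ((assumption | rule assms typing rels ambient)+)
  show "G \<tturnstile> x : V" by fact
  fix H A f assume H: "G \<preceq> H" and A: "H \<tturnstile> A : Type0" "H \<tturnstile> f : (\<^bold>\<forall>_ : A. V)"
  let ?Q = "(\<^bold>\<forall>i : A. \<^bold>\<exists>\<^sub>0j : bar y. f \<cdot> i \<^bold>\<approx> child y j) \<^bold>\<and> (\<^bold>\<forall>j : bar y. \<^bold>\<exists>\<^sub>0i : A. f \<cdot> i \<^bold>\<approx> child y j)"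
  let ?Q' = "(\<^bold>\<forall>i : bar (supd A f). \<^bold>\<exists>\<^sub>0j : bar y. child (supd A f) i \<^bold>\<approx> child y j) \<^bold>\<and> (\<^bold>\<forall>j : bar y. \<^bold>\<exists>\<^sub>0i : bar
    (supd A f). child (supd A f) i \<^bold>\<approx> child y j)"
  have 1: "H \<tturnstile> (supd A f \<^bold>\<approx> y) \<equiv> ?Q : Propd" by (rule deq_bisim_sup) ((assumption
    | rule A H assms typing uniI rels | (erule rel_mono, simp; fail) | rule rel_amb
    | (rule lift_deq lift_fam good_ext, (assumption | rule A H assms)) | erule good_tls | rule weak fam_weak)+)
  have 2: "H \<tturnstile> ?Q \<equiv> ?Q' : Propd"
    apply (rule deq_conj)
     apply (rule deq_all, rule deq_sym, rule deq_bar, ((assumption | rule A typing uniI rels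
       | (erule rel_mono, simp; fail) | rule rel_amb | (rule lift_deq lift_fam good_ext, (assumption | rule A))
       | erule good_tls | rule weak fam_weak)+)[], ((assumption | rule A typing uniI rels
       | (erule rel_mono, simp; fail) | rule rel_amb | (rule lift_deq lift_fam good_ext, (assumption | rule A))
       | erule good_tls | rule weak fam_weak)+)[])
     apply (rule deq_ex0, ((assumption | rule A H assms typing uniI rels | (erule rel_mono, simp; fail)
       | rule rel_amb | (rule lift_deq lift_fam good_ext, (assumption | rule A H assms)) | erule good_tls
       | rule weak fam_weak)+)[])
     apply (rule deq_bisim, rule deq_sym, rule deq_child)
     apply ((assumption | rule A H assms typing uniI rels | (erule rel_mono, simp; fail) | rule rel_amb
       | (rule lift_deq lift_fam good_ext, (assumption | rule A H assms)) | erule good_tls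
       | rule weak fam_weak)+)[4]
    subgoal by ((assumption | rule A H assms typing uniI rels | (erule rel_mono, simp; fail) | rule rel_amb
      | (rule lift_deq lift_fam good_ext, (assumption | rule A H assms)) | erule good_tls
      | rule weak fam_weak)+)
    subgoal by ((assumption | rule A H assms typing uniI rels | (erule rel_mono, simp; fail) | rule rel_amb
      | (rule lift_deq lift_fam good_ext, (assumption | rule A H assms)) | erule good_tls
      | rule weak fam_weak)+)
    subgoal by ((assumption | rule A H assms typing uniI rels | (erule rel_mono, simp; fail) | rule rel_amb
      | (rule lift_deq lift_fam good_ext, (assumption | rule A H assms)) | erule good_tls
      | rule weak fam_weak)+)
    subgoal by ((assumption | rule A H assms typing uniI rels | (erule rel_mono, simp; fail) | rule rel_amb
      | (rule lift_deq lift_fam good_ext, (assumption | rule A H assms)) | erule good_tls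
      | rule weak fam_weak)+)
    apply (rule deq_all, ((assumption | rule A H assms typing uniI rels | (erule rel_mono, simp; fail)
      | rule rel_amb | (rule lift_deq lift_fam good_ext, (assumption | rule A H assms)) | erule good_tls
      | rule weak fam_weak)+)[])
     apply (rule deq_ex0, rule deq_sym, rule deq_bar, ((assumption | rule A typing uniI rels
       | (erule rel_mono, simp; fail) | rule rel_amb | (rule lift_deq lift_fam good_ext, (assumption | rule A))
       | erule good_tls | rule weak fam_weak)+)[], ((assumption | rule A typing uniI rels
       | (erule rel_mono, simp; fail) | rule rel_amb | (rule lift_deq lift_fam good_ext, (assumption | rule A))
       | erule good_tls | rule weak fam_weak)+)[])
    apply (rule deq_bisim, rule deq_sym, rule deq_child)
     apply ((assumption | rule A H assms typing rels ambient | erule good_tls | rule lift_deq lift_fam good_ext,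
       (assumption | rule A H assms))+)
   done
  show "H \<TTurnstile> (supd A f \<^bold>\<approx> y) \<^bold>\<leftrightarrow> ?Q'"
    apply (rule iffI1, ((assumption | rule A H assms typing rels ambient | erule good_tls
      | rule lift_deq lift_fam good_ext, (assumption | rule A H assms))+)[], (rule deq_right[OF 2]))
    apply (erule holds_conv[OF _ lift_deq[OF _ deq_trans[OF 1 2]]], assumption)
    apply (erule holds_conv[OF _ lift_deq[OF _ deq_sym[OF deq_trans[OF 1 2]]]], assumption)
    done
qed

text \<open>A metalevel family has no congruence rule of its own; the rule for application is used
  on its abstraction, between two \<beta>-steps.\<close>

lemma deq_fam_cong:
  assumes "fam G A P v" "G \<tturnstile> a \<equiv> a' : A"
  shows "G \<tturnstile> P a \<equiv> P a' : Srt v"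
proof -
  have "G \<tturnstile> lamd A P \<cdot> a \<equiv> lamd A P \<cdot> a' : Srt v"
    by (rule deq_app_arr[OF fam_lam[OF assms(1)] typ_sort assms(2)])
  with deq_fam[OF assms(1) deq_left[OF assms(2)]] deq_fam[OF assms(1) deq_right[OF assms(2)]]
  show ?thesis by (blast intro: deq_trans deq_sym)
qed

text \<open>Phrasing induction with \<open>child\<close> makes it usable for sets that are not given
  by a constructor. An index of \<open>bar (supd A f)\<close> is one of \<open>A\<close> by
  conversion.\<close>

lemma V_ind:
  assumes "fam G V P 0" "G \<tturnstile> x : V"
    "\<And>H x. G \<preceq> H \<Longrightarrow> H \<tturnstile> x : V \<Longrightarrow>
      (\<And>H' i. H \<preceq> H' \<Longrightarrow> H' \<tturnstile> i : bar x \<Longrightarrow> H' \<TTurnstile> P (child x i)) \<Longrightarrow> H \<TTurnstile> P x"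
  shows "G \<TTurnstile> P x"
proof (rule V_induct1[OF assms(1,2)])
  fix H A f assume H: "G \<preceq> H" and A: "H \<tturnstile> A : Type0" "H \<tturnstile> f : (\<^bold>\<forall>_ : A. V)"
    and IH: "\<And>H' i. H \<preceq> H' \<Longrightarrow> H' \<tturnstile> i : A \<Longrightarrow> H' \<TTurnstile> P (f \<cdot> i)"
  show "H \<TTurnstile> P (supd A f)"
  proof (rule assms(3)[OF H])
    show "H \<tturnstile> supd A f : V" by ((assumption | rule A typing rels ambient)+)
    fix H' i assume H': "H \<preceq> H'" and i: "H' \<tturnstile> i : bar (supd A f)"
    note A' = A[THEN lift_deq[OF H']]
    have i': "H' \<tturnstile> i : A" by (rule deq_conv[OF i deq_bar[OF A']])
    show "H' \<TTurnstile> P (child (supd A f) i)"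
      by (rule holds_conv[OF IH[OF H' i'] deq_sym[OF deq_fam_cong[OF lift_fam[OF ext_trans[OF H H'] assms(1)]
        deq_child[OF A' i']]]])
  qed
qed

section \<open>Bisimilarity as an equivalence, membership and extensionality\<close>

lemma bisimI:
  assumes "G \<tturnstile> x : V" "G \<tturnstile> y : V"
    "\<And>H i. G \<preceq> H \<Longrightarrow> H \<tturnstile> i : bar x \<Longrightarrow> H \<TTurnstile> (\<^bold>\<exists>\<^sub>0j : bar y. child x i \<^bold>\<approx> child y j)"
    "\<And>H j. G \<preceq> H \<Longrightarrow> H \<tturnstile> j : bar y \<Longrightarrow> H \<TTurnstile> (\<^bold>\<exists>\<^sub>0i : bar x. child x i \<^bold>\<approx> child y j)"
  shows "G \<TTurnstile> x \<^bold>\<approx> y"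
  apply (rule iffD2_0[OF bisim_unfold[OF assms(1,2)]])
    apply ((assumption | rule assms(1,2) typing rels ambient)+)[1]
   apply ((assumption | rule assms(1,2) typing rels ambient)+)[1]
  apply (rule conjI0)
     apply ((assumption | rule assms(1,2) typing rels ambient)+)[1]
    apply ((assumption | rule assms(1,2) typing rels ambient)+)[1]
   apply (rule allI1, ((assumption | rule assms(1,2) typing rels ambient)+)[1], ((assumption
     | rule assms(1,2) typing rels ambient)+)[1], erule (1) assms)
  apply (rule allI1, ((assumption | rule assms(1,2) typing rels ambient)+)[1], ((assumption
    | rule assms(1,2) typing rels ambient)+)[1], erule (1) assms)
  done

lemma bisimE:
  assumes "G \<TTurnstile> x \<^bold>\<approx> y" "G \<tturnstile> x : V" "G \<tturnstile> y : V" "G \<tturnstile> R : Propd"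
  shows bisimE1: "G \<tturnstile> i : bar x \<Longrightarrow> (\<And>H j. G \<preceq> H \<Longrightarrow> H \<tturnstile> j : bar y \<Longrightarrow> H \<TTurnstile> child x i \<^bold>\<approx> child y j \<Longrightarrow> H \<TTurnstile> R) \<Longrightarrow> G \<TTurnstile> R"
    and bisimE2: "G \<tturnstile> j : bar y \<Longrightarrow> (\<And>H i. G \<preceq> H \<Longrightarrow> H \<tturnstile> i : bar x \<Longrightarrow> H \<TTurnstile> child x i \<^bold>\<approx> child y j \<Longrightarrow> H \<TTurnstile> R) \<Longrightarrow> G \<TTurnstile> R"
proof -
  note T = assms(2-4)
  let ?A = "\<^bold>\<forall>i : bar x. \<^bold>\<exists>\<^sub>0j : bar y. child x i \<^bold>\<approx> child y j" and ?B = "\<^bold>\<forall>j : bar y. \<^bold>\<exists>\<^sub>0i : bar x. child x i \<^bold>\<approx> child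
    y j"
  have t: "G \<tturnstile> ?A : Propd" "G \<tturnstile> ?B : Propd" by ((assumption | rule T typing rels ambient)+)
  have "G \<TTurnstile> ?A \<^bold>\<and> ?B"
    by (rule iffD1_0[OF bisim_unfold[OF assms(2,3)] _ _ assms(1)]) ((assumption
      | rule T t typing rels ambient)+)
  from conjunct1_0[OF this t] conjunct2_0[OF this t] have h: "G \<TTurnstile> ?A" "G \<TTurnstile> ?B" .
  { assume i: "G \<tturnstile> i : bar x" and R: "\<And>H j. G \<preceq> H \<Longrightarrow> H \<tturnstile> j : bar y \<Longrightarrow> H \<TTurnstile> child x i \<^bold>\<approx> child y j \<Longrightarrow> H \<TTurnstile> R"
    have "G \<TTurnstile> (\<^bold>\<exists>\<^sub>0j : bar y. child x i \<^bold>\<approx> child y j)" by (rule allE0[OF h(1) i]) ((assumption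
      | rule T typing rels ambient)+)
    then show "G \<TTurnstile> R" by (rule ex0E) (((assumption | rule T i typing rels ambient)+)[4], erule (2) R) }
  { assume i: "G \<tturnstile> j : bar y" and R: "\<And>H i. G \<preceq> H \<Longrightarrow> H \<tturnstile> i : bar x \<Longrightarrow> H \<TTurnstile> child x i \<^bold>\<approx> child y j \<Longrightarrow> H \<TTurnstile> R"
    have "G \<TTurnstile> (\<^bold>\<exists>\<^sub>0i : bar x. child x i \<^bold>\<approx> child y j)" by (rule allE0[OF h(2) i]) ((assumption
      | rule T typing rels ambient)+)
    then show "G \<TTurnstile> R" by (rule ex0E) (((assumption | rule T i typing rels ambient)+)[4], erule (2) R) }
qed

lemma memI:
  assumes "G \<tturnstile> x : V" "G \<tturnstile> y : V" "G \<tturnstile> j : bar y" "G \<TTurnstile> x \<^bold>\<approx> child y j"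
  shows "G \<TTurnstile> x \<^bold>\<in> y"
  unfolding mem_def by (rule ex0I[OF _ _ _ assms(3)]) ((assumption | rule assms typing rels ambient)+)

lemma memE:
  assumes "G \<TTurnstile> x \<^bold>\<in> y" "G \<tturnstile> x : V" "G \<tturnstile> y : V" "G \<tturnstile> R : Propd"
    "\<And>H j. G \<preceq> H \<Longrightarrow> H \<tturnstile> j : bar y \<Longrightarrow> H \<TTurnstile> x \<^bold>\<approx> child y j \<Longrightarrow> H \<TTurnstile> R"
  shows "G \<TTurnstile> R"
  by (rule ex0E[OF assms(1)[unfolded mem_def]]) (((assumption | rule assms(2-4) typing rels ambient)+)[4], erule
    (2) assms)

lemma typed_mem [typing]: "G \<tturnstile> x : V \<Longrightarrow> G \<tturnstile> y : V \<Longrightarrow> G \<tturnstile> (x \<^bold>\<in> y) : Propd"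
  unfolding mem_def by ((assumption | rule typing rels ambient)+)

lemma bisim_refl: "G \<tturnstile> x : V \<Longrightarrow> G \<TTurnstile> x \<^bold>\<approx> x"
proof (rule V_ind[where P = "\<lambda>x. x \<^bold>\<approx> x"], rule famI)
  fix H x assume H: "G \<preceq> H" and x: "H \<tturnstile> x : V"
    and IH: "\<And>H' i. H \<preceq> H' \<Longrightarrow> H' \<tturnstile> i : bar x \<Longrightarrow> H' \<TTurnstile> child x i \<^bold>\<approx> child x i"
  show "H \<TTurnstile> x \<^bold>\<approx> x"
    by (rule bisimI[OF x x]; rule ex0I, ((assumption | rule x typing rels ambient | erule good_tls
      | rule lift_deq lift_fam good_ext, (assumption | rule x))+)[4], erule (1) IH)
qed ((assumption | rule typing rels ambient)+)

lemma bisim_sym: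
  assumes "G \<TTurnstile> x \<^bold>\<approx> y" "G \<tturnstile> x : V" "G \<tturnstile> y : V"
  shows "G \<TTurnstile> y \<^bold>\<approx> x"
proof -
  \<comment> \<open>The step descends to children on both sides, so \<open>y\<close> has to vary in
    the induction on \<open>x\<close>.\<close>
  let ?P = "\<lambda>x. \<^bold>\<forall>y : V. (x \<^bold>\<approx> y \<^bold>\<rightarrow> y \<^bold>\<approx> x)"
  have "G \<TTurnstile> ?P x"
  proof (rule V_ind[of G ?P, OF _ assms(2)], rule famI)
    fix H x assume H: "G \<preceq> H" and x: "H \<tturnstile> x : V" and IH: "\<And>H' i. H \<preceq> H' \<Longrightarrow> H' \<tturnstile> i : bar x \<Longrightarrow> H' \<TTurnstile> ?P (child x i)"
    show "H \<TTurnstile> ?P x"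
    proof (rule allI1, ((assumption | rule typing rels ambient)+)[1], ((assumption
      | rule x typing rels ambient)+)[1], rule impI1)
      fix H1 y H2 assume H1: "H \<preceq> H1" and y: "H1 \<tturnstile> y : V" and H2: "H1 \<preceq> H2" and b: "H2 \<TTurnstile> x \<^bold>\<approx> y"
      have x2: "H2 \<tturnstile> x : V" and y2: "H2 \<tturnstile> y : V" by ((assumption | rule x y H1 H2 typing rels ambient
        | erule good_tls | rule lift_deq lift_fam good_ext, (assumption | rule x y H1 H2))+)
      have IH': "K \<TTurnstile> child y j \<^bold>\<approx> child x i" if "H2 \<preceq> K" "K \<tturnstile> i : bar x" "K \<tturnstile> j : bar y" "K \<TTurnstile> child x i \<^bold>\<approx> child y
        j" for K i j
        apply (rule mp0[OF allE0[OF IH[OF _ that(2)], of "child y j"] that(4)])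
        apply (blast intro: ext_trans that H1 H2)
        apply ((assumption | rule x2 y2 that typing rels ambient | erule good_tls
          | rule lift_deq lift_fam good_ext, (assumption | rule x2 y2 that))+)
        done
      show "H2 \<TTurnstile> y \<^bold>\<approx> x"
      proof (rule bisimI[OF y2 x2])
        fix K j assume K: "H2 \<preceq> K" "K \<tturnstile> j : bar y"
        show "K \<TTurnstile> (\<^bold>\<exists>\<^sub>0i : bar x. child y j \<^bold>\<approx> child x i)"
        proof (rule bisimE2[OF lift_holds[OF K(1) b] _ _ _ K(2)])
          fix L i assume L: "K \<preceq> L" "L \<tturnstile> i : bar x" "L \<TTurnstile> child x i \<^bold>\<approx> child y j"
          show "L \<TTurnstile> (\<^bold>\<exists>\<^sub>0i : bar x. child y j \<^bold>\<approx> child x i)"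
            apply (rule ex0I[OF _ _ _ L(2)])
               apply ((assumption | rule L K x2 y2 typing rels ambient | erule good_tls
                 | rule lift_deq lift_fam good_ext, (assumption | rule L K x2 y2))+)[3]
            apply (rule IH'[OF ext_trans[OF K(1) L(1)] L(2) _ L(3)])
            apply ((assumption | rule L K x2 y2 typing uniI rels | (erule rel_mono, simp; fail) | rule rel_amb
              | (rule lift_deq lift_fam good_ext, (assumption | rule L K x2 y2)) | erule good_tls
              | rule weak fam_weak)+)
            done
        qed ((assumption | rule K x2 y2 typing rels ambient | erule good_tls | rule lift_deq lift_fam good_ext,
          (assumption | rule K x2 y2))+)
      next
        fix K j assume K: "H2 \<preceq> K" "K \<tturnstile> j : bar x"
        show "K \<TTurnstile> (\<^bold>\<exists>\<^sub>0i : bar y. child y i \<^bold>\<approx> child x j)"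
        proof (rule bisimE1[OF lift_holds[OF K(1) b] _ _ _ K(2)])
          fix L i assume L: "K \<preceq> L" "L \<tturnstile> i : bar y" "L \<TTurnstile> child x j \<^bold>\<approx> child y i"
          show "L \<TTurnstile> (\<^bold>\<exists>\<^sub>0i : bar y. child y i \<^bold>\<approx> child x j)"
            apply (rule ex0I[OF _ _ _ L(2)])
               apply ((assumption | rule L K x2 y2 typing rels ambient | erule good_tls
                 | rule lift_deq lift_fam good_ext, (assumption | rule L K x2 y2))+)[3]
            apply (rule IH'[OF ext_trans[OF K(1) L(1)] _ L(2) L(3)])
            apply ((assumption | rule L K x2 y2 typing uniI rels | (erule rel_mono, simp; fail) | rule rel_amb
              | (rule lift_deq lift_fam good_ext, (assumption | rule L K x2 y2)) | erule good_tls
              | rule weak fam_weak)+)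
            done
        qed ((assumption | rule K x2 y2 typing rels ambient | erule good_tls | rule lift_deq lift_fam good_ext,
          (assumption | rule K x2 y2))+)
      qed
    qed ((assumption | rule x typing rels ambient | erule good_tls | rule lift_deq lift_fam good_ext,
      (assumption | rule x))+)
  qed ((assumption | rule typing rels ambient | erule good_tls | rule lift_deq lift_fam good_ext,
    (assumption))+)
  then show ?thesis
    by (rule mp0[OF allE0[of _ _ "\<lambda>y. x \<^bold>\<approx> y \<^bold>\<rightarrow> y \<^bold>\<approx> x", OF _ assms(3)] assms(1)]) ((assumption
      | rule assms typing rels ambient | erule good_tls | rule lift_deq lift_fam good_ext, (assumption
      | rule assms))+)
qed

lemma bisim_trans:
  assumes "G \<TTurnstile> x \<^bold>\<approx> y" "G \<TTurnstile> y \<^bold>\<approx> z" "G \<tturnstile> x : V" "G \<tturnstile> y : V" "G \<tturnstile> z : V"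
  shows "G \<TTurnstile> x \<^bold>\<approx> z"
proof -
  let ?R = "\<lambda>x y z. (x \<^bold>\<approx> y \<^bold>\<rightarrow> y \<^bold>\<approx> z \<^bold>\<rightarrow> x \<^bold>\<approx> z)"
  \<comment> \<open>The induction is on \<open>x\<close> alone, but the chain of children runs
    through the other two sets, so both are quantified inside.\<close>
  let ?P = "\<lambda>x. \<^bold>\<forall>y : V. \<^bold>\<forall>z : V. ?R x y z"
  have elim: "K \<TTurnstile> x \<^bold>\<approx> z" if "K \<TTurnstile> ?P x" "K \<TTurnstile> x \<^bold>\<approx> y" "K \<TTurnstile> y \<^bold>\<approx> z" "K \<tturnstile> x : V" "K \<tturnstile> y : V" "K \<tturnstile> z : V" for K x y z
  proof -
    have "K \<TTurnstile> (\<^bold>\<forall>z : V. ?R x y z)"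
      by (rule allE0[OF that(1,5)]) ((assumption | rule that(4-) typing rels ambient)+)
    then have "K \<TTurnstile> ?R x y z"
      by (rule allE0[OF _ that(6)]) ((assumption | rule that(4-) typing rels ambient)+)
    then show ?thesis
      by (rule mp0[OF mp0[OF _ that(2)] that(3)]) ((assumption | rule that(4-) typing rels ambient)+)
  qed
  have "G \<TTurnstile> ?P x"
  proof (rule V_ind[of G ?P, OF _ assms(3)], rule famI)
    fix H x assume H: "G \<preceq> H" and x: "H \<tturnstile> x : V" and IH: "\<And>H' i. H \<preceq> H' \<Longrightarrow> H' \<tturnstile> i : bar x \<Longrightarrow> H' \<TTurnstile> ?P (child x i)"
    show "H \<TTurnstile> ?P x"
    proof (rule allI1, ((assumption | rule typing rels ambient)+)[1], ((assumption
      | rule x typing rels ambient)+)[1])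
      fix H1 y assume H1: "H \<preceq> H1" and y: "H1 \<tturnstile> y : V"
      have x1: "H1 \<tturnstile> x : V" by ((assumption | rule x H1 typing rels ambient | erule good_tls
        | rule lift_deq lift_fam good_ext, (assumption | rule x H1))+)
      show "H1 \<TTurnstile> (\<^bold>\<forall>z : V. ?R x y z)"
      proof (rule allI1, ((assumption | rule typing rels ambient)+)[1], ((assumption
        | rule x1 y typing rels ambient)+)[1])
        fix H2 z assume H2: "H1 \<preceq> H2" and z: "H2 \<tturnstile> z : V"
        have xy2: "H2 \<tturnstile> x : V" "H2 \<tturnstile> y : V" by ((assumption | rule x1 y H2 typing rels ambient | erule good_tls
          | rule lift_deq lift_fam good_ext, (assumption | rule x1 y H2))+)
        show "H2 \<TTurnstile> ?R x y z"
        proof (rule impI1, ((assumption | rule xy2 z typing rels ambient)+)[1], ((assumption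
          | rule xy2 z typing rels ambient)+)[1], rule impI1)
          fix H3 H4 assume H3: "H2 \<preceq> H3" and b: "H3 \<TTurnstile> x \<^bold>\<approx> y" and H4: "H3 \<preceq> H4" and c: "H4 \<TTurnstile> y \<^bold>\<approx> z"
          note H24 = ext_trans[OF H3 H4]
          have T: "H4 \<tturnstile> x : V" "H4 \<tturnstile> y : V" "H4 \<tturnstile> z : V" by ((assumption | rule xy2 z H24 typing rels ambient
            | erule good_tls | rule lift_deq lift_fam good_ext, (assumption | rule xy2 z H24))+)
          have b: "H4 \<TTurnstile> x \<^bold>\<approx> y" by (rule lift_holds[OF H4 b])
          have IH': "K \<TTurnstile> child x i \<^bold>\<approx> child z k" if "H4 \<preceq> K" "K \<TTurnstile> child x i \<^bold>\<approx> child y j" "K \<TTurnstile> child y j \<^bold>\<approx> child z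
            k"
            "K \<tturnstile> i : bar x" "K \<tturnstile> j : bar y" "K \<tturnstile> k : bar z" for K i j k
            by (rule elim[OF IH[OF ext_trans[OF H1 ext_trans[OF H2 ext_trans[OF H24 that(1)]]] that(4)]
              that(2,3)])
              ((assumption | rule T that typing rels ambient | erule good_tls | rule lift_deq lift_fam good_ext,
                (assumption | rule T that))+)
          show "H4 \<TTurnstile> x \<^bold>\<approx> z"
          proof (rule bisimI[OF T(1,3)])
            fix K i assume K: "H4 \<preceq> K" "K \<tturnstile> i : bar x"
            show "K \<TTurnstile> (\<^bold>\<exists>\<^sub>0k : bar z. child x i \<^bold>\<approx> child z k)"
            proof (rule bisimE1[OF lift_holds[OF K(1) b] _ _ _ K(2)])
              fix L j assume L: "K \<preceq> L" "L \<tturnstile> j : bar y" "L \<TTurnstile> child x i \<^bold>\<approx> child y j"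
              note KL = ext_trans[OF K(1) L(1)]
              show "L \<TTurnstile> (\<^bold>\<exists>\<^sub>0k : bar z. child x i \<^bold>\<approx> child z k)"
              proof (rule bisimE1[OF lift_holds[OF KL c] _ _ _ L(2)])
                fix M k assume M: "L \<preceq> M" "M \<tturnstile> k : bar z" "M \<TTurnstile> child y j \<^bold>\<approx> child z k"
                note KM = ext_trans[OF KL M(1)]
                have T': "M \<tturnstile> x : V" "M \<tturnstile> z : V" "M \<tturnstile> i : bar x" "M \<tturnstile> j : bar y"
                  by (((assumption | rule T KM typing rels ambient | erule good_tls
                    | rule lift_deq lift_fam good_ext, (assumption | rule T KM))+)[1], ((assumption
                    | rule T KM typing rels ambient | erule good_tls | rule lift_deq lift_fam good_ext,
                    (assumption | rule T KM))+)[1], ((assumption | rule K(2) ext_trans[OF L(1) M(1)] typing rels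
                    ambient | erule good_tls | rule lift_deq lift_fam good_ext, (assumption
                    | rule K(2) ext_trans[OF L(1) M(1)]))+)[1], ((assumption
                    | rule L(2) M(1) typing rels ambient | erule good_tls | rule lift_deq lift_fam good_ext,
                    (assumption | rule L(2) M(1)))+)[1])
                show "M \<TTurnstile> (\<^bold>\<exists>\<^sub>0k : bar z. child x i \<^bold>\<approx> child z k)"
                  by (rule ex0I[OF _ _ _ M(2)]; (rule IH'[OF KM lift_holds[OF M(1) L(3)] M(3)])?) ((assumption
                    | rule T' M typing rels ambient)+)
              qed ((assumption | rule KL L T lift_deq[OF L(1) K(2)] typing rels ambient | erule good_tls
                | rule lift_deq lift_fam good_ext, (assumption | rule KL L T lift_deq[OF L(1) K(2)]))+)
            qed ((assumption | rule K T typing rels ambient | erule good_tls | rule lift_deq lift_fam good_ext,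
              (assumption | rule K T))+)
          next
            fix K k assume K: "H4 \<preceq> K" "K \<tturnstile> k : bar z"
            show "K \<TTurnstile> (\<^bold>\<exists>\<^sub>0i : bar x. child x i \<^bold>\<approx> child z k)"
            proof (rule bisimE2[OF lift_holds[OF K(1) c] _ _ _ K(2)])
              fix L j assume L: "K \<preceq> L" "L \<tturnstile> j : bar y" "L \<TTurnstile> child y j \<^bold>\<approx> child z k"
              note KL = ext_trans[OF K(1) L(1)]
              show "L \<TTurnstile> (\<^bold>\<exists>\<^sub>0i : bar x. child x i \<^bold>\<approx> child z k)"
              proof (rule bisimE2[OF lift_holds[OF KL b] _ _ _ L(2)])
                fix M i assume M: "L \<preceq> M" "M \<tturnstile> i : bar x" "M \<TTurnstile> child x i \<^bold>\<approx> child y j"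
                note KM = ext_trans[OF KL M(1)]
                have T': "M \<tturnstile> x : V" "M \<tturnstile> z : V" "M \<tturnstile> k : bar z" "M \<tturnstile> j : bar y"
                  by (((assumption | rule T KM typing rels ambient | erule good_tls
                    | rule lift_deq lift_fam good_ext, (assumption | rule T KM))+)[1], ((assumption
                    | rule T KM typing rels ambient | erule good_tls | rule lift_deq lift_fam good_ext,
                    (assumption | rule T KM))+)[1], ((assumption | rule K(2) ext_trans[OF L(1) M(1)] typing rels
                    ambient | erule good_tls | rule lift_deq lift_fam good_ext, (assumption
                    | rule K(2) ext_trans[OF L(1) M(1)]))+)[1], ((assumption
                    | rule L(2) M(1) typing rels ambient | erule good_tls | rule lift_deq lift_fam good_ext,
                    (assumption | rule L(2) M(1)))+)[1])
                show "M \<TTurnstile> (\<^bold>\<exists>\<^sub>0i : bar x. child x i \<^bold>\<approx> child z k)"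
                  by (rule ex0I[OF _ _ _ M(2)]; (rule IH'[OF KM M(3) lift_holds[OF M(1) L(3)]])?) ((assumption
                    | rule T' M typing rels ambient)+)
              qed ((assumption | rule KL L T lift_deq[OF L(1) K(2)] typing rels ambient | erule good_tls
                | rule lift_deq lift_fam good_ext, (assumption | rule KL L T lift_deq[OF L(1) K(2)]))+)
            qed ((assumption | rule K T typing rels ambient | erule good_tls | rule lift_deq lift_fam good_ext,
              (assumption | rule K T))+)
          qed
        qed ((assumption | rule xy2 z typing rels ambient | erule good_tls | rule lift_deq lift_fam good_ext,
          (assumption | rule xy2 z))+)
      qed
    qed
  qed ((assumption | rule typing rels ambient)+)
  from elim[OF this assms] show ?thesis .
qed

lemma mem_child: "G \<tturnstile> x : V \<Longrightarrow> G \<tturnstile> i : bar x \<Longrightarrow> G \<TTurnstile> child x i \<^bold>\<in> x"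
  by (rule memI, (assumption | rule typing rels ambient)+, rule bisim_refl, (assumption
    | rule typing rels ambient)+)

lemma mem_cong_right:
  assumes "G \<TTurnstile> y \<^bold>\<approx> z" "G \<TTurnstile> x \<^bold>\<in> y" "G \<tturnstile> x : V" "G \<tturnstile> y : V" "G \<tturnstile> z : V"
  shows "G \<TTurnstile> x \<^bold>\<in> z"
proof (rule memE[OF assms(2,3,4)])
  fix H j assume H: "G \<preceq> H" "H \<tturnstile> j : bar y" "H \<TTurnstile> x \<^bold>\<approx> child y j"
  note T = assms(3-)[THEN lift_deq[OF H(1)]]
  show "H \<TTurnstile> x \<^bold>\<in> z"
  proof (rule bisimE1[OF lift_holds[OF H(1) assms(1)] T(2,3) _ H(2)])
    fix K k assume K: "H \<preceq> K" "K \<tturnstile> k : bar z" "K \<TTurnstile> child y j \<^bold>\<approx> child z k"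
    note T = T[THEN lift_deq[OF K(1)]] K(2) lift_deq[OF K(1) H(2)]
    show "K \<TTurnstile> x \<^bold>\<in> z"
      by (rule memI[OF T(1,3) K(2)], rule bisim_trans[OF lift_holds[OF K(1) H(3)] K(3)])
        ((assumption | rule T typing rels ambient)+)
  qed ((assumption | rule T typing rels ambient)+)
qed ((assumption | rule assms(3-) typing rels ambient)+)

text \<open>A child of \<open>x\<close> is a member of \<open>x\<close>, hence of \<open>y\<close>,
  and its membership in \<open>y\<close> is by definition the existential that \<open>bisimI\<close>
  demands. In the other direction the bisimilarity comes out reversed and \<open>bisim_sym\<close>
  turns it round.\<close>

lemma ext_bisim:
  assumes "G \<tturnstile> x : V" "G \<tturnstile> y : V"
   "\<And>H w. G \<preceq> H \<Longrightarrow> H \<tturnstile> w : V \<Longrightarrow> H \<TTurnstile> w \<^bold>\<in> x \<Longrightarrow> H \<TTurnstile> w \<^bold>\<in> y"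
   "\<And>H w. G \<preceq> H \<Longrightarrow> H \<tturnstile> w : V \<Longrightarrow> H \<TTurnstile> w \<^bold>\<in> y \<Longrightarrow> H \<TTurnstile> w \<^bold>\<in> x"
  shows "G \<TTurnstile> x \<^bold>\<approx> y"
proof (rule bisimI[OF assms(1,2)])
  fix H i assume H: "G \<preceq> H" "H \<tturnstile> i : bar x"
  note T = assms(1,2)[THEN lift_deq[OF H(1)]]
  have c: "H \<tturnstile> child x i : V" by ((assumption | rule T H typing rels ambient)+)
  show "H \<TTurnstile> (\<^bold>\<exists>\<^sub>0j : bar y. child x i \<^bold>\<approx> child y j)"
    using assms(3)[OF H(1) c mem_child[OF T(1) H(2)]] by (simp add: mem_def)
next
  fix H j assume H: "G \<preceq> H" "H \<tturnstile> j : bar y"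
  note T = assms(1,2)[THEN lift_deq[OF H(1)]]
  have c: "H \<tturnstile> child y j : V" by ((assumption | rule T H typing rels ambient)+)
  show "H \<TTurnstile> (\<^bold>\<exists>\<^sub>0i : bar x. child x i \<^bold>\<approx> child y j)"
  proof (rule memE[OF assms(4)[OF H(1) c mem_child[OF T(2) H(2)]] c T(1)])
    fix K i assume K: "H \<preceq> K" "K \<tturnstile> i : bar x" "K \<TTurnstile> child y j \<^bold>\<approx> child x i"
    note T = T[THEN lift_deq[OF K(1)]] K(2) lift_deq[OF K(1) H(2)]
    show "K \<TTurnstile> (\<^bold>\<exists>\<^sub>0i : bar x. child x i \<^bold>\<approx> child y j)"
      by (rule ex0I[OF _ _ _ K(2)]; (rule bisim_sym[OF K(3)])?) ((assumption | rule T typing rels ambient)+)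
  qed ((assumption | rule T H typing rels ambient)+)
qed

lemma sup_memI:
  assumes "G \<tturnstile> A : Type0" "G \<tturnstile> f : (\<^bold>\<forall>_ : A. V)" "G \<tturnstile> w : V" "G \<tturnstile> a : A" "G \<TTurnstile> w \<^bold>\<approx> f \<cdot> a"
  shows "G \<TTurnstile> w \<^bold>\<in> supd A f"
proof (rule memI)
  show "G \<tturnstile> a : bar (supd A f)" by (rule deq_conv[OF assms(4) deq_sym[OF deq_bar[OF assms(1,2)]]])
  show "G \<TTurnstile> w \<^bold>\<approx> child (supd A f) a"
    by (rule holds_conv[OF assms(5) deq_bisim[OF assms(3) deq_sym[OF deq_child[OF assms(1,2,4)]]]])
qed ((assumption | rule assms typing rels ambient)+)

lemma sup_memE:
  assumes "G \<TTurnstile> w \<^bold>\<in> supd A f" "G \<tturnstile> A : Type0" "G \<tturnstile> f : (\<^bold>\<forall>_ : A. V)" "G \<tturnstile> w : V" "G \<tturnstile> R : Propd"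
    "\<And>H a. G \<preceq> H \<Longrightarrow> H \<tturnstile> a : A \<Longrightarrow> H \<TTurnstile> w \<^bold>\<approx> f \<cdot> a \<Longrightarrow> H \<TTurnstile> R"
  shows "G \<TTurnstile> R"
proof (rule memE[OF assms(1,4) _ assms(5)])
  fix H j assume H: "G \<preceq> H" "H \<tturnstile> j : bar (supd A f)" "H \<TTurnstile> w \<^bold>\<approx> child (supd A f) j"
  note T = assms(2-5)[THEN lift_deq[OF H(1)]]
  have j: "H \<tturnstile> j : A" by (rule deq_conv[OF H(2) deq_bar[OF T(1,2)]])
  show "H \<TTurnstile> R"
    by (rule assms(6)[OF H(1) j holds_conv[OF H(3) deq_bisim[OF T(3) deq_child[OF T(1,2) j]]]])
qed ((assumption | rule assms(2-5) typing rels ambient)+)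

section \<open>Unit type, sums, singletons and binary unions\<close>

lemma wf_Unit: "wf_decl Unit_decl" and wf_Sum: "wf_decl Sum_decl"
  unfolding Unit_decl_def Sum_decl_def
  by ((rule wf_intros conjI)+ | simp | (simp, rule wf_intros conjI))+

lemma typed_Unit [typing]: "G \<tturnstile> closed (Ind Unit_decl) : Type0" "G \<tturnstile> closed (Con Unit_decl 0) : closed
  (Ind Unit_decl)"
  by ((rule typed_Ind[OF wf_Unit] typed_Con[OF wf_Unit]); simp add: raw types Unit_decl_def)+

abbreviation "Sumd A B \<equiv> closed (Ind Sum_decl) \<cdot> A \<cdot> B"
abbreviation "inl A B a \<equiv> closed (Con Sum_decl 0) \<cdot> A \<cdot> B \<cdot> a"
abbreviation "inr A B a \<equiv> closed (Con Sum_decl 1) \<cdot> A \<cdot> B \<cdot> a"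

lemma typed_Sum [typing]:
  "G \<tturnstile> closed (Ind Sum_decl) : (\<^bold>\<forall>P : Type0. \<^bold>\<forall>Q : Type0. Type0)"
  "G \<tturnstile> closed (Con Sum_decl 0) : (\<^bold>\<forall>P : Type0. \<^bold>\<forall>Q : Type0. \<^bold>\<forall>p : P. Sumd P Q)"
  "G \<tturnstile> closed (Con Sum_decl 1) : (\<^bold>\<forall>P : Type0. \<^bold>\<forall>Q : Type0. \<^bold>\<forall>q : Q. Sumd P Q)"
  "G \<tturnstile> closed (Rec Sum_decl u) : (\<^bold>\<forall>P : Type0. \<^bold>\<forall>Q : Type0. \<^bold>\<forall>C : (\<^bold>\<forall>_ : Sumd P Q. Srt u).
      \<^bold>\<forall>m : (\<^bold>\<forall>p : P. C \<cdot> (inl P Q p)). \<^bold>\<forall>m' : (\<^bold>\<forall>q : Q. C \<cdot> (inr P Q q)). \<^bold>\<forall>x : Sumd P Q. C \<cdot> x)"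
  by ((rule typed_Ind[OF wf_Sum] typed_Con[OF wf_Sum] typed_Rec[OF wf_Sum]);
      simp add: raw types Sum_decl_def)+

lemma typed_Sumd: "G \<tturnstile> A : Type0 \<Longrightarrow> G \<tturnstile> B : Type0 \<Longrightarrow> G \<tturnstile> Sumd A B : Type0"
  by (rule typed_eqI, (assumption | rule typing rels ambient)+, rule refl)

lemma
  assumes "G \<tturnstile> A : Type0" "G \<tturnstile> B : Type0" "fam G (Sumd A B) P u"
    "G \<tturnstile> m : (\<^bold>\<forall>a : A. P (inl A B a))" "G \<tturnstile> m' : (\<^bold>\<forall>b : B. P (inr A B b))"
  shows typed_rec_Sum: "G \<tturnstile> closed (Rec Sum_decl u) \<cdot> A \<cdot> B \<cdot> lamd (Sumd A B) P \<cdot> m \<cdot> m' : (\<^bold>\<forall>x : Sumd A B. P x)"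
    and deq_rec_inl: "G \<tturnstile> a : A \<Longrightarrow> G \<tturnstile> closed (Rec Sum_decl u) \<cdot> A \<cdot> B \<cdot> lamd (Sumd A B) P \<cdot> m \<cdot> m' \<cdot> inl A B a \<equiv>
      m \<cdot> a : P (inl A B a)"
    and deq_rec_inr: "G \<tturnstile> b : B \<Longrightarrow> G \<tturnstile> closed (Rec Sum_decl u) \<cdot> A \<cdot> B \<cdot> lamd (Sumd A B) P \<cdot> m \<cdot> m' \<cdot> inr A B b \<equiv>
      m' \<cdot> b : P (inr A B b)"
proof -
  note F = typed_fam[where P = P] assms(3) and U = rel_uni[OF fam_uni[OF assms(3)]] and T = assms(1,2)
  let ?C = "lamd (Sumd A B) P" and ?n = "length G"
  have "G \<tturnstile> (\<^bold>\<forall>a : A. P (inl A B a)) \<equiv> (\<^bold>\<forall>a : A. ?C \<cdot> inl A B a) : Srt (imax 1 u)"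
    by (rule deq_pi, ((assumption | rule T typing rels ambient)+)[1], rule deq_sym, rule deq_fam,
      (rule assms fam_weak)+, rule typed_eqI, ((assumption | rule T typing rels ambient)+), rule refl,
      ((assumption | rule T fam_lam[OF assms(3)] typing rels U ambient)+))
  from deq_conv[OF assms(4) this] have m: "G \<tturnstile> m : (\<^bold>\<forall>a : A. ?C \<cdot> inl A B a)" .
  have "G \<tturnstile> (\<^bold>\<forall>b : B. P (inr A B b)) \<equiv> (\<^bold>\<forall>b : B. ?C \<cdot> inr A B b) : Srt (imax 1 u)"
    by (rule deq_pi, ((assumption | rule T typing rels ambient)+)[1], rule deq_sym, rule deq_fam,
      (rule assms fam_weak)+, rule typed_eqI, ((assumption | rule T typing rels ambient)+), rule refl,
      ((assumption | rule T fam_lam[OF assms(3)] typing rels U ambient)+))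
  from deq_conv[OF assms(5) this] have m': "G \<tturnstile> m' : (\<^bold>\<forall>b : B. ?C \<cdot> inr A B b)" .
  let ?R = "closed (Rec Sum_decl u) \<cdot> A \<cdot> B \<cdot> ?C \<cdot> m \<cdot> m'"
  have "G \<tturnstile> ?R : (\<^bold>\<forall>x : Sumd A B. ?C \<cdot> x)"
    by (rule typed_eqI, (assumption | rule T m m' fam_lam[OF assms(3)] typing rels U ambient)+, rule refl)
  from deq_conv[OF this deq_pi[OF typed_Sumd[OF T] deq_fam[OF fam_weak[OF assms(3)]]]]
  show R: "G \<tturnstile> ?R : (\<^bold>\<forall>x : Sumd A B. P x)"
    by (rule meta_mp[OF meta_mp]) ((assumption | rule T fam_lam[OF assms(3)] typing rels U ambient)+)
  have c: "st ?n ?C" "st ?n m" "st ?n m'" "st ?n A" "st ?n B"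
    using fam_lam[OF assms(3)] m m' T by (auto dest: deq_st)
  { assume a: "G \<tturnstile> a : A"
    have "G \<tturnstile> inl A B a : Sumd A B" by (rule typed_eqI, (assumption | rule T a typing rels ambient)+, rule refl)
    from typed_app[OF R this fam_uni[OF assms(3)]] have l: "G \<tturnstile> ?R \<cdot> inl A B a : P (inl A B a)" .
    have "cx G \<turnstile> (?R \<cdot> inl A B a) ?n \<equiv> (m \<cdot> a) ?n : P (inl A B a) ?n" if "ok G"
      using iota[of 0 Sum_decl "[A ?n, B ?n]" "[A ?n, B ?n]" "[m ?n, m' ?n]" "[]" "[a ?n]" "[]" "cx G" u "?C ?n"
        "P (inl A B a) ?n"] l that
      by (simp add: Sum_decl_def iota_def deq_def appd_def closed_def)
    then show "G \<tturnstile> ?R \<cdot> inl A B a \<equiv> m \<cdot> a : P (inl A B a)"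
      using deq_st[OF l] c deq_st[OF a] by (simp add: deq_def) }
  { assume a: "G \<tturnstile> b : B"
    have "G \<tturnstile> inr A B b : Sumd A B" by (rule typed_eqI, (assumption | rule T a typing rels ambient)+, rule refl)
    from typed_app[OF R this fam_uni[OF assms(3)]] have l: "G \<tturnstile> ?R \<cdot> inr A B b : P (inr A B b)" .
    have "cx G \<turnstile> (?R \<cdot> inr A B b) ?n \<equiv> (m' \<cdot> b) ?n : P (inr A B b) ?n" if "ok G"
      using iota[of 1 Sum_decl "[A ?n, B ?n]" "[A ?n, B ?n]" "[m ?n, m' ?n]" "[]" "[b ?n]" "[]" "cx G" u "?C ?n"
        "P (inr A B b) ?n"] l that
      by (simp add: Sum_decl_def iota_def deq_def appd_def closed_def)
    then show "G \<tturnstile> ?R \<cdot> inr A B b \<equiv> m' \<cdot> b : P (inr A B b)"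
      using deq_st[OF l] c deq_st[OF a] by (simp add: deq_def) }
qed

lemma rel_union [rels]: "rel \<theta> k x x' \<Longrightarrow> rel \<theta> k y y' \<Longrightarrow> rel \<theta> k (x \<^bold>\<union> y) (x' \<^bold>\<union> y')"
  and rel_singleton [rels]: "rel \<theta> k x x' \<Longrightarrow> rel \<theta> k (singleton x) (singleton x')"
  unfolding union_def Let_def singleton_def
  by (assumption | rule rels rel_shift)+

lemma typed_singleton [typing]: "G \<tturnstile> x : V \<Longrightarrow> G \<tturnstile> singleton x : V"
  unfolding singleton_def by ((assumption | rule typing rels ambient)+)

lemma deq_singleton_beta: "G \<tturnstile> x : V \<Longrightarrow> G \<tturnstile> i : closed (Ind Unit_decl) \<Longrightarrow> G \<tturnstile> (\<^bold>\<lambda>_ : closed (Ind Unit_decl). x) \<cdot> i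
  \<equiv> x : V"
  by (rule deq_beta) ((assumption | rule typing rels ambient)+)

lemma singletonI:
  assumes "G \<TTurnstile> w \<^bold>\<approx> x" "G \<tturnstile> w : V" "G \<tturnstile> x : V"
  shows "G \<TTurnstile> w \<^bold>\<in> singleton x"
  unfolding singleton_def
  by (rule sup_memI[OF _ _ _ typed_Unit(2)], ((assumption | rule assms(2,3) typing rels ambient)+)[3],
      rule holds_conv[OF assms(1) deq_bisim[OF assms(2) deq_sym[OF deq_singleton_beta[OF assms(3)
        typed_Unit(2)]]]])

lemma singletonD:
  assumes "G \<TTurnstile> w \<^bold>\<in> singleton x" "G \<tturnstile> w : V" "G \<tturnstile> x : V"
  shows "G \<TTurnstile> w \<^bold>\<approx> x"
proof (rule sup_memE[OF assms(1)[unfolded singleton_def]])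
  fix H a assume H: "G \<preceq> H" "H \<tturnstile> a : closed (Ind Unit_decl)" "H \<TTurnstile> w \<^bold>\<approx> (\<^bold>\<lambda>_ : closed (Ind Unit_decl). x) \<cdot> a"
  note T = assms(2,3)[THEN lift_deq[OF H(1)]]
  show "H \<TTurnstile> w \<^bold>\<approx> x" by (rule holds_conv[OF H(3) deq_bisim[OF T(1) deq_singleton_beta[OF T(2) H(2)]]])
qed ((assumption | rule assms(2,3) typing rels ambient)+)

lemma union:
  assumes "G \<tturnstile> x : V" "G \<tturnstile> y : V"
  shows typed_union [typing]: "G \<tturnstile> x \<^bold>\<union> y : V"
    and unionI1: "G \<tturnstile> w : V \<Longrightarrow> G \<TTurnstile> w \<^bold>\<in> x \<Longrightarrow> G \<TTurnstile> w \<^bold>\<in> x \<^bold>\<union> y"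
    and unionI2: "G \<tturnstile> w : V \<Longrightarrow> G \<TTurnstile> w \<^bold>\<in> y \<Longrightarrow> G \<TTurnstile> w \<^bold>\<in> x \<^bold>\<union> y"
    and unionD: "G \<tturnstile> w : V \<Longrightarrow> G \<TTurnstile> w \<^bold>\<in> x \<^bold>\<union> y \<Longrightarrow> G \<TTurnstile> w \<^bold>\<in> x \<^bold>\<or> w \<^bold>\<in> y"
proof -
  let ?S = "Sumd (bar x) (bar y)" and ?f = "\<^bold>\<lambda>i : bar x. child x i" and ?g = "\<^bold>\<lambda>i : bar y. child y i"
  let ?h = "closed (Rec Sum_decl 2) \<cdot> bar x \<cdot> bar y \<cdot> (\<^bold>\<lambda>_ : ?S. V) \<cdot> ?f \<cdot> ?g"
  have U: "x \<^bold>\<union> y = supd ?S ?h" unfolding union_def Let_def ..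
  note T = assms
  have b: "G \<tturnstile> bar x : Type0" "G \<tturnstile> bar y : Type0" by ((assumption | rule T typing rels ambient)+)
  have S: "G \<tturnstile> ?S : Type0" by (rule typed_Sumd[OF b])
  have F: "fam G ?S (\<lambda>_. V) 2" by (rule fam_const[OF S typed_V])
  have f: "G \<tturnstile> ?f : (\<^bold>\<forall>_ : bar x. V)" and g: "G \<tturnstile> ?g : (\<^bold>\<forall>_ : bar y. V)" by ((assumption
    | rule T typing rels ambient)+)
  have h: "G \<tturnstile> ?h : (\<^bold>\<forall>_ : ?S. V)" by (rule typed_rec_Sum[OF b F f g])
  show xy: "G \<tturnstile> x \<^bold>\<union> y : V" unfolding U by (rule typed_sup[OF S h])
  have hl: "H \<tturnstile> ?h \<cdot> inl (bar x) (bar y) i \<equiv> child x i : V" if H: "G \<preceq> H" and i: "H \<tturnstile> i : bar x" for H i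
    by (rule deq_trans[OF deq_rec_inl[OF lift_deq[OF H b(1)] lift_deq[OF H b(2)] lift_fam[OF H F] lift_deq[OF H
      f] lift_deq[OF H g] i]
      deq_beta[OF lift_deq[OF H f] _ _ i]])
      ((assumption | rule T[THEN lift_deq[OF H]] typing rels ambient)+)
  have hr: "H \<tturnstile> ?h \<cdot> inr (bar x) (bar y) i \<equiv> child y i : V" if H: "G \<preceq> H" and i: "H \<tturnstile> i : bar y" for H i
    by (rule deq_trans[OF deq_rec_inr[OF lift_deq[OF H b(1)] lift_deq[OF H b(2)] lift_fam[OF H F] lift_deq[OF H
      f] lift_deq[OF H g] i]
      deq_beta[OF lift_deq[OF H g] _ _ i]])
      ((assumption | rule T[THEN lift_deq[OF H]] typing rels ambient)+)
  have il: "H \<tturnstile> inl (bar x) (bar y) i : ?S" if H: "G \<preceq> H" and i: "H \<tturnstile> i : bar x" for H i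
    by (rule typed_eqI, (assumption | rule T[THEN lift_deq[OF H]] i typing rels ambient)+, rule refl)
  have ir: "H \<tturnstile> inr (bar x) (bar y) i : ?S" if H: "G \<preceq> H" and i: "H \<tturnstile> i : bar y" for H i
    by (rule typed_eqI, (assumption | rule T[THEN lift_deq[OF H]] i typing rels ambient)+, rule refl)
  { assume w: "G \<tturnstile> w : V" "G \<TTurnstile> w \<^bold>\<in> x"
    show "G \<TTurnstile> w \<^bold>\<in> x \<^bold>\<union> y"
    proof (rule memE[OF w(2,1) T(1)])
      fix H i assume H: "G \<preceq> H" "H \<tturnstile> i : bar x" "H \<TTurnstile> w \<^bold>\<approx> child x i"
      show "H \<TTurnstile> w \<^bold>\<in> x \<^bold>\<union> y" unfolding U
        by (rule sup_memI[OF lift_deq[OF H(1) S] lift_deq[OF H(1) h] lift_deq[OF H(1) w(1)] il[OF H(1,2)]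
           holds_conv[OF H(3) deq_bisim[OF lift_deq[OF H(1) w(1)] deq_sym[OF hl[OF H(1,2)]]]]])
    qed ((assumption | rule xy w(1) typing rels ambient)+) }
  { assume w: "G \<tturnstile> w : V" "G \<TTurnstile> w \<^bold>\<in> y"
    show "G \<TTurnstile> w \<^bold>\<in> x \<^bold>\<union> y"
    proof (rule memE[OF w(2,1) T(2)])
      fix H i assume H: "G \<preceq> H" "H \<tturnstile> i : bar y" "H \<TTurnstile> w \<^bold>\<approx> child y i"
      show "H \<TTurnstile> w \<^bold>\<in> x \<^bold>\<union> y" unfolding U
        by (rule sup_memI[OF lift_deq[OF H(1) S] lift_deq[OF H(1) h] lift_deq[OF H(1) w(1)] ir[OF H(1,2)]
           holds_conv[OF H(3) deq_bisim[OF lift_deq[OF H(1) w(1)] deq_sym[OF hr[OF H(1,2)]]]]])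
    qed ((assumption | rule xy w(1) typing rels ambient)+) }
  { assume w: "G \<tturnstile> w : V" "G \<TTurnstile> w \<^bold>\<in> x \<^bold>\<union> y"
    \<comment> \<open>The case distinction is made on an index of the union. The bisimilarity of
      \<open>w\<close> with the child at that index depends on it and is therefore made a premise
      inside the motive.\<close>
    let ?R = "w \<^bold>\<in> x \<^bold>\<or> w \<^bold>\<in> y" and ?P = "\<lambda>s. w \<^bold>\<approx> ?h \<cdot> s \<^bold>\<rightarrow> (w \<^bold>\<in> x \<^bold>\<or> w \<^bold>\<in> y)"
    have hs: "H \<tturnstile> ?h \<cdot> s : V" if "H \<tturnstile> s : ?S" "G \<preceq> H" for H s
      by (rule typed_app[OF lift_deq[OF that(2) h] that(1)]) ((assumption | rule typing rels ambient)+)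
    have FP: "fam G ?S ?P 0"
      by (rule famI[OF S]) ((assumption | rule w(1) T hs ext_Cons typing rels h ambient)+)
    have "G \<TTurnstile> (\<^bold>\<forall>i : bar x. ?P (inl (bar x) (bar y) i))"
    proof (rule allI1, ((assumption | rule b typing rels ambient)+)[1], ((assumption
      | rule T w(1) b typing rels h ambient)+)[1], rule impI1)
      fix H i K assume H: "G \<preceq> H" "H \<tturnstile> i : bar x" and K: "H \<preceq> K" "K \<TTurnstile> w \<^bold>\<approx> ?h \<cdot> inl (bar x) (bar y) i"
      note GK = ext_trans[OF H(1) K(1)]
      note T = T[THEN lift_deq[OF GK]] lift_deq[OF GK w(1)] lift_deq[OF K(1) H(2)]
      have "K \<TTurnstile> w \<^bold>\<in> x"
        by (rule memI[OF T(3) _ T(4) holds_conv[OF K(2) deq_bisim[OF T(3) hl[OF GK T(4)]]]]) ((assumption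
          | rule T typing rels ambient)+)
      then show "K \<TTurnstile> ?R" by - (rule disjI10, (assumption | rule T typing rels ambient)+)
    next
      fix H i assume H: "G \<preceq> H" "H \<tturnstile> i : bar x"
      show "H \<tturnstile> (w \<^bold>\<approx> ?h \<cdot> inl (bar x) (bar y) i) : Propd"
        by (rule typed_bisim[OF lift_deq[OF H(1) w(1)] hs[OF il[OF H] H(1)]])
      show "H \<tturnstile> ?R : Propd" by ((assumption | rule H(1) T w(1) typing rels ambient | erule good_tls
        | rule lift_deq lift_fam good_ext, (assumption | rule H(1) T w(1)))+)
    qed
    moreover have "G \<TTurnstile> (\<^bold>\<forall>i : bar y. ?P (inr (bar x) (bar y) i))"
    proof (rule allI1, ((assumption | rule b typing rels ambient)+)[1], ((assumption
      | rule T w(1) b typing rels h ambient)+)[1], rule impI1)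
      fix H i K assume H: "G \<preceq> H" "H \<tturnstile> i : bar y" and K: "H \<preceq> K" "K \<TTurnstile> w \<^bold>\<approx> ?h \<cdot> inr (bar x) (bar y) i"
      note GK = ext_trans[OF H(1) K(1)]
      note T = T[THEN lift_deq[OF GK]] lift_deq[OF GK w(1)] lift_deq[OF K(1) H(2)]
      have "K \<TTurnstile> w \<^bold>\<in> y"
        by (rule memI[OF T(3) _ T(4) holds_conv[OF K(2) deq_bisim[OF T(3) hr[OF GK T(4)]]]]) ((assumption
          | rule T typing rels ambient)+)
      then show "K \<TTurnstile> ?R" by - (rule disjI20, (assumption | rule T typing rels ambient)+)
    next
      fix H i assume H: "G \<preceq> H" "H \<tturnstile> i : bar y"
      show "H \<tturnstile> (w \<^bold>\<approx> ?h \<cdot> inr (bar x) (bar y) i) : Propd"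
        by (rule typed_bisim[OF lift_deq[OF H(1) w(1)] hs[OF ir[OF H] H(1)]])
      show "H \<tturnstile> ?R : Propd" by ((assumption | rule H(1) T w(1) typing rels ambient | erule good_tls
        | rule lift_deq lift_fam good_ext, (assumption | rule H(1) T w(1)))+)
    qed
    ultimately obtain m m' where "G \<tturnstile> m : (\<^bold>\<forall>i : bar x. ?P (inl (bar x) (bar y) i))" "G \<tturnstile> m' : (\<^bold>\<forall>i : bar y. ?P
      (inr (bar x) (bar y) i))"
      by (auto simp: holds_def)
    from holdsI[OF typed_rec_Sum[OF b FP this]] have all: "G \<TTurnstile> (\<^bold>\<forall>s : ?S. ?P s)" .
    show "G \<TTurnstile> ?R"
    proof (rule sup_memE[OF w(2)[unfolded U] S h w(1)])
      fix H s assume H: "G \<preceq> H" "H \<tturnstile> s : ?S" "H \<TTurnstile> w \<^bold>\<approx> ?h \<cdot> s"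
      show "H \<TTurnstile> ?R"
        by (rule mp0[OF allE0[OF lift_holds[OF H(1) all] H(2)] H(3)]) ((assumption
          | rule H(1) w(1) T typing rels h ambient | erule good_tls | rule lift_deq lift_fam good_ext,
          (assumption | rule H(1) w(1) T))+)
    qed ((assumption | rule w(1) T typing rels ambient)+) }
qed

section \<open>Unions over a small type with a propositional condition\<close>

text \<open>The triples of \<open>k : K\<close>, \<open>h : E k\<close> and an index of the set \<open>g k h\<close>. Since \<open>E k\<close> is a proposition,
  they form a type in \<open>Type\<^sub>0\<close>.\<close>

definition Fam_decl :: "tm decl" where
  "Fam_decl = Decl [Sort 1, Pi (Var 0) (Sort 0), Pi (Var 1) (Pi (App (Var 1) (Var 0)) (Ind V_decl))] [] 1
     [Ctor [Var 2, App (Var 2) (Var 0), bar (lvl 2 \<cdot> lvl 3 \<cdot> lvl 4) 5] [] []]"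

text \<open>The last argument of the constructor is \<open>bar\<close> of an application. So the
  telescopes are typed with named variables, where \<open>typed_bar\<close> is available, and then
  translated into de Bruijn terms.\<close>

lemma wf_Fam: "wf_decl Fam_decl"
proof -
  let ?E = "pid (lvl 0) (\<lambda>_. Propd)" and ?g = "pid (lvl 0) (\<lambda>k. pid (lvl 1 \<cdot> k) (\<lambda>_. V))"
  let ?G1 = "[Type0]" let ?G2 = "?E # ?G1" let ?G3 = "?g # ?G2" let ?G4 = "lvl 0 # ?G3" let ?G5 =
    "lvl 1 \<cdot> lvl 3 # ?G4"
  have 0: "?G1 \<tturnstile> lvl 0 : Type0" using typ_lvl[of "[]" Type0] by simp
  have E: "?G1 \<tturnstile> ?E : Srt (imax 1 (Suc 0))" using 0 by - ((assumption | rule typing rels ambient)+)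
  have 1: "?G2 \<tturnstile> lvl 1 : ?E" using typ_lvl[OF deq_st(1)[OF E]] by simp
  have g: "?G2 \<tturnstile> ?g : Srt (imax 1 (imax 0 2))" using 0 1 by - ((assumption | rule typing rels ambient)+)
  have 2: "?G3 \<tturnstile> lvl 2 : ?g" using typ_lvl[OF deq_st(1)[OF g]] by (simp add: numeral_2_eq_2)
  have k: "?G3 \<tturnstile> lvl 0 : Type0" using 0 by - ((assumption | rule typing rels ambient)+)
  have 3: "?G4 \<tturnstile> lvl 3 : lvl 0" using typ_lvl[OF deq_st(1)[OF k]] by (simp add: numeral_3_eq_3)
  have h: "?G4 \<tturnstile> lvl 1 \<cdot> lvl 3 : Propd" using 1 3 by - (rule typed_eqI, (assumption
    | rule typing rels ambient)+, rule refl)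
  have 4: "?G5 \<tturnstile> lvl 4 : lvl 1 \<cdot> lvl 3" using typ_lvl[OF deq_st(1)[OF h]] by (simp add: eval_nat_numeral)
  have V: "?G5 \<tturnstile> lvl 2 \<cdot> lvl 3 \<cdot> lvl 4 : V" using 0 1 2 3 4 by - (rule typed_eqI, (assumption
    | rule typing rels ambient)+, rule refl)
  have o1: "ok ?G1" using ok_Cons[of "[]", OF _ typ_Type0] by simp
  note o2 = ok_Cons[OF o1 E] note o3 = ok_Cons[OF o2 g] note o4 = ok_Cons[OF o3 k] note o5 = ok_Cons[OF o4 h]
  have raw_E: "cx ?G1 \<turnstile> Pi (Var 0) (Sort 0) : Sort (imax 1 (Suc 0))"
    using E o1 by (simp add: deq_def raw)
  have raw_g: "cx ?G2 \<turnstile> Pi (Var 1) (Pi (App (Var 1) (Var 0)) (Ind V_decl)) : Sort (imax 1 (imax 0 2))"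
    using g o2 by (simp add: deq_def raw V_def)
  have raw_k: "cx ?G3 \<turnstile> Var 2 : Sort 1"
    using k o3 by (simp add: deq_def raw eval_nat_numeral)
  have raw_h: "cx ?G4 \<turnstile> App (Var 2) (Var 0) : Sort 0"
    using h o4 by (simp add: deq_def raw eval_nat_numeral)
  have raw_j: "cx ?G5 \<turnstile> bar (lvl 2 \<cdot> lvl 3 \<cdot> lvl 4) 5 : Sort 1"
    using typed_bar[OF V] o5 by (simp add: deq_def closed_def eval_nat_numeral)
  have c: "cx ?G1 = [Sort 1]" "cx ?G2 = [Pi (Var 0) (Sort 0), Sort 1]"
    "cx ?G3 = [Pi (Var 1) (Pi (App (Var 1) (Var 0)) (Ind V_decl)), Pi (Var 0) (Sort 0), Sort 1]"
    "cx ?G4 = [Var 2, Pi (Var 1) (Pi (App (Var 1) (Var 0)) (Ind V_decl)), Pi (Var 0) (Sort 0), Sort 1]"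
    "cx ?G5 = [App (Var 2) (Var 0), Var 2, Pi (Var 1) (Pi (App (Var 1) (Var 0)) (Ind V_decl)), Pi (Var 0)
      (Sort 0), Sort 1]"
    by (simp_all add: raw V_def)
  note R = raw_E[unfolded c] raw_g[unfolded c] raw_k[unfolded c] raw_h[unfolded c] raw_j[unfolded c]
  show ?thesis
    unfolding Fam_decl_def
    apply (intro wf_declI list_all_ConsI list_all_NilI wf_ctorI)
       apply (rule tele_cons[OF sort], simp, rule tele_cons[OF R(1)], simp, rule tele_cons[OF R(2)], simp,
         rule tele_nil)
      apply (rule tele_nil)
     apply (simp only: rev.simps append.simps)
     \<comment> \<open>Smallness is checked here: the arguments lie in the sorts 1, 0 and 1, within
       the level 1 of the declaration, although the parameter \<open>g\<close> has values in the
       large type \<open>V\<close>.\<close>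
     apply (rule tele_cons[OF R(3)], simp, rule tele_cons[OF R(4)], simp, rule tele_cons[OF R(5)], simp,
       rule tele_nil)
    apply (simp add: spine_nil)
    done
qed

abbreviation "Famd K E g \<equiv> closed (Ind Fam_decl) \<cdot> K \<cdot> E \<cdot> g"
abbreviation "mkF K E g k h j \<equiv> closed (Con Fam_decl 0) \<cdot> K \<cdot> E \<cdot> g \<cdot> k \<cdot> h \<cdot> j"

lemma typed_Fam [typing]:
  "G \<tturnstile> closed (Ind Fam_decl) : (\<^bold>\<forall>K : Type0. \<^bold>\<forall>E : (\<^bold>\<forall>_ : K. Propd). \<^bold>\<forall>g : (\<^bold>\<forall>k : K. \<^bold>\<forall>h : E \<cdot> k. V). Type0)"
  "G \<tturnstile> closed (Con Fam_decl 0) : (\<^bold>\<forall>K : Type0. \<^bold>\<forall>E : (\<^bold>\<forall>_ : K. Propd). \<^bold>\<forall>g : (\<^bold>\<forall>k : K. \<^bold>\<forall>h : E \<cdot> k. V).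
     \<^bold>\<forall>k : K. \<^bold>\<forall>h : E \<cdot> k. \<^bold>\<forall>j : bar (g \<cdot> k \<cdot> h). Famd K E g)"
  "G \<tturnstile> closed (Rec Fam_decl u) : (\<^bold>\<forall>K : Type0. \<^bold>\<forall>E : (\<^bold>\<forall>_ : K. Propd). \<^bold>\<forall>g : (\<^bold>\<forall>k : K. \<^bold>\<forall>h : E \<cdot> k. V).
     \<^bold>\<forall>C : (\<^bold>\<forall>_ : Famd K E g. Srt u).
     \<^bold>\<forall>m : (\<^bold>\<forall>k : K. \<^bold>\<forall>h : E \<cdot> k. \<^bold>\<forall>j : bar (g \<cdot> k \<cdot> h). C \<cdot> mkF K E g k h j).
     \<^bold>\<forall>x : Famd K E g. C \<cdot> x)"
  by ((rule typed_Ind[OF wf_Fam] typed_Con[OF wf_Fam] typed_Rec[OF wf_Fam]);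
      simp add: raw types Fam_decl_def bar_def V_def eval_nat_numeral)+

lemma
  assumes "G \<tturnstile> K : Type0" "G \<tturnstile> E : (\<^bold>\<forall>_ : K. Propd)" "G \<tturnstile> g : (\<^bold>\<forall>k : K. \<^bold>\<forall>h : E \<cdot> k. V)" "fam G (Famd K E g) P u"
    "G \<tturnstile> m : (\<^bold>\<forall>k : K. \<^bold>\<forall>h : E \<cdot> k. \<^bold>\<forall>j : bar (g \<cdot> k \<cdot> h). P (mkF K E g k h j))"
  shows typed_rec_Fam: "G \<tturnstile> closed (Rec Fam_decl u) \<cdot> K \<cdot> E \<cdot> g \<cdot> lamd (Famd K E g) P \<cdot> m : (\<^bold>\<forall>x : Famd K E g. P
    x)"
    and deq_rec_Fam: "G \<tturnstile> k : K \<Longrightarrow> G \<tturnstile> h : E \<cdot> k \<Longrightarrow> G \<tturnstile> j : bar (g \<cdot> k \<cdot> h) \<Longrightarrow>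
       G \<tturnstile> closed (Rec Fam_decl u) \<cdot> K \<cdot> E \<cdot> g \<cdot> lamd (Famd K E g) P \<cdot> m \<cdot> mkF K E g k h j \<equiv> m \<cdot> k \<cdot> h \<cdot> j : P
         (mkF K E g k h j)"
proof -
  note F = typed_fam[where P = P] assms(4) and U = rel_uni[OF fam_uni[OF assms(4)]] and T = assms(1,2,3)
  let ?D = "Famd K E g"
  let ?C = "lamd ?D P" and ?n = "length G"
  have D: "G \<tturnstile> ?D : Type0" by (rule typed_eqI, (assumption | rule T typing rels ambient)+, rule refl)
  have "G \<tturnstile> (\<^bold>\<forall>k : K. \<^bold>\<forall>h : E \<cdot> k. \<^bold>\<forall>j : bar (g \<cdot> k \<cdot> h). P (mkF K E g k h j))
    \<equiv> (\<^bold>\<forall>k : K. \<^bold>\<forall>h : E \<cdot> k. \<^bold>\<forall>j : bar (g \<cdot> k \<cdot> h). ?C \<cdot> mkF K E g k h j) : Srt (imax 1 (imax 0 (imax 1 u)))"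
    apply (rule deq_pi, ((assumption | rule T typing rels ambient | erule good_tls
      | rule lift_deq lift_fam good_ext, (assumption | rule T))+)[1])
      apply (rule deq_pi, rule typed_eqI, ((assumption | rule T typing rels ambient | erule good_tls
        | rule lift_deq lift_fam good_ext, (assumption | rule T))+)[1], rule refl)
      apply (rule deq_pi, rule typed_bar, rule typed_eqI, ((assumption | rule T typing rels ambient
        | erule good_tls | rule lift_deq lift_fam good_ext, (assumption | rule T))+)[1], rule refl)
    apply (rule deq_sym, rule deq_fam, (rule assms fam_weak)+, rule typed_eqI, ((assumption
      | rule T typing rels ambient | erule good_tls | rule lift_deq lift_fam good_ext, (assumption
      | rule T))+)[1], rule refl)
    apply ((assumption | rule T fam_lam[OF assms(4)] typing rels U ambient | erule good_tls
      | rule lift_deq lift_fam good_ext, (assumption | rule T fam_lam[OF assms(4)]))+)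
    done
  from deq_conv[OF assms(5) this] have m: "G \<tturnstile> m : (\<^bold>\<forall>k : K. \<^bold>\<forall>h : E \<cdot> k. \<^bold>\<forall>j : bar (g \<cdot> k \<cdot> h). ?C \<cdot> mkF K E g k h
    j)" .
  let ?R = "closed (Rec Fam_decl u) \<cdot> K \<cdot> E \<cdot> g \<cdot> ?C \<cdot> m"
  have "G \<tturnstile> ?R : (\<^bold>\<forall>x : ?D. ?C \<cdot> x)"
    by (rule typed_eqI, (assumption | rule T m fam_lam[OF assms(4)] typing rels U ambient)+, rule refl)
  from deq_conv[OF this deq_pi[OF D deq_fam[OF fam_weak[OF assms(4)]]]]
  show R: "G \<tturnstile> ?R : (\<^bold>\<forall>x : ?D. P x)"
    by (rule meta_mp[OF meta_mp]) ((assumption | rule T fam_lam[OF assms(4)] typing rels U ambient)+)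
  have c: "st ?n ?C" "st ?n m" "st ?n K" "st ?n E" "st ?n g"
    using fam_lam[OF assms(4)] m T by (auto dest: deq_st)
  assume a: "G \<tturnstile> k : K" "G \<tturnstile> h : E \<cdot> k" "G \<tturnstile> j : bar (g \<cdot> k \<cdot> h)"
  have "G \<tturnstile> mkF K E g k h j : ?D" by (rule typed_eqI, (assumption | rule T a typing rels ambient)+, rule refl)
  from typed_app[OF R this fam_uni[OF assms(4)]] have l: "G \<tturnstile> ?R \<cdot> mkF K E g k h j : P (mkF K E g k h j)" .
  have "cx G \<turnstile> (?R \<cdot> mkF K E g k h j) ?n \<equiv> (m \<cdot> k \<cdot> h \<cdot> j) ?n : P (mkF K E g k h j) ?n" if "ok G"
    using iota[of 0 Fam_decl "[K ?n, E ?n, g ?n]" "[K ?n, E ?n, g ?n]" "[m ?n]" "[]" "[k ?n, h ?n, j ?n]" "[]"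
      "cx G" u "?C ?n" "P (mkF K E g k h j) ?n"] l that
    by (simp add: Fam_decl_def iota_def deq_def appd_def closed_def)
  then show "G \<tturnstile> ?R \<cdot> mkF K E g k h j \<equiv> m \<cdot> k \<cdot> h \<cdot> j : P (mkF K E g k h j)"
    using deq_st[OF l] c a[THEN deq_st(1)] by (simp add: deq_def)
qed

text \<open>The union of all \<open>g k h\<close>. An index contains a proof of \<open>E k\<close>
  in place of a decision whether \<open>E k\<close> holds, which makes such partial families
  available without excluded middle.\<close>

definition Uni :: "tmd \<Rightarrow> tmd \<Rightarrow> tmd \<Rightarrow> tmd" where
  "Uni K E g = supd (Famd K E g) (closed (Rec Fam_decl 2) \<cdot> K \<cdot> E \<cdot> g \<cdot> (\<^bold>\<lambda>_ : Famd K E g. V) \<cdot>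
     (\<^bold>\<lambda>k : K. \<^bold>\<lambda>h : E \<cdot> k. \<^bold>\<lambda>j : bar (g \<cdot> k \<cdot> h). child (g \<cdot> k \<cdot> h) j))"

lemma rel_Uni [rels]: "rel \<theta> k K K' \<Longrightarrow> rel \<theta> k E E' \<Longrightarrow> rel \<theta> k g g' \<Longrightarrow> rel \<theta> k (Uni K E g) (Uni K' E' g')"
  unfolding Uni_def by (assumption | rule rels rel_shift)+

lemma Uni:
  assumes "G \<tturnstile> K : Type0" "G \<tturnstile> E : (\<^bold>\<forall>_ : K. Propd)" "G \<tturnstile> g : (\<^bold>\<forall>k : K. \<^bold>\<forall>h : E \<cdot> k. V)"
  shows typed_Uni: "G \<tturnstile> Uni K E g : V"
    and UniI: "G \<tturnstile> w : V \<Longrightarrow> G \<tturnstile> k : K \<Longrightarrow> G \<tturnstile> h : E \<cdot> k \<Longrightarrow> G \<TTurnstile> w \<^bold>\<in> g \<cdot> k \<cdot> h \<Longrightarrow> G \<TTurnstile> w \<^bold>\<in> Uni K E g"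
    and UniE: "G \<tturnstile> w : V \<Longrightarrow> G \<TTurnstile> w \<^bold>\<in> Uni K E g \<Longrightarrow> G \<tturnstile> R : Propd \<Longrightarrow>
       (\<And>H k h. G \<preceq> H \<Longrightarrow> H \<tturnstile> k : K \<Longrightarrow> H \<tturnstile> h : E \<cdot> k \<Longrightarrow> H \<TTurnstile> w \<^bold>\<in> g \<cdot> k \<cdot> h \<Longrightarrow> H \<TTurnstile> R) \<Longrightarrow> G \<TTurnstile> R"
proof -
  note T = assms
  let ?D = "Famd K E g" and ?L = "\<^bold>\<lambda>k : K. \<^bold>\<lambda>h : E \<cdot> k. \<^bold>\<lambda>j : bar (g \<cdot> k \<cdot> h). child (g \<cdot> k \<cdot> h) j"
  let ?f = "closed (Rec Fam_decl 2) \<cdot> K \<cdot> E \<cdot> g \<cdot> (\<^bold>\<lambda>_ : ?D. V) \<cdot> ?L"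
  have gt: "H \<tturnstile> g \<cdot> k \<cdot> h : V" if "G \<preceq> H" "H \<tturnstile> k : K" "H \<tturnstile> h : E \<cdot> k" for H k h
    by (rule typed_eqI, (assumption | rule T that typing rels ambient | erule good_tls
      | rule lift_deq lift_fam good_ext, (assumption | rule T that))+, rule refl)
  have D: "G \<tturnstile> ?D : Type0" by (rule typed_eqI, (assumption | rule T typing rels ambient)+, rule refl)
  have F: "fam G ?D (\<lambda>_. V) 2" by (rule fam_const[OF D typed_V])
  have E: "H \<tturnstile> E \<cdot> k : Propd" if "G \<preceq> H" "H \<tturnstile> k : K" for H k
    by (rule typed_eqI, (assumption | rule T that typing rels ambient | erule good_tls
      | rule lift_deq lift_fam good_ext, (assumption | rule T that))+, rule refl)
  have L: "G \<tturnstile> ?L : (\<^bold>\<forall>k : K. \<^bold>\<forall>h : E \<cdot> k. \<^bold>\<forall>j : bar (g \<cdot> k \<cdot> h). V)"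
    by ((assumption | rule T gt E ext_Cons typing rels ambient)+)
  have f: "G \<tturnstile> ?f : (\<^bold>\<forall>_ : ?D. V)" by (rule typed_rec_Fam[OF T F L])
  show U: "G \<tturnstile> Uni K E g : V" unfolding Uni_def by (rule typed_sup[OF D f])
  have fm: "H \<tturnstile> ?f \<cdot> mkF K E g k h j \<equiv> child (g \<cdot> k \<cdot> h) j : V"
    if "G \<preceq> H" "H \<tturnstile> k : K" "H \<tturnstile> h : E \<cdot> k" "H \<tturnstile> j : bar (g \<cdot> k \<cdot> h)" for H k h j
    by (rule deq_trans[OF deq_rec_Fam[OF lift_deq[OF that(1) T(1)] lift_deq[OF that(1) T(2)] lift_deq[OF that(1)
      T(3)] lift_fam[OF that(1) F] lift_deq[OF that(1) L] that(2-4)]],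
      rule beta_step[OF beta_step[OF deq_beta[OF lift_deq[OF that(1) L]]]]) ((assumption
        | rule that(2-) T[THEN lift_deq[OF that(1)]] typing rels ambient)+)
  { assume w: "G \<tturnstile> w : V" and k: "G \<tturnstile> k : K" "G \<tturnstile> h : E \<cdot> k" and m: "G \<TTurnstile> w \<^bold>\<in> g \<cdot> k \<cdot> h"
    show "G \<TTurnstile> w \<^bold>\<in> Uni K E g"
    proof (rule memE[OF m w gt[OF ext_refl k]])
      fix H j assume H: "G \<preceq> H" "H \<tturnstile> j : bar (g \<cdot> k \<cdot> h)" "H \<TTurnstile> w \<^bold>\<approx> child (g \<cdot> k \<cdot> h) j"
      note T' = T[THEN lift_deq[OF H(1)]] k[THEN lift_deq[OF H(1)]] H(2)
      note w' = lift_deq[OF H(1) w]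
      show "H \<TTurnstile> w \<^bold>\<in> Uni K E g" unfolding Uni_def
        apply (rule sup_memI[OF lift_deq[OF H(1) D] lift_deq[OF H(1) f] w' _ holds_conv[OF H(3) deq_bisim[OF w'
          deq_sym[OF fm[OF H(1) T'(4-6)]]]]])
        apply (rule typed_eqI, (assumption | rule T' typing rels ambient)+, rule refl)
        done
    qed ((assumption | rule U w typing rels ambient)+) }
  assume w: "G \<tturnstile> w : V" and m: "G \<TTurnstile> w \<^bold>\<in> Uni K E g" and R: "G \<tturnstile> R : Propd"
    "\<And>H k h. G \<preceq> H \<Longrightarrow> H \<tturnstile> k : K \<Longrightarrow> H \<tturnstile> h : E \<cdot> k \<Longrightarrow> H \<TTurnstile> w \<^bold>\<in> g \<cdot> k \<cdot> h \<Longrightarrow> H \<TTurnstile> R"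
  let ?P = "\<lambda>s. w \<^bold>\<approx> ?f \<cdot> s \<^bold>\<rightarrow> R"
  have fs: "H \<tturnstile> ?f \<cdot> s : V" if "H \<tturnstile> s : ?D" "G \<preceq> H" for H s
    by (rule typed_app[OF lift_deq[OF that(2) f] that(1)]) ((assumption | rule typing rels ambient)+)
  have FP: "fam G ?D ?P 0"
    by (rule famI[OF D]) ((assumption | rule w R(1) T fs ext_Cons typing rels f ambient)+)
  have "G \<TTurnstile> (\<^bold>\<forall>k : K. \<^bold>\<forall>h : E \<cdot> k. \<^bold>\<forall>j : bar (g \<cdot> k \<cdot> h). ?P (mkF K E g k h j))"
  proof (rule allI1, ((assumption | rule T typing rels ambient)+)[1], ((assumption | rule T w R(1) typing rels f
    ambient)+)[1])
    fix H k assume H: "G \<preceq> H" "H \<tturnstile> k : K"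
    note T1 = T[THEN lift_deq[OF H(1)]] H(2) lift_deq[OF H(1) w] lift_deq[OF H(1) R(1)] lift_deq[OF H(1) f]
    show "H \<TTurnstile> (\<^bold>\<forall>h : E \<cdot> k. \<^bold>\<forall>j : bar (g \<cdot> k \<cdot> h). ?P (mkF K E g k h j))"
    proof (rule allI1, rule E[OF H], ((assumption | rule T1 typing rels T1 ambient)+)[1])
      fix I h assume I: "H \<preceq> I" "I \<tturnstile> h : E \<cdot> k"
      note GI = ext_trans[OF H(1) I(1)]
      note T2 = T1[THEN lift_deq[OF I(1)]] I(2)
      show "I \<TTurnstile> (\<^bold>\<forall>j : bar (g \<cdot> k \<cdot> h). ?P (mkF K E g k h j))"
      proof (rule allI1, rule typed_bar[OF gt[OF GI T2(4,8)]], ((assumption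
        | rule T2 typing rels T2 ambient)+)[1], rule impI1)
        fix J j M assume J: "I \<preceq> J" "J \<tturnstile> j : bar (g \<cdot> k \<cdot> h)" and M: "J \<preceq> M" "M \<TTurnstile> w \<^bold>\<approx> ?f \<cdot> mkF K E g k h j"
        note IM = ext_trans[OF J(1) M(1)] and GM = ext_trans[OF GI ext_trans[OF J(1) M(1)]]
        note T4 = T2[THEN lift_deq[OF IM]] lift_deq[OF M(1) J(2)]
        show "M \<TTurnstile> R"
          by (rule R(2)[OF GM T4(4,8)], rule memI[OF T4(5) gt[OF GM T4(4,8)] T4(9)], rule holds_conv[OF M(2)
            deq_bisim[OF T4(5) fm[OF GM T4(4,8,9)]]])
      next
        fix J j assume J: "I \<preceq> J" "J \<tturnstile> j : bar (g \<cdot> k \<cdot> h)"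
        note GJ = ext_trans[OF GI J(1)]
        note T3 = T2[THEN lift_deq[OF J(1)]] J(2)
        have "J \<tturnstile> mkF K E g k h j : ?D" by (rule typed_eqI, (assumption | rule T3(1-4,8,9) typing rels
          ambient)+, rule refl)
        from typed_bisim[OF T3(5) fs[OF this GJ]] show "J \<tturnstile> (w \<^bold>\<approx> ?f \<cdot> mkF K E g k h j) : Propd" .
        show "J \<tturnstile> R : Propd" by (rule T3)
      qed
    qed
  qed
  then obtain p where "G \<tturnstile> p : (\<^bold>\<forall>k : K. \<^bold>\<forall>h : E \<cdot> k. \<^bold>\<forall>j : bar (g \<cdot> k \<cdot> h). ?P (mkF K E g k h j))"
    by (auto simp: holds_def)
  from holdsI[OF typed_rec_Fam[OF T FP this]] have all: "G \<TTurnstile> (\<^bold>\<forall>s : ?D. ?P s)" .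
  show "G \<TTurnstile> R"
  proof (rule sup_memE[OF m[unfolded Uni_def] D f w R(1)])
    fix H s assume H: "G \<preceq> H" "H \<tturnstile> s : ?D" "H \<TTurnstile> w \<^bold>\<approx> ?f \<cdot> s"
    show "H \<TTurnstile> R"
      by (rule mp0[OF allE0[OF lift_holds[OF H(1) all] H(2)] H(3)]) ((assumption
        | rule H(1) w T R(1) typing rels f ambient | erule good_tls | rule lift_deq lift_fam good_ext,
        (assumption | rule H(1) w T R(1)))+)
  qed
qed

definition uni2 :: "nat \<Rightarrow> (tmd \<Rightarrow> tmd \<Rightarrow> tmd) \<Rightarrow> bool" where
  "uni2 n b \<longleftrightarrow> (\<forall>\<theta>. good n \<theta> \<longrightarrow> (\<forall>k x x' y y'. rel \<theta> k x x' \<longrightarrow> rel \<theta> k y y' \<longrightarrow> rel \<theta> k (b x y) (b x' y')))"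

lemma uni2I: "(\<And>\<theta> k x x' y y'. good n \<theta> \<Longrightarrow> rel \<theta> k x x' \<Longrightarrow> rel \<theta> k y y' \<Longrightarrow> rel \<theta> k (b x y) (b x' y')) \<Longrightarrow> uni2 n b"
  unfolding uni2_def by blast

lemma rel_uni2: "uni2 n b \<Longrightarrow> good n \<theta> \<Longrightarrow> rel \<theta> k x x' \<Longrightarrow> rel \<theta> k y y' \<Longrightarrow> rel \<theta> k (b x y) (b x' y')"
  unfolding uni2_def by blast

lemma lift_uni2: "G \<preceq> H \<Longrightarrow> uni2 (length G) b \<Longrightarrow> uni2 (length H) b"
  unfolding uni2_def by (blast intro: good_ext)

text \<open>A form of \<open>Uni\<close> with metalevel families, whose membership rules mention no
  \<beta>-redexes.\<close>

definition UniF :: "tmd \<Rightarrow> (tmd \<Rightarrow> tmd) \<Rightarrow> (tmd \<Rightarrow> tmd \<Rightarrow> tmd) \<Rightarrow> tmd" where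
  "UniF K E g = Uni K (lamd K E) (\<^bold>\<lambda>k : K. \<^bold>\<lambda>h : E k. g k h)"

lemma rel_UniF [rels]:
  "rel \<theta> k K K' \<Longrightarrow> (\<And>d x x'. rel \<theta> (Suc (k + d)) x x' \<Longrightarrow> rel \<theta> (Suc (k + d)) (E x) (E' x')) \<Longrightarrow>
   (\<And>d x x' y y'. rel \<theta> (Suc (k + d)) x x' \<Longrightarrow> rel \<theta> (Suc (k + d)) y y' \<Longrightarrow> rel \<theta> (Suc (k + d)) (g x y) (g' x' y'))
     \<Longrightarrow>
   rel \<theta> k (UniF K E g) (UniF K' E' g')"
  unfolding UniF_def
proof (rule rels, assumption, rule rel_lam, assumption, assumption, rule rel_lam, assumption, rule rel_lam,
  assumption)
  fix d x x' da xa x'a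
  assume g: "\<And>d x x' y y'. rel \<theta> (Suc (k + d)) x x' \<Longrightarrow> rel \<theta> (Suc (k + d)) y y' \<Longrightarrow> rel \<theta> (Suc (k + d)) (g x y)
    (g' x' y')"
    and x: "rel \<theta> (Suc (k + d)) x x'" "rel \<theta> (Suc (Suc (k + d) + da)) xa x'a"
  show "rel \<theta> (Suc (Suc (k + d) + da)) (g x xa) (g' x' x'a)"
    \<comment> \<open>The two arguments are bound at different depths and have to be compared at a
      common one, the depth below both binders.\<close>
    using g[of "Suc (d + da)" x x' xa x'a] rel_mono[OF x(1), of "Suc (Suc (k + d) + da)"] x(2)
      by (simp add: add.assoc)
qed

lemma UniF:
  assumes "G \<tturnstile> K : Type0" "fam G K E 0" "uni2 (length G) g"
    "\<And>H k h. G \<preceq> H \<Longrightarrow> H \<tturnstile> k : K \<Longrightarrow> H \<tturnstile> h : E k \<Longrightarrow> H \<tturnstile> g k h : V"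
  shows typed_UniF: "G \<tturnstile> UniF K E g : V"
    and UniFI: "G \<tturnstile> w : V \<Longrightarrow> G \<tturnstile> k : K \<Longrightarrow> G \<tturnstile> h : E k \<Longrightarrow> G \<TTurnstile> w \<^bold>\<in> g k h \<Longrightarrow> G \<TTurnstile> w \<^bold>\<in> UniF K E g"
    and UniFE: "G \<tturnstile> w : V \<Longrightarrow> G \<TTurnstile> w \<^bold>\<in> UniF K E g \<Longrightarrow> G \<tturnstile> R : Propd \<Longrightarrow>
       (\<And>H k h. G \<preceq> H \<Longrightarrow> H \<tturnstile> k : K \<Longrightarrow> H \<tturnstile> h : E k \<Longrightarrow> H \<TTurnstile> w \<^bold>\<in> g k h \<Longrightarrow> H \<TTurnstile> R) \<Longrightarrow> G \<TTurnstile> R"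
proof -
  note U = rel_uni[OF fam_uni[OF assms(2)]] and U2 = rel_uni2[OF assms(3)]
  let ?E = "lamd K E" and ?g = "\<^bold>\<lambda>k : K. \<^bold>\<lambda>h : E k. g k h"
  have E: "G \<tturnstile> ?E : (\<^bold>\<forall>_ : K. Propd)" by (rule fam_lam[OF assms(2)])
  have tE: "H \<tturnstile> E k : Propd" if "G \<preceq> H" "H \<tturnstile> k : K" for H k
    by (rule typed_fam[OF lift_fam[OF that(1) assms(2)] that(2)])
  have cE: "H \<tturnstile> ?E \<cdot> k \<equiv> E k : Propd" if "G \<preceq> H" "H \<tturnstile> k : K" for H k
    by (rule deq_fam[OF lift_fam[OF that(1) assms(2)] that(2)])
  have g0: "G \<tturnstile> ?g : (\<^bold>\<forall>k : K. \<^bold>\<forall>h : E k. V)"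
    by ((assumption | rule assms(1) tE assms(4) ext_Cons typing rels U U2 ambient | erule good_tls
      | rule lift_deq lift_fam good_ext, (assumption | rule assms(1) tE assms(4) ext_Cons))+)
  have g: "G \<tturnstile> ?g : (\<^bold>\<forall>k : K. \<^bold>\<forall>h : ?E \<cdot> k. V)"
    by (rule deq_conv[OF g0], rule deq_pi[OF assms(1)], rule deq_pi, rule deq_sym, rule cE) ((assumption
      | rule assms(1) tE E ext_Cons typing rels U U2 ambient)+)
  have cg: "H \<tturnstile> ?g \<cdot> k \<cdot> h \<equiv> g k h : V" if "G \<preceq> H" "H \<tturnstile> k : K" "H \<tturnstile> h : E k" for H k h
    by (rule beta_step[OF deq_beta[OF lift_deq[OF that(1) g0]]])
      ((assumption | rule that assms(1) typing rels U U2 ambient | erule good_tls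
        | rule lift_deq lift_fam good_ext, (assumption | rule that assms(1)))+)
  have c: "H \<tturnstile> (w \<^bold>\<in> ?g \<cdot> k \<cdot> h) \<equiv> (w \<^bold>\<in> g k h) : Propd" if "G \<preceq> H" "H \<tturnstile> w : V" "H \<tturnstile> k : K" "H \<tturnstile> h : E k"
    for H w k h
    by (rule deq_fam_cong[OF _ cg[OF that(1,3,4)], of "\<lambda>x. w \<^bold>\<in> x"], rule famI) ((assumption
      | rule that(2) typing rels ambient)+)
  show "G \<tturnstile> UniF K E g : V" unfolding UniF_def by (rule typed_Uni[OF assms(1) E g])
  show "G \<TTurnstile> w \<^bold>\<in> UniF K E g" if "G \<tturnstile> w : V" "G \<tturnstile> k : K" "G \<tturnstile> h : E k" "G \<TTurnstile> w \<^bold>\<in> g k h"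
    unfolding UniF_def
    by (rule UniI[OF assms(1) E g that(1,2) deq_conv[OF that(3) deq_sym[OF cE[OF ext_refl that(2)]]]
       holds_conv[OF that(4) deq_sym[OF c[OF ext_refl that(1-3)]]]])
  assume a: "G \<tturnstile> w : V" "G \<TTurnstile> w \<^bold>\<in> UniF K E g" "G \<tturnstile> R : Propd" and R:
    "\<And>H k h. G \<preceq> H \<Longrightarrow> H \<tturnstile> k : K \<Longrightarrow> H \<tturnstile> h : E k \<Longrightarrow> H \<TTurnstile> w \<^bold>\<in> g k h \<Longrightarrow> H \<TTurnstile> R"
  show "G \<TTurnstile> R"
  proof (rule UniE[OF assms(1) E g a(1) a(2)[unfolded UniF_def] a(3)])
    fix H k h assume H: "G \<preceq> H" "H \<tturnstile> k : K" "H \<tturnstile> h : ?E \<cdot> k" "H \<TTurnstile> w \<^bold>\<in> ?g \<cdot> k \<cdot> h"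
    have h: "H \<tturnstile> h : E k" by (rule deq_conv[OF H(3) cE[OF H(1,2)]])
    show "H \<TTurnstile> R"
      by (rule R[OF H(1,2) h holds_conv[OF H(4) c[OF H(1) lift_deq[OF H(1) a(1)] H(2) h]]])
  qed
qed

section \<open>Labels and paths as inductive types\<close>

lemma wf_Label: "wf_decl Label_decl"
proof -
  have V: "\<Gamma> \<turnstile> Ind V_decl : Sort 2" for \<Gamma>
    using ind[OF wf_V, of \<Gamma>] by (simp add: V_decl_def ind_type_def)
  show ?thesis unfolding Label_decl_def
    by (intro wf_declI list_all_ConsI list_all_NilI wf_ctorI) (auto intro: tele_cons V tele_nil spine_nil)
qed

lemma wf_List: "wf_decl (List_decl u)"
  unfolding List_decl_def
  by ((rule wf_intros conjI)+ | simp | (simp, rule wf_intros conjI))+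

lemma typed_Label [typing]:
  "G \<tturnstile> Label : Srt 2"
  "G \<tturnstile> lab_a : Label"
  "G \<tturnstile> closed (Con Label_decl 1) : (\<^bold>\<forall>w : V. Label)"
  "G \<tturnstile> closed (Con Label_decl 2) : (\<^bold>\<forall>w : V. Label)"
  "G \<tturnstile> closed (Rec Label_decl u) : (\<^bold>\<forall>C : (\<^bold>\<forall>_ : Label. Srt u). \<^bold>\<forall>ma : C \<cdot> lab_a.
     \<^bold>\<forall>mb : (\<^bold>\<forall>w : V. C \<cdot> lab_b w). \<^bold>\<forall>mc : (\<^bold>\<forall>w : V. C \<cdot> lab_c w). \<^bold>\<forall>x : Label. C \<cdot> x)"
  unfolding Label_def lab_a_def lab_b_def lab_c_def
  by ((rule typed_Ind[OF wf_Label] typed_Con[OF wf_Label] typed_Rec[OF wf_Label]);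
      simp add: raw types Label_decl_def V_def eval_nat_numeral)+

lemma rel_Label [rels]: "rel \<theta> k Label Label" "rel \<theta> k lab_a lab_a"
  "rel \<theta> k w w' \<Longrightarrow> rel \<theta> k (lab_b w) (lab_b w')" "rel \<theta> k w w' \<Longrightarrow> rel \<theta> k (lab_c w) (lab_c w')"
  unfolding Label_def lab_a_def lab_b_def lab_c_def by (assumption | rule rels)+

lemma typed_lab_b [typing]: "G \<tturnstile> w : V \<Longrightarrow> G \<tturnstile> lab_b w : Label"
  unfolding lab_b_def by (rule typed_eqI, (assumption | rule typing rels ambient)+, rule refl)
lemma typed_lab_c [typing]: "G \<tturnstile> w : V \<Longrightarrow> G \<tturnstile> lab_c w : Label"
  unfolding lab_c_def by (rule typed_eqI, (assumption | rule typing rels ambient)+, rule refl)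

lemma typed_List [typing]:
  "G \<tturnstile> closed (Ind (List_decl u)) : (\<^bold>\<forall>A : Srt u. Srt u)"
  "G \<tturnstile> closed (Con (List_decl u) 0) : (\<^bold>\<forall>A : Srt u. closed (Ind (List_decl u)) \<cdot> A)"
  "G \<tturnstile> closed (Con (List_decl u) 1) : (\<^bold>\<forall>A : Srt u. \<^bold>\<forall>x : A. \<^bold>\<forall>xs : closed (Ind (List_decl u)) \<cdot> A. closed (Ind
    (List_decl u)) \<cdot> A)"
  by ((rule typed_Ind[OF wf_List] typed_Con[OF wf_List]);
      simp add: raw types List_decl_def V_def)+

lemma rel_Path [rels]: "rel \<theta> k Path Path" "rel \<theta> k root root"
  "rel \<theta> k l l' \<Longrightarrow> rel \<theta> k p p' \<Longrightarrow> rel \<theta> k (l \<^bold># p) (l' \<^bold># p')"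
  unfolding Path_def root_def cons_def by (assumption | rule rels)+

lemma typed_Path [typing]: "G \<tturnstile> Path : Srt 2"
  unfolding Path_def by (rule typed_eqI, (assumption | rule typing rels ambient)+, rule refl)
lemma typed_root [typing]: "G \<tturnstile> root : Path"
  unfolding Path_def root_def by (rule typed_eqI, (assumption | rule typing rels ambient)+, rule refl)
lemma typed_cons [typing]: "G \<tturnstile> l : Label \<Longrightarrow> G \<tturnstile> p : Path \<Longrightarrow> G \<tturnstile> l \<^bold># p : Path"
  unfolding Path_def cons_def by (rule typed_eqI, (assumption | rule typing rels ambient)+, rule refl)

lemma
  assumes "fam G Label P u" "G \<tturnstile> ma : P lab_a" "G \<tturnstile> mb : (\<^bold>\<forall>w : V. P (lab_b w))" "G \<tturnstile> mc : (\<^bold>\<forall>w : V. P (lab_c w))"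
  shows typed_rec_Label: "G \<tturnstile> closed (Rec Label_decl u) \<cdot> lamd Label P \<cdot> ma \<cdot> mb \<cdot> mc : (\<^bold>\<forall>l : Label. P l)"
    and deq_rec_a: "G \<tturnstile> closed (Rec Label_decl u) \<cdot> lamd Label P \<cdot> ma \<cdot> mb \<cdot> mc \<cdot> lab_a \<equiv> ma : P lab_a"
    and deq_rec_b: "G \<tturnstile> w : V \<Longrightarrow> G \<tturnstile> closed (Rec Label_decl u) \<cdot> lamd Label P \<cdot> ma \<cdot> mb \<cdot> mc \<cdot> lab_b w \<equiv> mb \<cdot> w :
      P (lab_b w)"
    and deq_rec_c: "G \<tturnstile> w : V \<Longrightarrow> G \<tturnstile> closed (Rec Label_decl u) \<cdot> lamd Label P \<cdot> ma \<cdot> mb \<cdot> mc \<cdot> lab_c w \<equiv> mc \<cdot> w :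
      P (lab_c w)"
proof -
  note F = typed_fam[where P = P] assms(1) and U = rel_uni[OF fam_uni[OF assms(1)]]
  let ?C = "lamd Label P" and ?n = "length G"
  have ma: "G \<tturnstile> ma : ?C \<cdot> lab_a" by (rule deq_conv[OF assms(2) deq_sym[OF deq_fam[OF assms(1) typed_Label(2)]]])
  have "G \<tturnstile> (\<^bold>\<forall>w : V. P (lab_b w)) \<equiv> (\<^bold>\<forall>w : V. ?C \<cdot> lab_b w) : Srt (imax 2 u)"
    by (rule deq_pi, ((assumption | rule typing rels ambient)+)[1], rule deq_sym, rule deq_fam, rule fam_weak,
      rule assms, ((assumption | rule fam_lam[OF assms(1)] typing rels U ambient)+))
  from deq_conv[OF assms(3) this] have mb: "G \<tturnstile> mb : (\<^bold>\<forall>w : V. ?C \<cdot> lab_b w)" .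
  have "G \<tturnstile> (\<^bold>\<forall>w : V. P (lab_c w)) \<equiv> (\<^bold>\<forall>w : V. ?C \<cdot> lab_c w) : Srt (imax 2 u)"
    by (rule deq_pi, ((assumption | rule typing rels ambient)+)[1], rule deq_sym, rule deq_fam, rule fam_weak,
      rule assms, ((assumption | rule fam_lam[OF assms(1)] typing rels U ambient)+))
  from deq_conv[OF assms(4) this] have mc: "G \<tturnstile> mc : (\<^bold>\<forall>w : V. ?C \<cdot> lab_c w)" .
  let ?R = "closed (Rec Label_decl u) \<cdot> ?C \<cdot> ma \<cdot> mb \<cdot> mc"
  have "G \<tturnstile> ?R : (\<^bold>\<forall>x : Label. ?C \<cdot> x)"
    by (rule typed_eqI, (assumption | rule ma mb mc fam_lam[OF assms(1)] typing rels U ambient)+, rule refl)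
  from deq_conv[OF this deq_pi[OF typed_Label(1) deq_fam[OF fam_weak[OF assms(1)]]]]
  show R: "G \<tturnstile> ?R : (\<^bold>\<forall>x : Label. P x)"
    by (rule meta_mp[OF meta_mp]) ((assumption | rule fam_lam[OF assms(1)] typing rels U ambient)+)
  have c: "st ?n ?C" "st ?n ma" "st ?n mb" "st ?n mc"
    using fam_lam[OF assms(1)] ma mb mc by (auto dest: deq_st)
  note l = typed_app[OF R _ fam_uni[OF assms(1)]]
  { note l = l[OF typed_Label(2)]
    have "cx G \<turnstile> (?R \<cdot> lab_a) ?n \<equiv> ma ?n : P lab_a ?n" if "ok G"
      using iota[of 0 Label_decl "[]" "[]" "[ma ?n, mb ?n, mc ?n]" "[]" "[]" "[]" "cx G" u "?C ?n" "P lab_a ?n"]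
        l that
      by (simp add: Label_decl_def iota_def deq_def appd_def closed_def lab_a_def)
    then show "G \<tturnstile> ?R \<cdot> lab_a \<equiv> ma : P lab_a"
      using deq_st[OF l] c by (simp add: deq_def) }
  { assume w: "G \<tturnstile> w : V"
    note l = l[OF typed_lab_b[OF w]]
    have "cx G \<turnstile> (?R \<cdot> lab_b w) ?n \<equiv> (mb \<cdot> w) ?n : P (lab_b w) ?n" if "ok G"
      using iota[of 1 Label_decl "[]" "[]" "[ma ?n, mb ?n, mc ?n]" "[]" "[w ?n]" "[]" "cx G" u "?C ?n"
        "P (lab_b w) ?n"] l that
      by (simp add: Label_decl_def iota_def deq_def appd_def closed_def lab_b_def)
    then show "G \<tturnstile> ?R \<cdot> lab_b w \<equiv> mb \<cdot> w : P (lab_b w)"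
      using deq_st[OF l] c deq_st[OF w] by (simp add: deq_def) }
  { assume w: "G \<tturnstile> w : V"
    note l = l[OF typed_lab_c[OF w]]
    have "cx G \<turnstile> (?R \<cdot> lab_c w) ?n \<equiv> (mc \<cdot> w) ?n : P (lab_c w) ?n" if "ok G"
      using iota[of 2 Label_decl "[]" "[]" "[ma ?n, mb ?n, mc ?n]" "[]" "[w ?n]" "[]" "cx G" u "?C ?n"
        "P (lab_c w) ?n"] l that
      by (simp add: Label_decl_def iota_def deq_def appd_def closed_def lab_c_def eval_nat_numeral)
    then show "G \<tturnstile> ?R \<cdot> lab_c w \<equiv> mc \<cdot> w : P (lab_c w)"
      using deq_st[OF l] c deq_st[OF w] by (simp add: deq_def) }
qed

section \<open>Labels\<close>

lemma typ_Prop [typing]: "G \<tturnstile> Propd : Type0"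
  using typ_sort[of G 0] by simp

lemma rel_lab_case [rels]:
  "rel \<theta> k R R' \<Longrightarrow> rel \<theta> k ra ra' \<Longrightarrow> (\<And>d x x'. rel \<theta> (Suc (k + d)) x x' \<Longrightarrow> rel \<theta> (Suc (k + d)) (rb x) (rb' x')) \<Longrightarrow>
   (\<And>d x x'. rel \<theta> (Suc (k + d)) x x' \<Longrightarrow> rel \<theta> (Suc (k + d)) (rc x) (rc' x')) \<Longrightarrow> rel \<theta> k l l' \<Longrightarrow>
   rel \<theta> k (lab_case u R ra rb rc l) (lab_case u R' ra' rb' rc' l')"
  unfolding lab_case_def by (assumption | rule rels rel_shift)+

lemma lab_case:
  assumes "G \<tturnstile> R : Srt u" "G \<tturnstile> ra : R" "G \<tturnstile> lamd V rb : (\<^bold>\<forall>_ : V. R)" "G \<tturnstile> lamd V rc : (\<^bold>\<forall>_ : V. R)"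
     "uni (length G) rb" "uni (length G) rc"
  shows typed_lab_case: "G \<tturnstile> l : Label \<Longrightarrow> G \<tturnstile> lab_case u R ra rb rc l : R"
    and deq_case_a: "G \<tturnstile> lab_case u R ra rb rc lab_a \<equiv> ra : R"
    and deq_case_b: "G \<tturnstile> w : V \<Longrightarrow> G \<tturnstile> lab_case u R ra rb rc (lab_b w) \<equiv> rb w : R"
    and deq_case_c: "G \<tturnstile> w : V \<Longrightarrow> G \<tturnstile> lab_case u R ra rb rc (lab_c w) \<equiv> rc w : R"
proof -
  have F: "fam G Label (\<lambda>_. R) u" by (rule fam_const[OF typed_Label(1) assms(1)])
  note u = uni_const[OF deq_st(1)[OF assms(1)]]
  show "G \<tturnstile> l : Label \<Longrightarrow> G \<tturnstile> lab_case u R ra rb rc l : R"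
    unfolding lab_case_def by (rule typed_app[OF typed_rec_Label[OF F assms(2-4)] _ u])
  show "G \<tturnstile> lab_case u R ra rb rc lab_a \<equiv> ra : R"
    unfolding lab_case_def by (rule deq_rec_a[OF F assms(2-4)])
  show "G \<tturnstile> lab_case u R ra rb rc (lab_b w) \<equiv> rb w : R" if w: "G \<tturnstile> w : V"
    unfolding lab_case_def by (rule deq_trans[OF deq_rec_b[OF F assms(2-4) w] deq_beta[OF assms(3,5) u w]])
  show "G \<tturnstile> lab_case u R ra rb rc (lab_c w) \<equiv> rc w : R" if w: "G \<tturnstile> w : V"
    unfolding lab_case_def by (rule deq_trans[OF deq_rec_c[OF F assms(2-4) w] deq_beta[OF assms(4,6) u w]])
qed

abbreviation "Fd \<equiv> closed (Ind False_decl)"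
abbreviation "Td \<equiv> closed (Ind True_decl)"

lemma rel_lab_eqv [rels]: "rel \<theta> k l m \<Longrightarrow> rel \<theta> k l' m' \<Longrightarrow> rel \<theta> k (l \<^bold>\<sim> l') (m \<^bold>\<sim> m')"
  unfolding lab_eqv_def Let_def by (assumption | rule rels rel_shift)+

lemma lab_eqv:
  assumes "G \<tturnstile> l' : Label"
  shows typed_lab_eqv [typing]: "G \<tturnstile> l : Label \<Longrightarrow> G \<tturnstile> (l \<^bold>\<sim> l') : Propd"
   and deq_eqv_a: "G \<tturnstile> (lab_a \<^bold>\<sim> l') \<equiv> lab_case 1 Propd Td (\<lambda>_. Fd) (\<lambda>_. Fd) l' : Propd"
   and deq_eqv_b: "G \<tturnstile> w : V \<Longrightarrow> G \<tturnstile> (lab_b w \<^bold>\<sim> l') \<equiv> lab_case 1 Propd Fd (\<lambda>w'. w \<^bold>\<approx> w') (\<lambda>_. Fd) l' : Propd"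
   and deq_eqv_c: "G \<tturnstile> w : V \<Longrightarrow> G \<tturnstile> (lab_c w \<^bold>\<sim> l') \<equiv> lab_case 1 Propd Fd (\<lambda>_. Fd) (\<lambda>w'. w \<^bold>\<approx> w') l' : Propd"
proof -
  let ?R = "\<^bold>\<forall>_ : Label. Propd"
  have R: "H \<tturnstile> ?R : Srt 2" for H
    using typed_pi[of H Label 2 "\<lambda>_. Propd" 1] typed_Label(1) typ_Prop uni_const[OF st_closed, of "Sort 0"]
    by (simp add: imax_def numeral_2_eq_2)
  have F: "H \<tturnstile> (\<^bold>\<lambda>_ : V. Fd) : (\<^bold>\<forall>_ : V. Propd)" "uni (length H) (\<lambda>_. Fd)" for H by ((assumption
    | rule typing rels ambient)+)
  have B: "H \<tturnstile> (\<^bold>\<lambda>w' : V. w \<^bold>\<approx> w') : (\<^bold>\<forall>_ : V. Propd)" "uni (length H) (\<lambda>w'. w \<^bold>\<approx> w')" if "H \<tturnstile> w : V" for H w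
    by ((assumption | rule that typing rels ambient)+)
  have A: "H \<tturnstile> (\<^bold>\<lambda>l' : Label. lab_case 1 Propd Td (\<lambda>_. Fd) (\<lambda>_. Fd) l') : ?R" for H
    by ((assumption | rule typed_lab_case typing rels ambient)+)
  have b: "H \<tturnstile> (\<^bold>\<lambda>l' : Label. lab_case 1 Propd Fd (\<lambda>w'. w \<^bold>\<approx> w') (\<lambda>_. Fd) l') : ?R"
    "H \<tturnstile> (\<^bold>\<lambda>l' : Label. lab_case 1 Propd Fd (\<lambda>_. Fd) (\<lambda>w'. w \<^bold>\<approx> w') l') : ?R" if "H \<tturnstile> w : V" for H w
    by ((assumption | rule that typed_lab_case typing rels ambient)+)
  have b': "H \<tturnstile> (\<^bold>\<lambda>w : V. \<^bold>\<lambda>l' : Label. lab_case 1 Propd Fd (\<lambda>w'. w \<^bold>\<approx> w') (\<lambda>_. Fd) l') : (\<^bold>\<forall>_ : V. ?R)"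
    "H \<tturnstile> (\<^bold>\<lambda>w : V. \<^bold>\<lambda>l' : Label. lab_case 1 Propd Fd (\<lambda>_. Fd) (\<lambda>w'. w \<^bold>\<approx> w') l') : (\<^bold>\<forall>_ : V. ?R)" for H
    by ((assumption | rule b typing rels ambient)+)
  have u: "uni (length H) (\<lambda>w. \<^bold>\<lambda>l' : Label. lab_case 1 Propd Fd (\<lambda>w'. w \<^bold>\<approx> w') (\<lambda>_. Fd) l')"
    "uni (length H) (\<lambda>w. \<^bold>\<lambda>l' : Label. lab_case 1 Propd Fd (\<lambda>_. Fd) (\<lambda>w'. w \<^bold>\<approx> w') l')" for H
    by ((assumption | rule typing rels ambient)+)
  note L = R A b' u
  note E = lab_eqv_def Let_def arr_def
  have uP: "uni (length H) (\<lambda>_. Propd)" for H by ((assumption | rule typing rels ambient)+)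
  show "G \<tturnstile> l : Label \<Longrightarrow> G \<tturnstile> (l \<^bold>\<sim> l') : Propd"
    unfolding E by (rule typed_app[OF typed_lab_case[OF L] assms uP])
  show "G \<tturnstile> (lab_a \<^bold>\<sim> l') \<equiv> lab_case 1 Propd Td (\<lambda>_. Fd) (\<lambda>_. Fd) l' : Propd"
    unfolding E by (rule beta_step[OF deq_case_a[OF L] _ uP assms]) ((assumption | rule typing rels ambient)+)
  show "G \<tturnstile> (lab_b w \<^bold>\<sim> l') \<equiv> lab_case 1 Propd Fd (\<lambda>w'. w \<^bold>\<approx> w') (\<lambda>_. Fd) l' : Propd" if w: "G \<tturnstile> w : V"
    unfolding E by (rule beta_step[OF deq_case_b[OF L w] _ uP assms]) ((assumption
      | rule w typing rels ambient)+)
  show "G \<tturnstile> (lab_c w \<^bold>\<sim> l') \<equiv> lab_case 1 Propd Fd (\<lambda>_. Fd) (\<lambda>w'. w \<^bold>\<approx> w') l' : Propd" if w: "G \<tturnstile> w : V"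
    unfolding E by (rule beta_step[OF deq_case_c[OF L w] _ uP assms]) ((assumption
      | rule w typing rels ambient)+)
qed

text \<open>Both nested case distinctions compute once both labels are constructors. Distinctness of
  constructors thus takes the form of a conversion to \<open>Fd\<close>.\<close>

lemma lab_eqv_conv:
  assumes "G \<tturnstile> w : V"
  shows deq_eqv_ab: "G \<tturnstile> (lab_a \<^bold>\<sim> lab_b w) \<equiv> Fd : Propd"
    and deq_eqv_ac: "G \<tturnstile> (lab_a \<^bold>\<sim> lab_c w) \<equiv> Fd : Propd"
    and deq_eqv_bb: "G \<tturnstile> v : V \<Longrightarrow> G \<tturnstile> (lab_b v \<^bold>\<sim> lab_b w) \<equiv> (v \<^bold>\<approx> w) : Propd"
    and deq_eqv_bc: "G \<tturnstile> v : V \<Longrightarrow> G \<tturnstile> (lab_b v \<^bold>\<sim> lab_c w) \<equiv> Fd : Propd"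
    and deq_eqv_cb: "G \<tturnstile> v : V \<Longrightarrow> G \<tturnstile> (lab_c v \<^bold>\<sim> lab_b w) \<equiv> Fd : Propd"
    and deq_eqv_cc: "G \<tturnstile> v : V \<Longrightarrow> G \<tturnstile> (lab_c v \<^bold>\<sim> lab_c w) \<equiv> (v \<^bold>\<approx> w) : Propd"
proof -
  note b = typed_lab_b[OF assms] and c = typed_lab_c[OF assms]
  have F: "G \<tturnstile> (\<^bold>\<lambda>_ : V. Fd) : (\<^bold>\<forall>_ : V. Propd)" "uni (length G) (\<lambda>_. Fd)" by ((assumption
    | rule typing rels ambient)+)
  show "G \<tturnstile> (lab_a \<^bold>\<sim> lab_b w) \<equiv> Fd : Propd"
    by (rule deq_trans[OF deq_eqv_a[OF b] deq_case_b[OF typ_Prop typed_True F(1,1,2,2) assms]])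
  show "G \<tturnstile> (lab_a \<^bold>\<sim> lab_c w) \<equiv> Fd : Propd"
    by (rule deq_trans[OF deq_eqv_a[OF c] deq_case_c[OF typ_Prop typed_True F(1,1,2,2) assms]])
  assume v: "G \<tturnstile> v : V"
  have B: "G \<tturnstile> (\<^bold>\<lambda>w' : V. v \<^bold>\<approx> w') : (\<^bold>\<forall>_ : V. Propd)" "uni (length G) (\<lambda>w'. v \<^bold>\<approx> w')"
    by ((assumption | rule v typing rels ambient)+)
  note l = typ_Prop typed_False B(1) F(1) B(2) F(2) and l' = typ_Prop typed_False F(1) B(1) F(2) B(2)
  show "G \<tturnstile> (lab_b v \<^bold>\<sim> lab_b w) \<equiv> (v \<^bold>\<approx> w) : Propd" by (rule deq_trans[OF deq_eqv_b[OF b v] deq_case_b[OF l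
    assms]])
  show "G \<tturnstile> (lab_b v \<^bold>\<sim> lab_c w) \<equiv> Fd : Propd" by (rule deq_trans[OF deq_eqv_b[OF c v] deq_case_c[OF l assms]])
  show "G \<tturnstile> (lab_c v \<^bold>\<sim> lab_b w) \<equiv> Fd : Propd" by (rule deq_trans[OF deq_eqv_c[OF b v] deq_case_b[OF l' assms]])
  show "G \<tturnstile> (lab_c v \<^bold>\<sim> lab_c w) \<equiv> (v \<^bold>\<approx> w) : Propd" by (rule deq_trans[OF deq_eqv_c[OF c v] deq_case_c[OF l'
    assms]])
qed

lemma Label_cases:
  assumes "fam G Label P 0" "G \<tturnstile> l : Label" "G \<TTurnstile> P lab_a"
    "\<And>H w. G \<preceq> H \<Longrightarrow> H \<tturnstile> w : V \<Longrightarrow> H \<TTurnstile> P (lab_b w)" "\<And>H w. G \<preceq> H \<Longrightarrow> H \<tturnstile> w : V \<Longrightarrow> H \<TTurnstile> P (lab_c w)"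
  shows "G \<TTurnstile> P l"
proof -
  note U = rel_uni[OF fam_uni[OF assms(1)]]
  have "G \<TTurnstile> (\<^bold>\<forall>w : V. P (lab_b w))" "G \<TTurnstile> (\<^bold>\<forall>w : V. P (lab_c w))"
    by (rule allI1[OF typed_V _ assms(4)], ((assumption | rule typing rels U ambient)+))
      (rule allI1[OF typed_V _ assms(5)], ((assumption | rule typing rels U ambient)+))
  with assms(3) obtain ma mb mc where "G \<tturnstile> ma : P lab_a" "G \<tturnstile> mb : (\<^bold>\<forall>w : V. P (lab_b w))" "G \<tturnstile> mc : (\<^bold>\<forall>w : V. P
    (lab_c w))"
    by (auto simp: holds_def)
  from typed_app[OF typed_rec_Label[OF assms(1) this] assms(2) fam_uni[OF assms(1)]] show ?thesis
    by (rule holdsI)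
qed

text \<open>An available label is merely equivalent to some \<open>lab_b w\<close> or
  \<open>lab_c w\<close>, with \<open>w\<close> bisimilar to a child of the indexing set; these
  rules pass to the label of that child. Since the equivalence computes only on constructors, the
  proof distinguishes cases on \<open>l\<close> and refutes the mismatched ones.\<close>

lemma lab_eqv_trans:
  assumes "G \<tturnstile> l : Label" "G \<tturnstile> w : V" "G \<tturnstile> w' : V" "G \<TTurnstile> w \<^bold>\<approx> w'"
  shows lab_eqv_b: "G \<TTurnstile> l \<^bold>\<sim> lab_b w \<Longrightarrow> G \<TTurnstile> l \<^bold>\<sim> lab_b w'"
    and lab_eqv_c: "G \<TTurnstile> l \<^bold>\<sim> lab_c w \<Longrightarrow> G \<TTurnstile> l \<^bold>\<sim> lab_c w'"
proof -
  note T = assms(2,3)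
  { let ?P = "\<lambda>l. l \<^bold>\<sim> lab_b w \<^bold>\<rightarrow> l \<^bold>\<sim> lab_b w'"
    have "G \<TTurnstile> ?P l"
    proof (rule Label_cases[of _ ?P, OF _ assms(1)], rule famI, ((assumption | rule typing rels ambient)+)[1],
      ((assumption | rule T typing rels ambient)+)[1], ((assumption | rule T typing rels ambient)+)[1])
      show "G \<TTurnstile> ?P lab_a"
      proof (rule impI1)
        fix H assume H: "G \<preceq> H" "H \<TTurnstile> lab_a \<^bold>\<sim> lab_b w"
        note T = T[THEN lift_deq[OF H(1)]]
        show "H \<TTurnstile> lab_a \<^bold>\<sim> lab_b w'"
          by (rule FalseE0[OF holds_conv[OF H(2) deq_eqv_ab[OF T(1)]]]) ((assumption
            | rule T typing rels ambient)+)
      qed ((assumption | rule T typing rels ambient)+)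
    next
      fix H v assume H: "G \<preceq> H" "H \<tturnstile> v : V"
      note T1 = T[THEN lift_deq[OF H(1)]] H(2)
      show "H \<TTurnstile> ?P (lab_b v)"
      proof (rule impI1)
        fix K assume K: "H \<preceq> K" "K \<TTurnstile> lab_b v \<^bold>\<sim> lab_b w"
        note T2 = T1[THEN lift_deq[OF K(1)]]
        show "K \<TTurnstile> lab_b v \<^bold>\<sim> lab_b w'"
          by (rule holds_conv[OF _ deq_sym[OF deq_eqv_bb[OF T2(2,3)]]], rule bisim_trans[OF holds_conv[OF K(2)
            deq_eqv_bb[OF T2(1,3)]]
            lift_holds[OF ext_trans[OF H(1) K(1)] assms(4)] T2(3,1,2)])
      qed ((assumption | rule T1 typing rels ambient)+)
      show "H \<TTurnstile> ?P (lab_c v)"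
      proof (rule impI1)
        fix K assume K: "H \<preceq> K" "K \<TTurnstile> lab_c v \<^bold>\<sim> lab_b w"
        note T2 = T1[THEN lift_deq[OF K(1)]]
        show "K \<TTurnstile> lab_c v \<^bold>\<sim> lab_b w'"
          by (rule FalseE0[OF holds_conv[OF K(2) deq_eqv_cb[OF T2(1,3)]]]) ((assumption
            | rule T2 typing rels ambient)+)
      qed ((assumption | rule T1 typing rels ambient)+)
    qed
    then show "G \<TTurnstile> l \<^bold>\<sim> lab_b w \<Longrightarrow> G \<TTurnstile> l \<^bold>\<sim> lab_b w'" by (rule mp0) ((assumption | rule assms(1-3) typing rels
      ambient)+) }
  { let ?P = "\<lambda>l. l \<^bold>\<sim> lab_c w \<^bold>\<rightarrow> l \<^bold>\<sim> lab_c w'"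
    have "G \<TTurnstile> ?P l"
    proof (rule Label_cases[of _ ?P, OF _ assms(1)], rule famI, ((assumption | rule typing rels ambient)+)[1],
      ((assumption | rule T typing rels ambient)+)[1], ((assumption | rule T typing rels ambient)+)[1])
      show "G \<TTurnstile> ?P lab_a"
      proof (rule impI1)
        fix H assume H: "G \<preceq> H" "H \<TTurnstile> lab_a \<^bold>\<sim> lab_c w"
        note T = T[THEN lift_deq[OF H(1)]]
        show "H \<TTurnstile> lab_a \<^bold>\<sim> lab_c w'"
          by (rule FalseE0[OF holds_conv[OF H(2) deq_eqv_ac[OF T(1)]]]) ((assumption
            | rule T typing rels ambient)+)
      qed ((assumption | rule T typing rels ambient)+)
    next
      fix H v assume H: "G \<preceq> H" "H \<tturnstile> v : V"
      note T1 = T[THEN lift_deq[OF H(1)]] H(2)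
      show "H \<TTurnstile> ?P (lab_c v)"
      proof (rule impI1)
        fix K assume K: "H \<preceq> K" "K \<TTurnstile> lab_c v \<^bold>\<sim> lab_c w"
        note T2 = T1[THEN lift_deq[OF K(1)]]
        show "K \<TTurnstile> lab_c v \<^bold>\<sim> lab_c w'"
          by (rule holds_conv[OF _ deq_sym[OF deq_eqv_cc[OF T2(2,3)]]], rule bisim_trans[OF holds_conv[OF K(2)
            deq_eqv_cc[OF T2(1,3)]]
            lift_holds[OF ext_trans[OF H(1) K(1)] assms(4)] T2(3,1,2)])
      qed ((assumption | rule T1 typing rels ambient)+)
      show "H \<TTurnstile> ?P (lab_b v)"
      proof (rule impI1)
        fix K assume K: "H \<preceq> K" "K \<TTurnstile> lab_b v \<^bold>\<sim> lab_c w"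
        note T2 = T1[THEN lift_deq[OF K(1)]]
        show "K \<TTurnstile> lab_b v \<^bold>\<sim> lab_c w'"
          by (rule FalseE0[OF holds_conv[OF K(2) deq_eqv_bc[OF T2(1,3)]]]) ((assumption
            | rule T2 typing rels ambient)+)
      qed ((assumption | rule T1 typing rels ambient)+)
    qed
    then show "G \<TTurnstile> l \<^bold>\<sim> lab_c w \<Longrightarrow> G \<TTurnstile> l \<^bold>\<sim> lab_c w'" by (rule mp0) ((assumption | rule assms(1-3) typing rels
      ambient)+) }
qed

section \<open>Accessible paths\<close>

text \<open>The arguments of the constructor are the path, which is an index of the result, and proofs. So the
  recursor is available for motives in any sort.\<close>

definition Acc_decl :: "tm decl" where
  "Acc_decl = Decl [Pi (Path 0) (Sort 0)] [Path 1] 0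
     [Ctor [Path 1, (lvl 0 \<cdot> lvl 1) 2] [([Label 3, (lvl 0 \<cdot> (lvl 3 \<^bold># lvl 1)) 4], [(lvl 3 \<^bold># lvl 1) 5])] [lvl 1
       3]]"

text \<open>As for \<open>wf_Fam\<close>, the entries are typed with named variables and then
  translated. \<open>Acc_elim\<close> is kept because the rule \<open>ind_rec\<close> asks for this
  very typing before it allows elimination into large sorts.\<close>

lemma wf_Acc: "wf_decl Acc_decl"
  and Acc_elim: "[Path 1, Pi (Path 0) (Sort 0)] \<turnstile> (lvl 0 \<cdot> lvl 1) 2 : Sort 0"
proof -
  let ?E = "pid Path (\<lambda>_. Propd)"
  let ?G1 = "[?E]" let ?G2 = "Path # ?G1" let ?G3 = "lvl 0 \<cdot> lvl 1 # ?G2" let ?G4 = "Label # ?G3" let ?G5 =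
    "lvl 0 \<cdot> (lvl 3 \<^bold># lvl 1) # ?G4"
  have E: "[] \<tturnstile> ?E : Srt (imax 2 1)" by ((assumption | rule typing rels ambient)+)
  have 0: "?G1 \<tturnstile> lvl 0 : ?E" using typ_lvl[OF deq_st(1)[OF E]] by simp
  have P: "?G1 \<tturnstile> Path : Srt 2" by ((assumption | rule typing rels ambient)+)
  have 1: "?G2 \<tturnstile> lvl 1 : Path" using typ_lvl[OF deq_st(1)[OF P]] by simp
  have e: "?G2 \<tturnstile> lvl 0 \<cdot> lvl 1 : Propd" using 0 1 by - (rule typed_eqI, (assumption
    | rule typing rels ambient)+, rule refl)
  have L: "?G3 \<tturnstile> Label : Srt 2" by ((assumption | rule typing rels ambient)+)
  have 3: "?G4 \<tturnstile> lvl 3 : Label" using typ_lvl[OF deq_st(1)[OF L]] by (simp add: eval_nat_numeral)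
  have c: "?G4 \<tturnstile> lvl 3 \<^bold># lvl 1 : Path" using 1 3 by - ((assumption | rule typing rels ambient)+)
  have h: "?G4 \<tturnstile> lvl 0 \<cdot> (lvl 3 \<^bold># lvl 1) : Propd" using 0 c by - (rule typed_eqI, (assumption
    | rule typing rels ambient)+, rule refl)
  have o1: "ok ?G1" using ok_Cons[of "[]", OF _ E] by simp
  note o2 = ok_Cons[OF o1 P] note o3 = ok_Cons[OF o2 e] note o4 = ok_Cons[OF o3 L] note o5 = ok_Cons[OF o4 h]
  have cx: "cx ?G1 = [Pi (Path 0) (Sort 0)]"
    "cx ?G2 = [Path 1, Pi (Path 0) (Sort 0)]"
    "cx ?G3 = [(lvl 0 \<cdot> lvl 1) 2, Path 1, Pi (Path 0) (Sort 0)]"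
    "cx ?G4 = [Label 3, (lvl 0 \<cdot> lvl 1) 2, Path 1, Pi (Path 0) (Sort 0)]"
    "cx ?G5 = [(lvl 0 \<cdot> (lvl 3 \<^bold># lvl 1)) 4, Label 3, (lvl 0 \<cdot> lvl 1) 2, Path 1, Pi (Path 0) (Sort 0)]"
    by (simp_all add: pid_def closed_def eval_nat_numeral)
  have raw0: "[] \<turnstile> Pi (Path 0) (Sort 0) : Sort (imax 2 1)"
    using E by (simp add: deq_def pid_def closed_def Path_def Label_def appd_def)
  have raw1: "cx ?G1 \<turnstile> Path 1 : Sort 2" using P o1 by (simp add: deq_def closed_def)
  have raw2: "cx ?G2 \<turnstile> (lvl 0 \<cdot> lvl 1) 2 : Sort 0" using e o2 by (simp add: deq_def closed_def eval_nat_numeral)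
  have raw3: "cx ?G3 \<turnstile> Label 3 : Sort 2" using L o3 by (simp add: deq_def closed_def eval_nat_numeral)
  have raw4: "cx ?G4 \<turnstile> (lvl 0 \<cdot> (lvl 3 \<^bold># lvl 1)) 4 : Sort 0" using h o4 by (simp add: deq_def closed_def
    eval_nat_numeral)
  have P1: "Path m = Path 1" for m by (simp add: Path_def Label_def closed_def appd_def)
  have P2: "lift n k (Path m) = Path 1" for n k m by (simp add: Path_def Label_def closed_def appd_def)
  have raw5: "cx ?G5 \<turnstile> (lvl 3 \<^bold># lvl 1) 5 : Path 1"
    using weak[OF c] o5 P1[of 5] by (simp add: deq_def closed_def eval_nat_numeral)
  have raw6: "cx ?G3 \<turnstile> lvl 1 3 : Path 1"
    using weak[OF 1, of "lvl 0 \<cdot> lvl 1"] o3 P1[of 3] by (simp add: deq_def closed_def eval_nat_numeral)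
  note R = raw1[unfolded cx] raw2[unfolded cx] raw3[unfolded cx] raw4[unfolded cx] raw5[unfolded cx]
    raw6[unfolded cx]
  show "wf_decl Acc_decl"
    unfolding Acc_decl_def
    apply (intro wf_declI list_all_ConsI list_all_NilI wf_ctorI)
        apply (rule tele_cons[OF raw0], simp, rule tele_nil)
       apply (simp only: rev.simps append.simps)
       apply (rule tele_cons[OF R(1)], simp, rule tele_nil)
      apply (simp only: rev.simps append.simps)
      apply (rule tele_cons[OF R(1)], simp, rule tele_cons[OF R(2)], simp, rule tele_nil)
     apply (simp only: rev.simps append.simps prod.case)
     apply (rule conjI)
      apply (rule tele_cons[OF R(3)], simp, rule tele_cons[OF R(4)], simp, rule tele_nil)
     apply (simp add: P2 del: One_nat_def)
     apply (rule spine_cons[OF R(5)], simp add: spine_nil)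
    apply (simp add: P2 del: One_nat_def)
    apply (rule spine_cons[OF R(6)], simp add: spine_nil)
    done
  show "[Path 1, Pi (Path 0) (Sort 0)] \<turnstile> (lvl 0 \<cdot> lvl 1) 2 : Sort 0" by (rule R(2))
qed

abbreviation "Accd E p \<equiv> closed (Ind Acc_decl) \<cdot> E \<cdot> p"
abbreviation "mkA E p e k \<equiv> closed (Con Acc_decl 0) \<cdot> E \<cdot> p \<cdot> e \<cdot> k"

lemma typed_Acc [typing]:
  "G \<tturnstile> closed (Ind Acc_decl) : (\<^bold>\<forall>E : (\<^bold>\<forall>_ : Path. Propd). \<^bold>\<forall>p : Path. Propd)"
  "G \<tturnstile> closed (Con Acc_decl 0) : (\<^bold>\<forall>E : (\<^bold>\<forall>_ : Path. Propd). \<^bold>\<forall>p : Path. \<^bold>\<forall>e : E \<cdot> p.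
     \<^bold>\<forall>k : (\<^bold>\<forall>l : Label. \<^bold>\<forall>h : E \<cdot> (l \<^bold># p). Accd E (l \<^bold># p)). Accd E p)"
  "G \<tturnstile> closed (Rec Acc_decl u) : (\<^bold>\<forall>E : (\<^bold>\<forall>_ : Path. Propd). \<^bold>\<forall>C : (\<^bold>\<forall>p : Path. \<^bold>\<forall>x : Accd E p. Srt u).
     \<^bold>\<forall>m : (\<^bold>\<forall>p : Path. \<^bold>\<forall>e : E \<cdot> p. \<^bold>\<forall>k : (\<^bold>\<forall>l : Label. \<^bold>\<forall>h : E \<cdot> (l \<^bold># p). Accd E (l \<^bold># p)).
       \<^bold>\<forall>ih : (\<^bold>\<forall>l : Label. \<^bold>\<forall>h : E \<cdot> (l \<^bold># p). C \<cdot> (l \<^bold># p) \<cdot> (k \<cdot> l \<cdot> h)). C \<cdot> p \<cdot> mkA E p e k).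
     \<^bold>\<forall>p : Path. \<^bold>\<forall>x : Accd E p. C \<cdot> p \<cdot> x)"
  subgoal by (rule typed_Ind[OF wf_Acc]; simp add: raw types Acc_decl_def V_def Path_def Label_def cons_def
    eval_nat_numeral)
  subgoal by (rule typed_Con[OF wf_Acc]; simp add: raw types Acc_decl_def V_def Path_def Label_def cons_def
    eval_nat_numeral)
  subgoal
    apply (rule typed_Rec[OF wf_Acc])
    subgoal
      \<comment> \<open>Argument 0, the path, reappears as the index of the result; argument 1 is a
        proof by \<open>Acc_elim\<close>.\<close>
      using Acc_elim
      by (intro disjI2, simp add: Acc_decl_def less_Suc_eq all_conj_distrib lvl_def eval_nat_numeral)
     by (simp_all add: raw types Acc_decl_def V_def Path_def Label_def cons_def eval_nat_numeral)
  done

section \<open>Recursion and induction on accessible paths\<close>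

lemma st_at_2: "st n t \<Longrightarrow> t (Suc (Suc n)) = lift 2 0 (t n)"
  unfolding st_def by (metis add_2_eq_Suc)

text \<open>As for sets, the conversion between the abstracted motive \<open>C\<close> and the
  metalevel \<open>P\<close> is done once. The typing of \<open>P\<close> is assumed over all
  extensions, the form in which the nested binders of the minor premise use it.\<close>

lemma
  fixes E m u P
  defines "C \<equiv> \<^bold>\<lambda>p : Path. \<^bold>\<lambda>x : Accd E p. P p x"
  defines "R \<equiv> closed (Rec Acc_decl u) \<cdot> E \<cdot> C \<cdot> m"
  assumes tE: "G \<tturnstile> E : (\<^bold>\<forall>_ : Path. Propd)" and U2: "uni2 (length G) P"
    and P: "\<And>H p x. G \<preceq> H \<Longrightarrow> H \<tturnstile> p : Path \<Longrightarrow> H \<tturnstile> x : Accd E p \<Longrightarrow> H \<tturnstile> P p x : Srt u"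
    and m: "G \<tturnstile> m : (\<^bold>\<forall>p : Path. \<^bold>\<forall>e : E \<cdot> p. \<^bold>\<forall>k : (\<^bold>\<forall>l : Label. \<^bold>\<forall>h : E \<cdot> (l \<^bold># p). Accd E (l \<^bold># p)).
       \<^bold>\<forall>ih : (\<^bold>\<forall>l : Label. \<^bold>\<forall>h : E \<cdot> (l \<^bold># p). P (l \<^bold># p) (k \<cdot> l \<cdot> h)). P p (mkA E p e k))"
  shows typed_rec_Acc: "G \<tturnstile> R : (\<^bold>\<forall>p : Path. \<^bold>\<forall>x : Accd E p. P p x)"
    and deq_rec_Acc: "G \<tturnstile> p : Path \<Longrightarrow> G \<tturnstile> e : E \<cdot> p \<Longrightarrow> G \<tturnstile> k : (\<^bold>\<forall>l : Label. \<^bold>\<forall>h : E \<cdot> (l \<^bold># p). Accd E (l \<^bold># p)) \<Longrightarrow>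
      G \<tturnstile> R \<cdot> p \<cdot> mkA E p e k \<equiv> m \<cdot> p \<cdot> e \<cdot> k \<cdot> (\<^bold>\<lambda>l : Label. \<^bold>\<lambda>h : E \<cdot> (l \<^bold># p). R \<cdot> (l \<^bold># p) \<cdot> (k \<cdot> l \<cdot> h)) : P p
        (mkA E p e k)"
proof -
  note U = rel_uni2[OF U2]
  let ?n = "length G"
  have Ep: "H \<tturnstile> E \<cdot> p : Propd" if "G \<preceq> H" "H \<tturnstile> p : Path" for H p
    by (rule typed_eqI, (assumption | rule tE that typing uniI rels | (erule rel_mono, simp; fail)
      | rule rel_amb | (rule lift_deq lift_fam good_ext, (assumption | rule tE that)) | erule good_tls
      | rule weak fam_weak)+, rule refl)
  have Ac: "H \<tturnstile> Accd E p : Propd" if "G \<preceq> H" "H \<tturnstile> p : Path" for H p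
    by (rule typed_eqI, (assumption | rule tE that typing uniI rels | (erule rel_mono, simp; fail)
      | rule rel_amb | (rule lift_deq lift_fam good_ext, (assumption | rule tE that)) | erule good_tls
      | rule weak fam_weak)+, rule refl)
  have kt: "H \<tturnstile> (\<^bold>\<forall>l : Label. \<^bold>\<forall>h : E \<cdot> (l \<^bold># p). Accd E (l \<^bold># p)) : Propd" if "G \<preceq> H" "H \<tturnstile> p : Path" for H p
    by ((assumption | rule Ep[OF ext_trans[OF that(1) ext_Cons(1)]] Ac[OF ext_trans[OF that(1) ext_Cons(2)]]
      that tE typing uniI rels | (erule rel_mono, simp; fail) | rule rel_amb | (rule lift_deq lift_fam good_ext,
      (assumption | rule Ep[OF ext_trans[OF that(1) ext_Cons(1)]] Ac[OF ext_trans[OF that(1) ext_Cons(2)]] that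
      tE)) | erule good_tls | rule weak fam_weak)+)
  have klh: "H \<tturnstile> k \<cdot> l \<cdot> h : Accd E (l \<^bold># p)"
    if "H \<tturnstile> k : (\<^bold>\<forall>l : Label. \<^bold>\<forall>h : E \<cdot> (l \<^bold># p). Accd E (l \<^bold># p))" "H \<tturnstile> l : Label" "H \<tturnstile> h : E \<cdot> (l \<^bold># p)" "G \<preceq> H"
      "H \<tturnstile> p : Path" for H k l h p
    by (rule typed_eqI, (assumption | rule that tE typing uniI rels | (erule rel_mono, simp; fail)
      | rule rel_amb | (rule lift_deq lift_fam good_ext, (assumption | rule that tE)) | erule good_tls
      | rule weak fam_weak)+, rule refl)
  have mk: "H \<tturnstile> mkA E p e k : Accd E p"
    if "H \<tturnstile> e : E \<cdot> p" "H \<tturnstile> k : (\<^bold>\<forall>l : Label. \<^bold>\<forall>h : E \<cdot> (l \<^bold># p). Accd E (l \<^bold># p))" "H \<tturnstile> p : Path" "G \<preceq> H"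
      for H k e p
    by (rule typed_eqI, (assumption | rule that tE typing uniI rels | (erule rel_mono, simp; fail)
      | rule rel_amb | (rule lift_deq lift_fam good_ext, (assumption | rule that tE)) | erule good_tls
      | rule weak fam_weak)+, rule refl)
  have C: "G \<tturnstile> C : (\<^bold>\<forall>p : Path. \<^bold>\<forall>x : Accd E p. Srt u)"
    unfolding C_def by ((assumption | rule P Ac tE ext_Cons typing uniI rels | (erule rel_mono, simp; fail)
      | rule U rel_amb | (rule lift_deq lift_fam good_ext, (assumption | rule P Ac tE ext_Cons))
      | erule good_tls | rule weak fam_weak)+)
  have cC: "H \<tturnstile> C \<cdot> p \<cdot> x \<equiv> P p x : Srt u" if "G \<preceq> H" "H \<tturnstile> p : Path" "H \<tturnstile> x : Accd E p" for H p x
    unfolding C_def by (rule beta_step[OF deq_beta[OF lift_deq[OF that(1) C[unfolded C_def]]]])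
      ((assumption | rule that tE typing uniI rels | (erule rel_mono, simp; fail) | rule U rel_amb
        | (rule lift_deq lift_fam good_ext, (assumption | rule that tE)) | erule good_tls
        | rule weak fam_weak)+)
  have "G \<tturnstile> m : (\<^bold>\<forall>p : Path. \<^bold>\<forall>e : E \<cdot> p. \<^bold>\<forall>k : (\<^bold>\<forall>l : Label. \<^bold>\<forall>h : E \<cdot> (l \<^bold># p). Accd E (l \<^bold># p)).
       \<^bold>\<forall>ih : (\<^bold>\<forall>l : Label. \<^bold>\<forall>h : E \<cdot> (l \<^bold># p). C \<cdot> (l \<^bold># p) \<cdot> (k \<cdot> l \<cdot> h)). C \<cdot> p \<cdot> mkA E p e k)"
    apply (rule deq_conv[OF m])
    apply (rule deq_pi, ((assumption | rule typing rels ambient | erule good_tls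
      | rule lift_deq lift_fam good_ext, (assumption))+)[1])
      apply (rule deq_pi, ((assumption | rule Ep ext_Cons typing rels ambient | erule good_tls
        | rule lift_deq lift_fam good_ext, (assumption | rule Ep ext_Cons))+)[1])
        apply (rule deq_pi, ((assumption | rule kt ext_Cons typing rels ambient | erule good_tls
          | rule lift_deq lift_fam good_ext, (assumption | rule kt ext_Cons))+)[1])
          apply (rule deq_pi)
             apply (rule deq_pi, ((assumption | rule typing rels ambient | erule good_tls
               | rule lift_deq lift_fam good_ext, (assumption))+)[1])
               apply (rule deq_pi, ((assumption | rule Ep ext_Cons typing rels ambient | erule good_tls
                 | rule lift_deq lift_fam good_ext, (assumption | rule Ep ext_Cons))+)[1])
                 apply (rule deq_sym, rule cC, rule ext_Cons, ((assumption | rule typing rels ambient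
                   | erule good_tls | rule lift_deq lift_fam good_ext, (assumption))+)[1])
                 apply (rule klh, ((assumption | rule typing rels ambient | erule good_tls
                   | rule lift_deq lift_fam good_ext, (assumption))+)[1], ((assumption
                   | rule typing rels ambient | erule good_tls | rule lift_deq lift_fam good_ext,
                   (assumption))+)[1], ((assumption | rule typing rels ambient | erule good_tls
                   | rule lift_deq lift_fam good_ext, (assumption))+)[1], rule ext_Cons, ((assumption
                   | rule typing rels ambient | erule good_tls | rule lift_deq lift_fam good_ext,
                   (assumption))+)[1])
                apply ((assumption | rule tE C typing rels U ambient | erule good_tls
                  | rule lift_deq lift_fam good_ext, (assumption | rule tE C))+)[4]
            apply (rule deq_sym, rule cC, rule ext_Cons, ((assumption | rule typing uniI rels
              | (erule rel_mono, simp; fail) | rule rel_amb | (rule lift_deq lift_fam good_ext, assumption)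
              | erule good_tls | rule weak fam_weak)+)[1])
            apply (rule mk, ((assumption | rule typing rels ambient | erule good_tls
              | rule lift_deq lift_fam good_ext, (assumption))+)[1], ((assumption | rule typing rels ambient
              | erule good_tls | rule lift_deq lift_fam good_ext, (assumption))+)[1], ((assumption
              | rule typing rels ambient | erule good_tls | rule lift_deq lift_fam good_ext, (assumption))+)[1],
              rule ext_Cons)
           apply ((assumption | rule tE C typing rels U ambient | erule good_tls
             | rule lift_deq lift_fam good_ext, (assumption | rule tE C))+)
    done
  note m' = this
  have R': "G \<tturnstile> R : (\<^bold>\<forall>p : Path. \<^bold>\<forall>x : Accd E p. C \<cdot> p \<cdot> x)"
    unfolding R_def by (rule typed_eqI, (assumption | rule tE C m' typing rels ambient | erule good_tls
      | rule lift_deq lift_fam good_ext, (assumption | rule tE C m'))+, rule refl)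
  show tR: "G \<tturnstile> R : (\<^bold>\<forall>p : Path. \<^bold>\<forall>x : Accd E p. P p x)"
    apply (rule deq_conv[OF R'])
    apply (rule deq_pi, ((assumption | rule typing uniI rels | (erule rel_mono, simp; fail) | rule rel_amb
      | (rule lift_deq lift_fam good_ext, assumption) | erule good_tls | rule weak fam_weak)+)[1])
      apply (rule deq_pi, ((assumption | rule Ac ext_Cons typing uniI rels | (erule rel_mono, simp; fail)
        | rule rel_amb | (rule lift_deq lift_fam good_ext, (assumption | rule Ac ext_Cons)) | erule good_tls
        | rule weak fam_weak)+)[1])
        apply (rule cC, rule ext_Cons, ((assumption | rule typing uniI rels | (erule rel_mono, simp; fail)
          | rule rel_amb | (rule lift_deq lift_fam good_ext, assumption) | erule good_tls
          | rule weak fam_weak)+)[1])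
        apply ((assumption | rule tE C typing uniI rels | (erule rel_mono, simp; fail) | rule U rel_amb
          | (rule lift_deq lift_fam good_ext, (assumption | rule tE C)) | erule good_tls | rule weak fam_weak)+)
    done
  have Rpx: "H \<tturnstile> R \<cdot> p \<cdot> x : P p x" if "G \<preceq> H" "H \<tturnstile> p : Path" "H \<tturnstile> x : Accd E p" for H p x
    by (rule typed_eqI, (assumption | rule tR that tE typing uniI rels | (erule rel_mono, simp; fail)
      | rule U rel_amb | (rule lift_deq lift_fam good_ext, (assumption | rule tR that tE)) | erule good_tls
      | rule weak fam_weak)+, rule refl)
  assume a: "G \<tturnstile> p : Path" "G \<tturnstile> e : E \<cdot> p" "G \<tturnstile> k : (\<^bold>\<forall>l : Label. \<^bold>\<forall>h : E \<cdot> (l \<^bold># p). Accd E (l \<^bold># p))"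
  have l: "G \<tturnstile> R \<cdot> p \<cdot> mkA E p e k : P p (mkA E p e k)"
    by (rule Rpx[OF ext_refl a(1) mk[OF a(2,3,1) ext_refl]])
  let ?ih = "\<^bold>\<lambda>l : Label. \<^bold>\<lambda>h : E \<cdot> (l \<^bold># p). R \<cdot> (l \<^bold># p) \<cdot> (k \<cdot> l \<cdot> h)"
  have ih: "G \<tturnstile> ?ih : (\<^bold>\<forall>l : Label. \<^bold>\<forall>h : E \<cdot> (l \<^bold># p). P (l \<^bold># p) (k \<cdot> l \<cdot> h))"
    by ((assumption | rule Ep Rpx klh ext_Cons a tE typing rels tR U ambient | erule good_tls
      | rule lift_deq lift_fam good_ext, (assumption | rule Ep Rpx klh ext_Cons a tE))+)
  have c: "st ?n C" "st ?n m" "st ?n E" "st ?n p" "st ?n e" "st ?n k"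
    using C m tE a by (auto dest: deq_st)
  have "cx G \<turnstile> (R \<cdot> p \<cdot> mkA E p e k) ?n \<equiv> (m \<cdot> p \<cdot> e \<cdot> k \<cdot> ?ih) ?n : P p (mkA E p e k) ?n" if "ok G"
    \<comment> \<open>In the contractum the recursive call stands below the binders for the label
      and for the proof that the child lies in \<open>E\<close>, hence the shifts by one and by
      two.\<close>
    using iota[of 0 Acc_decl "[E ?n]" "[E ?n]" "[m ?n]" "[p ?n]" "[p ?n, e ?n]" "[k ?n]" "cx G" u "C ?n"
      "P p (mkA E p e k) ?n"] l that c[THEN st_at_Suc] c[THEN st_at_2]
    unfolding R_def
    by (simp add: Acc_decl_def iota_def deq_def appd_def closed_def vars_def lamd_def Path_def Label_def
      cons_def lvl_def eval_nat_numeral del: lvl_Suc)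
  then show "G \<tturnstile> R \<cdot> p \<cdot> mkA E p e k \<equiv> m \<cdot> p \<cdot> e \<cdot> k \<cdot> ?ih : P p (mkA E p e k)"
    using deq_st[OF l] c deq_st[OF ih] by (simp add: deq_def)
qed

text \<open>The case of a motive in \<open>Propd\<close>, with the induction hypothesis available in
  every extension. The motive may depend on the accessibility proof, because the values to be
  compared contain that proof.\<close>

lemma Acc_ind:
  assumes tE: "G \<tturnstile> E : (\<^bold>\<forall>_ : Path. Propd)" and U2: "uni2 (length G) P"
    and P: "\<And>H p x. G \<preceq> H \<Longrightarrow> H \<tturnstile> p : Path \<Longrightarrow> H \<tturnstile> x : Accd E p \<Longrightarrow> H \<tturnstile> P p x : Propd"
    and p: "G \<tturnstile> p : Path" "G \<tturnstile> x : Accd E p"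
    and step: "\<And>H p e k. G \<preceq> H \<Longrightarrow> H \<tturnstile> p : Path \<Longrightarrow> H \<tturnstile> e : E \<cdot> p \<Longrightarrow>
      H \<tturnstile> k : (\<^bold>\<forall>l : Label. \<^bold>\<forall>h : E \<cdot> (l \<^bold># p). Accd E (l \<^bold># p)) \<Longrightarrow>
      (\<And>H' l h. H \<preceq> H' \<Longrightarrow> H' \<tturnstile> l : Label \<Longrightarrow> H' \<tturnstile> h : E \<cdot> (l \<^bold># p) \<Longrightarrow> H' \<TTurnstile> P (l \<^bold># p) (k \<cdot> l \<cdot> h)) \<Longrightarrow>
      H \<TTurnstile> P p (mkA E p e k)"
  shows "G \<TTurnstile> P p x"
proof -
  note U = rel_uni2[OF U2]
  have Ep: "H \<tturnstile> E \<cdot> p : Propd" if "G \<preceq> H" "H \<tturnstile> p : Path" for H p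
    by (rule typed_eqI, (assumption | rule tE that typing rels ambient | erule good_tls
      | rule lift_deq lift_fam good_ext, (assumption | rule tE that))+, rule refl)
  have Ac: "H \<tturnstile> Accd E p : Propd" if "G \<preceq> H" "H \<tturnstile> p : Path" for H p
    by (rule typed_eqI, (assumption | rule tE that typing rels ambient | erule good_tls
      | rule lift_deq lift_fam good_ext, (assumption | rule tE that))+, rule refl)
  have kt: "H \<tturnstile> (\<^bold>\<forall>l : Label. \<^bold>\<forall>h : E \<cdot> (l \<^bold># p). Accd E (l \<^bold># p)) : Propd" if "G \<preceq> H" "H \<tturnstile> p : Path" for H p
    by ((assumption | rule Ep[OF ext_trans[OF that(1) ext_Cons(1)]] Ac[OF ext_trans[OF that(1) ext_Cons(2)]]
      that tE typing rels ambient | erule good_tls | rule lift_deq lift_fam good_ext, (assumption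
      | rule Ep[OF ext_trans[OF that(1) ext_Cons(1)]] Ac[OF ext_trans[OF that(1) ext_Cons(2)]] that tE))+)
  have klh: "H \<tturnstile> k \<cdot> l \<cdot> h : Accd E (l \<^bold># p)"
    if "H \<tturnstile> k : (\<^bold>\<forall>l : Label. \<^bold>\<forall>h : E \<cdot> (l \<^bold># p). Accd E (l \<^bold># p))" "H \<tturnstile> l : Label" "H \<tturnstile> h : E \<cdot> (l \<^bold># p)" "G \<preceq> H"
      "H \<tturnstile> p : Path" for H k l h p
    by (rule typed_eqI, (assumption | rule that tE typing rels ambient | erule good_tls
      | rule lift_deq lift_fam good_ext, (assumption | rule that tE))+, rule refl)
  have "G \<TTurnstile> (\<^bold>\<forall>p : Path. \<^bold>\<forall>e : E \<cdot> p. \<^bold>\<forall>k : (\<^bold>\<forall>l : Label. \<^bold>\<forall>h : E \<cdot> (l \<^bold># p). Accd E (l \<^bold># p)).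
       \<^bold>\<forall>ih : (\<^bold>\<forall>l : Label. \<^bold>\<forall>h : E \<cdot> (l \<^bold># p). P (l \<^bold># p) (k \<cdot> l \<cdot> h)). P p (mkA E p e k))"
  proof (rule allI1, ((assumption | rule typing rels ambient)+)[1], ((assumption
    | rule tE typing rels U ambient)+)[1])
    fix H1 p assume 1: "G \<preceq> H1" "H1 \<tturnstile> p : Path"
    note T1 = 1(2) lift_deq[OF 1(1) tE] and U1 = rel_uni2[OF lift_uni2[OF 1(1) U2]]
    show "H1 \<TTurnstile> (\<^bold>\<forall>e : E \<cdot> p. \<^bold>\<forall>k : (\<^bold>\<forall>l : Label. \<^bold>\<forall>h : E \<cdot> (l \<^bold># p). Accd E (l \<^bold># p)).
       \<^bold>\<forall>ih : (\<^bold>\<forall>l : Label. \<^bold>\<forall>h : E \<cdot> (l \<^bold># p). P (l \<^bold># p) (k \<cdot> l \<cdot> h)). P p (mkA E p e k))"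
    proof (rule allI1, rule Ep[OF 1], ((assumption | rule T1 typing rels U1 ambient)+)[1])
      fix H2 e assume 2: "H1 \<preceq> H2" "H2 \<tturnstile> e : E \<cdot> p"
      note T2 = T1[THEN lift_deq[OF 2(1)]] 2(2) and G2 = ext_trans[OF 1(1) 2(1)]
      note U2' = rel_uni2[OF lift_uni2[OF G2 U2]]
      show "H2 \<TTurnstile> (\<^bold>\<forall>k : (\<^bold>\<forall>l : Label. \<^bold>\<forall>h : E \<cdot> (l \<^bold># p). Accd E (l \<^bold># p)).
       \<^bold>\<forall>ih : (\<^bold>\<forall>l : Label. \<^bold>\<forall>h : E \<cdot> (l \<^bold># p). P (l \<^bold># p) (k \<cdot> l \<cdot> h)). P p (mkA E p e k))"
      proof (rule allI1, rule kt[OF G2 T2(1)], ((assumption | rule T2 typing rels U2' ambient)+)[1])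
        fix H3 k assume 3: "H2 \<preceq> H3" "H3 \<tturnstile> k : (\<^bold>\<forall>l : Label. \<^bold>\<forall>h : E \<cdot> (l \<^bold># p). Accd E (l \<^bold># p))"
        note T3 = T2[THEN lift_deq[OF 3(1)]] 3(2) and G3 = ext_trans[OF G2 3(1)]
        note U3 = rel_uni2[OF lift_uni2[OF G3 U2]]
        show "H3 \<TTurnstile> (\<^bold>\<forall>ih : (\<^bold>\<forall>l : Label. \<^bold>\<forall>h : E \<cdot> (l \<^bold># p). P (l \<^bold># p) (k \<cdot> l \<cdot> h)). P p (mkA E p e k))"
        proof (rule allI1)
          show "H3 \<tturnstile> (\<^bold>\<forall>l : Label. \<^bold>\<forall>h : E \<cdot> (l \<^bold># p). P (l \<^bold># p) (k \<cdot> l \<cdot> h)) : Propd"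
            by (rule typed_all, ((assumption | rule typing rels ambient | erule good_tls
              | rule lift_deq lift_fam good_ext, (assumption))+)[1], rule typed_all, ((assumption
              | rule Ep[OF ext_trans[OF G3 ext_Cons(1)]] T3 typing rels ambient | erule good_tls
              | rule lift_deq lift_fam good_ext, (assumption | rule Ep[OF ext_trans[OF G3 ext_Cons(1)]]
              T3))+)[1],
              rule P[OF ext_trans[OF G3 ext_Cons(2)]], ((assumption | rule T3 typing rels ambient)+)[1],
                rule klh,
              ((assumption | rule T3 typing rels ambient | erule good_tls | rule lift_deq lift_fam good_ext,
                (assumption | rule T3))+)[3], rule ext_trans[OF G3 ext_Cons(2)], ((assumption
                | rule T3 typing rels U3 ambient | erule good_tls | rule lift_deq lift_fam good_ext, (assumption
                | rule T3))+))
          show "uni (length H3) (\<lambda>_. P p (mkA E p e k))" by ((assumption | rule T3 typing rels U3 ambient)+)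
          fix H4 ih assume 4: "H3 \<preceq> H4" "H4 \<tturnstile> ih : (\<^bold>\<forall>l : Label. \<^bold>\<forall>h : E \<cdot> (l \<^bold># p). P (l \<^bold># p) (k \<cdot> l \<cdot> h))"
          note T4 = T3[THEN lift_deq[OF 4(1)]] 4(2) and G4 = ext_trans[OF G3 4(1)]
          show "H4 \<TTurnstile> P p (mkA E p e k)"
          proof (rule step[OF G4 T4(1,3,4)])
            fix H' l h assume 5: "H4 \<preceq> H'" "H' \<tturnstile> l : Label" "H' \<tturnstile> h : E \<cdot> (l \<^bold># p)"
            note T5 = T4[THEN lift_deq[OF 5(1)]] and U5 = rel_uni2[OF lift_uni2[OF ext_trans[OF G4 5(1)] U2]]
            have "H' \<tturnstile> ih \<cdot> l \<cdot> h : P (l \<^bold># p) (k \<cdot> l \<cdot> h)"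
              by (rule typed_eqI, (assumption | rule T5 5(2,3) typing rels U5 ambient)+, rule refl)
            then show "H' \<TTurnstile> P (l \<^bold># p) (k \<cdot> l \<cdot> h)" by (rule holdsI)
          qed
        qed
      qed
    qed
  qed
  then obtain m where "G \<tturnstile> m : (\<^bold>\<forall>p : Path. \<^bold>\<forall>e : E \<cdot> p. \<^bold>\<forall>k : (\<^bold>\<forall>l : Label. \<^bold>\<forall>h : E \<cdot> (l \<^bold># p). Accd E (l \<^bold># p)).
       \<^bold>\<forall>ih : (\<^bold>\<forall>l : Label. \<^bold>\<forall>h : E \<cdot> (l \<^bold># p). P (l \<^bold># p) (k \<cdot> l \<cdot> h)). P p (mkA E p e k))"
    by (auto simp: holds_def)
  from typed_rec_Acc[OF tE U2 P this] have R: "G \<tturnstile> closed (Rec Acc_decl 0) \<cdot> E \<cdot> (\<^bold>\<lambda>p : Path. \<^bold>\<lambda>x : Accd E p. P p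
    x) \<cdot> m : (\<^bold>\<forall>p : Path. \<^bold>\<forall>x : Accd E p. P p x)" .
  have "G \<tturnstile> closed (Rec Acc_decl 0) \<cdot> E \<cdot> (\<^bold>\<lambda>p : Path. \<^bold>\<lambda>x : Accd E p. P p x) \<cdot> m \<cdot> p \<cdot> x : P p x"
    by (rule typed_eqI, (assumption | rule R p tE typing rels U ambient)+, rule refl)
  then show ?thesis by (rule holdsI)
qed

section \<open>Values of accessible paths\<close>

text \<open>Here \<open>ih\<close> gives the values of the children, \<open>fstv\<close> is the first value, and \<open>piece\<close> is the contribution
  of the labels \<open>lab k\<close> for \<open>k : K\<close>.\<close>

abbreviation "succd t \<equiv> t \<^bold>\<union> singleton t"
definition "fstv E p ih = UniF (closed (Ind Unit_decl)) (\<lambda>_. E \<cdot> (lab_a \<^bold># p)) (\<lambda>_ h. ih \<cdot> lab_a \<cdot> h)"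
definition "piece K lab E p ih = UniF K (\<lambda>k. E \<cdot> (lab k \<^bold># p)) (\<lambda>k h. succd (ih \<cdot> lab k \<cdot> h))"
definition "body D s E p ih = piece (closed (Ind Unit_decl)) (\<lambda>_. lab_a) E p ih \<^bold>\<union>
   (piece (bar (D \<cdot> fstv E p ih)) (\<lambda>j. lab_b (child (D \<cdot> fstv E p ih) j)) E p ih \<^bold>\<union>
    piece (bar s) (\<lambda>i. lab_c (child s i)) E p ih)"
definition "val D s E = closed (Rec Acc_decl 2) \<cdot> E \<cdot> (\<^bold>\<lambda>p : Path. \<^bold>\<lambda>x : Accd E p. V) \<cdot>
   (\<^bold>\<lambda>p : Path. \<^bold>\<lambda>e : E \<cdot> p. \<^bold>\<lambda>k : (\<^bold>\<forall>l : Label. \<^bold>\<forall>h : E \<cdot> (l \<^bold># p). Accd E (l \<^bold># p)).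
      \<^bold>\<lambda>ih : (\<^bold>\<forall>l : Label. \<^bold>\<forall>h : E \<cdot> (l \<^bold># p). V). body D s E p ih)"

lemma rel_fstv [rels]: "rel \<theta> k E E' \<Longrightarrow> rel \<theta> k p p' \<Longrightarrow> rel \<theta> k ih ih' \<Longrightarrow> rel \<theta> k (fstv E p ih) (fstv E' p' ih')"
  unfolding fstv_def by (assumption | rule rels rel_shift)+
lemma rel_piece [rels]: "rel \<theta> k K K' \<Longrightarrow> (\<And>d x x'. rel \<theta> (Suc (k + d)) x x' \<Longrightarrow> rel \<theta> (Suc (k + d)) (lab x)
  (lab' x')) \<Longrightarrow>
  rel \<theta> k E E' \<Longrightarrow> rel \<theta> k p p' \<Longrightarrow> rel \<theta> k ih ih' \<Longrightarrow> rel \<theta> k (piece K lab E p ih) (piece K' lab' E' p' ih')"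
  unfolding piece_def by (assumption | rule rels rel_shift)+
lemma rel_body [rels]: "rel \<theta> k D D' \<Longrightarrow> rel \<theta> k s s' \<Longrightarrow>
  rel \<theta> k E E' \<Longrightarrow> rel \<theta> k p p' \<Longrightarrow> rel \<theta> k ih ih' \<Longrightarrow> rel \<theta> k (body D s E p ih) (body D' s' E' p' ih')"
  unfolding body_def by (assumption | rule rels rel_shift)+
lemma rel_val [rels]: "rel \<theta> k D D' \<Longrightarrow> rel \<theta> k s s' \<Longrightarrow> rel \<theta> k E E' \<Longrightarrow> rel \<theta> k (val D s E) (val D' s' E')"
  unfolding val_def by (assumption | rule rels rel_shift)+

text \<open>These are the side conditions of the rules for \<open>UniF\<close>, shared by the first
  value and by the three pieces of \<open>body\<close>.\<close>

lemma UniF_pre: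
  assumes "G \<tturnstile> E : (\<^bold>\<forall>_ : Path. Propd)" "G \<tturnstile> p : Path" "G \<tturnstile> ih : (\<^bold>\<forall>l : Label. \<^bold>\<forall>h : E \<cdot> (l \<^bold># p). V)"
    "G \<tturnstile> K : Type0"
    "\<And>H k. G \<preceq> H \<Longrightarrow> H \<tturnstile> k : K \<Longrightarrow> H \<tturnstile> lab k : Label" "uni (length G) lab"
  shows fam_pre: "fam G K (\<lambda>k. E \<cdot> (lab k \<^bold># p)) 0"
    and uni2_pre: "uni2 (length G) (\<lambda>k h. ih \<cdot> lab k \<cdot> h)" "uni2 (length G) (\<lambda>k h. succd (ih \<cdot> lab k \<cdot> h))"
    and ih_pre: "\<And>H k h. G \<preceq> H \<Longrightarrow> H \<tturnstile> k : K \<Longrightarrow> H \<tturnstile> h : E \<cdot> (lab k \<^bold># p) \<Longrightarrow> H \<tturnstile> ih \<cdot> lab k \<cdot> h : V"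
proof -
  note U = rel_uni[OF assms(6)]
  have Ep: "H \<tturnstile> E \<cdot> q : Propd" if "G \<preceq> H" "H \<tturnstile> q : Path" for H q
    by (rule typed_eqI, (assumption | rule assms(1) that typing rels ambient | erule good_tls
      | rule lift_deq lift_fam good_ext, (assumption | rule assms(1) that))+, rule refl)
  show "fam G K (\<lambda>k. E \<cdot> (lab k \<^bold># p)) 0"
    by (rule famI[OF assms(4)]) ((assumption | rule Ep assms(1,2,5) ext_Cons typing rels U ambient)+)
  show "uni2 (length G) (\<lambda>k h. ih \<cdot> lab k \<cdot> h)" "uni2 (length G) (\<lambda>k h. succd (ih \<cdot> lab k \<cdot> h))"
    by (rule uni2I, ((assumption | rule assms(3) typing rels U ambient)+))+
  show "H \<tturnstile> ih \<cdot> lab k \<cdot> h : V" if "G \<preceq> H" "H \<tturnstile> k : K" "H \<tturnstile> h : E \<cdot> (lab k \<^bold># p)" for H k h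
  proof -
    note T = assms(1-3)[THEN lift_deq[OF that(1)]] assms(5)[OF that(1,2)]
    show ?thesis by (rule typed_eqI, (assumption | rule T that(3) typing rels ambient)+, rule refl)
  qed
qed

context
  fixes G :: "tmd list" and D s E p ih :: tmd
  assumes tE: "G \<tturnstile> E : (\<^bold>\<forall>_ : Path. Propd)" and tp: "G \<tturnstile> p : Path" and tih: "G \<tturnstile> ih : (\<^bold>\<forall>l : Label. \<^bold>\<forall>h : E \<cdot>
    (l \<^bold># p). V)"
begin

lemmas pre = UniF_pre[OF tE tp tih]

lemma piece:
  assumes "G \<tturnstile> K : Type0" "\<And>H k. G \<preceq> H \<Longrightarrow> H \<tturnstile> k : K \<Longrightarrow> H \<tturnstile> lab k : Label" "uni (length G) lab"
  shows typed_piece: "G \<tturnstile> piece K lab E p ih : V"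
    and pieceI: "G \<tturnstile> w : V \<Longrightarrow> G \<tturnstile> k : K \<Longrightarrow> G \<tturnstile> h : E \<cdot> (lab k \<^bold># p) \<Longrightarrow> G \<TTurnstile> w \<^bold>\<in> succd (ih \<cdot> lab k \<cdot> h)
      \<Longrightarrow> G \<TTurnstile> w \<^bold>\<in> piece K lab E p ih"
    and pieceE: "G \<tturnstile> w : V \<Longrightarrow> G \<TTurnstile> w \<^bold>\<in> piece K lab E p ih \<Longrightarrow> G \<tturnstile> R : Propd \<Longrightarrow>
       (\<And>H k h. G \<preceq> H \<Longrightarrow> H \<tturnstile> k : K \<Longrightarrow> H \<tturnstile> h : E \<cdot> (lab k \<^bold># p) \<Longrightarrow> H \<TTurnstile> w \<^bold>\<in> succd (ih \<cdot> lab k \<cdot> h) \<Longrightarrow> H \<TTurnstile> R) \<Longrightarrow> G \<TTurnstile> R"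
proof -
  have t: "H \<tturnstile> succd (ih \<cdot> lab k \<cdot> h) : V" if "G \<preceq> H" "H \<tturnstile> k : K" "H \<tturnstile> h : E \<cdot> (lab k \<^bold># p)" for H k h
    by (rule typed_union[OF _ typed_singleton]; rule pre(4)[OF assms that])
  note P = assms(1) pre(1,3)[OF assms] t
  show "G \<tturnstile> piece K lab E p ih : V" unfolding piece_def by (rule typed_UniF[OF P])
  show "G \<tturnstile> w : V \<Longrightarrow> G \<tturnstile> k : K \<Longrightarrow> G \<tturnstile> h : E \<cdot> (lab k \<^bold># p) \<Longrightarrow> G \<TTurnstile> w \<^bold>\<in> succd (ih \<cdot> lab k \<cdot> h)
    \<Longrightarrow> G \<TTurnstile> w \<^bold>\<in> piece K lab E p ih"
    unfolding piece_def by (rule UniFI[OF P])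
  show "G \<tturnstile> w : V \<Longrightarrow> G \<TTurnstile> w \<^bold>\<in> piece K lab E p ih \<Longrightarrow> G \<tturnstile> R : Propd \<Longrightarrow>
       (\<And>H k h. G \<preceq> H \<Longrightarrow> H \<tturnstile> k : K \<Longrightarrow> H \<tturnstile> h : E \<cdot> (lab k \<^bold># p) \<Longrightarrow> H \<TTurnstile> w \<^bold>\<in> succd (ih \<cdot> lab k \<cdot> h) \<Longrightarrow> H \<TTurnstile> R) \<Longrightarrow> G \<TTurnstile> R"
    unfolding piece_def by (rule UniFE[OF P])
qed

lemma fstv:
  shows typed_fstv: "G \<tturnstile> fstv E p ih : V"
    and fstvI: "G \<tturnstile> w : V \<Longrightarrow> G \<tturnstile> h : E \<cdot> (lab_a \<^bold># p) \<Longrightarrow> G \<TTurnstile> w \<^bold>\<in> ih \<cdot> lab_a \<cdot> h \<Longrightarrow> G \<TTurnstile> w \<^bold>\<in> fstv E p ih"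
    and fstvE: "G \<tturnstile> w : V \<Longrightarrow> G \<TTurnstile> w \<^bold>\<in> fstv E p ih \<Longrightarrow> G \<tturnstile> R : Propd \<Longrightarrow>
       (\<And>H h. G \<preceq> H \<Longrightarrow> H \<tturnstile> h : E \<cdot> (lab_a \<^bold># p) \<Longrightarrow> H \<TTurnstile> w \<^bold>\<in> ih \<cdot> lab_a \<cdot> h \<Longrightarrow> H \<TTurnstile> R) \<Longrightarrow> G \<TTurnstile> R"
proof -
  have u: "uni (length G) (\<lambda>_. lab_a)" by ((assumption | rule typing rels ambient)+)
  note Q = pre[OF typed_Unit(1) typed_Label(2) u]
  note P = typed_Unit(1) Q(1,2,4)
  show "G \<tturnstile> fstv E p ih : V" unfolding fstv_def by (rule typed_UniF[OF P])
  show "G \<tturnstile> w : V \<Longrightarrow> G \<tturnstile> h : E \<cdot> (lab_a \<^bold># p) \<Longrightarrow> G \<TTurnstile> w \<^bold>\<in> ih \<cdot> lab_a \<cdot> h \<Longrightarrow> G \<TTurnstile> w \<^bold>\<in> fstv E p ih"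
    unfolding fstv_def by (rule UniFI[OF P _ typed_Unit(2)])
  show "G \<TTurnstile> R" if "G \<tturnstile> w : V" "G \<TTurnstile> w \<^bold>\<in> fstv E p ih" "G \<tturnstile> R : Propd" and
       R: "\<And>H h. G \<preceq> H \<Longrightarrow> H \<tturnstile> h : E \<cdot> (lab_a \<^bold># p) \<Longrightarrow> H \<TTurnstile> w \<^bold>\<in> ih \<cdot> lab_a \<cdot> h \<Longrightarrow> H \<TTurnstile> R"
    by (rule UniFE[OF P that(1) that(2)[unfolded fstv_def] that(3)]) (assumption | rule R)+
qed

context
  assumes tD: "G \<tturnstile> D : (\<^bold>\<forall>_ : V. V)" and ts: "G \<tturnstile> s : V"
begin

lemma typed_Dfstv: "G \<tturnstile> D \<cdot> fstv E p ih : V"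
  by (rule typed_eqI, (assumption | rule tD typed_fstv typing rels ambient)+, rule refl)

lemma lab_b_pre: "G \<tturnstile> bar (D \<cdot> fstv E p ih) : Type0"
    "\<And>H j. G \<preceq> H \<Longrightarrow> H \<tturnstile> j : bar (D \<cdot> fstv E p ih) \<Longrightarrow> H \<tturnstile> lab_b (child (D \<cdot> fstv E p ih) j) : Label"
    "uni (length G) (\<lambda>j. lab_b (child (D \<cdot> fstv E p ih) j))"
  by ((assumption | rule typed_Dfstv lift_deq[OF _ typed_Dfstv] typing rels tD tE tp tih ambient)+)

lemma lab_c_pre: "G \<tturnstile> bar s : Type0" "\<And>H i. G \<preceq> H \<Longrightarrow> H \<tturnstile> i : bar s \<Longrightarrow> H \<tturnstile> lab_c (child s i) : Label"
    "uni (length G) (\<lambda>i. lab_c (child s i))"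
  by ((assumption | rule ts typing rels ambient | erule good_tls | rule lift_deq lift_fam good_ext, (assumption
    | rule ts))+)

lemma lab_a_pre: "G \<tturnstile> closed (Ind Unit_decl) : Type0" "\<And>H i. G \<preceq> H \<Longrightarrow> H \<tturnstile> i : closed (Ind Unit_decl)
  \<Longrightarrow> H \<tturnstile> lab_a : Label"
    "uni (length G) (\<lambda>_. lab_a)"
  by ((assumption | rule typing rels ambient)+)

lemma typed_body: "G \<tturnstile> body D s E p ih : V"
  unfolding body_def by (intro typed_union typed_piece lab_a_pre lab_b_pre lab_c_pre)

end
end

text \<open>The motive is constantly \<open>V\<close>. The iota rule unfolds \<open>val\<close> at
  \<open>mkA\<close>; for other accessibility proofs its properties come from
  \<open>Acc_ind\<close>.\<close>

lemma val:
  assumes tE: "G \<tturnstile> E : (\<^bold>\<forall>_ : Path. Propd)" and tD: "G \<tturnstile> D : (\<^bold>\<forall>_ : V. V)" and ts: "G \<tturnstile> s : V"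
  shows typed_val: "G \<tturnstile> val D s E : (\<^bold>\<forall>p : Path. \<^bold>\<forall>x : Accd E p. V)"
    and deq_val: "G \<tturnstile> p : Path \<Longrightarrow> G \<tturnstile> e : E \<cdot> p \<Longrightarrow> G \<tturnstile> k : (\<^bold>\<forall>l : Label. \<^bold>\<forall>h : E \<cdot> (l \<^bold># p). Accd E (l \<^bold># p)) \<Longrightarrow>
      G \<tturnstile> val D s E \<cdot> p \<cdot> mkA E p e k \<equiv>
        body D s E p (\<^bold>\<lambda>l : Label. \<^bold>\<lambda>h : E \<cdot> (l \<^bold># p). val D s E \<cdot> (l \<^bold># p) \<cdot> (k \<cdot> l \<cdot> h)) : V"
proof -
  let ?m = "\<^bold>\<lambda>p : Path. \<^bold>\<lambda>e : E \<cdot> p. \<^bold>\<lambda>k : (\<^bold>\<forall>l : Label. \<^bold>\<forall>h : E \<cdot> (l \<^bold># p). Accd E (l \<^bold># p)).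
      \<^bold>\<lambda>ih : (\<^bold>\<forall>l : Label. \<^bold>\<forall>h : E \<cdot> (l \<^bold># p). V). body D s E p ih"
  have m: "G \<tturnstile> ?m : (\<^bold>\<forall>p : Path. \<^bold>\<forall>e : E \<cdot> p. \<^bold>\<forall>k : (\<^bold>\<forall>l : Label. \<^bold>\<forall>h : E \<cdot> (l \<^bold># p). Accd E (l \<^bold># p)).
       \<^bold>\<forall>ih : (\<^bold>\<forall>l : Label. \<^bold>\<forall>h : E \<cdot> (l \<^bold># p). V). V)"
    by ((assumption | rule tE tD ts typed_body typing rels ambient)+)
  have u: "uni2 (length G) (\<lambda>_ _. V)" by (rule uni2I) ((assumption | rule typing rels ambient)+)
  note r = typed_rec_Acc[OF tE u typed_V m, folded val_def] and d = deq_rec_Acc[OF tE u typed_V m,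
    folded val_def]
  show v: "G \<tturnstile> val D s E : (\<^bold>\<forall>p : Path. \<^bold>\<forall>x : Accd E p. V)" by (rule r)
  assume a: "G \<tturnstile> p : Path" "G \<tturnstile> e : E \<cdot> p" "G \<tturnstile> k : (\<^bold>\<forall>l : Label. \<^bold>\<forall>h : E \<cdot> (l \<^bold># p). Accd E (l \<^bold># p))"
  have ih: "G \<tturnstile> (\<^bold>\<lambda>l : Label. \<^bold>\<lambda>h : E \<cdot> (l \<^bold># p). val D s E \<cdot> (l \<^bold># p) \<cdot> (k \<cdot> l \<cdot> h)) : (\<^bold>\<forall>l : Label. \<^bold>\<forall>h : E \<cdot>
    (l \<^bold># p). V)"
    by ((assumption | rule a tE tD ts v typing rels ambient)+)
  show "G \<tturnstile> val D s E \<cdot> p \<cdot> mkA E p e k \<equiv>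
        body D s E p (\<^bold>\<lambda>l : Label. \<^bold>\<lambda>h : E \<cdot> (l \<^bold># p). val D s E \<cdot> (l \<^bold># p) \<cdot> (k \<cdot> l \<cdot> h)) : V"
    by (rule deq_trans[OF d[OF a]], rule beta_step[OF beta_step[OF beta_step[OF deq_beta[OF m]]]]) ((assumption
      | rule a ih tE tD ts typing rels ambient)+)
qed

section \<open>Coherence and availability as rules\<close>

lemma available_eq: "available D U G l = (eqd 2 Label l lab_a \<^bold>\<or>
      (\<^bold>\<exists>\<^sub>1w : V. l \<^bold>\<sim> lab_b w \<^bold>\<and> w \<^bold>\<in> D \<cdot> G) \<^bold>\<or> (\<^bold>\<exists>\<^sub>1x : V. l \<^bold>\<sim> lab_c x \<^bold>\<and> x \<^bold>\<in> U))"
  by (simp add: available_def eqd_def)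

lemma rel_available [rels]: "rel \<theta> k D D' \<Longrightarrow> rel \<theta> k U U' \<Longrightarrow> rel \<theta> k g g' \<Longrightarrow> rel \<theta> k l l'
  \<Longrightarrow> rel \<theta> k (available D U g l) (available D' U' g' l')"
  unfolding available_eq by (assumption | rule rels rel_shift)+
lemma rel_first_value [rels]: "rel \<theta> k \<tau> \<tau>' \<Longrightarrow> rel \<theta> k p p' \<Longrightarrow> rel \<theta> k g g' \<Longrightarrow> rel \<theta> k (first_value \<tau> p g)
  (first_value \<tau>' p' g')"
  unfolding first_value_def by (assumption | rule rels rel_shift)+

lemma typed_available [typing]: "G \<tturnstile> D : (\<^bold>\<forall>_ : V. V) \<Longrightarrow> G \<tturnstile> U : V \<Longrightarrow> G \<tturnstile> g : V \<Longrightarrow> G \<tturnstile> l : Label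
  \<Longrightarrow> G \<tturnstile> available D U g l : Propd"
  unfolding available_eq by ((assumption | rule typing rels ambient)+)
lemma typed_first_value [typing]: "G \<tturnstile> \<tau> : (\<^bold>\<forall>_ : Path. \<^bold>\<forall>_ : V. Propd) \<Longrightarrow> G \<tturnstile> p : Path \<Longrightarrow> G \<tturnstile> g : V
  \<Longrightarrow> G \<tturnstile> first_value \<tau> p g : Propd"
  unfolding first_value_def by ((assumption | rule typing rels ambient)+)

text \<open>The clauses are projected out of the nested conjunction and instantiated here, so that
  the later arguments apply coherence directly to terms in context.\<close>

lemma coherent:
  assumes tD: "G \<tturnstile> D : (\<^bold>\<forall>_ : V. V)" and ts: "G \<tturnstile> s : V" and tt: "G \<tturnstile> \<tau> : (\<^bold>\<forall>_ : Path. \<^bold>\<forall>_ : V. Propd)"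
    and coh: "G \<TTurnstile> coherent D s \<tau>" and p: "G \<tturnstile> p : Path"
  shows coh_closed: "G \<tturnstile> t : V \<Longrightarrow> G \<tturnstile> t' : V \<Longrightarrow> G \<TTurnstile> \<tau> \<cdot> p \<cdot> t \<Longrightarrow> G \<TTurnstile> t \<^bold>\<approx> t' \<Longrightarrow> G \<TTurnstile> \<tau> \<cdot> p \<cdot> t'"
    and coh_eqv: "G \<tturnstile> t : V \<Longrightarrow> G \<tturnstile> l : Label \<Longrightarrow> G \<tturnstile> l' : Label \<Longrightarrow> G \<TTurnstile> l \<^bold>\<sim> l' \<Longrightarrow> G \<TTurnstile> \<tau> \<cdot> (l \<^bold># p) \<cdot> t
      \<Longrightarrow> G \<TTurnstile> \<tau> \<cdot> (l' \<^bold># p) \<cdot> t"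
    and coh_mem: "G \<tturnstile> t : V \<Longrightarrow> G \<tturnstile> t' : V \<Longrightarrow> G \<tturnstile> l : Label \<Longrightarrow> G \<TTurnstile> \<tau> \<cdot> (l \<^bold># p) \<cdot> t \<Longrightarrow> G \<TTurnstile> \<tau> \<cdot> p \<cdot> t' \<Longrightarrow> G \<TTurnstile> t \<^bold>\<in> t'"
    and coh_values: "G \<tturnstile> t : V \<Longrightarrow> G \<tturnstile> g : V \<Longrightarrow> G \<tturnstile> x : V \<Longrightarrow> G \<TTurnstile> \<tau> \<cdot> p \<cdot> t \<Longrightarrow> G \<TTurnstile> first_value \<tau> p g \<Longrightarrow>
       G \<TTurnstile> x \<^bold>\<in> t \<^bold>\<leftrightarrow> (\<^bold>\<exists>\<^sub>1l : Label. \<^bold>\<exists>\<^sub>1t' : V. available D s g l \<^bold>\<and> \<tau> \<cdot> (l \<^bold># p) \<cdot> t' \<^bold>\<and> x \<^bold>\<in> succd t')"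
proof -
  let ?A1 = "\<lambda>p. \<^bold>\<forall>t : V. \<^bold>\<forall>t' : V. (\<tau> \<cdot> p \<cdot> t \<^bold>\<rightarrow> t \<^bold>\<approx> t' \<^bold>\<rightarrow> \<tau> \<cdot> p \<cdot> t')"
  let ?A2 = "\<lambda>p. \<^bold>\<forall>t : V. \<^bold>\<forall>t' : V. (\<tau> \<cdot> p \<cdot> t \<^bold>\<rightarrow> \<tau> \<cdot> p \<cdot> t' \<^bold>\<rightarrow> t \<^bold>\<approx> t')"
  let ?A = "\<lambda>p. ?A1 p \<^bold>\<and> ?A2 p"
  let ?B = "\<lambda>p. \<^bold>\<forall>l : Label. \<^bold>\<forall>l' : Label. (l \<^bold>\<sim> l' \<^bold>\<rightarrow> (\<^bold>\<forall>t : V. (\<tau> \<cdot> (l \<^bold># p) \<cdot> t \<^bold>\<leftrightarrow> \<tau> \<cdot> (l' \<^bold># p) \<cdot> t)))"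
  let ?C = "\<lambda>p. \<^bold>\<forall>l : Label. \<^bold>\<forall>t : V. \<^bold>\<forall>t' : V. (\<tau> \<cdot> (l \<^bold># p) \<cdot> t \<^bold>\<rightarrow> \<tau> \<cdot> p \<cdot> t' \<^bold>\<rightarrow> t \<^bold>\<in> t')"
  let ?X = "\<lambda>p t g x. x \<^bold>\<in> t \<^bold>\<leftrightarrow> (\<^bold>\<exists>\<^sub>1l : Label. \<^bold>\<exists>\<^sub>1t' : V. available D s g l \<^bold>\<and> \<tau> \<cdot> (l \<^bold># p) \<cdot> t' \<^bold>\<and> x \<^bold>\<in> succd t')"
  let ?D = "\<lambda>p. \<^bold>\<forall>t : V. \<^bold>\<forall>g : V. (\<tau> \<cdot> p \<cdot> t \<^bold>\<rightarrow> first_value \<tau> p g \<^bold>\<rightarrow> (\<^bold>\<forall>x : V. ?X p t g x))"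
  have h: "G \<TTurnstile> pid Path ?A \<^bold>\<and> pid Path ?B \<^bold>\<and> pid Path ?C \<^bold>\<and> pid Path ?D"
    using coh unfolding coherent_def .
  note T = tD ts tt p
  have tA: "G \<tturnstile> pid Path ?A : Propd" by ((assumption | rule T typing rels ambient)+)
  have tB: "G \<tturnstile> pid Path ?B : Propd" by ((assumption | rule T typing rels ambient)+)
  have tC: "G \<tturnstile> pid Path ?C : Propd" by ((assumption | rule T typing rels ambient)+)
  have tDD: "G \<tturnstile> pid Path ?D : Propd" by ((assumption | rule T typing rels ambient)+)
  have hA: "G \<TTurnstile> pid Path ?A" by (rule conjunct1_0[OF h]) (rule tA tB tC tDD typed_conj)+
  have h2: "G \<TTurnstile> pid Path ?B \<^bold>\<and> pid Path ?C \<^bold>\<and> pid Path ?D" by (rule conjunct2_0[OF h]) (rule tA tB tC tDD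
    typed_conj)+
  have hB: "G \<TTurnstile> pid Path ?B" by (rule conjunct1_0[OF h2]) (rule tA tB tC tDD typed_conj)+
  have h3: "G \<TTurnstile> pid Path ?C \<^bold>\<and> pid Path ?D" by (rule conjunct2_0[OF h2]) (rule tA tB tC tDD typed_conj)+
  have hC: "G \<TTurnstile> pid Path ?C" by (rule conjunct1_0[OF h3]) (rule tA tB tC tDD typed_conj)+
  have hD: "G \<TTurnstile> pid Path ?D" by (rule conjunct2_0[OF h3]) (rule tA tB tC tDD typed_conj)+
  have A: "G \<TTurnstile> ?A p" by (rule allE0[OF hA p]) ((assumption | rule T typing rels ambient)+)
  have A: "G \<TTurnstile> ?A1 p" by (rule conjunct1_0[OF A]) ((assumption | rule T typing rels ambient)+)
  have B: "G \<TTurnstile> ?B p" by (rule allE0[OF hB p]) ((assumption | rule T typing rels ambient)+)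
  have C: "G \<TTurnstile> ?C p" by (rule allE0[OF hC p]) ((assumption | rule T typing rels ambient)+)
  have D: "G \<TTurnstile> ?D p" by (rule allE0[OF hD p]) ((assumption | rule T typing rels ambient)+)
  { assume a: "G \<tturnstile> t : V" "G \<tturnstile> t' : V" "G \<TTurnstile> \<tau> \<cdot> p \<cdot> t" "G \<TTurnstile> t \<^bold>\<approx> t'"
    have "G \<TTurnstile> (\<^bold>\<forall>t' : V. (\<tau> \<cdot> p \<cdot> t \<^bold>\<rightarrow> t \<^bold>\<approx> t' \<^bold>\<rightarrow> \<tau> \<cdot> p \<cdot> t'))" by (rule allE0[OF A a(1)]) ((assumption
      | rule T a typing rels ambient)+)
    then have "G \<TTurnstile> \<tau> \<cdot> p \<cdot> t \<^bold>\<rightarrow> t \<^bold>\<approx> t' \<^bold>\<rightarrow> \<tau> \<cdot> p \<cdot> t'" by (rule allE0[OF _ a(2)]) ((assumption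
      | rule T a typing rels ambient)+)
    then show "G \<TTurnstile> \<tau> \<cdot> p \<cdot> t'" by (rule mp0[OF mp0[OF _ a(3)] a(4)]) ((assumption
      | rule T a(1,2) typing rels ambient)+) }
  { assume a: "G \<tturnstile> t : V" "G \<tturnstile> l : Label" "G \<tturnstile> l' : Label" "G \<TTurnstile> l \<^bold>\<sim> l'" "G \<TTurnstile> \<tau> \<cdot> (l \<^bold># p) \<cdot> t"
    have "G \<TTurnstile> (\<^bold>\<forall>l' : Label. (l \<^bold>\<sim> l' \<^bold>\<rightarrow> (\<^bold>\<forall>t : V. (\<tau> \<cdot> (l \<^bold># p) \<cdot> t \<^bold>\<leftrightarrow> \<tau> \<cdot> (l' \<^bold># p) \<cdot> t))))"
      by (rule allE0[OF B a(2)]) ((assumption | rule T a typing rels ambient)+)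
    then have "G \<TTurnstile> l \<^bold>\<sim> l' \<^bold>\<rightarrow> (\<^bold>\<forall>t : V. (\<tau> \<cdot> (l \<^bold># p) \<cdot> t \<^bold>\<leftrightarrow> \<tau> \<cdot> (l' \<^bold># p) \<cdot> t))" by (rule allE0[OF _ a(3)])
      ((assumption | rule T a typing rels ambient)+)
    then have "G \<TTurnstile> (\<^bold>\<forall>t : V. (\<tau> \<cdot> (l \<^bold># p) \<cdot> t \<^bold>\<leftrightarrow> \<tau> \<cdot> (l' \<^bold># p) \<cdot> t))" by (rule mp0[OF _ a(4)]) ((assumption
      | rule T a(1-3) typing rels ambient)+)
    then have "G \<TTurnstile> \<tau> \<cdot> (l \<^bold># p) \<cdot> t \<^bold>\<leftrightarrow> \<tau> \<cdot> (l' \<^bold># p) \<cdot> t" by (rule allE0[OF _ a(1)]) ((assumption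
      | rule T a typing rels ambient)+)
    then show "G \<TTurnstile> \<tau> \<cdot> (l' \<^bold># p) \<cdot> t" by (rule iffD1_0[OF _ _ _ a(5)]) ((assumption
      | rule T a(1-3) typing rels ambient)+) }
  { assume a: "G \<tturnstile> t : V" "G \<tturnstile> t' : V" "G \<tturnstile> l : Label" "G \<TTurnstile> \<tau> \<cdot> (l \<^bold># p) \<cdot> t" "G \<TTurnstile> \<tau> \<cdot> p \<cdot> t'"
    have "G \<TTurnstile> (\<^bold>\<forall>t : V. \<^bold>\<forall>t' : V. (\<tau> \<cdot> (l \<^bold># p) \<cdot> t \<^bold>\<rightarrow> \<tau> \<cdot> p \<cdot> t' \<^bold>\<rightarrow> t \<^bold>\<in> t'))" by (rule allE0[OF C a(3)])
      ((assumption | rule T a typing rels ambient)+)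
    then have "G \<TTurnstile> (\<^bold>\<forall>t' : V. (\<tau> \<cdot> (l \<^bold># p) \<cdot> t \<^bold>\<rightarrow> \<tau> \<cdot> p \<cdot> t' \<^bold>\<rightarrow> t \<^bold>\<in> t'))" by (rule allE0[OF _ a(1)]) ((assumption
      | rule T a typing rels ambient)+)
    then have "G \<TTurnstile> \<tau> \<cdot> (l \<^bold># p) \<cdot> t \<^bold>\<rightarrow> \<tau> \<cdot> p \<cdot> t' \<^bold>\<rightarrow> t \<^bold>\<in> t'" by (rule allE0[OF _ a(2)]) ((assumption
      | rule T a typing rels ambient)+)
    then show "G \<TTurnstile> t \<^bold>\<in> t'" by (rule mp0[OF mp0[OF _ a(4)] a(5)]) ((assumption
      | rule T a(1-3) typing rels ambient)+) }
  { assume a: "G \<tturnstile> t : V" "G \<tturnstile> g : V" "G \<tturnstile> x : V" "G \<TTurnstile> \<tau> \<cdot> p \<cdot> t" "G \<TTurnstile> first_value \<tau> p g"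
    have "G \<TTurnstile> (\<^bold>\<forall>g : V. (\<tau> \<cdot> p \<cdot> t \<^bold>\<rightarrow> first_value \<tau> p g \<^bold>\<rightarrow> (\<^bold>\<forall>x : V. ?X p t g x)))" by (rule allE0[OF D a(1)])
      ((assumption | rule T a typing rels ambient)+)
    then have "G \<TTurnstile> \<tau> \<cdot> p \<cdot> t \<^bold>\<rightarrow> first_value \<tau> p g \<^bold>\<rightarrow> (\<^bold>\<forall>x : V. ?X p t g x)" by (rule allE0[OF _ a(2)]) ((assumption
      | rule T a typing rels ambient)+)
    then have "G \<TTurnstile> (\<^bold>\<forall>x : V. ?X p t g x)" by (rule mp0[OF mp0[OF _ a(4)] a(5)]) ((assumption
      | rule T a(1-3) typing rels ambient)+)
    then show "G \<TTurnstile> ?X p t g x" by (rule allE0[OF _ a(3)]) ((assumption | rule T a typing rels ambient)+) }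
qed

lemma succd_cong:
  assumes "G \<TTurnstile> t \<^bold>\<approx> t'" "G \<TTurnstile> x \<^bold>\<in> succd t" "G \<tturnstile> x : V" "G \<tturnstile> t : V" "G \<tturnstile> t' : V"
  shows "G \<TTurnstile> x \<^bold>\<in> succd t'"
proof (rule disjE1[OF unionD[OF assms(4) typed_singleton[OF assms(4)] assms(3,2)]])
  fix H assume H: "G \<preceq> H" "H \<TTurnstile> x \<^bold>\<in> t"
  note T = assms(3-)[THEN lift_deq[OF H(1)]]
  show "H \<TTurnstile> x \<^bold>\<in> succd t'"
    by (rule unionI1[OF T(3) typed_singleton[OF T(3)] T(1) mem_cong_right[OF lift_holds[OF H(1) assms(1)] H(2)
      T(1-3)]])
next
  fix H assume H: "G \<preceq> H" "H \<TTurnstile> x \<^bold>\<in> singleton t"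
  note T = assms(3-)[THEN lift_deq[OF H(1)]]
  show "H \<TTurnstile> x \<^bold>\<in> succd t'"
    by (rule unionI2[OF T(3) typed_singleton[OF T(3)] T(1) singletonI[OF bisim_trans[OF singletonD[OF H(2)
      T(1,2)] lift_holds[OF H(1) assms(1)] T(1-3)] T(1,3)]])
qed ((assumption | rule assms(3-) typing rels ambient)+)

lemma typed_ih_app: "G \<tturnstile> ih : (\<^bold>\<forall>l : Label. \<^bold>\<forall>h : E \<cdot> (l \<^bold># p). V) \<Longrightarrow> G \<tturnstile> E : (\<^bold>\<forall>_ : Path. Propd) \<Longrightarrow> G \<tturnstile> p : Path \<Longrightarrow>
    G \<tturnstile> l : Label \<Longrightarrow> G \<tturnstile> h : E \<cdot> (l \<^bold># p) \<Longrightarrow> G \<tturnstile> ih \<cdot> l \<cdot> h : V"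
  by (rule typed_eqI, (assumption | rule typing rels ambient)+, rule refl)

lemma typed_app_Path: "G \<tturnstile> E : (\<^bold>\<forall>_ : Path. Propd) \<Longrightarrow> G \<tturnstile> p : Path \<Longrightarrow> G \<tturnstile> E \<cdot> p : Propd"
  by (rule typed_eqI, (assumption | rule typing rels ambient)+, rule refl)

lemma typed_target: "G \<tturnstile> \<tau> : (\<^bold>\<forall>_ : Path. \<^bold>\<forall>_ : V. Propd) \<Longrightarrow> G \<tturnstile> p : Path \<Longrightarrow> G \<tturnstile> t : V \<Longrightarrow> G \<tturnstile> \<tau> \<cdot> p \<cdot> t : Propd"
  by (rule typed_eqI, (assumption | rule typing rels ambient)+, rule refl)

section \<open>One step of the recursion computes the target\<close>

context
  fixes G :: "tmd list" and D s \<tau> E p ih t :: tmd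
  assumes tD: "G \<tturnstile> D : (\<^bold>\<forall>_ : V. V)" and ts: "G \<tturnstile> s : V" and tt: "G \<tturnstile> \<tau> : (\<^bold>\<forall>_ : Path. \<^bold>\<forall>_ : V. Propd)"
    and tE: "G \<tturnstile> E : (\<^bold>\<forall>_ : Path. Propd)" and coh: "G \<TTurnstile> coherent D s \<tau>"
    and E1: "\<And>H p t. G \<preceq> H \<Longrightarrow> H \<tturnstile> p : Path \<Longrightarrow> H \<tturnstile> t : V \<Longrightarrow> H \<TTurnstile> \<tau> \<cdot> p \<cdot> t \<Longrightarrow> H \<TTurnstile> E \<cdot> p"
    and E2: "\<And>H p h. G \<preceq> H \<Longrightarrow> H \<tturnstile> p : Path \<Longrightarrow> H \<tturnstile> h : E \<cdot> p \<Longrightarrow> H \<TTurnstile> (\<^bold>\<exists>\<^sub>1t : V. \<tau> \<cdot> p \<cdot> t)"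
    and p: "G \<tturnstile> p : Path" and tih: "G \<tturnstile> ih : (\<^bold>\<forall>l : Label. \<^bold>\<forall>h : E \<cdot> (l \<^bold># p). V)" and t: "G \<tturnstile> t : V"
    and pt: "G \<TTurnstile> \<tau> \<cdot> p \<cdot> t"
    and IH: "\<And>H l h t'. G \<preceq> H \<Longrightarrow> H \<tturnstile> l : Label \<Longrightarrow> H \<tturnstile> h : E \<cdot> (l \<^bold># p) \<Longrightarrow> H \<tturnstile> t' : V \<Longrightarrow>
       H \<TTurnstile> \<tau> \<cdot> (l \<^bold># p) \<cdot> t' \<Longrightarrow> H \<TTurnstile> ih \<cdot> l \<cdot> h \<^bold>\<approx> t'"
begin

lemmas T = tD ts tt tE p tih t

text \<open>\<open>E\<close> enters only through \<open>E1\<close> and \<open>E2\<close>, which make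
  it the domain of \<open>\<tau>\<close>. It stays abstract because replacement uses a domain that
  is defined without reference to one particular \<open>\<tau>\<close>. A proof \<open>h\<close> of
  membership yields a target, but only towards a proposition \<open>R\<close>.\<close>

lemma target_ex:
  assumes "G \<preceq> H" "H \<tturnstile> l : Label" "H \<tturnstile> h : E \<cdot> (l \<^bold># p)" "H \<tturnstile> R : Propd"
    "\<And>K t'. H \<preceq> K \<Longrightarrow> K \<tturnstile> t' : V \<Longrightarrow> K \<TTurnstile> \<tau> \<cdot> (l \<^bold># p) \<cdot> t' \<Longrightarrow> K \<TTurnstile> ih \<cdot> l \<cdot> h \<^bold>\<approx> t' \<Longrightarrow> K \<TTurnstile> R"
  shows "H \<TTurnstile> R"
proof -
  note T = T[THEN lift_deq[OF assms(1)]] assms(2,3)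
  have lp: "H \<tturnstile> l \<^bold># p : Path" by ((assumption | rule T typing rels ambient)+)
  show ?thesis
  proof (rule ex1E[OF E2[OF assms(1) lp assms(3)] typed_V _ _ assms(4)])
    fix K t' assume K: "H \<preceq> K" "K \<tturnstile> t' : V" "K \<TTurnstile> \<tau> \<cdot> (l \<^bold># p) \<cdot> t'"
    note T = T[THEN lift_deq[OF K(1)]]
    show "K \<TTurnstile> R" by (rule assms(5)[OF K IH[OF ext_trans[OF assms(1) K(1)] T(8,9) K(2,3)]])
  qed ((assumption | rule T typing rels ambient)+)
qed

text \<open>The union over all proofs of \<open>E\<close> at the child \<open>lab_a\<close> replaces
  the question whether that child has a target. If it has one, \<open>E1\<close> supplies an index,
  and each set in the union is bisimilar to the target; if it has none, \<open>E2\<close> leaves no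
  index.\<close>

lemma first_value_fstv: "G \<TTurnstile> first_value \<tau> p (fstv E p ih)"
  unfolding first_value_def
proof (rule allI1, rule typed_V, ((assumption | rule T typing rels ambient)+)[1], rule iffI1)
  fix H x K assume H: "G \<preceq> H" "H \<tturnstile> x : V" and K: "H \<preceq> K" "K \<TTurnstile> x \<^bold>\<in> fstv E p ih"
  note GK = ext_trans[OF H(1) K(1)]
  note T1 = T[THEN lift_deq[OF GK]] lift_deq[OF K(1) H(2)]
  let ?R = "\<^bold>\<exists>\<^sub>1t : V. \<tau> \<cdot> (lab_a \<^bold># p) \<cdot> t \<^bold>\<and> x \<^bold>\<in> t"
  have tR: "K \<tturnstile> ?R : Propd" by ((assumption | rule T1 typing rels ambient)+)
  show "K \<TTurnstile> ?R"
  proof (rule fstvE[OF T1(4-6,8) K(2) tR])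
    fix L h assume L: "K \<preceq> L" "L \<tturnstile> h : E \<cdot> (lab_a \<^bold># p)" "L \<TTurnstile> x \<^bold>\<in> ih \<cdot> lab_a \<cdot> h"
    note GL = ext_trans[OF GK L(1)]
    show "L \<TTurnstile> ?R"
    proof (rule target_ex[OF GL typed_Label(2) L(2) lift_deq[OF L(1) tR]])
      fix M t' assume M: "L \<preceq> M" "M \<tturnstile> t' : V" "M \<TTurnstile> \<tau> \<cdot> (lab_a \<^bold># p) \<cdot> t'" "M \<TTurnstile> ih \<cdot> lab_a \<cdot> h \<^bold>\<approx> t'"
      note T2 = T1[THEN lift_deq[OF ext_trans[OF L(1) M(1)]]] M(2)
      have i: "M \<tturnstile> ih \<cdot> lab_a \<cdot> h : V"
        by (rule typed_ih_app[OF T2(6,4,5) typed_Label(2) lift_deq[OF M(1) L(2)]])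
      have x: "M \<TTurnstile> x \<^bold>\<in> t'" by (rule mem_cong_right[OF M(4) lift_holds[OF M(1) L(3)] T2(8) i M(2)])
      show "M \<TTurnstile> ?R"
        by (rule ex1I[OF typed_V _ _ M(2)], ((assumption | rule T2 typing rels ambient)+)[2], rule conjI0[OF _ _
          M(3) x], ((assumption | rule T2 typing rels ambient)+))
    qed
  qed
next
  fix H x K assume H: "G \<preceq> H" "H \<tturnstile> x : V" and K: "H \<preceq> K" "K \<TTurnstile> (\<^bold>\<exists>\<^sub>1t : V. \<tau> \<cdot> (lab_a \<^bold># p) \<cdot> t \<^bold>\<and> x \<^bold>\<in> t)"
  note GK = ext_trans[OF H(1) K(1)]
  note T1 = T[THEN lift_deq[OF GK]] lift_deq[OF K(1) H(2)]
  have f: "K \<tturnstile> fstv E p ih : V" by (rule typed_fstv[OF T1(4-6)])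
  have tR: "K \<tturnstile> (x \<^bold>\<in> fstv E p ih) : Propd" by ((assumption | rule f T1 typing rels ambient)+)
  show "K \<TTurnstile> x \<^bold>\<in> fstv E p ih"
  proof (rule ex1E[OF K(2) typed_V _ _ tR])
    fix L t' assume L: "K \<preceq> L" "L \<tturnstile> t' : V" "L \<TTurnstile> \<tau> \<cdot> (lab_a \<^bold># p) \<cdot> t' \<^bold>\<and> x \<^bold>\<in> t'"
    note GL = ext_trans[OF GK L(1)]
    note T2 = T1[THEN lift_deq[OF L(1)]] L(2)
    have ap: "L \<tturnstile> lab_a \<^bold># p : Path" by ((assumption | rule T2 typing rels ambient)+)
    have 1: "L \<TTurnstile> \<tau> \<cdot> (lab_a \<^bold># p) \<cdot> t'" by (rule conjunct1_0[OF L(3)]) ((assumption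
      | rule T2 typing rels ambient)+)
    have 2: "L \<TTurnstile> x \<^bold>\<in> t'" by (rule conjunct2_0[OF L(3)]) ((assumption | rule T2 typing rels ambient)+)
    from E1[OF GL ap L(2) 1] obtain h where h: "L \<tturnstile> h : E \<cdot> (lab_a \<^bold># p)" by (auto simp: holds_def)
    have i: "L \<tturnstile> ih \<cdot> lab_a \<cdot> h : V"
      by (rule typed_ih_app[OF T2(6,4,5) typed_Label(2) h])
    show "L \<TTurnstile> x \<^bold>\<in> fstv E p ih"
      by (rule fstvI[OF T2(4-6,8) h mem_cong_right[OF bisim_sym[OF IH[OF GL typed_Label(2) h L(2) 1] i L(2)] 2
        T2(8) L(2) i]])
  qed ((assumption | rule T1 typing rels ambient)+)
next
  fix H x assume H: "G \<preceq> H" "H \<tturnstile> x : V"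
  note T1 = T[THEN lift_deq[OF H(1)]] H(2)
  show "H \<tturnstile> (x \<^bold>\<in> fstv E p ih) : Propd" by ((assumption | rule typed_fstv[OF T1(4-6)] T1 typing rels ambient)+)
  show "H \<tturnstile> (\<^bold>\<exists>\<^sub>1t : V. \<tau> \<cdot> (lab_a \<^bold># p) \<cdot> t \<^bold>\<and> x \<^bold>\<in> t) : Propd" by ((assumption | rule T1 typing rels ambient)+)
qed

text \<open>Clause (4) of coherence, with the computed set \<open>fstv E p ih\<close> as the first
  value.\<close>

lemma mem_target_iff:
  assumes "G \<preceq> H" "H \<tturnstile> x : V"
  shows "H \<TTurnstile> x \<^bold>\<in> t \<^bold>\<leftrightarrow> (\<^bold>\<exists>\<^sub>1l : Label. \<^bold>\<exists>\<^sub>1t' : V. available D s (fstv E p ih) l \<^bold>\<and> \<tau> \<cdot> (l \<^bold># p) \<cdot> t' \<^bold>\<and> x \<^bold>\<in> succd t')"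
proof -
  note T1 = T[THEN lift_deq[OF assms(1)]]
  show ?thesis
    by (rule coh_values[OF T1(1-3) lift_holds[OF assms(1) coh] T1(5,7) typed_fstv[OF T1(4-6)] assms(2)
         lift_holds[OF assms(1) pt] lift_holds[OF assms(1) first_value_fstv]])
qed

lemma mem_targetI:
  assumes "G \<preceq> H" "H \<tturnstile> w : V" "H \<tturnstile> l : Label" "H \<tturnstile> h : E \<cdot> (l \<^bold># p)" "H \<TTurnstile> w \<^bold>\<in> succd (ih \<cdot> l \<cdot> h)"
    "H \<TTurnstile> available D s (fstv E p ih) l"
  shows "H \<TTurnstile> w \<^bold>\<in> t"
proof -
  note T1 = T[THEN lift_deq[OF assms(1)]] assms(2-4)
  note f1 = typed_fstv[OF T1(4-6)]
  have tR: "H \<tturnstile> (w \<^bold>\<in> t) : Propd" by ((assumption | rule T1 typing rels ambient)+)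
  show ?thesis
  proof (rule target_ex[OF assms(1,3,4) tR])
    fix K t' assume K: "H \<preceq> K" "K \<tturnstile> t' : V" "K \<TTurnstile> \<tau> \<cdot> (l \<^bold># p) \<cdot> t'" "K \<TTurnstile> ih \<cdot> l \<cdot> h \<^bold>\<approx> t'"
    note T2 = T1[THEN lift_deq[OF K(1)]] K(2) lift_deq[OF K(1) f1] and GK = ext_trans[OF assms(1) K(1)]
    have i: "K \<tturnstile> ih \<cdot> l \<cdot> h : V" by (rule typed_ih_app[OF T2(6,4,5,9,10)])
    have w: "K \<TTurnstile> w \<^bold>\<in> succd t'" by (rule succd_cong[OF K(4) lift_holds[OF K(1) assms(5)] T2(8) i K(2)])
    show "K \<TTurnstile> w \<^bold>\<in> t"
      apply (rule iffD2_0[OF mem_target_iff[OF GK T2(8)]], ((assumption | rule T2 typing rels ambient)+)[2])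
      apply (rule ex1I[OF typed_Label(1) _ _ T2(9)], ((assumption | rule T2 typing rels ambient)+)[2])
      apply (rule ex1I[OF typed_V _ _ K(2)], ((assumption | rule T2 typing rels ambient)+)[2])
      apply (rule conjI0[OF _ _ lift_holds[OF K(1) assms(6)]], ((assumption | rule T2 typing rels ambient)+)[2])
      apply (rule conjI0[OF _ _ K(3) w], ((assumption | rule T2 typing rels ambient)+))
      done
  qed
qed

text \<open>The existential is on the metalevel because the proof \<open>h\<close> is to become part
  of an index of a union.\<close>

lemma target_succ:
  assumes "G \<preceq> H" "H \<tturnstile> w : V" "H \<tturnstile> l : Label" "H \<tturnstile> t' : V" "H \<TTurnstile> \<tau> \<cdot> (l \<^bold># p) \<cdot> t'" "H \<TTurnstile> w \<^bold>\<in> succd t'"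
  shows "\<exists>h. H \<tturnstile> h : E \<cdot> (l \<^bold># p) \<and> (H \<TTurnstile> w \<^bold>\<in> succd (ih \<cdot> l \<cdot> h))"
proof -
  note T1 = T[THEN lift_deq[OF assms(1)]] assms(2-4)
  have lp: "H \<tturnstile> l \<^bold># p : Path" by ((assumption | rule T1 typing rels ambient)+)
  from E1[OF assms(1) lp assms(4,5)] obtain h where h: "H \<tturnstile> h : E \<cdot> (l \<^bold># p)" by (auto simp: holds_def)
  have i: "H \<tturnstile> ih \<cdot> l \<cdot> h : V" by (rule typed_ih_app[OF T1(6,4,5,9) h])
  have "H \<TTurnstile> w \<^bold>\<in> succd (ih \<cdot> l \<cdot> h)"
    by (rule succd_cong[OF bisim_sym[OF IH[OF assms(1,3) h assms(4,5)] i assms(4)] assms(6,2,4) i])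
  with h show ?thesis by blast
qed

text \<open>By extensionality. A member of a piece comes from a label that is available by
  construction, so clause (4) places it in \<open>t\<close>. Conversely, clause (4) gives an
  available label, possibly only equivalent to one that indexes a piece; clause (2) gives the
  indexing label the same targets. Because \<open>fstv E p ih\<close> is a first value at
  \<open>p\<close>, availability refers to the same sets that index the pieces.\<close>

lemma body_target: "G \<TTurnstile> body D s E p ih \<^bold>\<approx> t"
proof (rule ext_bisim[OF typed_body[OF tE p tih tD ts] t])
  fix H w assume H: "G \<preceq> H" "H \<tturnstile> w : V" "H \<TTurnstile> w \<^bold>\<in> body D s E p ih"
  note T1 = T[THEN lift_deq[OF H(1)]] H(2)
  note c1 = T1(4-6)
  let ?g = "fstv E p ih"
  let ?a = "piece (closed (Ind Unit_decl)) (\<lambda>_. lab_a) E p ih" and ?b = "piece (bar (D \<cdot> ?g)) (\<lambda>j. lab_b (child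
    (D \<cdot> ?g) j)) E p ih"
    and ?c = "piece (bar s) (\<lambda>i. lab_c (child s i)) E p ih"
  have ta: "H \<tturnstile> ?a : V" by (rule typed_piece[OF c1 lab_a_pre[OF T1(4-6,1,2)]])
  have tb: "H \<tturnstile> ?b : V" by (rule typed_piece[OF c1 lab_b_pre[OF T1(4-6,1,2)]])
  have tc: "H \<tturnstile> ?c : V" by (rule typed_piece[OF c1 lab_c_pre[OF T1(4-6,1,2)]])
  have tR: "H \<tturnstile> (w \<^bold>\<in> t) : Propd" by ((assumption | rule T1 typing rels ambient)+)
  have a: "K \<TTurnstile> w \<^bold>\<in> t" if "H \<preceq> K" "K \<TTurnstile> w \<^bold>\<in> ?a" for K
  proof -
    note T2 = T1[THEN lift_deq[OF that(1)]] and GK = ext_trans[OF H(1) that(1)]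
    show ?thesis
    proof (rule pieceE[OF T2(4-6) lab_a_pre[OF T2(4-6,1,2)] T2(8) that(2) lift_deq[OF that(1) tR]])
      fix L k h assume L: "K \<preceq> L" "L \<tturnstile> h : E \<cdot> (lab_a \<^bold># p)" "L \<TTurnstile> w \<^bold>\<in> succd (ih \<cdot> lab_a \<cdot> h)"
      note T3 = T2[THEN lift_deq[OF L(1)]]
      have "L \<TTurnstile> available D s ?g lab_a" unfolding available_eq
        by (rule disjI10, ((assumption | rule T3 typed_fstv typing rels ambient)+)[2], rule eqI0, ((assumption
          | rule typing rels ambient)+))
      then show "L \<TTurnstile> w \<^bold>\<in> t" by (rule mem_targetI[OF ext_trans[OF GK L(1)] T3(8) typed_Label(2) L(2,3)])
    qed
  qed
  have b: "K \<TTurnstile> w \<^bold>\<in> t" if "H \<preceq> K" "K \<TTurnstile> w \<^bold>\<in> ?b" for K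
  proof -
    note T2 = T1[THEN lift_deq[OF that(1)]] and GK = ext_trans[OF H(1) that(1)]
    show ?thesis
    proof (rule pieceE[OF T2(4-6) lab_b_pre[OF T2(4-6,1,2)] T2(8) that(2) lift_deq[OF that(1) tR]])
      fix L j h assume L: "K \<preceq> L" "L \<tturnstile> j : bar (D \<cdot> ?g)" "L \<tturnstile> h : E \<cdot> (lab_b (child (D \<cdot> ?g) j) \<^bold># p)"
        "L \<TTurnstile> w \<^bold>\<in> succd (ih \<cdot> lab_b (child (D \<cdot> ?g) j) \<cdot> h)"
      note T3 = T2[THEN lift_deq[OF L(1)]]
      note Dg = typed_Dfstv[OF T3(4-6,1,2)]
      let ?v = "child (D \<cdot> ?g) j"
      have v: "L \<tturnstile> ?v : V" by (rule typed_child[OF Dg L(2)])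
      have "L \<TTurnstile> available D s ?g (lab_b ?v)" unfolding available_eq
        apply (rule disjI20, ((assumption | rule T3 typed_fstv v Dg L(2) lift_deq[OF ext_Cons(1) Dg] lift_deq[OF
          ext_Cons(1) v] typing rels ambient)+)[2])
        apply (rule disjI10, ((assumption | rule T3 typed_fstv v Dg L(2) lift_deq[OF ext_Cons(1) Dg] lift_deq[OF
          ext_Cons(1) v] typing rels ambient)+)[2])
        apply (rule ex1I[OF typed_V _ _ v], ((assumption | rule T3 typed_fstv v Dg L(2) lift_deq[OF ext_Cons(1)
          Dg] lift_deq[OF ext_Cons(1) v] typing rels ambient)+)[2])
        apply (rule conjI0, ((assumption | rule T3 typed_fstv v Dg L(2) lift_deq[OF ext_Cons(1) Dg] lift_deq[OF
          ext_Cons(1) v] typing rels ambient)+)[2])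
         apply (rule holds_conv[OF bisim_refl[OF v] deq_sym[OF deq_eqv_bb[OF v v]]])
        apply (rule mem_child[OF Dg L(2)])
        done
      then show "L \<TTurnstile> w \<^bold>\<in> t" by (rule mem_targetI[OF ext_trans[OF GK L(1)] T3(8) typed_lab_b[OF v] L(3,4)])
    qed
  qed
  have c: "K \<TTurnstile> w \<^bold>\<in> t" if "H \<preceq> K" "K \<TTurnstile> w \<^bold>\<in> ?c" for K
  proof -
    note T2 = T1[THEN lift_deq[OF that(1)]] and GK = ext_trans[OF H(1) that(1)]
    show ?thesis
    proof (rule pieceE[OF T2(4-6) lab_c_pre[OF T2(4-6,1,2)] T2(8) that(2) lift_deq[OF that(1) tR]])
      fix L j h assume L: "K \<preceq> L" "L \<tturnstile> j : bar s" "L \<tturnstile> h : E \<cdot> (lab_c (child s j) \<^bold># p)" "L \<TTurnstile> w \<^bold>\<in> succd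
        (ih \<cdot> lab_c (child s j) \<cdot> h)"
      note T3 = T2[THEN lift_deq[OF L(1)]]
      note Dg = typed_Dfstv[OF T3(4-6,1,2)]
      let ?v = "child s j"
      have v: "L \<tturnstile> ?v : V" by (rule typed_child[OF T3(2) L(2)])
      have "L \<TTurnstile> available D s ?g (lab_c ?v)" unfolding available_eq
        apply (rule disjI20, ((assumption | rule T3 typed_fstv v Dg L(2) lift_deq[OF ext_Cons(1) Dg] lift_deq[OF
          ext_Cons(1) v] typing rels ambient)+)[2])
        apply (rule disjI20, ((assumption | rule T3 typed_fstv v Dg L(2) lift_deq[OF ext_Cons(1) Dg] lift_deq[OF
          ext_Cons(1) v] typing rels ambient)+)[2])
        apply (rule ex1I[OF typed_V _ _ v], ((assumption | rule T3 typed_fstv v Dg L(2) lift_deq[OF ext_Cons(1)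
          Dg] lift_deq[OF ext_Cons(1) v] typing rels ambient)+)[2])
        apply (rule conjI0, ((assumption | rule T3 typed_fstv v Dg L(2) lift_deq[OF ext_Cons(1) Dg] lift_deq[OF
          ext_Cons(1) v] typing rels ambient)+)[2])
         apply (rule holds_conv[OF bisim_refl[OF v] deq_sym[OF deq_eqv_cc[OF v v]]])
        apply (rule mem_child[OF T3(2) L(2)])
        done
      then show "L \<TTurnstile> w \<^bold>\<in> t" by (rule mem_targetI[OF ext_trans[OF GK L(1)] T3(8) typed_lab_c[OF v] L(3,4)])
    qed
  qed
  show "H \<TTurnstile> w \<^bold>\<in> t"
  proof (rule disjE1[OF unionD[OF ta typed_union[OF tb tc] H(2) H(3)[unfolded body_def]]])
    fix K assume K: "H \<preceq> K" "K \<TTurnstile> w \<^bold>\<in> ?b \<^bold>\<union> ?c"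
    show "K \<TTurnstile> w \<^bold>\<in> t"
    proof (rule disjE1[OF unionD[OF lift_deq[OF K(1) tb] lift_deq[OF K(1) tc] lift_deq[OF K(1) H(2)] K(2)]])
      fix L assume L: "K \<preceq> L" "L \<TTurnstile> w \<^bold>\<in> ?b" then show "L \<TTurnstile> w \<^bold>\<in> t" by (rule b[OF ext_trans[OF K(1)]])
    next
      fix L assume L: "K \<preceq> L" "L \<TTurnstile> w \<^bold>\<in> ?c" then show "L \<TTurnstile> w \<^bold>\<in> t" by (rule c[OF ext_trans[OF K(1)]])
    qed (rule lift_deq[OF K(1) typed_mem[OF H(2) tb]] lift_deq[OF K(1) typed_mem[OF H(2) tc]] lift_deq[OF K(1)
      tR])+
  qed (rule a tR typed_mem typed_union ta tb tc H(2) | assumption)+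
next
  fix H w assume H: "G \<preceq> H" "H \<tturnstile> w : V" "H \<TTurnstile> w \<^bold>\<in> t"
  note T1 = T[THEN lift_deq[OF H(1)]] H(2)
  let ?g = "fstv E p ih"
  have g: "H \<tturnstile> ?g : V" by (rule typed_fstv[OF T1(4-6)])
  let ?R = "w \<^bold>\<in> body D s E p ih"
  let ?Q = "\<lambda>l t'. available D s ?g l \<^bold>\<and> \<tau> \<cdot> (l \<^bold># p) \<cdot> t' \<^bold>\<and> w \<^bold>\<in> succd t'"
  have tR: "H \<tturnstile> ?R : Propd" by (rule typed_mem[OF H(2) typed_body[OF T1(4-6,1,2)]])
  have "H \<TTurnstile> (\<^bold>\<exists>\<^sub>1l : Label. \<^bold>\<exists>\<^sub>1t' : V. ?Q l t')"
    by (rule iffD1_0[OF mem_target_iff[OF H(1,2)] _ _ H(3)]) ((assumption | rule T1 g typing rels ambient)+)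
  then show "H \<TTurnstile> ?R"
  proof (rule ex1E[OF _ typed_Label(1) _ _ tR])
    fix I l assume I: "H \<preceq> I" "I \<tturnstile> l : Label" "I \<TTurnstile> (\<^bold>\<exists>\<^sub>1t' : V. ?Q l t')"
    note T2 = T1[THEN lift_deq[OF I(1)]] I(2) lift_deq[OF I(1) g]
    show "I \<TTurnstile> ?R"
    proof (rule ex1E[OF I(3) typed_V _ _ lift_deq[OF I(1) tR]])
      fix K t' assume K: "I \<preceq> K" "K \<tturnstile> t' : V" "K \<TTurnstile> ?Q l t'"
      note HK = ext_trans[OF I(1) K(1)] and GK = ext_trans[OF H(1) ext_trans[OF I(1) K(1)]]
      note T3 = T2[THEN lift_deq[OF K(1)]] K(2)
      have av: "K \<TTurnstile> available D s ?g l" by (rule conjunct1_0[OF K(3)]) ((assumption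
        | rule T3 typing rels ambient)+)
      have 1: "K \<TTurnstile> \<tau> \<cdot> (l \<^bold># p) \<cdot> t' \<^bold>\<and> w \<^bold>\<in> succd t'" by (rule conjunct2_0[OF K(3)]) ((assumption
        | rule T3 typing rels ambient)+)
      have lt: "K \<TTurnstile> \<tau> \<cdot> (l \<^bold># p) \<cdot> t'" by (rule conjunct1_0[OF 1]) ((assumption | rule T3 typing rels ambient)+)
      have wt: "K \<TTurnstile> w \<^bold>\<in> succd t'" by (rule conjunct2_0[OF 1]) ((assumption | rule T3 typing rels ambient)+)
      let ?a = "piece (closed (Ind Unit_decl)) (\<lambda>_. lab_a) E p ih" and ?b = "piece (bar (D \<cdot> ?g)) (\<lambda>j. lab_b
        (child (D \<cdot> ?g) j)) E p ih"
        and ?c = "piece (bar s) (\<lambda>i. lab_c (child s i)) E p ih"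
      have tp: "L \<tturnstile> ?a : V" "L \<tturnstile> ?b : V" "L \<tturnstile> ?c : V" if "K \<preceq> L" for L
        by (rule lift_deq[OF that], rule typed_piece[OF T3(4-6) lab_a_pre[OF T3(4-6,1,2)]] typed_piece[OF
          T3(4-6) lab_b_pre[OF T3(4-6,1,2)]] typed_piece[OF T3(4-6) lab_c_pre[OF T3(4-6,1,2)]], assumption+)+
      note tRK = lift_deq[OF HK tR]
      have Dg: "K \<tturnstile> D \<cdot> ?g : V" by (rule typed_Dfstv[OF T3(4-6,1,2)])
      show "K \<TTurnstile> ?R"
      proof (rule disjE1[OF av[unfolded available_eq]])
        fix L assume L: "K \<preceq> L" "L \<TTurnstile> eqd 2 Label l lab_a"
        note T4 = T3[THEN lift_deq[OF L(1)]] and GL = ext_trans[OF GK L(1)]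
        \<comment> \<open>For the first label, availability is an equality and not an equivalence,
          so the target is moved by \<open>eq_elim0\<close>.\<close>
        have "L \<TTurnstile> \<tau> \<cdot> (lab_a \<^bold># p) \<cdot> t'"
          by (rule eq_elim0[of L 2 Label l lab_a "\<lambda>l. \<tau> \<cdot> (l \<^bold># p) \<cdot> t'", OF L(2) typed_Label(1) T4(9)
            typed_Label(2) _ lift_holds[OF L(1) lt]], rule famI) ((assumption | rule T4 typing rels ambient)+)
        from target_succ[OF GL T4(8) typed_Label(2) T4(11) this lift_holds[OF L(1) wt]]
        obtain h where h: "L \<tturnstile> h : E \<cdot> (lab_a \<^bold># p)" "L \<TTurnstile> w \<^bold>\<in> succd (ih \<cdot> lab_a \<cdot> h)" by blast
        show "L \<TTurnstile> ?R" unfolding body_def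
          by (rule unionI1[OF tp(1)[OF L(1)] typed_union[OF tp(2,3)[OF L(1)]] T4(8)
                pieceI[OF T4(4-6) lab_a_pre[OF T4(4-6,1,2)] T4(8) typed_Unit(2) h]]) assumption+
      next
        let ?B = "\<^bold>\<exists>\<^sub>1v : V. l \<^bold>\<sim> lab_b v \<^bold>\<and> v \<^bold>\<in> D \<cdot> ?g" and ?C = "\<^bold>\<exists>\<^sub>1v : V. l \<^bold>\<sim> lab_c v \<^bold>\<and> v \<^bold>\<in> s"
        fix L0 assume L0: "K \<preceq> L0" "L0 \<TTurnstile> ?B \<^bold>\<or> ?C"
        note T4 = T3[THEN lift_deq[OF L0(1)]] lift_deq[OF L0(1) Dg]
        have tB: "L0 \<tturnstile> ?B : Propd" and tC: "L0 \<tturnstile> ?C : Propd"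
          by ((assumption | rule T4 lift_deq[OF ext_Cons(1) T4(12)] typing rels ambient)+)
        show "L0 \<TTurnstile> ?R"
        proof (rule disjE1[OF L0(2) tB tC lift_deq[OF L0(1) tRK]])
          fix L assume L: "L0 \<preceq> L" "L \<TTurnstile> ?B"
          note T5 = T4[THEN lift_deq[OF L(1)]] and KL = ext_trans[OF L0(1) L(1)]
          show "L \<TTurnstile> ?R"
          proof (rule ex1E[OF L(2) typed_V _ _ lift_deq[OF KL tRK]])
            fix M v assume M: "L \<preceq> M" "M \<tturnstile> v : V" "M \<TTurnstile> l \<^bold>\<sim> lab_b v \<^bold>\<and> v \<^bold>\<in> D \<cdot> ?g"
            note T6 = T5[THEN lift_deq[OF M(1)]] M(2) and KM = ext_trans[OF KL M(1)]
            have l: "M \<TTurnstile> l \<^bold>\<sim> lab_b v" by (rule conjunct1_0[OF M(3)]) ((assumption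
              | rule T6 typing rels ambient)+)
            have v: "M \<TTurnstile> v \<^bold>\<in> D \<cdot> ?g" by (rule conjunct2_0[OF M(3)]) ((assumption
              | rule T6 typing rels ambient)+)
            show "M \<TTurnstile> ?R"
            proof (rule memE[OF v M(2) T6(12) lift_deq[OF KM tRK]])
              fix N j assume N: "M \<preceq> N" "N \<tturnstile> j : bar (D \<cdot> ?g)" "N \<TTurnstile> v \<^bold>\<approx> child (D \<cdot> ?g) j"
              note T7 = T6[THEN lift_deq[OF N(1)]] and KN = ext_trans[OF KM N(1)]
              let ?l = "lab_b (child (D \<cdot> ?g) j)"
              have cj: "N \<tturnstile> child (D \<cdot> ?g) j : V" by (rule typed_child[OF T7(12) N(2)])
              \<comment> \<open>The label \<open>l\<close> itself is no index. It is traded for the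
                label of a child of \<open>D \<cdot> ?g\<close>, which is one.\<close>
              have "N \<TTurnstile> l \<^bold>\<sim> ?l" by (rule lab_eqv_b[OF T7(9,13) cj N(3) lift_holds[OF N(1) l]])
              from coh_eqv[OF T7(1-3) lift_holds[OF ext_trans[OF GK KN] coh] T7(5,11,9) typed_lab_b[OF cj] this
                lift_holds[OF KN lt]]
              have "N \<TTurnstile> \<tau> \<cdot> (?l \<^bold># p) \<cdot> t'" .
              from target_succ[OF ext_trans[OF GK KN] T7(8) typed_lab_b[OF cj] T7(11) this lift_holds[OF KN wt]]
              obtain h where h: "N \<tturnstile> h : E \<cdot> (?l \<^bold># p)" "N \<TTurnstile> w \<^bold>\<in> succd (ih \<cdot> ?l \<cdot> h)" by blast
              have "N \<TTurnstile> w \<^bold>\<in> ?b"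
                by (rule pieceI[OF T7(4-6) lab_b_pre[OF T7(4-6,1,2)] T7(8) N(2) h]) assumption+
              then show "N \<TTurnstile> ?R" unfolding body_def
                by (rule unionI2[OF tp(1)[OF KN] typed_union[OF tp(2,3)[OF KN]] T7(8) unionI1[OF tp(2,3)[OF KN]
                  T7(8)]])
            qed
          qed ((assumption | rule T5 lift_deq[OF ext_Cons(1) T5(12)] typing rels ambient)+)
        next
          fix L assume L: "L0 \<preceq> L" "L \<TTurnstile> ?C"
          note T5 = T4[THEN lift_deq[OF L(1)]] and KL = ext_trans[OF L0(1) L(1)]
          show "L \<TTurnstile> ?R"
          proof (rule ex1E[OF L(2) typed_V _ _ lift_deq[OF KL tRK]])
            fix M v assume M: "L \<preceq> M" "M \<tturnstile> v : V" "M \<TTurnstile> l \<^bold>\<sim> lab_c v \<^bold>\<and> v \<^bold>\<in> s"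
            note T6 = T5[THEN lift_deq[OF M(1)]] M(2) and KM = ext_trans[OF KL M(1)]
            have l: "M \<TTurnstile> l \<^bold>\<sim> lab_c v" by (rule conjunct1_0[OF M(3)]) ((assumption
              | rule T6 typing rels ambient)+)
            have v: "M \<TTurnstile> v \<^bold>\<in> s" by (rule conjunct2_0[OF M(3)]) ((assumption | rule T6 typing rels ambient)+)
            show "M \<TTurnstile> ?R"
            proof (rule memE[OF v M(2) T6(2) lift_deq[OF KM tRK]])
              fix N j assume N: "M \<preceq> N" "N \<tturnstile> j : bar s" "N \<TTurnstile> v \<^bold>\<approx> child s j"
              note T7 = T6[THEN lift_deq[OF N(1)]] and KN = ext_trans[OF KM N(1)]
              let ?l = "lab_c (child s j)"
              have cj: "N \<tturnstile> child s j : V" by (rule typed_child[OF T7(2) N(2)])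
              have "N \<TTurnstile> l \<^bold>\<sim> ?l" by (rule lab_eqv_c[OF T7(9,13) cj N(3) lift_holds[OF N(1) l]])
              from coh_eqv[OF T7(1-3) lift_holds[OF ext_trans[OF GK KN] coh] T7(5,11,9) typed_lab_c[OF cj] this
                lift_holds[OF KN lt]]
              have "N \<TTurnstile> \<tau> \<cdot> (?l \<^bold># p) \<cdot> t'" .
              from target_succ[OF ext_trans[OF GK KN] T7(8) typed_lab_c[OF cj] T7(11) this lift_holds[OF KN wt]]
              obtain h where h: "N \<tturnstile> h : E \<cdot> (?l \<^bold># p)" "N \<TTurnstile> w \<^bold>\<in> succd (ih \<cdot> ?l \<cdot> h)" by blast
              have "N \<TTurnstile> w \<^bold>\<in> ?c"
                by (rule pieceI[OF T7(4-6) lab_c_pre[OF T7(4-6,1,2)] T7(8) N(2) h]) assumption+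
              then show "N \<TTurnstile> ?R" unfolding body_def
                by (rule unionI2[OF tp(1)[OF KN] typed_union[OF tp(2,3)[OF KN]] T7(8) unionI2[OF tp(2,3)[OF KN]
                  T7(8)]])
            qed
          qed ((assumption | rule T5 lift_deq[OF ext_Cons(1) T5(12)] typing rels ambient)+)
        qed
      next
        show "K \<tturnstile> eqd 2 Label l lab_a : Propd" by ((assumption | rule T3 typing rels ambient)+)
        show "K \<tturnstile> ((\<^bold>\<exists>\<^sub>1v : V. l \<^bold>\<sim> lab_b v \<^bold>\<and> v \<^bold>\<in> D \<cdot> ?g) \<^bold>\<or> (\<^bold>\<exists>\<^sub>1v : V. l \<^bold>\<sim> lab_c v \<^bold>\<and> v \<^bold>\<in> s)) : Propd"
          by ((assumption | rule T3 Dg lift_deq[OF ext_Cons(1) Dg] typing rels ambient)+)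
        show "K \<tturnstile> ?R : Propd" by (rule tRK)
      qed
    qed ((assumption | rule T2 typing rels ambient)+)
  qed ((assumption | rule T1 g typing rels ambient)+)
qed

end

text \<open>This is the reason why \<open>mkA\<close> contains a proof that its own path lies in
  \<open>E\<close>: applied to the root in the proof of replacement, it supplies a value
  \<eta>.\<close>

lemma Acc_E:
  assumes "G \<tturnstile> E : (\<^bold>\<forall>_ : Path. Propd)" "G \<tturnstile> p : Path" "G \<tturnstile> x : Accd E p"
  shows "G \<TTurnstile> E \<cdot> p"
proof (rule Acc_ind[where P = "\<lambda>p x. E \<cdot> p", OF assms(1) _ _ assms(2,3)])
  show "uni2 (length G) (\<lambda>p x. E \<cdot> p)" by (rule uni2I) ((assumption | rule assms(1) typing rels ambient)+)
  show "H \<tturnstile> E \<cdot> p : Propd" if "G \<preceq> H" "H \<tturnstile> p : Path" for H p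
    by (rule typed_app_Path[OF lift_deq[OF that(1) assms(1)] that(2)])
qed (erule holdsI)

section \<open>Values and accessibility of paths with a target\<close>

context
  fixes G :: "tmd list" and D s \<tau> E :: tmd
  assumes tD: "G \<tturnstile> D : (\<^bold>\<forall>_ : V. V)" and ts: "G \<tturnstile> s : V" and tt: "G \<tturnstile> \<tau> : (\<^bold>\<forall>_ : Path. \<^bold>\<forall>_ : V. Propd)"
    and tE: "G \<tturnstile> E : (\<^bold>\<forall>_ : Path. Propd)" and coh: "G \<TTurnstile> coherent D s \<tau>"
    and E1: "\<And>H p t. G \<preceq> H \<Longrightarrow> H \<tturnstile> p : Path \<Longrightarrow> H \<tturnstile> t : V \<Longrightarrow> H \<TTurnstile> \<tau> \<cdot> p \<cdot> t \<Longrightarrow> H \<TTurnstile> E \<cdot> p"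
    and E2: "\<And>H p h. G \<preceq> H \<Longrightarrow> H \<tturnstile> p : Path \<Longrightarrow> H \<tturnstile> h : E \<cdot> p \<Longrightarrow> H \<TTurnstile> (\<^bold>\<exists>\<^sub>1t : V. \<tau> \<cdot> p \<cdot> t)"
begin

lemmas T0 = tD ts tt tE

text \<open>At \<open>mkA\<close> the value unfolds to the body over the values of the children; the
  induction hypothesis makes these bisimilar to their targets, as \<open>body_target\<close>
  requires. The result holds for every proof \<open>x\<close> of accessibility, so the value is
  independent of it up to bisimilarity.\<close>

lemma val_target:
  assumes p: "G \<tturnstile> p : Path" and x: "G \<tturnstile> x : Accd E p" and t: "G \<tturnstile> t : V" "G \<TTurnstile> \<tau> \<cdot> p \<cdot> t"
  shows "G \<TTurnstile> val D s E \<cdot> p \<cdot> x \<^bold>\<approx> t"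
proof -
  \<comment> \<open>The targets of the children differ from \<open>t\<close>, so the target is
    quantified inside the motive.\<close>
  let ?P = "\<lambda>p x. \<^bold>\<forall>t : V. (\<tau> \<cdot> p \<cdot> t \<^bold>\<rightarrow> val D s E \<cdot> p \<cdot> x \<^bold>\<approx> t)"
  have vt: "H \<tturnstile> val D s E \<cdot> p \<cdot> x : V" if "G \<preceq> H" "H \<tturnstile> p : Path" "H \<tturnstile> x : Accd E p" for H p x
    by (rule typed_eqI, (assumption | rule that typed_val[OF lift_deq[OF that(1) tE] lift_deq[OF that(1) tD]
      lift_deq[OF that(1) ts]] tE typing rels ambient | erule good_tls | rule lift_deq lift_fam good_ext,
      (assumption | rule that typed_val[OF lift_deq[OF that(1) tE] lift_deq[OF that(1) tD] lift_deq[OF that(1)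
      ts]] tE))+, rule refl)
  have tP: "H \<tturnstile> ?P p x : Propd" if "G \<preceq> H" "H \<tturnstile> p : Path" "H \<tturnstile> x : Accd E p" for H p x
    by ((assumption | rule that weak[OF vt[OF that]] T0 typing rels ambient | erule good_tls
      | rule lift_deq lift_fam good_ext, (assumption | rule that weak[OF vt[OF that]] T0))+)
  have "G \<TTurnstile> ?P p x"
  proof (rule Acc_ind[of _ _ ?P, OF tE _ tP p x], rule uni2I, ((assumption | rule T0 typing rels ambient)+))
    fix H p e k assume H: "G \<preceq> H" "H \<tturnstile> p : Path" "H \<tturnstile> e : E \<cdot> p" "H \<tturnstile> k : (\<^bold>\<forall>l : Label. \<^bold>\<forall>h : E \<cdot> (l \<^bold># p). Accd E
      (l \<^bold># p))"
      and IH: "\<And>H' l h. H \<preceq> H' \<Longrightarrow> H' \<tturnstile> l : Label \<Longrightarrow> H' \<tturnstile> h : E \<cdot> (l \<^bold># p) \<Longrightarrow> H' \<TTurnstile> ?P (l \<^bold># p) (k \<cdot> l \<cdot> h)"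
    note T1 = T0[THEN lift_deq[OF H(1)]] H(2-4)
    have mk: "H \<tturnstile> mkA E p e k : Accd E p" by (rule typed_eqI, (assumption | rule T1 typing rels ambient)+,
      rule refl)
    show "H \<TTurnstile> ?P p (mkA E p e k)"
    proof (rule allI1[OF typed_V], ((assumption | rule T1 typing rels ambient)+)[1], rule impI1)
      fix H1 t assume H1: "H \<preceq> H1" "H1 \<tturnstile> t : V"
      note T2 = T1[THEN lift_deq[OF H1(1)]] H1(2)
      show "H1 \<tturnstile> \<tau> \<cdot> p \<cdot> t : Propd" by (rule typed_target[OF T2(3,5,8)])
      show "H1 \<tturnstile> (val D s E \<cdot> p \<cdot> mkA E p e k \<^bold>\<approx> t) : Propd"
        by (rule typed_bisim[OF vt[OF ext_trans[OF H(1) H1(1)] T2(5) lift_deq[OF H1(1) mk]] T2(8)])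
      fix H2 assume H2: "H1 \<preceq> H2" "H2 \<TTurnstile> \<tau> \<cdot> p \<cdot> t"
      note GH2 = ext_trans[OF H(1) ext_trans[OF H1(1) H2(1)]]
      note T3 = T2[THEN lift_deq[OF H2(1)]]
      note v = typed_val[OF T3(4,1,2)]
      let ?ih = "\<^bold>\<lambda>l : Label. \<^bold>\<lambda>h : E \<cdot> (l \<^bold># p). val D s E \<cdot> (l \<^bold># p) \<cdot> (k \<cdot> l \<cdot> h)"
      have ih: "H2 \<tturnstile> ?ih : (\<^bold>\<forall>l : Label. \<^bold>\<forall>h : E \<cdot> (l \<^bold># p). V)" by ((assumption | rule T3 v typing rels ambient)+)
      have "H2 \<TTurnstile> body D s E p ?ih \<^bold>\<approx> t"
      proof (rule body_target[OF T3(1-4) lift_holds[OF GH2 coh] E1[OF ext_trans[OF GH2]] E2[OF ext_trans[OF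
        GH2]] T3(5) ih T3(8) H2(2)])
        fix K l h t' assume K: "H2 \<preceq> K" "K \<tturnstile> l : Label" "K \<tturnstile> h : E \<cdot> (l \<^bold># p)" "K \<tturnstile> t' : V" "K \<TTurnstile> \<tau> \<cdot>
          (l \<^bold># p) \<cdot> t'"
        note T4 = T3[THEN lift_deq[OF K(1)]]
        have lp: "K \<tturnstile> l \<^bold># p : Path" by ((assumption | rule T4 K(2) typing rels ambient)+)
        have klh: "K \<tturnstile> k \<cdot> l \<cdot> h : Accd E (l \<^bold># p)" by (rule typed_eqI, (assumption
          | rule T4 K(2,3) typing rels ambient)+, rule refl)
        note vl = vt[OF ext_trans[OF GH2 K(1)] lp klh]
        have b: "K \<tturnstile> ?ih \<cdot> l \<cdot> h \<equiv> val D s E \<cdot> (l \<^bold># p) \<cdot> (k \<cdot> l \<cdot> h) : V"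
          by (rule beta_step[OF deq_beta[OF lift_deq[OF K(1) ih]]]) ((assumption
            | rule T4 K(2,3) typing rels ambient)+)
        have "K \<TTurnstile> \<tau> \<cdot> (l \<^bold># p) \<cdot> t' \<^bold>\<rightarrow> val D s E \<cdot> (l \<^bold># p) \<cdot> (k \<cdot> l \<cdot> h) \<^bold>\<approx> t'"
          by (rule allE0[OF IH[OF ext_trans[OF H1(1) ext_trans[OF H2(1) K(1)]] K(2,3)] K(4)]) ((assumption
            | rule T4 K(2,3) typing rels ambient)+)
        from mp0[OF this K(5) typed_bisim[OF vl K(4)]]
        show "K \<TTurnstile> ?ih \<cdot> l \<cdot> h \<^bold>\<approx> t'" by (rule holds_conv[OF _ deq_bisim[OF deq_sym[OF b] K(4)]])
      qed
      then show "H2 \<TTurnstile> val D s E \<cdot> p \<cdot> mkA E p e k \<^bold>\<approx> t"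
        by (rule holds_conv[OF _ deq_bisim[OF deq_sym[OF deq_val[OF T3(4,1,2,5-7)]] T3(8)]])
    qed
  qed
  then have "G \<TTurnstile> \<tau> \<cdot> p \<cdot> t \<^bold>\<rightarrow> val D s E \<cdot> p \<cdot> x \<^bold>\<approx> t"
    by (rule allE0[OF _ t(1)]) ((assumption | rule T0 p x typing rels ambient)+)
  from mp0[OF this t(2) typed_bisim[OF vt[OF ext_refl p x] t(1)]] show ?thesis .
qed

text \<open>The induction is on the target as a set. The target of a child is a member by clause
  (3), hence bisimilar to some \<open>child t i\<close>, and by clause (1) this
  \<open>child t i\<close> is itself a target of the child path, to which the induction hypothesis
  applies.\<close>

lemma Acc_target:
  assumes p: "G \<tturnstile> p : Path" and t: "G \<tturnstile> t : V" "G \<TTurnstile> \<tau> \<cdot> p \<cdot> t"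
  shows "G \<TTurnstile> Accd E p"
proof -
  let ?P = "\<lambda>t. \<^bold>\<forall>p : Path. (\<tau> \<cdot> p \<cdot> t \<^bold>\<rightarrow> Accd E p)"
  have Ac: "H \<tturnstile> Accd E p : Propd" if "G \<preceq> H" "H \<tturnstile> p : Path" for H p
    by (rule typed_eqI, (assumption | rule tE that typing rels ambient | erule good_tls
      | rule lift_deq lift_fam good_ext, (assumption | rule tE that))+, rule refl)
  have "G \<TTurnstile> ?P t"
  proof (rule V_ind[of _ ?P, OF _ t(1)])
    show "fam G V ?P 0" by (rule famI[OF typed_V]) ((assumption | rule T0 Ac ext_Cons typing rels ambient)+)
    fix H t assume H: "G \<preceq> H" "H \<tturnstile> t : V" and IH: "\<And>H' i. H \<preceq> H' \<Longrightarrow> H' \<tturnstile> i : bar t \<Longrightarrow> H' \<TTurnstile> ?P (child t i)"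
    note T1 = T0[THEN lift_deq[OF H(1)]] H(2)
    show "H \<TTurnstile> ?P t"
    proof (rule allI1[OF typed_Path], ((assumption | rule T1 typing rels ambient)+)[1], rule impI1)
      fix H1 p assume H1: "H \<preceq> H1" "H1 \<tturnstile> p : Path"
      note T2 = T1[THEN lift_deq[OF H1(1)]] H1(2)
      show "H1 \<tturnstile> \<tau> \<cdot> p \<cdot> t : Propd" by (rule typed_target[OF T2(3,6,5)])
      show "H1 \<tturnstile> Accd E p : Propd" by (rule Ac[OF ext_trans[OF H(1) H1(1)] H1(2)])
      fix H2 assume H2: "H1 \<preceq> H2" "H2 \<TTurnstile> \<tau> \<cdot> p \<cdot> t"
      note GH2 = ext_trans[OF H(1) ext_trans[OF H1(1) H2(1)]] and HH2 = ext_trans[OF H1(1) H2(1)]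
      note T3 = T2[THEN lift_deq[OF H2(1)]]
      have "H2 \<TTurnstile> (\<^bold>\<forall>l : Label. \<^bold>\<forall>h : E \<cdot> (l \<^bold># p). Accd E (l \<^bold># p))"
      proof (rule allI1[OF typed_Label(1)], ((assumption | rule T3 typing rels ambient)+)[1])
        fix H3 l assume H3: "H2 \<preceq> H3" "H3 \<tturnstile> l : Label"
        note T4 = T3[THEN lift_deq[OF H3(1)]] H3(2)
        have lp: "H3 \<tturnstile> l \<^bold># p : Path" by ((assumption | rule T4 typing rels ambient)+)
        show "H3 \<TTurnstile> (\<^bold>\<forall>h : E \<cdot> (l \<^bold># p). Accd E (l \<^bold># p))"
        proof (rule allI1, rule typed_app_Path[OF T4(4) lp], ((assumption | rule T4 typing rels ambient)+)[1])
          fix H4 h assume H4: "H3 \<preceq> H4" "H4 \<tturnstile> h : E \<cdot> (l \<^bold># p)"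
          note T5 = T4[THEN lift_deq[OF H4(1)]] lift_deq[OF H4(1) lp] and H24 = ext_trans[OF H3(1) H4(1)]
          note G4 = ext_trans[OF GH2 H24]
          note R = Ac[OF G4 T5(8)]
          show "H4 \<TTurnstile> Accd E (l \<^bold># p)"
          proof (rule ex1E[OF E2[OF G4 T5(8) H4(2)] typed_V _ _ R])
            fix K t' assume K: "H4 \<preceq> K" "K \<tturnstile> t' : V" "K \<TTurnstile> \<tau> \<cdot> (l \<^bold># p) \<cdot> t'"
            note T6 = T5[THEN lift_deq[OF K(1)]] and GK = ext_trans[OF G4 K(1)]
            have m: "K \<TTurnstile> t' \<^bold>\<in> t"
              by (rule coh_mem[OF T6(1-3) lift_holds[OF GK coh] T6(6) K(2) T6(5,7) K(3) lift_holds[OF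
                ext_trans[OF H24 K(1)] H2(2)]])
            show "K \<TTurnstile> Accd E (l \<^bold># p)"
            proof (rule memE[OF m K(2) T6(5) lift_deq[OF K(1) R]])
              fix L i assume L: "K \<preceq> L" "L \<tturnstile> i : bar t" "L \<TTurnstile> t' \<^bold>\<approx> child t i"
              note T7 = T6[THEN lift_deq[OF L(1)]] lift_deq[OF L(1) K(2)] and GL = ext_trans[OF GK L(1)]
              have c: "L \<tturnstile> child t i : V" by (rule typed_child[OF T7(5) L(2)])
              have "L \<TTurnstile> \<tau> \<cdot> (l \<^bold># p) \<cdot> child t i"
                by (rule coh_closed[OF T7(1-3) lift_holds[OF GL coh] T7(8,9) c lift_holds[OF L(1) K(3)] L(3)])
              moreover have "L \<TTurnstile> \<tau> \<cdot> (l \<^bold># p) \<cdot> child t i \<^bold>\<rightarrow> Accd E (l \<^bold># p)"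
                by (rule allE0[OF IH[OF ext_trans[OF HH2 ext_trans[OF H24 ext_trans[OF K(1) L(1)]]] L(2)]
                  T7(8)]) ((assumption | rule T7 L(2) c typing rels ambient)+)
              ultimately show "L \<TTurnstile> Accd E (l \<^bold># p)"
                by (intro mp0[OF _ _ Ac[OF GL T7(8)]])
            qed
          qed ((assumption | rule T5 typing rels ambient)+)
        qed
      qed
      then obtain k where k: "H2 \<tturnstile> k : (\<^bold>\<forall>l : Label. \<^bold>\<forall>h : E \<cdot> (l \<^bold># p). Accd E (l \<^bold># p))" by (auto simp: holds_def)
      \<comment> \<open>\<open>mkA\<close> also asks that \<open>p\<close> itself lie in the domain,
        which its target provides.\<close>
      from E1[OF GH2 T3(6,5) H2(2)] obtain e where e: "H2 \<tturnstile> e : E \<cdot> p" by (auto simp: holds_def)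
      have "H2 \<tturnstile> mkA E p e k : Accd E p" by (rule typed_eqI, (assumption | rule T3 e k typing rels ambient)+,
        rule refl)
      then show "H2 \<TTurnstile> Accd E p" by (rule holdsI)
    qed
  qed
  then have "G \<TTurnstile> \<tau> \<cdot> p \<cdot> t \<^bold>\<rightarrow> Accd E p"
    by (rule allE0[OF _ p]) ((assumption | rule T0 t(1) typing rels ambient)+)
  from mp0[OF this t(2) Ac[OF ext_refl p]] show ?thesis .
qed

end

section \<open>Replacement\<close>

lemma rel_coherent [rels]: "rel \<theta> k D D' \<Longrightarrow> rel \<theta> k U U' \<Longrightarrow> rel \<theta> k \<tau> \<tau>' \<Longrightarrow> rel \<theta> k (coherent D U \<tau>) (coherent D'
  U' \<tau>')"
  unfolding coherent_def by (assumption | rule rels rel_shift)+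

lemma typed_coherent [typing]: "G \<tturnstile> D : (\<^bold>\<forall>_ : V. V) \<Longrightarrow> G \<tturnstile> U : V \<Longrightarrow> G \<tturnstile> \<tau> : (\<^bold>\<forall>_ : Path. \<^bold>\<forall>_ : V. Propd)
  \<Longrightarrow> G \<tturnstile> coherent D U \<tau> : Propd"
  unfolding coherent_def by ((assumption | rule typing rels ambient)+)

text \<open>Naming the hypotheses lets the scoping and typing rules treat each of them as a
  unit.\<close>

definition "hypT T = (\<^bold>\<forall>\<eta> : V. \<^bold>\<forall>\<eta>' : V. (\<eta> \<^bold>\<approx> \<eta>' \<^bold>\<rightarrow>
           (\<^bold>\<forall>p : Path. \<^bold>\<forall>t : V. (T \<cdot> \<eta> \<cdot> p \<cdot> t \<^bold>\<leftrightarrow> T \<cdot> \<eta>' \<cdot> p \<cdot> t))))"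
definition "hypC D s C T = (\<^bold>\<forall>\<eta> : V. (C \<cdot> \<eta> \<^bold>\<rightarrow> coherent D s (T \<cdot> \<eta>) \<^bold>\<and> T \<cdot> \<eta> \<cdot> root \<cdot> \<eta>))"
definition "hyp_ext \<phi> = (\<^bold>\<forall>x : V. \<^bold>\<forall>x' : V. \<^bold>\<forall>y : V. \<^bold>\<forall>y' : V.
              (x \<^bold>\<approx> x' \<^bold>\<rightarrow> y \<^bold>\<approx> y' \<^bold>\<rightarrow> \<phi> \<cdot> x \<cdot> y \<^bold>\<rightarrow> \<phi> \<cdot> x' \<cdot> y'))"
definition "hyp_fun s \<phi> = (\<^bold>\<forall>x : V. (x \<^bold>\<in> s \<^bold>\<rightarrow> (\<^bold>\<forall>y : V. \<^bold>\<forall>y' : V.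
              (\<phi> \<cdot> x \<cdot> y \<^bold>\<rightarrow> \<phi> \<cdot> x \<cdot> y' \<^bold>\<rightarrow> y \<^bold>\<approx> y'))))"
definition "hyp_val s C \<phi> = (\<^bold>\<forall>x : V. \<^bold>\<forall>y : V. (x \<^bold>\<in> s \<^bold>\<rightarrow> \<phi> \<cdot> x \<cdot> y \<^bold>\<rightarrow> C \<cdot> y))"
definition "concl s \<phi> = (\<^bold>\<exists>\<^sub>1z : V. \<^bold>\<forall>y : V. (y \<^bold>\<in> z \<^bold>\<leftrightarrow> (\<^bold>\<exists>\<^sub>1x : V. x \<^bold>\<in> s \<^bold>\<and> \<phi> \<cdot> x \<cdot> y)))"

lemmas hyp_defs = hypT_def hypC_def hyp_ext_def hyp_fun_def hyp_val_def concl_def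

lemma rel_hyps [rels]:
  "rel \<theta> k T T' \<Longrightarrow> rel \<theta> k (hypT T) (hypT T')"
  "rel \<theta> k D D' \<Longrightarrow> rel \<theta> k s s' \<Longrightarrow> rel \<theta> k C C' \<Longrightarrow> rel \<theta> k T T' \<Longrightarrow> rel \<theta> k (hypC D s C T) (hypC D' s' C' T')"
  "rel \<theta> k \<phi> \<phi>' \<Longrightarrow> rel \<theta> k (hyp_ext \<phi>) (hyp_ext \<phi>')"
  "rel \<theta> k s s' \<Longrightarrow> rel \<theta> k \<phi> \<phi>' \<Longrightarrow> rel \<theta> k (hyp_fun s \<phi>) (hyp_fun s' \<phi>')"
  "rel \<theta> k s s' \<Longrightarrow> rel \<theta> k C C' \<Longrightarrow> rel \<theta> k \<phi> \<phi>' \<Longrightarrow> rel \<theta> k (hyp_val s C \<phi>) (hyp_val s' C' \<phi>')"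
  "rel \<theta> k s s' \<Longrightarrow> rel \<theta> k \<phi> \<phi>' \<Longrightarrow> rel \<theta> k (concl s \<phi>) (concl s' \<phi>')"
  unfolding hyp_defs by (assumption | rule rels rel_shift)+

lemma typed_hyps [typing]:
  "G \<tturnstile> T : (\<^bold>\<forall>_ : V. \<^bold>\<forall>_ : Path. \<^bold>\<forall>_ : V. Propd) \<Longrightarrow> G \<tturnstile> hypT T : Propd"
  "G \<tturnstile> D : (\<^bold>\<forall>_ : V. V) \<Longrightarrow> G \<tturnstile> s : V \<Longrightarrow> G \<tturnstile> C : (\<^bold>\<forall>_ : V. Propd) \<Longrightarrow> G \<tturnstile> T : (\<^bold>\<forall>_ : V. \<^bold>\<forall>_ : Path. \<^bold>\<forall>_ : V. Propd)
    \<Longrightarrow> G \<tturnstile> hypC D s C T : Propd"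
  "G \<tturnstile> \<phi> : (\<^bold>\<forall>_ : V. \<^bold>\<forall>_ : V. Propd) \<Longrightarrow> G \<tturnstile> hyp_ext \<phi> : Propd"
  "G \<tturnstile> s : V \<Longrightarrow> G \<tturnstile> \<phi> : (\<^bold>\<forall>_ : V. \<^bold>\<forall>_ : V. Propd) \<Longrightarrow> G \<tturnstile> hyp_fun s \<phi> : Propd"
  "G \<tturnstile> s : V \<Longrightarrow> G \<tturnstile> C : (\<^bold>\<forall>_ : V. Propd) \<Longrightarrow> G \<tturnstile> \<phi> : (\<^bold>\<forall>_ : V. \<^bold>\<forall>_ : V. Propd) \<Longrightarrow> G \<tturnstile> hyp_val s C \<phi> : Propd"
  "G \<tturnstile> s : V \<Longrightarrow> G \<tturnstile> \<phi> : (\<^bold>\<forall>_ : V. \<^bold>\<forall>_ : V. Propd) \<Longrightarrow> G \<tturnstile> concl s \<phi> : Propd"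
  unfolding hyp_defs by ((assumption | rule typing rels ambient)+)+

context
  fixes G :: "tmd list" and D s C T \<phi> :: tmd
  assumes tD: "G \<tturnstile> D : (\<^bold>\<forall>_ : V. V)" and ts: "G \<tturnstile> s : V" and tC: "G \<tturnstile> C : (\<^bold>\<forall>_ : V. Propd)"
    and tT: "G \<tturnstile> T : (\<^bold>\<forall>_ : V. \<^bold>\<forall>_ : Path. \<^bold>\<forall>_ : V. Propd)" and tp: "G \<tturnstile> \<phi> : (\<^bold>\<forall>_ : V. \<^bold>\<forall>_ : V. Propd)"
begin

lemmas TT = tD ts tC tT tp

lemma typed_T: "G \<tturnstile> x : V \<Longrightarrow> G \<tturnstile> T \<cdot> x : (\<^bold>\<forall>_ : Path. \<^bold>\<forall>_ : V. Propd)"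
  by (rule typed_eqI, (assumption | rule TT typing rels ambient)+, rule refl)
lemma hypT_D:
  assumes "G \<TTurnstile> hypT T" "G \<TTurnstile> x \<^bold>\<approx> y" "G \<TTurnstile> T \<cdot> x \<cdot> p \<cdot> t" and t: "G \<tturnstile> x : V" "G \<tturnstile> y : V" "G \<tturnstile> p : Path" "G \<tturnstile> t : V"
  shows "G \<TTurnstile> T \<cdot> y \<cdot> p \<cdot> t"
proof -
  let ?R = "\<lambda>x y. \<^bold>\<forall>p : Path. \<^bold>\<forall>t : V. (T \<cdot> x \<cdot> p \<cdot> t \<^bold>\<leftrightarrow> T \<cdot> y \<cdot> p \<cdot> t)"
  have "G \<TTurnstile> (\<^bold>\<forall>y : V. (x \<^bold>\<approx> y \<^bold>\<rightarrow> ?R x y))" by (rule allE0[OF assms(1)[unfolded hypT_def] t(1)]) ((assumption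
    | rule TT t typing rels ambient)+)
  then have "G \<TTurnstile> x \<^bold>\<approx> y \<^bold>\<rightarrow> ?R x y" by (rule allE0[OF _ t(2)]) ((assumption | rule TT t typing rels ambient)+)
  then have "G \<TTurnstile> ?R x y" by (rule mp0[OF _ assms(2)]) ((assumption | rule TT t typing rels ambient)+)
  then have "G \<TTurnstile> (\<^bold>\<forall>t : V. (T \<cdot> x \<cdot> p \<cdot> t \<^bold>\<leftrightarrow> T \<cdot> y \<cdot> p \<cdot> t))" by (rule allE0[OF _ t(3)]) ((assumption
    | rule TT t typing rels ambient)+)
  then have "G \<TTurnstile> T \<cdot> x \<cdot> p \<cdot> t \<^bold>\<leftrightarrow> T \<cdot> y \<cdot> p \<cdot> t" by (rule allE0[OF _ t(4)]) ((assumption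
    | rule TT t typing rels ambient)+)
  then show ?thesis by (rule iffD1_0[OF _ _ _ assms(3)]) ((assumption | rule TT t typing rels ambient)+)
qed

lemma hypC_D:
  assumes "G \<TTurnstile> hypC D s C T" "G \<TTurnstile> C \<cdot> x" and t: "G \<tturnstile> x : V"
  shows "G \<TTurnstile> coherent D s (T \<cdot> x)" "G \<TTurnstile> T \<cdot> x \<cdot> root \<cdot> x"
proof -
  have "G \<TTurnstile> C \<cdot> x \<^bold>\<rightarrow> coherent D s (T \<cdot> x) \<^bold>\<and> T \<cdot> x \<cdot> root \<cdot> x"
    by (rule allE0[OF assms(1)[unfolded hypC_def] t]) ((assumption | rule TT t typing rels ambient)+)
  then have 1: "G \<TTurnstile> coherent D s (T \<cdot> x) \<^bold>\<and> T \<cdot> x \<cdot> root \<cdot> x" by (rule mp0[OF _ assms(2)]) ((assumption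
    | rule TT typed_T t typing rels ambient)+)
  show "G \<TTurnstile> coherent D s (T \<cdot> x)" by (rule conjunct1_0[OF 1]) ((assumption | rule TT typed_T t typing rels
    ambient)+)
  show "G \<TTurnstile> T \<cdot> x \<cdot> root \<cdot> x" by (rule conjunct2_0[OF 1]) ((assumption | rule TT typed_T t typing rels
    ambient)+)
qed

lemma hyp_ext_D:
  assumes "G \<TTurnstile> hyp_ext \<phi>" "G \<TTurnstile> x \<^bold>\<approx> x'" "G \<TTurnstile> y \<^bold>\<approx> y'" "G \<TTurnstile> \<phi> \<cdot> x \<cdot> y"
    and t: "G \<tturnstile> x : V" "G \<tturnstile> x' : V" "G \<tturnstile> y : V" "G \<tturnstile> y' : V"
  shows "G \<TTurnstile> \<phi> \<cdot> x' \<cdot> y'"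
proof -
  let ?R = "\<lambda>x x' y y'. x \<^bold>\<approx> x' \<^bold>\<rightarrow> y \<^bold>\<approx> y' \<^bold>\<rightarrow> \<phi> \<cdot> x \<cdot> y \<^bold>\<rightarrow> \<phi> \<cdot> x' \<cdot> y'"
  have "G \<TTurnstile> (\<^bold>\<forall>x' : V. \<^bold>\<forall>y : V. \<^bold>\<forall>y' : V. ?R x x' y y')" by (rule allE0[OF assms(1)[unfolded hyp_ext_def] t(1)])
    ((assumption | rule TT t typing rels ambient)+)
  then have "G \<TTurnstile> (\<^bold>\<forall>y : V. \<^bold>\<forall>y' : V. ?R x x' y y')" by (rule allE0[OF _ t(2)]) ((assumption
    | rule TT t typing rels ambient)+)
  then have "G \<TTurnstile> (\<^bold>\<forall>y' : V. ?R x x' y y')" by (rule allE0[OF _ t(3)]) ((assumption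
    | rule TT t typing rels ambient)+)
  then have "G \<TTurnstile> ?R x x' y y'" by (rule allE0[OF _ t(4)]) ((assumption | rule TT t typing rels ambient)+)
  then show ?thesis by (rule mp0[OF mp0[OF mp0[OF _ assms(2)] assms(3)] assms(4)]) ((assumption
    | rule TT t typing rels ambient)+)
qed

lemma hyp_fun_D:
  assumes "G \<TTurnstile> hyp_fun s \<phi>" "G \<TTurnstile> x \<^bold>\<in> s" "G \<TTurnstile> \<phi> \<cdot> x \<cdot> y" "G \<TTurnstile> \<phi> \<cdot> x \<cdot> y'"
    and t: "G \<tturnstile> x : V" "G \<tturnstile> y : V" "G \<tturnstile> y' : V"
  shows "G \<TTurnstile> y \<^bold>\<approx> y'"
proof -
  let ?R = "\<lambda>y y'. \<phi> \<cdot> x \<cdot> y \<^bold>\<rightarrow> \<phi> \<cdot> x \<cdot> y' \<^bold>\<rightarrow> y \<^bold>\<approx> y'"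
  have "G \<TTurnstile> x \<^bold>\<in> s \<^bold>\<rightarrow> (\<^bold>\<forall>y : V. \<^bold>\<forall>y' : V. ?R y y')" by (rule allE0[OF assms(1)[unfolded hyp_fun_def] t(1)])
    ((assumption | rule TT t typing rels ambient)+)
  then have "G \<TTurnstile> (\<^bold>\<forall>y : V. \<^bold>\<forall>y' : V. ?R y y')" by (rule mp0[OF _ assms(2)]) ((assumption
    | rule TT t typing rels ambient)+)
  then have "G \<TTurnstile> (\<^bold>\<forall>y' : V. ?R y y')" by (rule allE0[OF _ t(2)]) ((assumption | rule TT t typing rels ambient)+)
  then have "G \<TTurnstile> ?R y y'" by (rule allE0[OF _ t(3)]) ((assumption | rule TT t typing rels ambient)+)
  then show ?thesis by (rule mp0[OF mp0[OF _ assms(3)] assms(4)]) ((assumption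
    | rule TT t typing rels ambient)+)
qed

lemma hyp_val_D:
  assumes "G \<TTurnstile> hyp_val s C \<phi>" "G \<TTurnstile> x \<^bold>\<in> s" "G \<TTurnstile> \<phi> \<cdot> x \<cdot> y" and t: "G \<tturnstile> x : V" "G \<tturnstile> y : V"
  shows "G \<TTurnstile> C \<cdot> y"
proof -
  have "G \<TTurnstile> (\<^bold>\<forall>y : V. (x \<^bold>\<in> s \<^bold>\<rightarrow> \<phi> \<cdot> x \<cdot> y \<^bold>\<rightarrow> C \<cdot> y))" by (rule allE0[OF assms(1)[unfolded hyp_val_def] t(1)])
    ((assumption | rule TT t typing rels ambient)+)
  then have "G \<TTurnstile> x \<^bold>\<in> s \<^bold>\<rightarrow> \<phi> \<cdot> x \<cdot> y \<^bold>\<rightarrow> C \<cdot> y" by (rule allE0[OF _ t(2)]) ((assumption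
    | rule TT t typing rels ambient)+)
  then show ?thesis by (rule mp0[OF mp0[OF _ assms(2)] assms(3)]) ((assumption
    | rule TT t typing rels ambient)+)
qed

end

text \<open>The existential over \<eta> remains inside the proposition, so that the recursion
  \<open>val\<close> can be set up on this domain before any value is known.\<close>

definition "pdom T \<phi> x = (\<^bold>\<lambda>q : Path. \<^bold>\<exists>\<^sub>1\<eta> : V. \<phi> \<cdot> x \<cdot> \<eta> \<^bold>\<and> (\<^bold>\<exists>\<^sub>1t : V. T \<cdot> \<eta> \<cdot> q \<cdot> t))"

lemma rel_dom [rels]: "rel \<theta> k T T' \<Longrightarrow> rel \<theta> k \<phi> \<phi>' \<Longrightarrow> rel \<theta> k x x' \<Longrightarrow> rel \<theta> k (pdom T \<phi> x) (pdom T' \<phi>' x')"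
  unfolding pdom_def by (assumption | rule rels rel_shift)+

lemma dom:
  assumes "G \<tturnstile> T : (\<^bold>\<forall>_ : V. \<^bold>\<forall>_ : Path. \<^bold>\<forall>_ : V. Propd)" "G \<tturnstile> \<phi> : (\<^bold>\<forall>_ : V. \<^bold>\<forall>_ : V. Propd)" "G \<tturnstile> x : V"
  shows typed_dom [typing]: "G \<tturnstile> pdom T \<phi> x : (\<^bold>\<forall>_ : Path. Propd)"
    and deq_dom: "G \<tturnstile> q : Path \<Longrightarrow> G \<tturnstile> pdom T \<phi> x \<cdot> q \<equiv> (\<^bold>\<exists>\<^sub>1\<eta> : V. \<phi> \<cdot> x \<cdot> \<eta> \<^bold>\<and> (\<^bold>\<exists>\<^sub>1t : V. T \<cdot> \<eta> \<cdot> q \<cdot> t)) : Propd"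
proof -
  have 1: "G \<tturnstile> pdom T \<phi> x : (\<^bold>\<forall>_ : Path. Propd)" unfolding pdom_def by ((assumption
    | rule assms typing rels ambient)+)
  then show "G \<tturnstile> pdom T \<phi> x : (\<^bold>\<forall>_ : Path. Propd)" .
  show "G \<tturnstile> pdom T \<phi> x \<cdot> q \<equiv> (\<^bold>\<exists>\<^sub>1\<eta> : V. \<phi> \<cdot> x \<cdot> \<eta> \<^bold>\<and> (\<^bold>\<exists>\<^sub>1t : V. T \<cdot> \<eta> \<cdot> q \<cdot> t)) : Propd" if "G \<tturnstile> q : Path"
    unfolding pdom_def by (rule deq_beta[OF 1[unfolded pdom_def] _ _ that]) ((assumption
      | rule assms that typing rels ambient)+)
qed

context
  fixes G :: "tmd list" and D s C T \<phi> :: tmd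
  assumes tD: "G \<tturnstile> D : (\<^bold>\<forall>_ : V. V)" and ts: "G \<tturnstile> s : V" and tC: "G \<tturnstile> C : (\<^bold>\<forall>_ : V. Propd)"
    and tT: "G \<tturnstile> T : (\<^bold>\<forall>_ : V. \<^bold>\<forall>_ : Path. \<^bold>\<forall>_ : V. Propd)" and tp: "G \<tturnstile> \<phi> : (\<^bold>\<forall>_ : V. \<^bold>\<forall>_ : V. Propd)"
    and hT: "G \<TTurnstile> hypT T" and hC: "G \<TTurnstile> hypC D s C T" and he: "G \<TTurnstile> hyp_ext \<phi>" and hf: "G \<TTurnstile> hyp_fun s \<phi>"
      and hv: "G \<TTurnstile> hyp_val s C \<phi>"
begin

lemmas TU = tD ts tC tT tp

text \<open>Once a value \<open>y\<close> of \<open>x\<close> is fixed, the domain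
  \<open>pdom T \<phi> x\<close> consists of the paths with a target for \<open>y\<close>: every
  other value is bisimilar to \<open>y\<close> by functionality, and \<open>T\<close> respects
  bisimilarity. So the results on a single coherent assignment apply to \<open>T \<cdot> y\<close>,
  although \<open>val\<close> was defined without \<open>y\<close>.\<close>

lemma value_facts:
  assumes x: "G \<tturnstile> x : V" "G \<TTurnstile> x \<^bold>\<in> s" and y: "G \<tturnstile> y : V" "G \<TTurnstile> \<phi> \<cdot> x \<cdot> y"
  shows Acc_value: "G \<TTurnstile> Accd (pdom T \<phi> x) root"
    and val_value: "G \<tturnstile> h : Accd (pdom T \<phi> x) root \<Longrightarrow> G \<TTurnstile> val D s (pdom T \<phi> x) \<cdot> root \<cdot> h \<^bold>\<approx> y"
proof -
  let ?E = "pdom T \<phi> x" and ?F = "\<lambda>q. (\<^bold>\<exists>\<^sub>1\<eta> : V. \<phi> \<cdot> x \<cdot> \<eta> \<^bold>\<and> (\<^bold>\<exists>\<^sub>1t : V. T \<cdot> \<eta> \<cdot> q \<cdot> t))"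
  note C = hyp_val_D[OF TU hv x(2) y(2) x(1) y(1)]
  note coh = hypC_D[OF TU hC C y(1)]
  have tE: "G \<tturnstile> ?E : (\<^bold>\<forall>_ : Path. Propd)" by (rule typed_dom[OF tT tp x(1)])
  have tTy: "G \<tturnstile> T \<cdot> y : (\<^bold>\<forall>_ : Path. \<^bold>\<forall>_ : V. Propd)" by (rule typed_T[OF TU y(1)])
  have E1: "H \<TTurnstile> ?E \<cdot> q" if H: "G \<preceq> H" "H \<tturnstile> q : Path" "H \<tturnstile> t : V" "H \<TTurnstile> T \<cdot> y \<cdot> q \<cdot> t" for H q t
  proof -
    note T1 = TU[THEN lift_deq[OF H(1)]] lift_deq[OF H(1) x(1)] lift_deq[OF H(1) y(1)] H(2,3)
    have "H \<TTurnstile> ?F q"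
      apply (rule ex1I[OF typed_V _ _ T1(7)], ((assumption | rule T1 typing rels ambient)+)[2])
      apply (rule conjI0[OF _ _ lift_holds[OF H(1) y(2)]], ((assumption | rule T1 typing rels ambient)+)[2])
      apply (rule ex1I[OF typed_V _ _ H(3)], ((assumption | rule T1 typing rels ambient)+)[2], rule H(4))
      done
    then show ?thesis by (rule holds_conv[OF _ deq_sym[OF deq_dom[OF T1(4-6,8)]]])
  qed
  have E2: "H \<TTurnstile> (\<^bold>\<exists>\<^sub>1t : V. T \<cdot> y \<cdot> q \<cdot> t)" if H: "G \<preceq> H" "H \<tturnstile> q : Path" "H \<tturnstile> h : ?E \<cdot> q" for H q h
  proof -
    note T1 = TU[THEN lift_deq[OF H(1)]] lift_deq[OF H(1) x(1)] lift_deq[OF H(1) y(1)] H(2)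
    let ?R = "\<^bold>\<exists>\<^sub>1t : V. T \<cdot> y \<cdot> q \<cdot> t"
    have tR: "H \<tturnstile> ?R : Propd" by ((assumption | rule T1 typing rels ambient)+)
    have "H \<TTurnstile> ?F q" by (rule holds_conv[OF holdsI[OF H(3)] deq_dom[OF T1(4-6,8)]])
    then show ?thesis
    proof (rule ex1E[OF _ typed_V _ _ tR])
      fix K \<eta> assume K: "H \<preceq> K" "K \<tturnstile> \<eta> : V" "K \<TTurnstile> \<phi> \<cdot> x \<cdot> \<eta> \<^bold>\<and> (\<^bold>\<exists>\<^sub>1t : V. T \<cdot> \<eta> \<cdot> q \<cdot> t)"
      note T2 = T1[THEN lift_deq[OF K(1)]] K(2) and GK = ext_trans[OF H(1) K(1)]
      have p: "K \<TTurnstile> \<phi> \<cdot> x \<cdot> \<eta>" by (rule conjunct1_0[OF K(3)]) ((assumption | rule T2 typing rels ambient)+)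
      have e: "K \<TTurnstile> (\<^bold>\<exists>\<^sub>1t : V. T \<cdot> \<eta> \<cdot> q \<cdot> t)" by (rule conjunct2_0[OF K(3)]) ((assumption
        | rule T2 typing rels ambient)+)
      have b: "K \<TTurnstile> \<eta> \<^bold>\<approx> y"
        by (rule hyp_fun_D[OF T2(1-5) lift_holds[OF GK hf] lift_holds[OF GK x(2)] p lift_holds[OF GK y(2)]
          T2(6,9,7)])
      show "K \<TTurnstile> ?R"
      proof (rule ex1E[OF e typed_V _ _ lift_deq[OF K(1) tR]])
        fix L t assume L: "K \<preceq> L" "L \<tturnstile> t : V" "L \<TTurnstile> T \<cdot> \<eta> \<cdot> q \<cdot> t"
        note T3 = T2[THEN lift_deq[OF L(1)]] L(2) and GL = ext_trans[OF GK L(1)]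
        have h: "L \<TTurnstile> T \<cdot> y \<cdot> q \<cdot> t"
          by (rule hypT_D[OF T3(1-5) lift_holds[OF GL hT] lift_holds[OF L(1) b] L(3) T3(9,7,8) L(2)])
        show "L \<TTurnstile> ?R" by (rule ex1I[OF typed_V _ _ L(2)], ((assumption | rule T3 typing rels ambient)+)[2],
          rule h)
      qed ((assumption | rule T2 typing rels ambient)+)
    qed ((assumption | rule T1 typing rels ambient)+)
  qed
  show "G \<TTurnstile> Accd ?E root"
    by (rule Acc_target[OF tD ts tTy tE coh(1) E1 E2 typed_root y(1) coh(2)])
  show "G \<TTurnstile> val D s ?E \<cdot> root \<cdot> h \<^bold>\<approx> y" if "G \<tturnstile> h : Accd ?E root"
    by (rule val_target[OF tD ts tTy tE coh(1) E1 E2 typed_root that y(1) coh(2)])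
qed

end

text \<open>For every index \<open>i\<close> of \<open>s\<close> and every proof that the root is
  accessible, the computed value is bisimilar to each value of \<open>child s i\<close> under
  \<open>\<phi>\<close>. If there is no such value, no proof exists and the index contributes
  nothing.\<close>

lemma replacement:
  assumes TT: "G \<tturnstile> D : (\<^bold>\<forall>_ : V. V)" "G \<tturnstile> s : V" "G \<tturnstile> C : (\<^bold>\<forall>_ : V. Propd)"
     "G \<tturnstile> T : (\<^bold>\<forall>_ : V. \<^bold>\<forall>_ : Path. \<^bold>\<forall>_ : V. Propd)" "G \<tturnstile> \<phi> : (\<^bold>\<forall>_ : V. \<^bold>\<forall>_ : V. Propd)"
    and hyps: "G \<TTurnstile> hypT T" "G \<TTurnstile> hypC D s C T" "G \<TTurnstile> hyp_ext \<phi>" "G \<TTurnstile> hyp_fun s \<phi>" "G \<TTurnstile> hyp_val s C \<phi>"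
  shows "G \<TTurnstile> concl s \<phi>"
proof -
  let ?E = "\<lambda>i. pdom T \<phi> (child s i)"
  let ?A = "\<lambda>i. Accd (?E i) root" and ?v = "\<lambda>i h. singleton (val D s (?E i) \<cdot> root \<cdot> h)"
  let ?z = "UniF (bar s) ?A ?v"
  have Ac: "H \<tturnstile> Accd (?E i) root : Propd" if "H \<tturnstile> D : (\<^bold>\<forall>_ : V. V)" "H \<tturnstile> s : V" "H \<tturnstile> T : (\<^bold>\<forall>_ : V. \<^bold>\<forall>_ : Path. \<^bold>\<forall>_ :
    V. Propd)" "H \<tturnstile> \<phi> : (\<^bold>\<forall>_ : V. \<^bold>\<forall>_ : V. Propd)" "H \<tturnstile> i : bar s" for H i
    by (rule typed_eqI, (assumption | rule that typing rels ambient)+, rule refl)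
  have vt: "H \<tturnstile> val D s (?E i) \<cdot> root \<cdot> h : V" if H: "H \<tturnstile> D : (\<^bold>\<forall>_ : V. V)" "H \<tturnstile> s : V" "H \<tturnstile> T : (\<^bold>\<forall>_ : V. \<^bold>\<forall>_ :
    Path. \<^bold>\<forall>_ : V. Propd)" "H \<tturnstile> \<phi> : (\<^bold>\<forall>_ : V. \<^bold>\<forall>_ : V. Propd)" "H \<tturnstile> i : bar s"
    and h: "H \<tturnstile> h : Accd (?E i) root" for H i h
  proof -
    have E: "H \<tturnstile> ?E i : (\<^bold>\<forall>_ : Path. Propd)" by (rule typed_dom[OF H(3,4) typed_child[OF H(2,5)]])
    show ?thesis by (rule typed_eqI, (assumption | rule H h E typed_val[OF E H(1,2)] typing rels ambient)+,
      rule refl)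
  qed
  have u: "G \<tturnstile> bar s : Type0" "fam G (bar s) ?A 0" "uni2 (length G) ?v"
      "\<And>H i h. G \<preceq> H \<Longrightarrow> H \<tturnstile> i : bar s \<Longrightarrow> H \<tturnstile> h : ?A i \<Longrightarrow> H \<tturnstile> ?v i h : V"
  proof -
    show "G \<tturnstile> bar s : Type0" by (rule typed_bar[OF TT(2)])
    show "fam G (bar s) ?A 0" by (rule famI[OF typed_bar[OF TT(2)]]) ((assumption
      | rule Ac TT typing rels ambient)+)
    show "uni2 (length G) ?v" by (rule uni2I) ((assumption | rule TT typing rels ambient)+)
    fix H i h assume H: "G \<preceq> H" "H \<tturnstile> i : bar s" "H \<tturnstile> h : ?A i"
    note T1 = TT[THEN lift_deq[OF H(1)]]
    show "H \<tturnstile> ?v i h : V" by (rule typed_singleton[OF vt[OF T1(1,2,4,5) H(2,3)]])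
  qed
  have z: "G \<tturnstile> ?z : V" by (rule typed_UniF[OF u])
  let ?R = "\<lambda>y. \<^bold>\<exists>\<^sub>1x : V. x \<^bold>\<in> s \<^bold>\<and> \<phi> \<cdot> x \<cdot> y"
  have "G \<TTurnstile> (\<^bold>\<forall>y : V. (y \<^bold>\<in> ?z \<^bold>\<leftrightarrow> ?R y))"
  proof (rule allI1[OF typed_V], ((assumption | rule TT typing rels ambient)+)[1], rule iffI1)
    fix H y assume H: "G \<preceq> H" "H \<tturnstile> y : V"
    note T1 = TT[THEN lift_deq[OF H(1)]] H(2) lift_deq[OF H(1) z]
    show tz: "H \<tturnstile> (y \<^bold>\<in> ?z) : Propd" by (rule typed_mem[OF T1(6,7)])
    show tR: "H \<tturnstile> ?R y : Propd" by ((assumption | rule T1 typing rels ambient)+)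
    { fix K assume K: "H \<preceq> K" "K \<TTurnstile> y \<^bold>\<in> ?z"
      note GK = ext_trans[OF H(1) K(1)]
      note T2 = T1[THEN lift_deq[OF K(1)]]
      show "K \<TTurnstile> ?R y"
      proof (rule UniFE[OF lift_deq[OF GK u(1)] lift_fam[OF GK u(2)] lift_uni2[OF GK u(3)] _ T2(6) K(2)
        lift_deq[OF K(1) tR]])
        fix L i h assume L: "K \<preceq> L" "L \<tturnstile> i : bar s" "L \<tturnstile> h : ?A i"
        show "L \<tturnstile> ?v i h : V" by (rule u(4)[OF ext_trans[OF GK L(1)] L(2,3)])
        assume m: "L \<TTurnstile> y \<^bold>\<in> ?v i h"
        note T3 = T2[THEN lift_deq[OF L(1)]] and GL = ext_trans[OF GK L(1)]
        note h3 = hyps[THEN lift_holds[OF GL]]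
        have c: "L \<tturnstile> child s i : V" by (rule typed_child[OF T3(2) L(2)])
        have v: "L \<tturnstile> val D s (?E i) \<cdot> root \<cdot> h : V" by (rule vt[OF T3(1,2,4,5) L(2,3)])
        have yv: "L \<TTurnstile> y \<^bold>\<approx> val D s (?E i) \<cdot> root \<cdot> h" by (rule singletonD[OF m T3(6) v])
        note Et = typed_dom[OF T3(4,5) c]
        \<comment> \<open>Membership of the root in the domain is contained in its accessibility,
          and it yields a value \<eta> of \<open>child s i\<close>.\<close>
        have "L \<TTurnstile> (\<^bold>\<exists>\<^sub>1\<eta> : V. \<phi> \<cdot> child s i \<cdot> \<eta> \<^bold>\<and> (\<^bold>\<exists>\<^sub>1t : V. T \<cdot> \<eta> \<cdot> root \<cdot> t))"
          by (rule holds_conv[OF Acc_E[OF Et typed_root L(3)] deq_dom[OF T3(4,5) c typed_root]])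
        then show "L \<TTurnstile> ?R y"
        proof (rule ex1E[OF _ typed_V _ _ lift_deq[OF ext_trans[OF K(1) L(1)] tR]])
          fix M \<eta> assume M: "L \<preceq> M" "M \<tturnstile> \<eta> : V" "M \<TTurnstile> \<phi> \<cdot> child s i \<cdot> \<eta> \<^bold>\<and> (\<^bold>\<exists>\<^sub>1t : V. T \<cdot> \<eta> \<cdot> root \<cdot> t)"
          note T4 = T3[THEN lift_deq[OF M(1)]] M(2) lift_deq[OF M(1) L(2)] lift_deq[OF M(1) c] lift_deq[OF M(1)
            v]
          note h4 = h3[THEN lift_holds[OF M(1)]]
          have p: "M \<TTurnstile> \<phi> \<cdot> child s i \<cdot> \<eta>" by (rule conjunct1_0[OF M(3)]) ((assumption
            | rule T4 typing rels ambient)+)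
          note cs = mem_child[OF T4(2,9)]
          have "M \<TTurnstile> val D s (?E i) \<cdot> root \<cdot> h \<^bold>\<approx> \<eta>"
            by (rule val_value[OF T4(1-5) h4 T4(10) cs T4(8) p lift_deq[OF M(1) L(3)]])
          from bisim_sym[OF bisim_trans[OF lift_holds[OF M(1) yv] this T4(6,11,8)] T4(6,8)]
          have "M \<TTurnstile> \<eta> \<^bold>\<approx> y" .
          \<comment> \<open>The computed set is bisimilar to both \<open>y\<close> and \<eta>, and
            \<open>\<phi>\<close> respects bisimilarity, so \<open>y\<close> is a value
            itself.\<close>
          from hyp_ext_D[OF T4(1-5) h4(3) bisim_refl[OF T4(10)] this p T4(10,10,8,6)]
          have "M \<TTurnstile> \<phi> \<cdot> child s i \<cdot> y" .
          have h: "M \<TTurnstile> child s i \<^bold>\<in> s \<^bold>\<and> \<phi> \<cdot> child s i \<cdot> y"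
            by (rule conjI0[OF _ _ cs \<open>M \<TTurnstile> \<phi> \<cdot> child s i \<cdot> y\<close>]) ((assumption | rule T4 typing rels ambient)+)
          show "M \<TTurnstile> ?R y" by (rule ex1I[OF typed_V _ _ T4(10)], ((assumption
            | rule T4 typing rels ambient)+)[2], rule h)
        qed ((assumption | rule T3 L(2) typing rels ambient)+)
      qed }
    { fix K assume K: "H \<preceq> K" "K \<TTurnstile> ?R y"
      note GK = ext_trans[OF H(1) K(1)]
      note T2 = T1[THEN lift_deq[OF K(1)]]
      show "K \<TTurnstile> y \<^bold>\<in> ?z"
      proof (rule ex1E[OF K(2) typed_V _ _ lift_deq[OF K(1) tz]])
        fix L x assume L: "K \<preceq> L" "L \<tturnstile> x : V" "L \<TTurnstile> x \<^bold>\<in> s \<^bold>\<and> \<phi> \<cdot> x \<cdot> y"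
        note T3 = T2[THEN lift_deq[OF L(1)]] L(2)
        have x: "L \<TTurnstile> x \<^bold>\<in> s" by (rule conjunct1_0[OF L(3)]) ((assumption | rule T3 typing rels ambient)+)
        have p: "L \<TTurnstile> \<phi> \<cdot> x \<cdot> y" by (rule conjunct2_0[OF L(3)]) ((assumption | rule T3 typing rels ambient)+)
        show "L \<TTurnstile> y \<^bold>\<in> ?z"
        proof (rule memE[OF x T3(8,2) lift_deq[OF ext_trans[OF K(1) L(1)] tz]])
          fix M i assume M: "L \<preceq> M" "M \<tturnstile> i : bar s" "M \<TTurnstile> x \<^bold>\<approx> child s i"
          note T4 = T3[THEN lift_deq[OF M(1)]] and GM = ext_trans[OF GK ext_trans[OF L(1) M(1)]]
          note h4 = hyps[THEN lift_holds[OF GM]]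
          have c: "M \<tturnstile> child s i : V" by (rule typed_child[OF T4(2) M(2)])
          note cs = mem_child[OF T4(2) M(2)]
          \<comment> \<open>The element \<open>x\<close> is only bisimilar to a child of
            \<open>s\<close>; \<open>\<phi>\<close> is moved to that child, whose index can serve in
            the union.\<close>
          have p: "M \<TTurnstile> \<phi> \<cdot> child s i \<cdot> y"
            by (rule hyp_ext_D[OF T4(1-5) h4(3) M(3) bisim_refl[OF T4(6)] lift_holds[OF M(1) p] T4(8) c
              T4(6,6)])
          \<comment> \<open>The proof term \<open>h\<close> is the second component of the index at
            which \<open>y\<close> is found.\<close>
          from Acc_value[OF T4(1-5) h4 c cs T4(6) p] obtain h where h: "M \<tturnstile> h : ?A i" by (auto simp: holds_def)
          have v: "M \<tturnstile> val D s (?E i) \<cdot> root \<cdot> h : V" by (rule vt[OF T4(1,2,4,5) M(2) h])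
          have m: "M \<TTurnstile> y \<^bold>\<in> ?v i h"
            by (rule singletonI[OF bisim_sym[OF val_value[OF T4(1-5) h4 c cs T4(6) p h] v T4(6)] T4(6) v])
          show "M \<TTurnstile> y \<^bold>\<in> ?z"
            by (rule UniFI[OF lift_deq[OF GM u(1)] lift_fam[OF GM u(2)] lift_uni2[OF GM u(3)] u(4)[OF
              ext_trans[OF GM]] T4(6) M(2) h m])
        qed
      qed ((assumption | rule T2 typing rels ambient)+) }
  qed
  note h = this
  show ?thesis unfolding concl_def
    by (rule ex1I[OF typed_V _ _ z], ((assumption | rule TT typing rels ambient)+)[2], rule h)
qed

theorem theorem4p1:
  shows "\<exists>t. [] \<turnstile> t : close
    (\<^bold>\<forall>D : (V \<^bold>\<rightarrow> V). \<^bold>\<forall>s : V.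
     \<^bold>\<forall>C : (V \<^bold>\<rightarrow> Propd). \<^bold>\<forall>T : (V \<^bold>\<rightarrow> Path \<^bold>\<rightarrow> V \<^bold>\<rightarrow> Propd).
       ((\<^bold>\<forall>\<eta> : V. \<^bold>\<forall>\<eta>' : V. (\<eta> \<^bold>\<approx> \<eta>' \<^bold>\<rightarrow>
           (\<^bold>\<forall>p : Path. \<^bold>\<forall>t : V. (T \<cdot> \<eta> \<cdot> p \<cdot> t \<^bold>\<leftrightarrow> T \<cdot> \<eta>' \<cdot> p \<cdot> t)))) \<^bold>\<rightarrow>
        (\<^bold>\<forall>\<eta> : V. (C \<cdot> \<eta> \<^bold>\<rightarrow> coherent D s (T \<cdot> \<eta>) \<^bold>\<and> T \<cdot> \<eta> \<cdot> root \<cdot> \<eta>)) \<^bold>\<rightarrow>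
        (\<^bold>\<forall>\<phi> : (V \<^bold>\<rightarrow> V \<^bold>\<rightarrow> Propd).
          ((\<^bold>\<forall>x : V. \<^bold>\<forall>x' : V. \<^bold>\<forall>y : V. \<^bold>\<forall>y' : V.
              (x \<^bold>\<approx> x' \<^bold>\<rightarrow> y \<^bold>\<approx> y' \<^bold>\<rightarrow> \<phi> \<cdot> x \<cdot> y \<^bold>\<rightarrow> \<phi> \<cdot> x' \<cdot> y')) \<^bold>\<rightarrow>
           (\<^bold>\<forall>x : V. (x \<^bold>\<in> s \<^bold>\<rightarrow> (\<^bold>\<forall>y : V. \<^bold>\<forall>y' : V.
              (\<phi> \<cdot> x \<cdot> y \<^bold>\<rightarrow> \<phi> \<cdot> x \<cdot> y' \<^bold>\<rightarrow> y \<^bold>\<approx> y')))) \<^bold>\<rightarrow>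
           (\<^bold>\<forall>x : V. \<^bold>\<forall>y : V. (x \<^bold>\<in> s \<^bold>\<rightarrow> \<phi> \<cdot> x \<cdot> y \<^bold>\<rightarrow> C \<cdot> y)) \<^bold>\<rightarrow>
           (\<^bold>\<exists>\<^sub>1z : V. \<^bold>\<forall>y : V. (y \<^bold>\<in> z \<^bold>\<leftrightarrow> (\<^bold>\<exists>\<^sub>1x : V. x \<^bold>\<in> s \<^bold>\<and> \<phi> \<cdot> x \<cdot> y)))))))"
    (is "\<exists>t. [] \<turnstile> t : close ?P")
proof -
  \<comment> \<open>The arrows become products and the hypotheses are folded into their names, the
    shape that the typing rules expect.\<close>
  have P: "?P = (\<^bold>\<forall>D : (\<^bold>\<forall>_ : V. V). \<^bold>\<forall>s : V. \<^bold>\<forall>C : (\<^bold>\<forall>_ : V. Propd). \<^bold>\<forall>T : (\<^bold>\<forall>_ : V. \<^bold>\<forall>_ : Path. \<^bold>\<forall>_ : V. Propd).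
     (hypT T \<^bold>\<rightarrow> hypC D s C T \<^bold>\<rightarrow> (\<^bold>\<forall>\<phi> : (\<^bold>\<forall>_ : V. \<^bold>\<forall>_ : V. Propd). (hyp_ext \<phi> \<^bold>\<rightarrow> hyp_fun s \<phi> \<^bold>\<rightarrow> hyp_val s C \<phi> \<^bold>\<rightarrow> concl s
       \<phi>))))"
    unfolding hyp_defs arr_def ..
  have c1: "H \<TTurnstile> hyp_ext \<phi> \<^bold>\<rightarrow> hyp_fun s \<phi> \<^bold>\<rightarrow> hyp_val s C \<phi> \<^bold>\<rightarrow> concl s \<phi>"
    if T: "H \<tturnstile> D : (\<^bold>\<forall>_ : V. V)" "H \<tturnstile> s : V" "H \<tturnstile> C : (\<^bold>\<forall>_ : V. Propd)"
      "H \<tturnstile> T : (\<^bold>\<forall>_ : V. \<^bold>\<forall>_ : Path. \<^bold>\<forall>_ : V. Propd)" "H \<tturnstile> \<phi> : (\<^bold>\<forall>_ : V. \<^bold>\<forall>_ : V. Propd)"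
      and h: "H \<TTurnstile> hypT T" "H \<TTurnstile> hypC D s C T" for H D s C T \<phi>
  proof (rule impI1, ((assumption | rule T typing uniI rels | (erule rel_mono, simp; fail) | rule rel_amb
    | (rule lift_deq lift_fam good_ext, (assumption | rule T)) | erule good_tls | rule weak fam_weak)+)[2],
    rule impI1, ((assumption | rule T typing uniI rels | (erule rel_mono, simp; fail) | rule rel_amb
    | (rule lift_deq lift_fam good_ext, (assumption | rule T)) | erule good_tls | rule weak fam_weak)+)[2],
    rule impI1, ((assumption | rule T typing uniI rels | (erule rel_mono, simp; fail) | rule rel_amb
    | (rule lift_deq lift_fam good_ext, (assumption | rule T)) | erule good_tls | rule weak fam_weak)+)[2])
    fix K L M assume *: "H \<preceq> K" "K \<TTurnstile> hyp_ext \<phi>" "K \<preceq> L" "L \<TTurnstile> hyp_fun s \<phi>" "L \<preceq> M" "M \<TTurnstile> hyp_val s C \<phi>"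
    note LM = *(5) and KM = ext_trans[OF *(3,5)] and HM = ext_trans[OF *(1) ext_trans[OF *(3,5)]]
    show "M \<TTurnstile> concl s \<phi>"
      by (rule replacement[OF T[THEN lift_deq[OF HM]] h[THEN lift_holds[OF HM]] lift_holds[OF KM *(2)]
        lift_holds[OF LM *(4)] *(6)])
  qed
  have c2: "H \<TTurnstile> hypT T \<^bold>\<rightarrow> hypC D s C T \<^bold>\<rightarrow> (\<^bold>\<forall>\<phi> : (\<^bold>\<forall>_ : V. \<^bold>\<forall>_ : V. Propd). (hyp_ext \<phi> \<^bold>\<rightarrow> hyp_fun s \<phi> \<^bold>\<rightarrow> hyp_val s C \<phi>
    \<^bold>\<rightarrow> concl s \<phi>))"
    if T: "H \<tturnstile> D : (\<^bold>\<forall>_ : V. V)" "H \<tturnstile> s : V" "H \<tturnstile> C : (\<^bold>\<forall>_ : V. Propd)"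
      "H \<tturnstile> T : (\<^bold>\<forall>_ : V. \<^bold>\<forall>_ : Path. \<^bold>\<forall>_ : V. Propd)" for H D s C T
  proof (rule impI1, ((assumption | rule T typing uniI rels | (erule rel_mono, simp; fail) | rule rel_amb
    | (rule lift_deq lift_fam good_ext, (assumption | rule T)) | erule good_tls | rule weak fam_weak)+)[2],
    rule impI1, ((assumption | rule T typing uniI rels | (erule rel_mono, simp; fail) | rule rel_amb
    | (rule lift_deq lift_fam good_ext, (assumption | rule T)) | erule good_tls | rule weak fam_weak)+)[2],
    rule allI1, ((assumption | rule T typing uniI rels | (erule rel_mono, simp; fail) | rule rel_amb
    | (rule lift_deq lift_fam good_ext, (assumption | rule T)) | erule good_tls | rule weak fam_weak)+)[2])
    fix K L M \<phi> assume *: "H \<preceq> K" "K \<TTurnstile> hypT T" "K \<preceq> L" "L \<TTurnstile> hypC D s C T" "L \<preceq> M" "M \<tturnstile> \<phi> : (\<^bold>\<forall>_ : V. \<^bold>\<forall>_ : V.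
      Propd)"
    note LM = *(5) and KM = ext_trans[OF *(3,5)] and HM = ext_trans[OF *(1) ext_trans[OF *(3,5)]]
    show "M \<TTurnstile> hyp_ext \<phi> \<^bold>\<rightarrow> hyp_fun s \<phi> \<^bold>\<rightarrow> hyp_val s C \<phi> \<^bold>\<rightarrow> concl s \<phi>"
      by (rule c1[OF T[THEN lift_deq[OF HM]] *(6) lift_holds[OF KM *(2)] lift_holds[OF LM *(4)]])
  qed
  have "[] \<TTurnstile> ?P" unfolding P
    by (rule allI1, ((assumption | rule typing uniI rels | (erule rel_mono, simp; fail) | rule rel_amb
      | (rule lift_deq lift_fam good_ext, assumption) | erule good_tls | rule weak fam_weak)+)[2], rule allI1,
      ((assumption | rule typing uniI rels | (erule rel_mono, simp; fail) | rule rel_amb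
      | (rule lift_deq lift_fam good_ext, assumption) | erule good_tls | rule weak fam_weak)+)[2], rule allI1,
      ((assumption | rule typing uniI rels | (erule rel_mono, simp; fail) | rule rel_amb
      | (rule lift_deq lift_fam good_ext, assumption) | erule good_tls | rule weak fam_weak)+)[2], rule allI1,
      ((assumption | rule typing uniI rels | (erule rel_mono, simp; fail) | rule rel_amb
      | (rule lift_deq lift_fam good_ext, assumption) | erule good_tls | rule weak fam_weak)+)[2],
       rule c2) (meson lift_deq ext_trans)+
  then obtain t where "[] \<tturnstile> t : ?P" by (auto simp: holds_def)
  \<comment> \<open>The empty context satisfies \<open>ok\<close>, so the judgement can be read off
    at zero binders.\<close>
  then have "[] \<turnstile> t 0 : close ?P" by (simp add: deq_def close_def)
  then show ?thesis by blast
qed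

end
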